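(* There is a deterministic algorithm that, given a directed graph $G=(V,E,c,t)$ with $n$ vertices and $m$ edges in which every edge $e$ has a real cost $c(e)$ and a real transit time $t(e)$, computes a minimum ratio cycle of $G$ in time $O(n^{3/2} m^{3/4} \log^2 n)$.
   Context: A minimum ratio (minimum cost-to-time ratio) cycle of $G$ is a directed cycle $C$ minimizing $\sum_{e\in C} c(e) / \sum_{e\in C} t(e)$. Running time is measured in the strongly polynomial sense: the number of arithmetic operations and comparisons on the real input values, independent of their encoding size.
   Formalization: The formal theorem assumes in addition that every directed cycle has positive total transit time (single edges may have any real transit time); without such a condition the ratio can be undefined, e.g. for a loop of transit time 0. Graphs have no parallel edges. *)

theory Defs
  imports Complex_Main "Graph_Theory.Weighted_Graph"
begin

section \<open>A uniform real random access machine\<close>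

text \<open>
  Programs work on two separate kinds of storage: named arrays of words (natural numbers) and named
  arrays of real numbers; a scalar variable is cell 0 of an array. The only ways in which
  reals are used are the field operations and the test \<open><\<close>. There is no rounding and no
  conversion between reals and words, and the only real literals are 0 and 1, so no
  information can be smuggled in through real constants. As everywhere in HOL, division by
  0 yields 0, for words and for reals.
\<close>

type_synonym name = string

record store =
  words :: "name \<Rightarrow> nat \<Rightarrow> nat"
  reals :: "name \<Rightarrow> nat \<Rightarrow> real"

datatype wexp =
    WLit nat
  | WCell name wexp
  | WAdd wexp wexp
  | WSub wexp wexp
  | WMul wexp wexp
  | WDiv wexp wexp

datatype rexp =
    RZero
  | ROne
  | RCell name wexp
  | RAdd rexp rexp
  | RSub rexp rexp
  | RMul rexp rexp
  | RDiv rexp rexp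

datatype bexp =
    WLess wexp wexp
  | RLess rexp rexp
  | BNot bexp
  | BAnd bexp bexp

datatype com =
    Skip
  | WAssign name wexp wexp
  | RAssign name wexp rexp
  | Then com com
  | Cond bexp com com
  | While bexp com

primrec wval :: "store \<Rightarrow> wexp \<Rightarrow> nat" where
  "wval s (WLit k) = k"
| "wval s (WCell a i) = words s a (wval s i)"
| "wval s (WAdd x y) = wval s x + wval s y"
| "wval s (WSub x y) = wval s x - wval s y"
| "wval s (WMul x y) = wval s x * wval s y"
| "wval s (WDiv x y) = wval s x div wval s y"

primrec rval :: "store \<Rightarrow> rexp \<Rightarrow> real" where
  "rval s RZero = 0"
| "rval s ROne = 1"
| "rval s (RCell a i) = reals s a (wval s i)"
| "rval s (RAdd x y) = rval s x + rval s y"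
| "rval s (RSub x y) = rval s x - rval s y"
| "rval s (RMul x y) = rval s x * rval s y"
| "rval s (RDiv x y) = rval s x / rval s y"

primrec bval :: "store \<Rightarrow> bexp \<Rightarrow> bool" where
  "bval s (WLess x y) \<longleftrightarrow> wval s x < wval s y"
| "bval s (RLess x y) \<longleftrightarrow> rval s x < rval s y"
| "bval s (BNot b) \<longleftrightarrow> \<not> bval s b"
| "bval s (BAnd b b') \<longleftrightarrow> bval s b \<and> bval s b'"

text \<open>
  Every operation on reals and on words, every memory access and every control step costs one
  unit, so that the time below bounds in particular the number of arithmetic operations and
  comparisons on reals.
\<close>

primrec wcost :: "wexp \<Rightarrow> nat" where
  "wcost (WLit k) = 1"
| "wcost (WCell a i) = 1 + wcost i"
| "wcost (WAdd x y) = 1 + wcost x + wcost y"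
| "wcost (WSub x y) = 1 + wcost x + wcost y"
| "wcost (WMul x y) = 1 + wcost x + wcost y"
| "wcost (WDiv x y) = 1 + wcost x + wcost y"

primrec rcost :: "rexp \<Rightarrow> nat" where
  "rcost RZero = 1"
| "rcost ROne = 1"
| "rcost (RCell a i) = 1 + wcost i"
| "rcost (RAdd x y) = 1 + rcost x + rcost y"
| "rcost (RSub x y) = 1 + rcost x + rcost y"
| "rcost (RMul x y) = 1 + rcost x + rcost y"
| "rcost (RDiv x y) = 1 + rcost x + rcost y"

primrec bcost :: "bexp \<Rightarrow> nat" where
  "bcost (WLess x y) = 1 + wcost x + wcost y"
| "bcost (RLess x y) = 1 + rcost x + rcost y"
| "bcost (BNot b) = 1 + bcost b"
| "bcost (BAnd b b') = 1 + bcost b + bcost b'"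

text \<open>
  \<open>exec W P s T s'\<close>: started in \<open>s\<close>, program \<open>P\<close> halts in \<open>s'\<close> after \<open>T\<close> steps and never stores a
  word exceeding \<open>W\<close>. An execution that tries to store a larger word is stuck; with \<open>W\<close>
  polynomial in the input size this is the usual restriction to words of logarithmic length,
  which keeps the unit-cost word operations from simulating more powerful computations. Reals
  are unrestricted.
\<close>

inductive exec :: "nat \<Rightarrow> com \<Rightarrow> store \<Rightarrow> nat \<Rightarrow> store \<Rightarrow> bool" for W :: nat where
  Skip: "exec W Skip s 1 s"
| WAssign: "wval s x \<le> W \<Longrightarrow>
    exec W (WAssign a i x) s (1 + wcost i + wcost x)
      (s\<lparr>words := (words s)(a := (words s a)(wval s i := wval s x))\<rparr>)"
| RAssign:
    "exec W (RAssign a i x) s (1 + wcost i + rcost x)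
      (s\<lparr>reals := (reals s)(a := (reals s a)(wval s i := rval s x))\<rparr>)"
| Then: "exec W P s T s' \<Longrightarrow> exec W Q s' T' s'' \<Longrightarrow> exec W (Then P Q) s (T + T') s''"
| CondTrue: "bval s b \<Longrightarrow> exec W P s T s' \<Longrightarrow> exec W (Cond b P Q) s (1 + bcost b + T) s'"
| CondFalse: "\<not> bval s b \<Longrightarrow> exec W Q s T s' \<Longrightarrow> exec W (Cond b P Q) s (1 + bcost b + T) s'"
| WhileFalse: "\<not> bval s b \<Longrightarrow> exec W (While b P) s (1 + bcost b) s"
| WhileTrue: "bval s b \<Longrightarrow> exec W P s T s' \<Longrightarrow> exec W (While b P) s' T' s'' \<Longrightarrow>
    exec W (While b P) s (1 + bcost b + T + T') s''"

inductive_cases SkipE: "exec W Skip s T s'"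
inductive_cases WAssignE: "exec W (WAssign a i x) s T s'"
inductive_cases RAssignE: "exec W (RAssign a i x) s T s'"
inductive_cases ThenE: "exec W (Then P Q) s T s'"
inductive_cases CondE: "exec W (Cond b P Q) s T s'"
inductive_cases WhileE: "exec W (While b P) s T s'"

lemma exec_deterministic:
  "exec W P s T s' \<Longrightarrow> exec W P s U u \<Longrightarrow> U = T \<and> u = s'"
proof (induction arbitrary: U u rule: exec.induct)
  case (Skip s)
  then show ?case by (auto elim: SkipE)
next
  case (WAssign s x a i)
  then show ?case by (auto elim: WAssignE)
next
  case (RAssign a i x s)
  then show ?case by (auto elim: RAssignE)
next
  case (Then P s T s' Q T' s'')
  from Then.prems obtain V v V' where "U = V + V'" "exec W P s V v" "exec W Q v V' u"
    by (rule ThenE)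
  with Then.IH(1)[of V v] Then.IH(2)[of V' u] show ?case by simp
next
  case (CondTrue s b P T s' Q)
  from CondTrue.prems obtain V where "U = 1 + bcost b + V" "exec W P s V u"
    by (rule CondE) (use CondTrue.hyps(1) in simp_all)
  with CondTrue.IH[of V u] show ?case by simp
next
  case (CondFalse s b Q T s' P)
  from CondFalse.prems obtain V where "U = 1 + bcost b + V" "exec W Q s V u"
    by (rule CondE) (use CondFalse.hyps(1) in simp_all)
  with CondFalse.IH[of V u] show ?case by simp
next
  case (WhileFalse s b P)
  from WhileFalse.prems show ?case by (rule WhileE) (use WhileFalse.hyps in simp_all)
next
  case (WhileTrue s b P T s' T' s'')
  from WhileTrue.prems obtain V v V'
    where "U = 1 + bcost b + V + V'" "exec W P s V v" "exec W (While b P) v V' u"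
    by (rule WhileE) (use WhileTrue.hyps(1) in simp_all)
  with WhileTrue.IH(1)[of V v] WhileTrue.IH(2)[of V' u] show ?case by simp
qed


section \<open>The minimum ratio cycle problem\<close>

definition ratio :: "(nat \<Rightarrow> real) \<Rightarrow> (nat \<Rightarrow> real) \<Rightarrow> nat list \<Rightarrow> real" where
  "ratio c t C = wf_digraph.awalk_cost c C / wf_digraph.awalk_cost t C"

definition min_ratio_cycle ::
  "(nat, nat) pre_digraph \<Rightarrow> (nat \<Rightarrow> real) \<Rightarrow> (nat \<Rightarrow> real) \<Rightarrow> nat list \<Rightarrow> bool" where
  "min_ratio_cycle G c t C \<longleftrightarrow>
     pre_digraph.cycle G C \<and> (\<forall>C'. pre_digraph.cycle G C' \<longrightarrow> ratio c t C \<le> ratio c t C')"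

text \<open>
  Inputs are directed graphs with at most one arc per ordered pair of vertices (loops are
  allowed), whose vertices and arcs are numbered consecutively. Costs and transit times are
  arbitrary reals, of either sign, subject only to the total transit time of every cycle being
  positive; without a condition of this kind the ratio need not be defined.
\<close>

definition ratio_input ::
  "nat \<Rightarrow> nat \<Rightarrow> (nat, nat) pre_digraph \<Rightarrow> (nat \<Rightarrow> real) \<Rightarrow> (nat \<Rightarrow> real) \<Rightarrow> bool" where
  "ratio_input n m G c t \<longleftrightarrow>
     nomulti_digraph G \<and> verts G = {..<n} \<and> arcs G = {..<m} \<and>
     (\<forall>C. pre_digraph.cycle G C \<longrightarrow> wf_digraph.awalk_cost t C > 0)"

definition encode ::
  "nat \<Rightarrow> nat \<Rightarrow> (nat, nat) pre_digraph \<Rightarrow> (nat \<Rightarrow> real) \<Rightarrow> (nat \<Rightarrow> real) \<Rightarrow> store" where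
  "encode n m G c t = \<lparr>
     words = (\<lambda>_ _. 0)(
       ''n'' := (\<lambda>_. 0)(0 := n),
       ''m'' := (\<lambda>_. 0)(0 := m),
       ''tail'' := (\<lambda>e. if e < m then tail G e else 0),
       ''head'' := (\<lambda>e. if e < m then head G e else 0)),
     reals = (\<lambda>_ _. 0)(
       ''cost'' := (\<lambda>e. if e < m then c e else 0),
       ''time'' := (\<lambda>e. if e < m then t e else 0))\<rparr>"

definition read_cycle :: "store \<Rightarrow> nat list" where
  "read_cycle s = map (words s ''cycle'') [0..<words s ''length'' 0]"

text \<open>A cycle is a nonempty list of arcs, so the empty list reports that there is none.\<close>

definition correct_output ::
  "(nat, nat) pre_digraph \<Rightarrow> (nat \<Rightarrow> real) \<Rightarrow> (nat \<Rightarrow> real) \<Rightarrow> nat list \<Rightarrow> bool" where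
  "correct_output G c t C \<longleftrightarrow>
     (if \<exists>C'. pre_digraph.cycle G C' then min_ratio_cycle G c t C else C = [])"

end

(* The minimum ratio is the largest lambda for which the arc costs c - lambda t admit no negative cycle, and
   Bellman-Ford decides whether a given number is at most lambda. For all lengths up to h, the cheapest walks of a given
   length between two vertices with respect to the unknown costs c - lambda t are computed simultaneously in the manner of
   Megiddo: walks are points (cost, time), and a batch of comparisons at lambda is resolved by medians of critical values,
   with a logarithmic number of calls of Bellman-Ford. A greedily chosen set of q vertices meets every computed walk of
   length h that does not contain a short cycle, q being about (n/h) log n. Either a cycle of length at most h is of
   minimum ratio, or one is composed of at most q computed walks between vertices of the hitting set and is found by
   repeated squaring of a (min,+) matrix of order q. With h about n^(1/2) m^(-1/4) log n all parts balance. An optimal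
   cycle is finally read off the arcs that are tight for the potentials at lambda. *)

theory Submission
  imports Defs
begin

section \<open>Weakest preconditions\<close>

text \<open>No computed walk is ever shown to be cheapest. Correctness rests on a feasible potential
  \<open>p\<close> for the costs c - \<open>lam\<close> t, fixed in the locale \<open>mrc\<close>
  and used in proofs only: a walk is tight if it meets the lower bound given by \<open>p\<close>.
  Tightness passes to subwalks and concatenations, nonempty closed tight walks are exactly those of
  minimum ratio, and a table cell need only be right where a tight walk exists. On acyclic input
  \<open>lam\<close> is arbitrary and the oracle says nothing about it, so claims about values are
  guarded by \<open>cyc\<close>, while the tables still hold genuine walks. Vertices without arcs
  are dropped, so N <= 2 m, and m <= N^2 since parallel arcs are excluded; the balance uses both.
  With L about log N, the levels cost h N m L and the matrix powers q^3 L^2, where q is about N L /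
  h; equating them gives h^4 m = N^2 L^4. A batch at a level has at most N m candidates, the order
  of one oracle call, and the cost of selection is charged to the discarded candidates instead of
  being multiplied by the number of rounds. Hence medians found with a heap, at an extra logarithm,
  are good enough.\<close>

declare One_nat_def [simp del]

abbreviation V :: "name \<Rightarrow> wexp" where "V x \<equiv> WCell x (WLit 0)"
abbreviation RV :: "name \<Rightarrow> rexp" where "RV x \<equiv> RCell x (WLit 0)"
abbreviation wset :: "name \<Rightarrow> wexp \<Rightarrow> com" (infix "::=" 61) where "x ::= e \<equiv> WAssign x (WLit 0) e"
abbreviation seq :: "com \<Rightarrow> com \<Rightarrow> com" (infixr ";;" 60) where "P ;; Q \<equiv> Then P Q"

primrec wmod :: "com \<Rightarrow> name set" where
  "wmod Skip = {}"
| "wmod (WAssign a i x) = {a}"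
| "wmod (RAssign a i x) = {}"
| "wmod (Then P Q) = wmod P \<union> wmod Q"
| "wmod (Cond b P Q) = wmod P \<union> wmod Q"
| "wmod (While b P) = wmod P"

primrec rmod :: "com \<Rightarrow> name set" where
  "rmod Skip = {}"
| "rmod (WAssign a i x) = {}"
| "rmod (RAssign a i x) = {a}"
| "rmod (Then P Q) = rmod P \<union> rmod Q"
| "rmod (Cond b P Q) = rmod P \<union> rmod Q"
| "rmod (While b P) = rmod P"

text \<open>Frames are syntactic and concern whole arrays: an array that \<open>P\<close> never
  assigns to is unchanged (\<open>exec_frm\<close>). Loop invariants can therefore be restricted to
  the arrays that the loop writes.\<close>

definition frm :: "com \<Rightarrow> store \<Rightarrow> store \<Rightarrow> bool" where
  "frm P s s' \<longleftrightarrow> (\<forall>a. a \<notin> wmod P \<longrightarrow> words s' a = words s a) \<and> (\<forall>a. a \<notin> rmod P \<longrightarrow> reals s' a = reals s a)"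

lemma frm_refl [simp]: "frm P s s"
  by (simp add: frm_def)

lemma frm_trans: "frm P s s' \<Longrightarrow> frm P s' s'' \<Longrightarrow> frm P s s''"
  by (simp add: frm_def)

lemma frm_mono: "frm P s s' \<Longrightarrow> wmod P \<subseteq> wmod Q \<Longrightarrow> rmod P \<subseteq> rmod Q \<Longrightarrow> frm Q s s'"
  by (auto simp: frm_def)

lemma exec_frm: "exec W P s T s' \<Longrightarrow> frm P s s'"
  by (induction rule: exec.induct) (auto simp: frm_def)

text \<open>Total correctness: a halting run exists that never stores a word above \<open>W\<close>.
  The postcondition also receives the number of steps, so that results and costs are established
  together.\<close>

definition wp :: "nat \<Rightarrow> com \<Rightarrow> (nat \<Rightarrow> store \<Rightarrow> bool) \<Rightarrow> store \<Rightarrow> bool" where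
  "wp W P Q s \<longleftrightarrow> (\<exists>T s'. exec W P s T s' \<and> Q T s')"

lemma wp_Skip [simp]: "wp W Skip Q s \<longleftrightarrow> Q 1 s"
  unfolding wp_def by (metis exec.Skip SkipE)

lemma wp_WAssign [simp]: "wp W (WAssign a i x) Q s \<longleftrightarrow> wval s x \<le> W \<and>
    Q (1 + wcost i + wcost x) (s\<lparr>words := (words s)(a := (words s a)(wval s i := wval s x))\<rparr>)"
  unfolding wp_def by (metis exec.WAssign WAssignE)

lemma wp_RAssign [simp]: "wp W (RAssign a i x) Q s \<longleftrightarrow>
    Q (1 + wcost i + rcost x) (s\<lparr>reals := (reals s)(a := (reals s a)(wval s i := rval s x))\<rparr>)"
  unfolding wp_def by (metis exec.RAssign RAssignE)

lemma wp_Then [simp]: "wp W (Then P R) Q s \<longleftrightarrow> wp W P (\<lambda>t. wp W R (\<lambda>t'. Q (t + t'))) s"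
  by (auto simp: wp_def intro: exec.Then elim!: ThenE)

lemma exec_Cond: "exec W (Cond b P R) s T s' \<longleftrightarrow>
    (\<exists>t. T = 1 + bcost b + t \<and> (if bval s b then exec W P s t s' else exec W R s t s'))"
proof
  assume "exec W (Cond b P R) s T s'"
  then show "\<exists>t. T = 1 + bcost b + t \<and> (if bval s b then exec W P s t s' else exec W R s t s')"
    by (rule CondE) auto
next
  assume "\<exists>t. T = 1 + bcost b + t \<and> (if bval s b then exec W P s t s' else exec W R s t s')"
  then obtain t where T: "T = 1 + bcost b + t" and e: "if bval s b then exec W P s t s' else exec W R s t s'"
    by blast
  show "exec W (Cond b P R) s T s'" unfolding T
    using e by (cases "bval s b") (auto intro: exec.CondTrue exec.CondFalse simp del: add.assoc)
qed

lemma wp_Cond [simp]: "wp W (Cond b P R) Q s \<longleftrightarrow>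
    (if bval s b then wp W P (\<lambda>t. Q (1 + bcost b + t)) s else wp W R (\<lambda>t. Q (1 + bcost b + t)) s)"
  unfolding wp_def exec_Cond by (cases "bval s b") auto

lemma wp_conseq: "wp W P Q s \<Longrightarrow> (\<And>t s'. frm P s s' \<Longrightarrow> Q t s' \<Longrightarrow> R t s') \<Longrightarrow> wp W P R s"
  unfolding wp_def using exec_frm by blast

lemma wp_seq: "wp W P Q s \<Longrightarrow> (\<And>t s'. frm P s s' \<Longrightarrow> Q t s' \<Longrightarrow> wp W R (\<lambda>t'. Q' (t + t')) s') \<Longrightarrow> wp W (Then P R) Q' s"
  using wp_conseq[of W P Q s] by simp

text \<open>\<open>\<tau>\<close> is the time spent since the loop was entered. Having it in the
  invariant allows amortized bounds; the measure \<open>\<mu>\<close> serves termination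
  alone.\<close>

lemma wp_while:
  assumes init: "Inv 0 s0"
    and step: "\<And>\<tau> s. frm P s0 s \<Longrightarrow> Inv \<tau> s \<Longrightarrow> bval s b \<Longrightarrow>
      wp W P (\<lambda>t s'. Inv (\<tau> + (1 + bcost b + t)) s' \<and> \<mu> s' < (\<mu> s :: nat)) s"
    and fin: "\<And>\<tau> s. frm P s0 s \<Longrightarrow> Inv \<tau> s \<Longrightarrow> \<not> bval s b \<Longrightarrow> Q (\<tau> + (1 + bcost b)) s"
  shows "wp W (While b P) Q s0"
proof -
  have "\<exists>T s'. exec W (While b P) s T s' \<and> Q (\<tau> + T) s'" if "frm P s0 s" "Inv \<tau> s" for \<tau> s
    using that
  proof (induction "\<mu> s" arbitrary: s \<tau> rule: less_induct)
    case less
    show ?case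
    proof (cases "bval s b")
      case True
      from step[OF less.prems True] obtain t s' where e: "exec W P s t s'"
        and i: "Inv (\<tau> + (1 + bcost b + t)) s'" and l: "\<mu> s' < \<mu> s"
        by (auto simp: wp_def)
      from less.hyps[OF l frm_trans[OF less.prems(1) exec_frm[OF e]] i] obtain T s''
        where "exec W (While b P) s' T s''" "Q (\<tau> + (1 + bcost b + t) + T) s''" by blast
      with exec.WhileTrue[OF True e] show ?thesis by (metis add.assoc)
    next
      case False
      then show ?thesis using fin[OF less.prems False] exec.WhileFalse[OF False] by blast
    qed
  qed
  from this[OF frm_refl init] show ?thesis by (simp add: wp_def)
qed

section \<open>Counting loops\<close>

definition For :: "name \<Rightarrow> wexp \<Rightarrow> com \<Rightarrow> com" where
  "For x B P = (x ::= WLit 0 ;; While (WLess (V x) B) (P ;; x ::= WAdd (V x) (WLit 1)))"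

lemma wmod_For [simp]: "wmod (For x B P) = insert x (wmod P)"
  by (auto simp: For_def)

lemma rmod_For [simp]: "rmod (For x B P) = rmod P"
  by (auto simp: For_def)

text \<open>The bound \<open>B\<close> is evaluated anew before every round, hence
  \<open>bnd\<close>; the counter advances after the body, so \<open>step\<close> must yield the
  invariant for the store in which the counter is already \<open>Suc k\<close>. A round costs
  \<open>c\<close> for the body, 6 for the increment and 4 + \<open>wcost B\<close> for the test;
  the extra round in \<open>n + 1\<close> pays for the initial assignment and the failing
  test.\<close>

lemma wp_for:
  assumes x: "x \<notin> wmod P" and nW: "n \<le> W"
    and init: "I 0 (s0\<lparr>words := (words s0)(x := (words s0 x)(0 := 0))\<rparr>)"
    and bnd: "\<And>k s. k \<le> n \<Longrightarrow> frm (For x B P) s0 s \<Longrightarrow> words s x 0 = k \<Longrightarrow> I k s \<Longrightarrow> wval s B = n"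
    and step: "\<And>k s. k < n \<Longrightarrow> frm (For x B P) s0 s \<Longrightarrow> words s x 0 = k \<Longrightarrow> I k s \<Longrightarrow>
      wp W P (\<lambda>t s'. t \<le> c \<and> I (Suc k) (s'\<lparr>words := (words s')(x := (words s' x)(0 := Suc k))\<rparr>)) s"
    and fin: "\<And>t s. frm (For x B P) s0 s \<Longrightarrow> words s x 0 = n \<Longrightarrow> I n s \<Longrightarrow>
      t \<le> (n + 1) * (c + wcost B + 10) \<Longrightarrow> Q t s"
  shows "wp W (For x B P) Q s0"
proof -
  define s1 where "s1 = s0\<lparr>words := (words s0)(x := (words s0 x)(0 := 0))\<rparr>"
  have f1: "frm (For x B P) s0 s1" by (auto simp: frm_def s1_def)
  let ?L = "P ;; x ::= WAdd (V x) (WLit 1)"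
  have fL: "frm (For x B P) s0 s" if "frm ?L s1 s" for s
    using f1 frm_mono[OF that, of "For x B P"] by (auto intro: frm_trans)
  let ?b = "WLess (V x) B"
  have "wp W (While ?b ?L) (\<lambda>t. Q (3 + t)) s1"
  proof (rule wp_while[where \<mu> = "\<lambda>s. n - words s x 0" and
        Inv = "\<lambda>\<tau> s. words s x 0 \<le> n \<and> I (words s x 0) s \<and> \<tau> \<le> words s x 0 * (c + wcost B + 10)"], goal_cases)
    case 1 show ?case using init by (simp add: s1_def)
  next
    case (2 \<tau> s)
    define k where "k = words s x 0"
    have inv: "words s x 0 \<le> n" "I k s" "\<tau> \<le> k * (c + wcost B + 10)" using 2(2) by (simp_all add: k_def)
    have f: "frm (For x B P) s0 s" by (rule fL[OF 2(1)])
    have B: "wval s B = n" using bnd[OF _ f k_def[symmetric] inv(2)] inv(1) by (simp add: k_def)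
    then have k: "k < n" using 2(3) by (simp add: k_def)
    have "wp W P (\<lambda>t s'. t \<le> c \<and> I (Suc k) (s'\<lparr>words := (words s')(x := (words s' x)(0 := Suc k))\<rparr>)) s"
      by (rule step[OF k f k_def[symmetric] inv(2)])
    then show ?case unfolding wp_Then
    proof (rule wp_conseq)
      fix t s' assume f: "frm P s s'" and q: "t \<le> c \<and> I (Suc k) (s'\<lparr>words := (words s')(x := (words s' x)(0 := Suc k))\<rparr>)"
      have [simp]: "words s' x 0 = k" using f x by (simp add: frm_def k_def)
      show "wp W (x ::= WAdd (V x) (WLit 1))
          (\<lambda>t'. (\<lambda>t s'. (words s' x 0 \<le> n \<and> I (words s' x 0) s' \<and> \<tau> + (1 + bcost ?b + t) \<le> words s' x 0 * (c + wcost B + 10)) \<and>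
            n - words s' x 0 < n - words s x 0) (t + t')) s'"
        using q k nW inv(3) by (simp add: k_def[symmetric] Suc_eq_plus1[symmetric] del: Suc_eq_plus1)
    qed
  next
    case (3 \<tau> s)
    have f: "frm (For x B P) s0 s" by (rule fL[OF 3(1)])
    have B: "wval s B = n" using bnd[OF _ f refl] 3(2) by simp
    then have n: "words s x 0 = n" using 3(2,3) by simp
    show ?case using 3(2) n by (intro fin[OF f n]) (auto simp: add_mult_distrib)
  qed
  then show ?thesis by (simp add: For_def s1_def)
qed

section \<open>Walks and tight arcs\<close>

locale arcgraph =
  fixes N m :: nat and sr ds :: "nat \<Rightarrow> nat"
  assumes sr_less: "e < m \<Longrightarrow> sr e < N" and ds_less: "e < m \<Longrightarrow> ds e < N"
begin

primrec walk :: "nat \<Rightarrow> nat list \<Rightarrow> nat \<Rightarrow> bool" where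
  "walk u [] v \<longleftrightarrow> u = v"
| "walk u (e # es) v \<longleftrightarrow> e < m \<and> sr e = u \<and> walk (ds e) es v"

definition wt :: "(nat \<Rightarrow> real) \<Rightarrow> nat list \<Rightarrow> real" where
  "wt w es = sum_list (map w es)"

lemma wt_simps [simp]:
  "wt w [] = 0" "wt w (e # es) = w e + wt w es" "wt w (xs @ ys) = wt w xs + wt w ys"
  by (simp_all add: wt_def)

lemma walk_append: "walk u (xs @ ys) v \<longleftrightarrow> (\<exists>x. walk u xs x \<and> walk x ys v)"
  by (induction xs arbitrary: u) auto

lemma walk_snoc: "walk u (xs @ [e]) v \<longleftrightarrow> e < m \<and> walk u xs (sr e) \<and> ds e = v"
  by (auto simp: walk_append)

lemma walk_arcs: "walk u es v \<Longrightarrow> set es \<subseteq> {..<m}"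
  by (induction es arbitrary: u) auto

lemma walk_end_less: "walk u es v \<Longrightarrow> es \<noteq> [] \<Longrightarrow> v < N"
  by (induction es arbitrary: u rule: rev_induct) (auto simp: walk_snoc ds_less)

lemma walk_start_less: "walk u es v \<Longrightarrow> es \<noteq> [] \<Longrightarrow> u < N"
  by (cases es) (auto simp: sr_less)

lemma walk_hd: "walk u es v \<Longrightarrow> es \<noteq> [] \<Longrightarrow> sr (hd es) = u"
  by (cases es) auto

text \<open>The cuts are made before two arcs with the same source \<open>y\<close>. As
  \<open>d\<close> begins with the second of these arcs, neither \<open>b\<close> nor
  \<open>a @ d\<close> is empty, which \<open>closed_decomp\<close> relies on.\<close>

lemma walk_repeat:
  assumes "walk u es v" "\<not> distinct (map sr es)"
  shows "\<exists>a b d y. es = a @ b @ d \<and> b \<noteq> [] \<and> d \<noteq> [] \<and> walk u a y \<and> walk y b y \<and> walk y d v"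
proof -
  from not_distinct_decomp[OF assms(2)] obtain xs ys zs y where
    "map sr es = xs @ [y] @ ys @ [y] @ zs" by blast
  then obtain a r where es: "es = a @ r" "map sr r = [y] @ ys @ [y] @ zs" "map sr a = xs"
    by (auto simp: map_eq_append_conv)
  then have "map sr r = ([y] @ ys) @ ([y] @ zs)" by simp
  then have "\<exists>b d. r = b @ d \<and> [y] @ ys = map sr b \<and> [y] @ zs = map sr d"
    unfolding map_eq_append_conv .
  then obtain b d where r: "r = b @ d" "[y] @ ys = map sr b" "[y] @ zs = map sr d" by (elim exE conjE)
  from r(2,3) have h: "b \<noteq> []" "d \<noteq> []" "sr (hd b) = y" "sr (hd d) = y" by (cases b; cases d; simp)+
  from assms(1) es(1) r(1) obtain x1 x2 where w: "walk u a x1" "walk x1 b x2" "walk x2 d v"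
    by (auto simp: walk_append)
  moreover have "x1 = y" "x2 = y" using walk_hd[OF w(2)] walk_hd[OF w(3)] h by simp_all
  moreover have "es = a @ b @ d" using es(1) r(1) by simp
  ultimately show ?thesis using h(1,2) by (intro exI conjI) simp_all
qed

lemma walk_long_repeat:
  assumes "walk u es v" "N < length es"
  shows "\<not> distinct (map sr es)"
proof
  assume "distinct (map sr es)"
  then have "card (set (map sr es)) = length es" by (metis distinct_card length_map)
  moreover have "set (map sr es) \<subseteq> {..<N}" using walk_arcs[OF assms(1)] sr_less by auto
  then have "card (set (map sr es)) \<le> N" by (metis card_lessThan card_mono finite_lessThan)
  ultimately show False using assms(2) by simp
qed

text \<open>By pigeonhole a longer walk leaves some vertex twice; the closed part in between can be
  cut out without raising the weight.\<close>

lemma walk_shorten: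
  assumes nn: "\<And>y b. walk y b y \<Longrightarrow> 0 \<le> wt w b" and "walk u es v"
  shows "\<exists>es'. walk u es' v \<and> length es' \<le> N \<and> wt w es' \<le> wt w es"
  using assms(2)
proof (induction "length es" arbitrary: es rule: less_induct)
  case less
  show ?case
  proof (cases "length es \<le> N")
    case False
    then have "\<not> distinct (map sr es)" using walk_long_repeat[OF less.prems] by simp
    from walk_repeat[OF less.prems this] obtain a b d y where
      es: "es = a @ b @ d" "b \<noteq> []" "walk u a y" "walk y b y" "walk y d v" by blast
    then have "walk u (a @ d) v" "length (a @ d) < length es" by (auto simp: walk_append)
    from less.hyps[OF this(2,1)] obtain es' where
      "walk u es' v" "length es' \<le> N" "wt w es' \<le> wt w (a @ d)" by blast
    with nn[OF es(4)] es(1) show ?thesis by (intro exI[of _ es']) auto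
  qed (use less.prems in auto)
qed

text \<open>For a closed walk the sources of its arcs are precisely its vertices, so this is a cycle
  in the usual sense, loops included.\<close>

definition simple_closed :: "nat list \<Rightarrow> bool" where
  "simple_closed es \<longleftrightarrow> es \<noteq> [] \<and> distinct (map sr es) \<and> (\<exists>u. walk u es u)"

text \<open>Removing one closed subwalk at a time splits a closed walk into simple ones, and weights
  add up. \<open>P\<close> will be positivity or nonnegativity, which thereby pass from cycles to
  all nonempty closed walks.\<close>

lemma closed_decomp:
  assumes "walk u es u" "es \<noteq> []"
    and simple: "\<And>es. simple_closed es \<Longrightarrow> P (wt w es)"
    and add: "\<And>x y :: real. P x \<Longrightarrow> P y \<Longrightarrow> P (x + y)"
  shows "P (wt w es)"
  using assms(1,2)
proof (induction "length es" arbitrary: es u rule: less_induct)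
  case less
  show ?case
  proof (cases "distinct (map sr es)")
    case True
    then show ?thesis using less.prems simple by (auto simp: simple_closed_def)
  next
    case False
    from walk_repeat[OF less.prems(1) False] obtain a b d y where
      es: "es = a @ b @ d" "b \<noteq> []" "d \<noteq> []" "walk u a y" "walk y b y" "walk y d u" by blast
    have "P (wt w b)" using less.hyps[OF _ es(5,2)] es by simp
    moreover have "P (wt w (a @ d))" using es by (intro less.hyps[of "a @ d" u]) (auto simp: walk_append)
    ultimately show ?thesis using add[of "wt w b" "wt w (a @ d)"] es(1) by (simp add: algebra_simps)
  qed
qed

lemma finite_simple_closed: "finite {es. simple_closed es}"
proof (rule finite_subset)
  show "{es. simple_closed es} \<subseteq> {es. set es \<subseteq> {..<m} \<and> length es \<le> N}"
    using walk_arcs walk_long_repeat unfolding simple_closed_def by (auto simp: not_less[symmetric])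
  show "finite {es. set es \<subseteq> {..<m} \<and> length es \<le> N}"
    by (intro finite_lists_length_le) simp
qed

lemma ex_simple_closed:
  assumes "walk u es u" "es \<noteq> []"
  shows "\<exists>es. simple_closed es"
  using assms
proof (induction "length es" arbitrary: es u rule: less_induct)
  case less
  show ?case
  proof (cases "distinct (map sr es)")
    case True
    then show ?thesis using less.prems unfolding simple_closed_def by blast
  next
    case False
    from walk_repeat[OF less.prems(1) False] obtain a b d y where
      es: "es = a @ b @ d" "b \<noteq> []" "d \<noteq> []" "walk y b y" by blast
    show ?thesis using less.hyps[OF _ es(4,2)] es by simp
  qed
qed

section \<open>Feasible potentials\<close>

definition feasible :: "(nat \<Rightarrow> real) \<Rightarrow> (nat \<Rightarrow> real) \<Rightarrow> bool" where
  "feasible w p \<longleftrightarrow> (\<forall>e<m. p (ds e) \<le> p (sr e) + w e)"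

lemma feasible_walk: "feasible w p \<Longrightarrow> walk u es v \<Longrightarrow> p v - p u \<le> wt w es"
  by (induction es arbitrary: u) (auto simp: feasible_def, smt (verit, best))

text \<open>An arc \<open>e\<close> prolongs a walk realizing \<open>p (sr e)\<close> to one that
  may exceed \<open>N\<close> arcs, and \<open>walk_shorten\<close> brings it back within reach of
  \<open>le\<close>. Serves both the existence proof and the output of Bellman-Ford.\<close>

lemma feasible_of_short:
  assumes nn: "\<And>y b. walk y b y \<Longrightarrow> 0 \<le> wt w b"
    and le: "\<And>v u es. v < N \<Longrightarrow> walk u es v \<Longrightarrow> length es \<le> N \<Longrightarrow> p v \<le> wt w es"
    and ex: "\<And>v. v < N \<Longrightarrow> \<exists>u es. walk u es v \<and> p v = wt w es"
  shows "feasible w p"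
  unfolding feasible_def
proof (intro allI impI)
  fix e assume e: "e < m"
  from ex[OF sr_less[OF e]] obtain u es where es: "walk u es (sr e)" "p (sr e) = wt w es" by blast
  then have "walk u (es @ [e]) (ds e)" using e by (auto simp: walk_snoc)
  from walk_shorten[where w = w, OF _ this] nn obtain es' where
    "walk u es' (ds e)" "length es' \<le> N" "wt w es' \<le> wt w (es @ [e])" by blast
  with le[OF ds_less[OF e]] es show "p (ds e) \<le> p (sr e) + w e" by force
qed

text \<open>The potential of \<open>v\<close> is the least weight of a walk of at most
  \<open>N\<close> arcs ending in \<open>v\<close>, from any start. This amounts to a virtual source
  joined to all vertices at weight 0, so every vertex gets a finite value.\<close>

lemma ex_feasible:
  assumes nn: "\<And>y b. walk y b y \<Longrightarrow> 0 \<le> wt w b"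
  shows "\<exists>p. feasible w p"
proof -
  let ?A = "\<lambda>v. {es. \<exists>u. walk u es v \<and> length es \<le> N}"
  have "?A v \<subseteq> {es. set es \<subseteq> {..<m} \<and> length es \<le> N}" for v using walk_arcs by blast
  then have fin: "finite (?A v)" for v by (rule finite_subset) (intro finite_lists_length_le, simp)
  have ne: "[] \<in> ?A v" for v by simp
  let ?p = "\<lambda>v. Min (wt w ` ?A v)"
  have "feasible w ?p"
  proof (rule feasible_of_short[OF nn])
    fix v u es assume "walk u es v" "length es \<le> N"
    then show "?p v \<le> wt w es" using fin by (intro Min_le) auto
  next
    fix v
    have "wt w ` ?A v \<noteq> {}" using ne by blast
    then have "?p v \<in> wt w ` ?A v" using fin by (intro Min_in finite_imageI)
    then show "\<exists>u es. walk u es v \<and> ?p v = wt w es" by blast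
  qed assumption
  then show ?thesis by blast
qed

end

text \<open>\<open>lam\<close> is the minimum ratio and \<open>p\<close> a potential certifying that
  nothing lies below it. \<open>attained\<close> is conditional on the existence of a closed walk,
  so acyclic graphs fit the locale as well, with an arbitrary \<open>lam\<close>.\<close>

locale mrc = arcgraph +
  fixes c t :: "nat \<Rightarrow> real" and lam :: real and p :: "nat \<Rightarrow> real"
  assumes tpos: "walk u es u \<Longrightarrow> es \<noteq> [] \<Longrightarrow> 0 < wt t es"
    and feas: "feasible (\<lambda>e. c e - lam * t e) p"
    and attained: "walk u es u \<Longrightarrow> es \<noteq> [] \<Longrightarrow>
      \<exists>v es'. walk v es' v \<and> es' \<noteq> [] \<and> wt c es' = lam * wt t es'"
begin

definition cyc :: bool where "cyc \<longleftrightarrow> (\<exists>u es. walk u es u \<and> es \<noteq> [])"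

lemma wt_diff: "wt (\<lambda>e. c e - x * t e) es = wt c es - x * wt t es"
  by (induction es) (auto simp: algebra_simps)

lemma lam_le: "walk u es u \<Longrightarrow> lam * wt t es \<le> wt c es"
  using feasible_walk[OF feas, of u es u] by (simp add: wt_diff)

text \<open>Positive transit times make the weight of each nonempty closed walk strictly decreasing
  in \<open>x\<close>; at \<open>lam\<close> none is negative and one vanishes. Testing all closed
  walks at \<open>x\<close> thus compares \<open>x\<close> with the unknown
  \<open>lam\<close>.\<close>

lemma oracle_iff:
  assumes cyc
  shows "(\<forall>u es. walk u es u \<longrightarrow> 0 \<le> wt (\<lambda>e. c e - x * t e) es) \<longleftrightarrow> x \<le> lam"
proof
  assume "x \<le> lam"
  show "\<forall>u es. walk u es u \<longrightarrow> 0 \<le> wt (\<lambda>e. c e - x * t e) es"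
  proof (intro allI impI)
    fix u es assume w: "walk u es u"
    have "0 \<le> wt t es" using tpos[OF w] by (cases "es = []") auto
    then have "x * wt t es \<le> lam * wt t es" using \<open>x \<le> lam\<close> by (simp add: mult_right_mono)
    then show "0 \<le> wt (\<lambda>e. c e - x * t e) es" using lam_le[OF w] by (simp add: wt_diff)
  qed
next
  assume a: "\<forall>u es. walk u es u \<longrightarrow> 0 \<le> wt (\<lambda>e. c e - x * t e) es"
  from assms obtain v es where es: "walk v es v" "es \<noteq> []" "wt c es = lam * wt t es"
    unfolding cyc_def using attained by blast
  then have "0 \<le> (lam - x) * wt t es" using a[rule_format, OF es(1)] by (simp add: wt_diff algebra_simps)
  then show "x \<le> lam" using tpos[OF es(1,2)] by (simp add: zero_le_mult_iff)
qed

text \<open>Equality in the bound \<open>walk_ge\<close>. A tight walk is cheapest between its ends,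
  but a cheapest walk need not be tight. Tightness survives both cutting and joining because the
  slacks of the parts are nonnegative and add up.\<close>

definition tight :: "nat \<Rightarrow> nat list \<Rightarrow> nat \<Rightarrow> bool" where
  "tight u es v \<longleftrightarrow> walk u es v \<and> wt c es - lam * wt t es = p v - p u"

lemma walk_ge: "walk u es v \<Longrightarrow> p v - p u \<le> wt c es - lam * wt t es"
  using feasible_walk[OF feas, of u es v] by (simp add: wt_diff)

lemma tight_append: "tight u (xs @ ys) v \<longleftrightarrow> (\<exists>x. tight u xs x \<and> tight x ys v)"
proof
  assume a: "tight u (xs @ ys) v"
  then obtain x where x: "walk u xs x" "walk x ys v" by (auto simp: tight_def walk_append)
  with a walk_ge[OF x(1)] walk_ge[OF x(2)] show "\<exists>x. tight u xs x \<and> tight x ys v"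
    by (intro exI[of _ x]) (auto simp: tight_def algebra_simps)
qed (auto simp: tight_def walk_append algebra_simps)

lemma tight_Nil [simp]: "tight u [] v \<longleftrightarrow> u = v"
  by (auto simp: tight_def)

lemma tight_closed_iff: "tight u es u \<longleftrightarrow> walk u es u \<and> wt c es = lam * wt t es"
  by (auto simp: tight_def)

lemma ex_tight_closed: "cyc \<Longrightarrow> \<exists>u es. tight u es u \<and> es \<noteq> []"
  unfolding cyc_def tight_closed_iff using attained by blast

text \<open>A vertex that reaches a fixed tight closed walk starts tight walks of every length. Unless a short cycle
  exists, such a walk meets the hitting set again and again, so that some of its vertices recurs.\<close>

lemma tight_core:
  assumes cyc
    and E: "\<And>l u v es. l \<le> h \<Longrightarrow> u < N \<Longrightarrow> tight u es v \<Longrightarrow> length es = l \<Longrightarrow> E l u v"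
    and tr0: "\<And>u v. tr u v 0 = v"
    and trE: "\<And>u v j. u < N \<Longrightarrow> v < N \<Longrightarrow> E h u v \<Longrightarrow> j \<le> h \<Longrightarrow> E (h - j) u (tr u v j)"
    and trw: "\<And>u v j. u < N \<Longrightarrow> v < N \<Longrightarrow> E h u v \<Longrightarrow> j < h \<Longrightarrow> \<exists>e. tight (tr u v (Suc j)) [e] (tr u v j)"
    and hit: "\<And>u v. u < N \<Longrightarrow> v < N \<Longrightarrow> E h u v \<Longrightarrow> inj_on (tr u v) {..<h} \<Longrightarrow> \<exists>j<h. \<exists>i<q. tr u v j = hs i"
    and hs: "\<And>i. i < q \<Longrightarrow> hs i < N"
    and h: "1 \<le> h"
  shows "(\<exists>l\<in>{1..h}. \<exists>v<N. E l v v) \<or>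
    (\<exists>i<q. \<exists>k\<in>{1..q}. (i, i) \<in> {(i, k). i < q \<and> k < q \<and> (\<exists>l\<in>{1..h}. E l (hs i) (hs k))} ^^ k)"
proof (rule disjCI)
  let ?R = "{(i, k). i < q \<and> k < q \<and> (\<exists>l\<in>{1..h}. E l (hs i) (hs k))}"
  assume nk: "\<not> (\<exists>i<q. \<exists>k\<in>{1..q}. (i, i) \<in> ?R ^^ k)"
  show "\<exists>l\<in>{1..h}. \<exists>v<N. E l v v"
  proof (rule ccontr)
    assume no: "\<not> (\<exists>l\<in>{1..h}. \<exists>v<N. E l v v)"
    from ex_tight_closed[OF assms(1)] obtain z zs where z: "tight z zs z" "zs \<noteq> []" by blast
    \<comment> \<open>Every vertex of \<open>S\<close> has a tight walk to \<open>z\<close>, and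
      appending the closed walk \<open>zs\<close> repeatedly makes it as long as desired; its first
      \<open>h\<close> arcs then end in \<open>S\<close> again.\<close>
    define S where "S = {x. \<exists>es. tight x es z}"
    have zN: "z < N" using z walk_end_less by (auto simp: tight_def)
    have long: "\<exists>es. tight x es z \<and> k \<le> length es" if "x \<in> S" for x k
    proof (induction k)
      case 0 then show ?case using that by (auto simp: S_def)
    next
      case (Suc k)
      then obtain es where "tight x es z" "k \<le> length es" by blast
      then have "tight x (es @ zs) z \<and> Suc k \<le> length (es @ zs)" using z by (cases zs) (auto simp: tight_append)
      then show ?case by blast
    qed
    have SN: "x < N" if x: "x \<in> S" for x
    proof -
      from x obtain es where "walk x es z" by (auto simp: S_def tight_def)
      then show ?thesis using zN walk_start_less[of x es z] by (cases "es = []") auto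
    qed
    have reach: "\<exists>v es. v \<in> S \<and> tight x es v \<and> length es = h" if x: "x \<in> S" for x
    proof -
      from long[OF x] obtain es where es: "tight x es z" "h \<le> length es" by blast
      then have "tight x (take h es @ drop h es) z" by simp
      then obtain v where "tight x (take h es) v" "tight v (drop h es) z" unfolding tight_append by blast
      with es(2) show ?thesis by (intro exI[of _ v] exI[of _ "take h es"]) (auto simp: S_def)
    qed
    have seg: "\<exists>es. tight (tr u v (j + k)) es (tr u v j) \<and> length es = k"
      if "u < N" "v < N" "E h u v" "j + k \<le> h" for u v j k
      using that(4)
    proof (induction k)
      case (Suc k)
      from Suc obtain es where es: "tight (tr u v (j + k)) es (tr u v j)" "length es = k" by auto
      from trw[OF that(1-3), of "j + k"] Suc.prems obtain e where "tight (tr u v (Suc (j + k))) [e] (tr u v (j + k))" by auto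
      with es show ?case using tight_append[of "tr u v (j + Suc k)" "[e]" es] by (intro exI[of _ "e # es"]) auto
    qed simp
    have step: "\<exists>i<q. hs i \<in> S \<and> (\<exists>l\<in>{1..h}. E l x (hs i))" if x: "x \<in> S" for x
    proof -
      from reach[OF x] obtain v es where v: "v \<in> S" "tight x es v" "length es = h" by blast
      have xv: "x < N" "v < N" using x v SN by auto
      have Eh: "E h x v" using E[OF order_refl xv(1) v(2,3)] .
      \<comment> \<open>If the traced walk met a vertex twice, the arcs between the two visits would
        form a tight closed walk of \<open>j - i < h\<close> arcs, which \<open>no\<close> excludes.
        Indices of \<open>tr\<close> count backwards from the end \<open>v\<close>.\<close>
      have "tr x v i \<noteq> tr x v j" if ij: "i < j" "j < h" for i j
      proof
        assume eq: "tr x v i = tr x v j"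
        from seg[OF xv Eh, of i "j - i"] ij obtain fs where fs: "tight (tr x v j) fs (tr x v i)" "length fs = j - i" by auto
        have "tr x v j < N" using fs ij walk_start_less unfolding tight_def by fastforce
        then have "E (j - i) (tr x v j) (tr x v j)" using E[of "j - i" "tr x v j" fs] fs ij eq by auto
        moreover have "j - i \<in> {1..h}" using ij by auto
        ultimately show False using no \<open>tr x v j < N\<close> by blast
      qed
      then have "inj_on (tr x v) {..<h}" by (intro linorder_inj_onI) auto
      from hit[OF xv Eh this] obtain j i where ji: "j < h" "i < q" "tr x v j = hs i" by blast
      \<comment> \<open>From the hit vertex the rest of the traced walk leads tightly to
        \<open>v\<close>, so it lies in \<open>S\<close>. The part before it has
        \<open>h - j\<close> arcs, at least one because \<open>j < h\<close>.\<close>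
      from seg[OF xv Eh, of 0 j] ji tr0 obtain fs where "tight (hs i) fs v" by auto
      with v(1) have "hs i \<in> S" unfolding S_def using tight_append by blast
      moreover have "E (h - j) x (hs i)" using trE[OF xv Eh, of j] ji by simp
      moreover have "h - j \<in> {1..h}" using ji by auto
      ultimately show ?thesis using ji by blast
    qed
    define I where "I = {i. i < q \<and> hs i \<in> S}"
    have "\<exists>k. k \<in> I \<and> (i, k) \<in> ?R" if "i \<in> I" for i
    proof -
      from that step[of "hs i"] obtain k where "k < q" "hs k \<in> S" "\<exists>l\<in>{1..h}. E l (hs i) (hs k)"
        unfolding I_def by blast
      with that show ?thesis unfolding I_def by blast
    qed
    then obtain f where f: "\<And>i. i \<in> I \<Longrightarrow> f i \<in> I \<and> (i, f i) \<in> ?R"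
      using bchoice[of I "\<lambda>i k. k \<in> I \<and> (i, k) \<in> ?R"] by blast
    have "z \<in> S" unfolding S_def using tight_Nil by blast
    from step[OF this] obtain i0 where i0: "i0 \<in> I" unfolding I_def by blast
    have fI: "(f ^^ k) i0 \<in> I" for k
    proof (induction k)
      case (Suc k) then show ?case using f[of "(f ^^ k) i0"] by simp
    qed (simp add: i0)
    have fR: "((f ^^ a) i0, (f ^^ (a + k)) i0) \<in> ?R ^^ k" for a k
    proof (induction k)
      case (Suc k)
      from f[OF fI[of "a + k"]] have "((f ^^ (a + k)) i0, (f ^^ (a + Suc k)) i0) \<in> ?R" by simp
      with Suc show ?case unfolding relpow.simps by blast
    qed simp
    \<comment> \<open>These are \<open>q + 1\<close> iterates inside a set of at most
      \<open>q\<close> indices: two coincide, and the piece between them is a closed chain of at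
      most \<open>q\<close> hops.\<close>
    have "\<not> inj_on (\<lambda>k. (f ^^ k) i0) {..q}"
    proof
      assume "inj_on (\<lambda>k. (f ^^ k) i0) {..q}"
      then have "card ((\<lambda>k. (f ^^ k) i0) ` {..q}) = Suc q" by (simp add: card_image)
      moreover have "(\<lambda>k. (f ^^ k) i0) ` {..q} \<subseteq> {..<q}" using fI by (auto simp: I_def)
      then have "card ((\<lambda>k. (f ^^ k) i0) ` {..q}) \<le> q" by (metis card_lessThan card_mono finite_lessThan)
      ultimately show False by simp
    qed
    then obtain a b where ab: "a < b" "b \<le> q" "(f ^^ a) i0 = (f ^^ b) i0"
      by (metis atMost_iff linorder_inj_onI')
    from fR[of a "b - a"] ab have "((f ^^ a) i0, (f ^^ a) i0) \<in> ?R ^^ (b - a)" by simp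
    then have loop: "\<exists>k\<in>{1..q}. ((f ^^ a) i0, (f ^^ a) i0) \<in> ?R ^^ k"
      by (rule bexI) (use ab in auto)
    have "(f ^^ a) i0 < q" using fI[of a] by (simp add: I_def)
    with loop have "\<exists>i<q. \<exists>k\<in>{1..q}. (i, i) \<in> ?R ^^ k" by (intro exI[of _ "(f ^^ a) i0"] conjI)
    with nk show False by (rule notE)
  qed
qed

end

section \<open>The Bellman-Ford oracle\<close>

text \<open>\<open>S\<close> dominates the size of the input and \<open>W\<close> is a fixed power
  of it. Word bounds are obtained by estimating quantities by powers of \<open>S\<close>, see
  \<open>le_W\<close>.\<close>

locale mrc_ram = mrc +
  fixes W S :: nat
  assumes S2: "2 \<le> S" and NS: "N \<le> S" and mS: "m \<le> S" and W_def: "W = S ^ 16"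
begin

definition inp :: "store \<Rightarrow> bool" where
  "inp s \<longleftrightarrow> words s ''N'' 0 = N \<and> words s ''m'' 0 = m \<and>
     (\<forall>e<m. words s ''tl'' e = sr e \<and> words s ''hd'' e = ds e \<and> reals s ''cost'' e = c e \<and> reals s ''time'' e = t e)"

lemma inp_frm:
  assumes "inp s" "frm P s s'" "wmod P \<inter> {''N'', ''m'', ''tl'', ''hd''} = {}" "rmod P \<inter> {''cost'', ''time''} = {}"
  shows "inp s'"
proof -
  have "''N'' \<notin> wmod P" "''m'' \<notin> wmod P" "''tl'' \<notin> wmod P" "''hd'' \<notin> wmod P" "''cost'' \<notin> rmod P" "''time'' \<notin> rmod P"
    using assms(3,4) by blast+
  then show ?thesis using assms(1,2) by (simp add: inp_def frm_def)
qed

lemma le_W: "x \<le> S ^ k \<Longrightarrow> k \<le> 16 \<Longrightarrow> x \<le> W"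
  unfolding W_def using S2 by (meson le_trans power_increasing one_le_numeral)

lemma N_le_W: "N \<le> W" using le_W[of N 1] NS by simp
lemma m_le_W: "m \<le> W" using le_W[of m 1] mS by simp
lemma one_le_W: "1 \<le> W" using le_W[of 1 1] S2 by simp

definition noneg :: "real \<Rightarrow> bool" where
  "noneg x \<longleftrightarrow> (\<forall>u es. walk u es u \<longrightarrow> 0 \<le> wt (\<lambda>e. c e - x * t e) es)"

text \<open>State of Bellman-Ford after \<open>r\<close> full rounds and the first \<open>k\<close>
  arcs of the next one. Values start at 0 everywhere, so walks with arbitrary start compete and
  negative closed walks are noticed wherever they lie. The first clause keeps values realizable by
  walks; the last one lets a finished round count as one more arc
  (\<open>relaxed_round\<close>).\<close>

definition relaxed :: "(nat \<Rightarrow> real) \<Rightarrow> nat \<Rightarrow> nat \<Rightarrow> (nat \<Rightarrow> real) \<Rightarrow> bool" where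
  "relaxed w r k d \<longleftrightarrow> (\<forall>v<N. \<exists>u es. walk u es v \<and> d v = wt w es) \<and>
     (\<forall>u es. \<forall>v<N. walk u es v \<longrightarrow> length es \<le> r \<longrightarrow> d v \<le> wt w es) \<and>
     (\<forall>u es. \<forall>e<k. walk u es (sr e) \<longrightarrow> length es \<le> r \<longrightarrow> d (ds e) \<le> wt w es + w e)"

lemma relaxed_init: "relaxed w 0 0 (\<lambda>_. 0)"
  unfolding relaxed_def by (auto intro!: exI[of _ "[]"])

lemma relaxed_cong: "relaxed w r k d \<Longrightarrow> k \<le> m \<Longrightarrow> (\<And>v. v < N \<Longrightarrow> d v = d' v) \<Longrightarrow> relaxed w r k d'"
  unfolding relaxed_def by (simp add: ds_less)

lemma relaxed_step:
  assumes "relaxed w r k d" "k < m"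
  shows "relaxed w r (Suc k) (if d (sr k) + w k < d (ds k) then d(ds k := d (sr k) + w k) else d)"
proof -
  let ?d = "if d (sr k) + w k < d (ds k) then d(ds k := d (sr k) + w k) else d"
  have le: "?d v \<le> d v" for v by simp
  have a: "\<exists>u es. walk u es v \<and> ?d v = wt w es" if "v < N" for v
  proof (cases "?d v = d v")
    case True
    then show ?thesis using assms(1) that unfolding relaxed_def by metis
  next
    case False
    then have v: "v = ds k" "?d v = d (sr k) + w k" by (auto split: if_splits)
    from assms sr_less[OF assms(2)] obtain u es where "walk u es (sr k)" "d (sr k) = wt w es"
      unfolding relaxed_def by metis
    then show ?thesis using v assms(2) by (intro exI[of _ u] exI[of _ "es @ [k]"]) (simp add: walk_snoc)
  qed
  moreover have "?d v \<le> wt w es" if "v < N" "walk u es v" "length es \<le> r" for u es v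
    using assms(1) that le[of v] unfolding relaxed_def by (meson order_trans)
  moreover have "?d (ds e) \<le> wt w es + w e" if "e < Suc k" "walk u es (sr e)" "length es \<le> r" for u es e
  proof (cases "e = k")
    case True
    have "d (sr k) \<le> wt w es" using assms that True sr_less unfolding relaxed_def by metis
    then show ?thesis using True by auto
  next
    case False
    then have "d (ds e) \<le> wt w es + w e" using assms(1) that unfolding relaxed_def by (metis less_antisym)
    then show ?thesis using le[of "ds e"] by linarith
  qed
  ultimately show ?thesis unfolding relaxed_def by blast
qed

lemma relaxed_round:
  assumes "relaxed w r m d"
  shows "relaxed w (Suc r) 0 d"
proof -
  have "d v \<le> wt w es" if "v < N" "walk u es v" "length es \<le> Suc r" for u es v
  proof (cases es rule: rev_cases)
    case Nil
    then show ?thesis using assms that(1,2) unfolding relaxed_def by (metis le0 list.size(3))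
  next
    case (snoc fs e)
    then show ?thesis using assms that unfolding relaxed_def by (auto simp: walk_snoc)
  qed
  then show ?thesis using assms unfolding relaxed_def by simp
qed

lemma relaxed_feasible:
  assumes "relaxed w N 0 d" "\<And>y b. walk y b y \<Longrightarrow> 0 \<le> wt w b"
  shows "feasible w d"
  using assms(1) by (intro feasible_of_short[OF assms(2)]) (auto simp: relaxed_def)

definition tl_be :: wexp where "tl_be = WCell ''tl'' (V ''be'')"
definition hd_be :: wexp where "hd_be = WCell ''hd'' (V ''be'')"
definition via_be :: rexp where
  "via_be = RAdd (RCell ''d'' tl_be) (RSub (RCell ''cost'' (V ''be'')) (RMul (RV ''x'') (RCell ''time'' (V ''be''))))"

definition BF :: com where
  "BF = For ''bv'' (V ''N'') (RAssign ''d'' (V ''bv'') RZero) ;;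
    For ''br'' (V ''N'') (For ''be'' (V ''m'')
      (Cond (RLess via_be (RCell ''d'' hd_be)) (RAssign ''d'' hd_be via_be) Skip)) ;;
    ''ok'' ::= WLit 1 ;;
    For ''be'' (V ''m'') (Cond (RLess via_be (RCell ''d'' hd_be)) (''ok'' ::= WLit 0) Skip)"

lemma wmod_BF [simp]: "wmod BF = {''bv'', ''br'', ''be'', ''ok''}"
  by (auto simp: BF_def)

lemma rmod_BF [simp]: "rmod BF = {''d''}"
  by (auto simp: BF_def)

lemma BF_round:
  assumes i: "inp s" and x: "reals s ''x'' 0 = x" and J: "relaxed (\<lambda>e. c e - x * t e) r 0 (reals s ''d'')"
  shows "wp W (For ''be'' (V ''m'') (Cond (RLess via_be (RCell ''d'' hd_be)) (RAssign ''d'' hd_be via_be) Skip))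
    (\<lambda>\<tau> s'. \<tau> \<le> 60 * (m + 1) \<and> relaxed (\<lambda>e. c e - x * t e) (Suc r) 0 (reals s' ''d'')) s"
proof (rule wp_for[where n = m and c = 45 and I = "\<lambda>k s. relaxed (\<lambda>e. c e - x * t e) r k (reals s ''d'')"], goal_cases)
  case (5 k s')
  have f: "inp s'" by (rule inp_frm[OF i 5(2)]) simp_all
  have x': "reals s' ''x'' 0 = x" using 5(2) x by (simp add: frm_def)
  show ?case using 5(1,3) f relaxed_step[OF 5(4,1)] x'
    by (simp add: inp_def via_be_def tl_be_def hd_be_def sr_less ds_less split: if_splits)
next
  case (6 \<tau> s')
  then show ?case using relaxed_round by simp
qed (use i J m_le_W in \<open>simp_all add: inp_def frm_def\<close>)

text \<open>The last pass tests feasibility of the computed array directly. A feasible array rules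
  out negative closed walks, and in their absence \<open>N\<close> rounds produce a feasible array,
  so the flag is right in both cases.\<close>

lemma BF_wp:
  assumes i: "inp s" and x: "reals s ''x'' 0 = x"
  shows "wp W BF (\<lambda>\<tau> s'. \<tau> \<le> 250 * ((N + 1) * (m + 1)) \<and>
      words s' ''ok'' 0 = (if noneg x then 1 else 0) \<and>
      (noneg x \<longrightarrow> feasible (\<lambda>e. c e - x * t e) (reals s' ''d''))) s"
  unfolding BF_def
proof (rule wp_seq)
  let ?w = "\<lambda>e. c e - x * t e"
  let ?C = "For ''bv'' (V ''N'') (RAssign ''d'' (V ''bv'') RZero)"
  show "wp W ?C (\<lambda>\<tau> s'. \<tau> \<le> 20 * (N + 1) \<and> relaxed ?w 0 0 (reals s' ''d'')) s"
  proof (rule wp_for[where n = N and c = 4 and I = "\<lambda>k s. \<forall>v<k. reals s ''d'' v = 0"], goal_cases)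
    case (6 \<tau> s')
    then show ?case using relaxed_cong[OF relaxed_init, of "reals s' ''d''"] by auto
  qed (use i N_le_W in \<open>auto simp: inp_def frm_def less_Suc_eq\<close>)
  fix \<tau>1 s1 assume f1: "frm ?C s s1" and q1: "\<tau>1 \<le> 20 * (N + 1) \<and> relaxed ?w 0 0 (reals s1 ''d'')"
  have i1: "inp s1" by (rule inp_frm[OF i f1]) simp_all
  have x1: "reals s1 ''x'' 0 = x" using f1 x by (simp add: frm_def)
  let ?D = "For ''be'' (V ''m'') (Cond (RLess via_be (RCell ''d'' hd_be)) (RAssign ''d'' hd_be via_be) Skip)"
  let ?F = "For ''be'' (V ''m'') (Cond (RLess via_be (RCell ''d'' hd_be)) (''ok'' ::= WLit 0) Skip)"
  show "wp W (For ''br'' (V ''N'') ?D ;; ''ok'' ::= WLit 1 ;; ?F)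
     (\<lambda>\<tau>. (\<lambda>\<tau> s'. \<tau> \<le> 250 * ((N + 1) * (m + 1)) \<and> words s' ''ok'' 0 = (if noneg x then 1 else 0) \<and>
      (noneg x \<longrightarrow> feasible ?w (reals s' ''d''))) (\<tau>1 + \<tau>)) s1"
  proof (rule wp_seq)
    show "wp W (For ''br'' (V ''N'') ?D)
      (\<lambda>\<tau> s'. \<tau> \<le> (N + 1) * (60 * (m + 1) + 12) \<and> relaxed ?w N 0 (reals s' ''d'')) s1"
    proof (rule wp_for[where n = N and c = "60 * (m + 1)" and I = "\<lambda>k s. relaxed ?w k 0 (reals s ''d'')"], goal_cases)
      case (5 k s')
      have f: "inp s'" by (rule inp_frm[OF i1 5(2)]) simp_all
      have x': "reals s' ''x'' 0 = x" using 5(2) x1 by (simp add: frm_def)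
      show ?case using BF_round[OF f x' 5(4)] by simp
    qed (use i1 q1 N_le_W in \<open>simp_all add: inp_def frm_def\<close>)
    fix \<tau>2 s2 assume f2: "frm (For ''br'' (V ''N'') ?D) s1 s2"
      and q2: "\<tau>2 \<le> (N + 1) * (60 * (m + 1) + 12) \<and> relaxed ?w N 0 (reals s2 ''d'')"
    have i2: "inp s2" by (rule inp_frm[OF i1 f2]) simp_all
    have x2: "reals s2 ''x'' 0 = x" using f2 x1 by (simp add: frm_def)
    define s3 where "s3 = s2\<lparr>words := (words s2)(''ok'' := (words s2 ''ok'')(0 := 1))\<rparr>"
    have i3: "inp s3" "reals s3 ''x'' 0 = x" "reals s3 ''d'' = reals s2 ''d''" "words s3 ''ok'' 0 = 1"
      using i2 x2 by (simp_all add: s3_def inp_def)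
    have "wp W ?F (\<lambda>\<tau> s'. \<tau> \<le> 60 * (m + 1) \<and> reals s' ''d'' = reals s2 ''d'' \<and>
       words s' ''ok'' 0 = (if feasible ?w (reals s2 ''d'') then 1 else 0)) s3"
    proof (rule wp_for[where n = m and c = 30 and I = "\<lambda>k s. reals s ''d'' = reals s2 ''d'' \<and>
        words s ''ok'' 0 = (if \<forall>e<k. reals s2 ''d'' (ds e) \<le> reals s2 ''d'' (sr e) + ?w e then 1 else 0)"], goal_cases)
      case (5 k s')
      have f: "inp s'" by (rule inp_frm[OF i3(1) 5(2)]) simp_all
      have x': "reals s' ''x'' 0 = x" using 5(2) i3 by (simp add: frm_def)
      show ?case using 5(1,3,4) f x'
        by (auto simp: inp_def via_be_def tl_be_def hd_be_def less_Suc_eq)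
    next
      case (6 \<tau> s')
      then show ?case by (simp add: feasible_def)
    qed (use i3 m_le_W in \<open>simp_all add: inp_def frm_def\<close>)
    then have "wp W (''ok'' ::= WLit 1 ;; ?F) (\<lambda>\<tau> s'. \<tau> \<le> 60 * (m + 1) + 3 \<and> reals s' ''d'' = reals s2 ''d'' \<and>
       words s' ''ok'' 0 = (if feasible ?w (reals s2 ''d'') then 1 else 0)) s2"
      using one_le_W by (auto simp: s3_def intro: wp_conseq)
    then show "wp W (''ok'' ::= WLit 1 ;; ?F) (\<lambda>\<tau>. (\<lambda>\<tau>. (\<lambda>\<tau> s'. \<tau> \<le> 250 * ((N + 1) * (m + 1)) \<and> words s' ''ok'' 0 = (if noneg x then 1 else 0) \<and>
      (noneg x \<longrightarrow> feasible ?w (reals s' ''d''))) (\<tau>1 + \<tau>)) (\<tau>2 + \<tau>)) s2"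
    proof (rule wp_conseq, goal_cases)
      case (1 \<tau>3 s4)
      have "noneg x \<longleftrightarrow> feasible ?w (reals s2 ''d'')"
      proof
        assume "noneg x"
        then show "feasible ?w (reals s2 ''d'')" using relaxed_feasible q2 unfolding noneg_def by blast
      next
        assume "feasible ?w (reals s2 ''d'')"
        then show "noneg x" unfolding noneg_def using feasible_walk by fastforce
      qed
      moreover have "\<tau>1 + (\<tau>2 + \<tau>3) \<le> 250 * ((N + 1) * (m + 1))" using q1 q2 1 by (simp add: algebra_simps)
      ultimately show ?case using 1(2) by simp
    qed
  qed
qed

end

section \<open>Medians\<close>

text \<open>Empty slots lose, and ties go to the left child.\<close>

definition win :: "(nat \<Rightarrow> real) \<Rightarrow> nat \<Rightarrow> nat \<Rightarrow> nat" where
  "win xs l r = (if 0 < l \<and> \<not> (0 < r \<and> xs (r - 1) < xs (l - 1)) then l else r)"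

text \<open>\<open>A\<close> is the set of surviving indices. \<open>X\<close> collects the inner
  nodes at which the winner rule is suspended: those not yet built, or the ancestors of a leaf that
  has just been changed.\<close>

definition tour :: "(nat \<Rightarrow> real) \<Rightarrow> nat \<Rightarrow> nat set \<Rightarrow> (nat \<Rightarrow> nat) \<Rightarrow> nat set \<Rightarrow> bool" where
  "tour xs p A tr X \<longleftrightarrow> (\<forall>i<p. tr (p + i) = (if i \<in> A then i + 1 else 0)) \<and> (\<forall>b < 2 * p. tr b \<le> p) \<and>
     (\<forall>b. 1 \<le> b \<and> b < p \<and> b \<notin> X \<longrightarrow> tr b = win xs (tr (2 * b)) (tr (2 * b + 1)))"

text \<open>Climbing from the leaf \<open>p + i\<close>, each halving passes to the parent, whose
  winner is at most the winner of either child.\<close>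

lemma tour_le:
  assumes "tour xs p A tr {}" "i \<in> A" "i < p" "1 \<le> (p + i) div 2 ^ d"
  shows "0 < tr ((p + i) div 2 ^ d) \<and> xs (tr ((p + i) div 2 ^ d) - 1) \<le> xs i"
  using assms(4)
proof (induction d)
  case 0
  then show ?case using assms by (simp add: tour_def)
next
  case (Suc d)
  define a where "a = (p + i) div 2 ^ d"
  have h: "(p + i) div 2 ^ Suc d = a div 2" by (simp only: a_def power_Suc2 div_mult2_eq)
  have a1: "1 \<le> a" "1 \<le> a div 2" using Suc.prems unfolding h by simp_all
  have "a \<le> p + i" by (simp add: a_def)
  then have "a div 2 < p" using assms(3) by linarith
  then have e: "tr (a div 2) = win xs (tr (2 * (a div 2))) (tr (2 * (a div 2) + 1))"
    using assms(1) a1(2) by (simp add: tour_def)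
  have IH: "0 < tr a \<and> xs (tr a - 1) \<le> xs i" using Suc.IH a1(1) by (simp add: a_def)
  have "a = 2 * (a div 2) \<or> a = 2 * (a div 2) + 1" by linarith
  then have "0 < win xs (tr (2 * (a div 2))) (tr (2 * (a div 2) + 1)) \<and>
      xs (win xs (tr (2 * (a div 2))) (tr (2 * (a div 2) + 1)) - 1) \<le> xs i"
  proof
    assume "a = 2 * (a div 2)"
    then show ?thesis using IH by (auto simp: win_def)
  next
    assume "a = 2 * (a div 2) + 1"
    then show ?thesis using IH by (auto simp: win_def)
  qed
  then show ?case unfolding h e .
qed

lemma tour_mem:
  assumes "tour xs p A tr {}" "1 \<le> b" "b < 2 * p" "0 < tr b"
  shows "tr b - 1 \<in> A"
  using assms(2-4)
proof (induction "2 * p - b" arbitrary: b rule: less_induct)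
  case less
  show ?case
  proof (cases "b < p")
    case True
    then have e: "tr b = win xs (tr (2 * b)) (tr (2 * b + 1))" using assms(1) less.prems by (simp add: tour_def)
    then have "tr b = tr (2 * b) \<or> tr b = tr (2 * b + 1)" by (simp add: win_def)
    then consider "tr b = tr (2 * b)" | "tr b = tr (2 * b + 1)" by blast
    then show ?thesis using less.hyps[of "2 * b"] less.hyps[of "2 * b + 1"] less.prems True by cases auto
  next
    case False
    then have "b - p < p" "p + (b - p) = b" using less.prems by linarith+
    then have "tr b = (if b - p \<in> A then b - p + 1 else 0)" using assms(1) unfolding tour_def by metis
    then show ?thesis using False less.prems by (auto split: if_splits)
  qed
qed

text \<open>Every leaf reaches the root 1 by halving, so the array forms a single tree for all
  \<open>p\<close>, powers of 2 or not.\<close>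

lemma div_pow2_eq_1: "0 < (x :: nat) \<Longrightarrow> \<exists>d. x div 2 ^ d = 1"
proof (induction x rule: less_induct)
  case (less x)
  show ?case
  proof (cases "x = 1")
    case True
    then show ?thesis by (intro exI[of _ 0]) simp
  next
    case False
    then have "x div 2 < x" "0 < x div 2" using less.prems by linarith+
    from less.IH[OF this] obtain d where "x div 2 div 2 ^ d = 1" by blast
    then show ?thesis by (intro exI[of _ "Suc d"]) (simp add: div_mult2_eq)
  qed
qed

lemma tour_root:
  assumes "tour xs p A tr {}" "A \<subseteq> {..<p}" "A \<noteq> {}"
  shows "0 < tr 1" "tr 1 - 1 \<in> A" "i \<in> A \<Longrightarrow> xs (tr 1 - 1) \<le> xs i"
proof -
  have le: "0 < tr 1 \<and> xs (tr 1 - 1) \<le> xs i" if "i \<in> A" for i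
  proof -
    have "i < p" using that assms(2) by auto
    then obtain d where "(p + i) div 2 ^ d = 1" using div_pow2_eq_1[of "p + i"] by auto
    then show ?thesis using tour_le[OF assms(1) that \<open>i < p\<close>, of d] by simp
  qed
  from assms(3) obtain j where j: "j \<in> A" by blast
  show pos: "0 < tr 1" using le[OF j] by simp
  have "p > 0" using j assms(2) by auto
  then show "tr 1 - 1 \<in> A" using tour_mem[OF assms(1), of 1] pos by simp
  show "i \<in> A \<Longrightarrow> xs (tr 1 - 1) \<le> xs i" using le by simp
qed

lemma win_le: "l \<le> p \<Longrightarrow> r \<le> p \<Longrightarrow> win xs l r \<le> p"
  by (simp add: win_def)

lemma tour_build:
  assumes "tour xs p A tr {..a}" "1 \<le> a" "a < p"
  shows "tour xs p A (tr(a := win xs (tr (2 * a)) (tr (2 * a + 1)))) {..a - 1}"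
proof -
  let ?tr = "tr(a := win xs (tr (2 * a)) (tr (2 * a + 1)))"
  have "?tr b = win xs (?tr (2 * b)) (?tr (2 * b + 1))" if "1 \<le> b" "b < p" "b \<notin> {..a - 1}" for b
  proof -
    have ne: "2 * b \<noteq> a" "2 * b + 1 \<noteq> a" using that assms(2) by auto
    show ?thesis
    proof (cases "b = a")
      case False
      then have "b \<notin> {..a}" using that by auto
      then show ?thesis using assms(1) that False ne by (simp add: tour_def)
    qed (use ne in simp)
  qed
  moreover have "?tr b \<le> p" if "b < 2 * p" for b
    using assms that win_le[of "tr (2 * a)" p "tr (2 * a + 1)" xs] by (simp add: tour_def)
  moreover have "?tr (p + i) = (if i \<in> A then i + 1 else 0)" if "i < p" for i
    using assms that by (simp add: tour_def)
  ultimately show ?thesis unfolding tour_def by blast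
qed

text \<open>The rule is suspended at the proper ancestors of \<open>a\<close>. Recomputing the
  parent restores it there and leaves the proper ancestors of the parent, so the defect moves up
  towards the root.\<close>

lemma tour_update:
  assumes "tour xs p A tr {b. \<exists>d\<ge>1. b = a div 2 ^ d}" "2 \<le> a" "a < 2 * p"
  shows "tour xs p A (tr(a div 2 := win xs (tr (2 * (a div 2))) (tr (2 * (a div 2) + 1)))) {b. \<exists>d\<ge>1. b = a div 2 div 2 ^ d}"
proof -
  let ?a = "a div 2"
  let ?tr = "tr(?a := win xs (tr (2 * ?a)) (tr (2 * ?a + 1)))"
  have a: "1 \<le> ?a" "?a < p" using assms by linarith+
  have "?tr b = win xs (?tr (2 * b)) (?tr (2 * b + 1))"
    if b: "1 \<le> b" "b < p" "\<not> (\<exists>d\<ge>1. b = ?a div 2 ^ d)" for b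
  proof -
    have "b \<noteq> ?a div 2" using b(3) by (metis order_refl power_one_right)
    then have ne: "2 * b \<noteq> ?a" "2 * b + 1 \<noteq> ?a" by auto
    have ne2: "2 * ?a \<noteq> ?a" "2 * ?a + 1 \<noteq> ?a" using a by auto
    show ?thesis
    proof (cases "b = ?a")
      case True
      then show ?thesis using ne2 by simp
    next
      case False
      have "\<not> (\<exists>d\<ge>1. b = a div 2 ^ d)"
      proof
        assume "\<exists>d\<ge>1. b = a div 2 ^ d"
        then obtain d where d: "d \<ge> 1" "b = a div 2 ^ d" by blast
        then obtain d' where "d = Suc d'" by (cases d) auto
        then have "b = ?a div 2 ^ d'" using d by (simp add: div_mult2_eq)
        moreover have "d' \<noteq> 0" using False calculation by (cases d') auto
        ultimately show False using b(3) by (metis One_nat_def Suc_leI gr0I)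
      qed
      then have "tr b = win xs (tr (2 * b)) (tr (2 * b + 1))" using assms(1) b by (simp add: tour_def)
      then show ?thesis using False ne by simp
    qed
  qed
  moreover have "?tr b \<le> p" if "b < 2 * p" for b
    using assms(1) that a win_le[of "tr (2 * ?a)" p "tr (2 * ?a + 1)" xs] by (auto simp: tour_def)
  moreover have "?tr (p + i) = (if i \<in> A then i + 1 else 0)" if "i < p" for i
    using assms(1) that a by (auto simp: tour_def)
  ultimately show ?thesis unfolding tour_def by blast
qed

lemma tour_remove:
  assumes "tour xs p A tr {}" "i \<in> A" "i < p"
  shows "tour xs p (A - {i}) (tr(p + i := 0)) {b. \<exists>d\<ge>1. b = (p + i) div 2 ^ d}"
proof -
  have "2 * b \<noteq> p + i \<and> 2 * b + 1 \<noteq> p + i" if "\<not> (\<exists>d\<ge>1. b = (p + i) div 2 ^ d)" for b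
  proof -
    have "b \<noteq> (p + i) div 2" using that by (metis order_refl power_one_right)
    then show ?thesis by auto
  qed
  then show ?thesis using assms by (simp add: tour_def)
qed

section \<open>The tournament as a program\<close>

definition tr_l :: wexp where "tr_l = WCell ''tr'' (WMul (WLit 2) (V ''sa''))"
definition tr_r :: wexp where "tr_r = WCell ''tr'' (WAdd (WMul (WLit 2) (V ''sa'')) (WLit 1))"

definition upd_tr :: com where
  "upd_tr = Cond (BAnd (WLess (WLit 0) tr_l) (BNot (BAnd (WLess (WLit 0) tr_r)
       (RLess (RCell ''xs'' (WSub tr_r (WLit 1))) (RCell ''xs'' (WSub tr_l (WLit 1)))))))
     (WAssign ''tr'' (V ''sa'') tr_l) (WAssign ''tr'' (V ''sa'') tr_r)"

lemma wmod_upd_tr [simp]: "wmod upd_tr = {''tr''}" "rmod upd_tr = {}"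
  by (auto simp: upd_tr_def)

lemma upd_tr_wp:
  assumes "words s ''sa'' 0 = a" "win (reals s ''xs'') (words s ''tr'' (2 * a)) (words s ''tr'' (2 * a + 1)) \<le> W"
    and "\<And>\<tau>. \<tau> \<le> 60 \<Longrightarrow> Q \<tau> (s\<lparr>words := (words s)(''tr'' := (words s ''tr'')(a :=
        win (reals s ''xs'') (words s ''tr'' (2 * a)) (words s ''tr'' (2 * a + 1))))\<rparr>)"
  shows "wp W upd_tr Q s"
  using assms by (auto simp: upd_tr_def tr_l_def tr_r_def win_def split: if_splits)

definition drop_min :: com where
  "drop_min = ''sa'' ::= WSub (WAdd (V ''p'') (WCell ''tr'' (WLit 1))) (WLit 1) ;;
     WAssign ''tr'' (V ''sa'') (WLit 0) ;;
     While (WLess (WLit 1) (V ''sa'')) (''sa'' ::= WDiv (V ''sa'') (WLit 2) ;; upd_tr)"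

lemma wmod_drop_min [simp]: "wmod drop_min = {''tr'', ''sa''}" "rmod drop_min = {}"
  by (auto simp: drop_min_def)

lemma drop_min_wp:
  assumes t: "tour (reals s ''xs'') p A (words s ''tr'') {}" and A: "A \<subseteq> {..<p}" "A \<noteq> {}"
    and p: "words s ''p'' 0 = p" "2 * p \<le> W" "p \<le> 2 ^ k"
  shows "wp W drop_min (\<lambda>\<tau> s'. \<tau> \<le> 80 * k + 100 \<and>
    tour (reals s ''xs'') p (A - {words s ''tr'' 1 - 1}) (words s' ''tr'') {}) s"
proof -
  let ?xs = "reals s ''xs''" let ?i = "words s ''tr'' 1 - 1"
  note root = tour_root[OF t A]
  have i: "?i \<in> A" "?i < p" using root(2) A by auto
  define s1 where "s1 = s\<lparr>words := (words s)(''sa'' := (words s ''sa'')(0 := p + ?i), ''tr'' := (words s ''tr'')(p + ?i := 0))\<rparr>"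
  let ?b = "WLess (WLit 1) (V ''sa'')" let ?P = "''sa'' ::= WDiv (V ''sa'') (WLit 2) ;; upd_tr"
  have "wp W (While ?b ?P) (\<lambda>\<tau> s'. \<tau> \<le> 80 * k + 5 + 79 \<and> tour ?xs p (A - {?i}) (words s' ''tr'') {}) s1"
  \<comment> \<open>The bound on \<open>sa\<close> times \<open>2 ^ it\<close> counts the halvings:
    when the root 1 is reached, \<open>2 ^ it < 2 ^ Suc k\<close>, so there are at most
    \<open>k\<close> of them.\<close>
  proof (rule wp_while[where \<mu> = "\<lambda>s. words s ''sa'' 0" and Inv = "\<lambda>\<tau> s. \<exists>it. \<tau> \<le> 80 * it \<and> 1 \<le> words s ''sa'' 0 \<and>
      words s ''sa'' 0 * 2 ^ it < 2 * p \<and> tour ?xs p (A - {?i}) (words s ''tr'') {b. \<exists>d\<ge>1. b = words s ''sa'' 0 div 2 ^ d}"], goal_cases)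
    case 1
    show ?case using tour_remove[OF t i] i by (intro exI[of _ 0]) (auto simp: s1_def)
  next
    case (2 \<tau> s')
    then obtain it where it: "\<tau> \<le> 80 * it" "words s' ''sa'' 0 * 2 ^ it < 2 * p"
      "tour ?xs p (A - {?i}) (words s' ''tr'') {b. \<exists>d\<ge>1. b = words s' ''sa'' 0 div 2 ^ d}" by blast
    define a where "a = words s' ''sa'' 0"
    have a: "2 \<le> a" using 2(3) by (simp add: a_def)
    have "a * 1 \<le> a * 2 ^ it" by (intro mult_left_mono) auto
    then have a2: "a < 2 * p" using it(2) unfolding a_def by linarith
    have xs: "reals s' ''xs'' = ?xs" using 2(1) by (simp add: frm_def s1_def)
    have "a div 2 * 2 ^ Suc it \<le> a * 2 ^ it" by simp
    then have h: "a div 2 * 2 ^ Suc it < 2 * p" using it(2) unfolding a_def by linarith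
    have "a div 2 < p" using a2 by linarith
    then have "2 * (a div 2) + 1 < 2 * p" by linarith
    note T = tour_update[OF it(3)[folded a_def] a a2]
    have "win ?xs (words s' ''tr'' (2 * (a div 2))) (words s' ''tr'' (2 * (a div 2) + 1)) \<le> p"
      using it(3) a2 a \<open>2 * (a div 2) + 1 < 2 * p\<close> by (intro win_le) (simp_all add: tour_def)
    then have W1: "win ?xs (words s' ''tr'' (2 * (a div 2))) (words s' ''tr'' (2 * (a div 2) + 1)) \<le> W" "a div 2 \<le> W"
      using p(2) a2 by linarith+
    show ?case using W1 T h a it(1)
      by (auto simp: a_def[symmetric] xs simp del: power_Suc intro!: upd_tr_wp exI[of _ "Suc it"])
  next
    case (3 \<tau> s')
    then obtain it where it: "\<tau> \<le> 80 * it" "words s' ''sa'' 0 * 2 ^ it < 2 * p" "words s' ''sa'' 0 = 1"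
      "tour ?xs p (A - {?i}) (words s' ''tr'') {b. \<exists>d\<ge>1. b = words s' ''sa'' 0 div 2 ^ d}" by fastforce
    have "2 ^ it < (2 ^ Suc k :: nat)" using it(2,3) p(3) by simp
    then have "it < Suc k" by (rule power_less_imp_less_exp[rotated]) simp
    moreover have "tour ?xs p (A - {?i}) (words s' ''tr'') {}"
      using it(4) unfolding it(3) tour_def by (auto simp: div_eq_0_iff)
    ultimately show ?case using it(1) by simp
  qed
  then have "wp W (While ?b ?P) (\<lambda>\<tau> s'. \<tau> + 13 \<le> 80 * k + 100 \<and> tour ?xs p (A - {?i}) (words s' ''tr'') {}) s1"
    by (rule wp_conseq) auto
  moreover have "p + (words s ''tr'' 1) - 1 = p + ?i" using root(1) by simp
  moreover have "p + ?i \<le> W" using p(2) i(2) by linarith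
  ultimately show ?thesis unfolding drop_min_def using p(1)
    by (simp add: s1_def add.commute)
qed

text \<open>Selection by a tournament: delete the minimum \<open>p div 2\<close> times. The tree is stored in an array in which
  node \<open>a\<close> has the children \<open>2 * a\<close> and \<open>2 * a + 1\<close>, the leaves are the nodes \<open>p, \<dots>, 2 * p - 1\<close>, and a node
  contains one plus the index of its winner, or 0.\<close>

definition median :: com where
  "median = For ''sk'' (V ''p'') (WAssign ''tr'' (WAdd (V ''p'') (V ''sk'')) (WAdd (V ''sk'') (WLit 1)) ;; WAssign ''tr'' (V ''sk'') (WLit 0)) ;;
     For ''sk'' (WSub (V ''p'') (WLit 1)) (''sa'' ::= WSub (WSub (V ''p'') (WLit 1)) (V ''sk'') ;; upd_tr) ;;
     For ''sk'' (WDiv (V ''p'') (WLit 2)) drop_min ;;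
     RAssign ''x'' (WLit 0) (RCell ''xs'' (WSub (WCell ''tr'' (WLit 1)) (WLit 1)))"

lemma wmod_median [simp]: "wmod median = {''tr'', ''sa'', ''sk''}" "rmod median = {''x''}"
  by (auto simp: median_def)

text \<open>After \<open>p div 2\<close> deletions every deleted value is at most every remaining
  one. The least remaining value has the deleted ones and itself on one side and the
  \<open>p - p div 2\<close> remaining ones on the other, hence at least half of all values on both
  sides.\<close>

lemma median_wp:
  assumes p: "words s ''p'' 0 = p" "1 \<le> p" "2 * p \<le> W" "p \<le> 2 ^ k"
  shows "wp W median (\<lambda>\<tau> s'. \<tau> \<le> 400 * ((p + 1) * (k + 1)) \<and>
     p \<le> 2 * card {i. i < p \<and> reals s ''xs'' i \<le> reals s' ''x'' 0} \<and>
     p \<le> 2 * card {i. i < p \<and> reals s' ''x'' 0 \<le> reals s ''xs'' i}) s"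
  unfolding median_def
proof (rule wp_seq)
  let ?xs = "reals s ''xs''"
  let ?A = "For ''sk'' (V ''p'') (WAssign ''tr'' (WAdd (V ''p'') (V ''sk'')) (WAdd (V ''sk'') (WLit 1)) ;; WAssign ''tr'' (V ''sk'') (WLit 0))"
  let ?B = "For ''sk'' (WSub (V ''p'') (WLit 1)) (''sa'' ::= WSub (WSub (V ''p'') (WLit 1)) (V ''sk'') ;; upd_tr)"
  let ?C = "For ''sk'' (WDiv (V ''p'') (WLit 2)) drop_min"
  show "wp W ?A (\<lambda>\<tau> s'. \<tau> \<le> 40 * (p + 1) \<and> tour ?xs p {..<p} (words s' ''tr'') {..p - 1}) s"
  proof (rule wp_for[where n = p and c = 20 and I = "\<lambda>k s. \<forall>i<k. words s ''tr'' (p + i) = i + 1 \<and> words s ''tr'' i = 0"], goal_cases)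
    case (6 \<tau> s')
    have "words s' ''tr'' b \<le> p" if "b < 2 * p" for b
    proof (cases "b < p")
      case False
      then have "b - p < p" "p + (b - p) = b" using that by linarith+
      then show ?thesis using 6(3) by (metis Suc_eq_plus1 Suc_leI)
    qed (use 6 in simp)
    then show ?case using 6 p by (auto simp: tour_def)
  qed (use p in \<open>auto simp: frm_def less_Suc_eq\<close>)
  fix \<tau>1 s1 assume f1: "frm ?A s s1" and q1: "\<tau>1 \<le> 40 * (p + 1) \<and> tour ?xs p {..<p} (words s1 ''tr'') {..p - 1}"
  have p1: "words s1 ''p'' 0 = p" and x1: "reals s1 ''xs'' = ?xs" using f1 p by (simp_all add: frm_def)
  show "wp W (?B ;; ?C ;; RAssign ''x'' (WLit 0) (RCell ''xs'' (WSub (WCell ''tr'' (WLit 1)) (WLit 1))))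
    (\<lambda>\<tau>. (\<lambda>\<tau> s'. \<tau> \<le> 400 * ((p + 1) * (k + 1)) \<and>
     p \<le> 2 * card {i. i < p \<and> reals s ''xs'' i \<le> reals s' ''x'' 0} \<and>
     p \<le> 2 * card {i. i < p \<and> reals s' ''x'' 0 \<le> reals s ''xs'' i}) (\<tau>1 + \<tau>)) s1"
  proof (rule wp_seq)
    show "wp W ?B (\<lambda>\<tau> s'. \<tau> \<le> 100 * (p + 1) \<and> tour ?xs p {..<p} (words s' ''tr'') {}) s1"
    proof (rule wp_for[where n = "p - 1" and c = 70 and I = "\<lambda>k s. tour ?xs p {..<p} (words s ''tr'') {..p - 1 - k}"], goal_cases)
      case (5 j s')
      let ?a = "p - 1 - j"
      have a: "1 \<le> ?a" "?a < p" using 5(1) by linarith+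
      have r: "reals s' ''xs'' = ?xs" "words s' ''p'' 0 = p" using 5(2) p1 x1 by (simp_all add: frm_def)
      have "win ?xs (words s' ''tr'' (2 * ?a)) (words s' ''tr'' (2 * ?a + 1)) \<le> p"
        using 5(4) a by (intro win_le) (auto simp: tour_def)
      then have W1: "win ?xs (words s' ''tr'' (2 * ?a)) (words s' ''tr'' (2 * ?a + 1)) \<le> W" "?a \<le> W"
        using p(3) by linarith+
      have e: "p - 1 - Suc j = ?a - 1" by simp
      show ?case using W1 r 5(3) tour_build[OF 5(4) a]
        by (auto simp del: diff_diff_left simp: e intro!: upd_tr_wp)
    next
      case (6 \<tau> s')
      have "tour ?xs p {..<p} (words s' ''tr'') {..0}" using 6(3) by simp
      then have "tour ?xs p {..<p} (words s' ''tr'') {}" by (auto simp: tour_def)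
      then show ?case using 6(4) p(2) by simp
    qed (use q1 p1 p in \<open>auto simp: frm_def\<close>)
    fix \<tau>2 s2 assume f2: "frm ?B s1 s2" and q2: "\<tau>2 \<le> 100 * (p + 1) \<and> tour ?xs p {..<p} (words s2 ''tr'') {}"
    have p2: "words s2 ''p'' 0 = p" and x2: "reals s2 ''xs'' = ?xs" using f2 p1 x1 by (simp_all add: frm_def)
    define J where "J = (\<lambda>k (s :: store). \<exists>A\<subseteq>{..<p}. card A = p - k \<and> tour ?xs p A (words s ''tr'') {} \<and>
        (\<forall>i\<in>A. \<forall>j<p. j \<notin> A \<longrightarrow> ?xs j \<le> ?xs i))"
    have "wp W ?C (\<lambda>\<tau> s'. \<tau> \<le> (p div 2 + 1) * (114 + 80 * k) \<and> J (p div 2) s') s2"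
    proof (rule wp_for[where n = "p div 2" and c = "80 * k + 100" and I = J], goal_cases)
      case 3
      show ?case using q2 unfolding J_def by (intro exI[of _ "{..<p}"]) auto
    next
      case (5 j s')
      have r: "reals s' ''xs'' = ?xs" "words s' ''p'' 0 = p" using 5(2) p2 x2 by (simp_all add: frm_def)
      from 5(4) obtain A where A: "A \<subseteq> {..<p}" "card A = p - j" "tour ?xs p A (words s' ''tr'') {}"
        "\<forall>i\<in>A. \<forall>j<p. j \<notin> A \<longrightarrow> ?xs j \<le> ?xs i" unfolding J_def by blast
      have ne: "A \<noteq> {}" using A(2) 5(1) by auto
      note root = tour_root[OF A(3,1) ne]
      let ?i = "words s' ''tr'' 1 - 1"
      have fin: "finite A" using A(1) finite_subset by blast
      have "wp W drop_min (\<lambda>\<tau> s''. \<tau> \<le> 80 * k + 100 \<and> tour ?xs p (A - {?i}) (words s'' ''tr'') {}) s'"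
        using drop_min_wp[OF _ A(1) ne r(2) p(3,4), unfolded r(1), OF A(3)] .
      then show ?case
      proof (rule wp_conseq, goal_cases)
        case (1 \<tau>' s'')
        have "J (Suc j) (s''\<lparr>words := (words s'')(''sk'' := (words s'' ''sk'')(0 := Suc j))\<rparr>)"
          unfolding J_def using 1(2) A root fin 
          by (intro exI[of _ "A - {?i}"]) (auto simp: card_Diff_singleton)
        then show ?case using 1(2) by simp
      qed
    qed (use p2 p in \<open>simp_all add: frm_def\<close>)
    then show "wp W (?C ;; RAssign ''x'' (WLit 0) (RCell ''xs'' (WSub (WCell ''tr'' (WLit 1)) (WLit 1))))
     (\<lambda>\<tau>. (\<lambda>\<tau>. (\<lambda>\<tau> s'. \<tau> \<le> 400 * ((p + 1) * (k + 1)) \<and>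
     p \<le> 2 * card {i. i < p \<and> reals s ''xs'' i \<le> reals s' ''x'' 0} \<and>
     p \<le> 2 * card {i. i < p \<and> reals s' ''x'' 0 \<le> reals s ''xs'' i}) (\<tau>1 + \<tau>)) (\<tau>2 + \<tau>)) s2"
    proof (rule wp_seq, goal_cases)
      case (1 \<tau>3 s3)
      have x3: "reals s3 ''xs'' = ?xs" using 1(1) x2 by (simp add: frm_def)
      from 1(2) obtain A where A: "A \<subseteq> {..<p}" "card A = p - p div 2" "tour ?xs p A (words s3 ''tr'') {}"
        "\<forall>i\<in>A. \<forall>j<p. j \<notin> A \<longrightarrow> ?xs j \<le> ?xs i" unfolding J_def by blast
      have ne: "A \<noteq> {}" using A(2) p(2) by auto
      note root = tour_root[OF A(3,1) ne]
      let ?i = "words s3 ''tr'' 1 - 1"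
      have fin: "finite A" using A(1) finite_subset by blast
      have "card A \<le> card {i. i < p \<and> ?xs ?i \<le> ?xs i}" using A(1) root by (intro card_mono) auto
      moreover have "card ({..<p} - A) \<le> card {i. i < p \<and> ?xs i \<le> ?xs ?i}"
        using A root by (intro card_mono) auto
      moreover have "card ({..<p} - A) = p div 2" using A(1,2) fin by (simp add: card_Diff_subset)
      moreover have "card (insert ?i ({..<p} - A)) \<le> card {i. i < p \<and> ?xs i \<le> ?xs ?i}"
        using A root by (intro card_mono) auto
      moreover have "card (insert ?i ({..<p} - A)) = Suc (card ({..<p} - A))" using root by simp
      ultimately have "p \<le> 2 * card {i. i < p \<and> ?xs ?i \<le> ?xs i} \<and> p \<le> 2 * card {i. i < p \<and> ?xs i \<le> ?xs ?i}"
        using A(2) by linarith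
      moreover have "(p div 2 + 1) * (114 + 80 * k) \<le> (p + 1) * (114 + 80 * k)" by (intro mult_right_mono) auto
      then have "\<tau>1 + (\<tau>2 + (\<tau>3 + 9)) \<le> 400 * ((p + 1) * (k + 1))"
        using q1 q2 1(2) by (simp add: algebra_simps)
      ultimately show ?case by (simp add: x3)
    qed
  qed
qed

section \<open>Comparing lines at the optimum\<close>

definition pairing :: "(nat \<Rightarrow> nat) \<Rightarrow> nat \<Rightarrow> nat \<Rightarrow> (nat \<Rightarrow> nat) \<Rightarrow> (nat \<Rightarrow> nat) \<Rightarrow> bool" where
  "pairing g k p pa pb \<longleftrightarrow> (\<forall>l<p. pa l < pb l \<and> pb l < k \<and> g (pa l) = g (pb l)) \<and>
     inj_on pa {..<p} \<and> inj_on pb {..<p} \<and> pa ` {..<p} \<inter> pb ` {..<p} = {}"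

text \<open>\<open>pend\<close> holds, for each group, one plus the index of its line that still
  lacks a partner, or 0. A new line either becomes pending or is matched with the pending one, so a
  group never has two unmatched lines.\<close>

definition pairing_pend :: "(nat \<Rightarrow> nat) \<Rightarrow> nat \<Rightarrow> nat \<Rightarrow> nat \<Rightarrow> (nat \<Rightarrow> nat) \<Rightarrow> (nat \<Rightarrow> nat) \<Rightarrow> (nat \<Rightarrow> nat) \<Rightarrow> bool" where
  "pairing_pend g L k p pa pb pend \<longleftrightarrow> pairing g k p pa pb \<and>
     (\<forall>i<k. i \<notin> pa ` {..<p} \<union> pb ` {..<p} \<longrightarrow> pend (g i) = i + 1) \<and>
     (\<forall>i<L. pend (g i) \<noteq> 0 \<longrightarrow> pend (g i) \<le> k \<and> pend (g i) - 1 \<notin> pa ` {..<p} \<union> pb ` {..<p} \<and> g (pend (g i) - 1) = g i)"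

lemma pairing_pend_single:
  assumes "pairing_pend g L k p pa pb pend" "k < L" "pend (g k) = 0"
  shows "pairing_pend g L (Suc k) p pa pb (pend(g k := k + 1))"
proof -
  let ?U = "pa ` {..<p} \<union> pb ` {..<p}"
  have P: "pairing g k p pa pb" and i1: "\<And>i. i < k \<Longrightarrow> i \<notin> ?U \<Longrightarrow> pend (g i) = i + 1"
    and i2: "\<And>i. i < L \<Longrightarrow> pend (g i) \<noteq> 0 \<Longrightarrow> pend (g i) \<le> k \<and> pend (g i) - 1 \<notin> ?U \<and> g (pend (g i) - 1) = g i"
    using assms(1) unfolding pairing_pend_def by blast+
  have "\<forall>l<p. pa l < k \<and> pb l < k" using P unfolding pairing_def by (meson less_trans)
  then have kU: "k \<notin> ?U" by auto
  have "pairing g (Suc k) p pa pb" using P unfolding pairing_def by (meson less_Suc_eq)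
  moreover have "(pend(g k := k + 1)) (g i) = i + 1" if "i < Suc k" "i \<notin> ?U" for i
  proof (cases "i = k")
    case False
    then have "pend (g i) = i + 1" using i1 that by simp
    then have "g i \<noteq> g k" using assms(3) by auto
    then show ?thesis using \<open>pend (g i) = i + 1\<close> by simp
  qed simp
  moreover have "(pend(g k := k + 1)) (g i) \<le> Suc k \<and> (pend(g k := k + 1)) (g i) - 1 \<notin> ?U \<and>
      g ((pend(g k := k + 1)) (g i) - 1) = g i" if "i < L" "(pend(g k := k + 1)) (g i) \<noteq> 0" for i
    using i2[OF that(1)] that kU by (cases "g i = g k") auto
  ultimately show ?thesis unfolding pairing_pend_def by blast
qed

lemma inj_on_upd_less:
  fixes p :: nat
  assumes "inj_on f {..<p}" "y \<notin> f ` {..<p}"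
  shows "inj_on (f(p := y)) {..<p + 1}"
proof (rule inj_onI)
  fix i j assume ij: "i \<in> {..<p + 1}" "j \<in> {..<p + 1}" "(f(p := y)) i = (f(p := y)) j"
  then have "i < p + 1" "j < p + 1" by simp_all
  then have "i < p \<or> i = p" "j < p \<or> j = p" by arith+
  then consider "i = p" "j = p" | "i < p" "j = p" | "i = p" "j < p" | "i < p" "j < p" by blast
  then show "i = j"
  proof cases
    case 4
    then show ?thesis using ij(3) assms(1) by (simp add: inj_on_eq_iff)
  qed (use ij(3) assms(2) in auto)
qed

lemma pairing_pend_pair:
  assumes "pairing_pend g L k p pa pb pend" "k < L" "pend (g k) \<noteq> 0"
  shows "pairing_pend g L (Suc k) (p + 1) (pa(p := pend (g k) - 1)) (pb(p := k)) (pend(g k := 0))"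
proof -
  let ?U = "pa ` {..<p} \<union> pb ` {..<p}"
  let ?a = "pend (g k) - 1" let ?pa = "pa(p := ?a)" let ?pb = "pb(p := k)"
  have P: "pairing g k p pa pb" and i1: "\<And>i. i < k \<Longrightarrow> i \<notin> ?U \<Longrightarrow> pend (g i) = i + 1"
    and i2: "\<And>i. i < L \<Longrightarrow> pend (g i) \<noteq> 0 \<Longrightarrow> pend (g i) \<le> k \<and> pend (g i) - 1 \<notin> ?U \<and> g (pend (g i) - 1) = g i"
    using assms(1) unfolding pairing_pend_def by blast+
  have a: "?a < k" "?a \<notin> ?U" "g ?a = g k" using i2[OF assms(2,3)] assms(3) by auto
  have lt: "\<forall>l<p. pa l < k \<and> pb l < k" using P unfolding pairing_def by (meson less_trans)
  then have kU: "k \<notin> ?U" by auto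
  have ia: "?pa ` {..<p + 1} = insert ?a (pa ` {..<p})" "?pb ` {..<p + 1} = insert k (pb ` {..<p})"
    by (auto simp: image_iff less_Suc_eq)
  have "pairing g (Suc k) (p + 1) ?pa ?pb"
    unfolding pairing_def
  proof (intro conjI)
    show "\<forall>l<p + 1. ?pa l < ?pb l \<and> ?pb l < Suc k \<and> g (?pa l) = g (?pb l)"
      using P a unfolding pairing_def by (auto simp: less_Suc_eq)
    show "inj_on ?pa {..<p + 1}" using P a(2) unfolding pairing_def by (intro inj_on_upd_less) auto
    show "inj_on ?pb {..<p + 1}" using P kU unfolding pairing_def by (intro inj_on_upd_less) auto
    show "?pa ` {..<p + 1} \<inter> ?pb ` {..<p + 1} = {}"
      unfolding ia using P a kU unfolding pairing_def by auto
  qed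
  moreover have "(pend(g k := 0)) (g i) = i + 1" if "i < Suc k" "i \<notin> ?pa ` {..<p + 1} \<union> ?pb ` {..<p + 1}" for i
  proof -
    have i: "i < k" "i \<notin> ?U" "i \<noteq> ?a" using that unfolding ia by auto
    then have "pend (g i) = i + 1" using i1 by simp
    moreover then have "g i \<noteq> g k" using i(3) by auto
    ultimately show ?thesis by simp
  qed
  moreover have "(pend(g k := 0)) (g i) \<le> Suc k \<and> (pend(g k := 0)) (g i) - 1 \<notin> ?pa ` {..<p + 1} \<union> ?pb ` {..<p + 1} \<and>
      g ((pend(g k := 0)) (g i) - 1) = g i" if "i < L" "(pend(g k := 0)) (g i) \<noteq> 0" for i
  proof -
    have gi: "g i \<noteq> g k" "pend (g i) \<noteq> 0" using that by (auto split: if_splits)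
    note j = i2[OF that(1) gi(2)]
    have "pend (g i) - 1 \<noteq> ?a" using j a(3) gi(1) by metis
    moreover have "pend (g i) - 1 \<noteq> k" using j gi(2) by linarith
    ultimately show ?thesis using j gi(1) unfolding ia by auto
  qed
  ultimately show ?thesis unfolding pairing_pend_def by simp
qed

lemma pairing_card:
  assumes "pairing g k p pa pb"
  shows "card (pa ` {..<p} \<union> pb ` {..<p}) = 2 * p" "pa ` {..<p} \<union> pb ` {..<p} \<subseteq> {..<k}"
  using assms unfolding pairing_def by (auto simp: card_Un_disjoint card_image intro: less_trans)

text \<open>Unmatched lines have different groups, as \<open>pend\<close> recovers the line from its
  group.\<close>

lemma pairing_pend_bound:
  assumes "pairing_pend g L L p pa pb pend"
  shows "L \<le> 2 * p + card (g ` {..<L})"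
proof -
  let ?U = "pa ` {..<p} \<union> pb ` {..<p}"
  have P: "pairing g L p pa pb" and i1: "\<And>i. i < L \<Longrightarrow> i \<notin> ?U \<Longrightarrow> pend (g i) = i + 1"
    using assms unfolding pairing_pend_def by blast+
  have "inj_on g ({..<L} - ?U)"
    by (intro inj_onI) (metis DiffD1 DiffD2 i1 add_right_cancel lessThan_iff)
  then have "card ({..<L} - ?U) = card (g ` ({..<L} - ?U))" by (simp add: card_image)
  also have "\<dots> \<le> card (g ` {..<L})" by (intro card_mono) auto
  finally show ?thesis using pairing_card[OF P] by (simp add: card_Diff_subset)
qed

text \<open>Deleting the second members of all pairs loses no group, since the first member of a
  pair is never the second member of another.\<close>

lemma pairing_le:
  assumes "pairing g L p pa pb"
  shows "p + card (g ` {..<L}) \<le> L"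
proof -
  let ?B = "pb ` {..<p}"
  have B: "?B \<subseteq> {..<L}" "card ?B = p" using assms unfolding pairing_def by (auto simp: card_image)
  have "g ` {..<L} \<subseteq> g ` ({..<L} - ?B)"
  proof
    fix y assume "y \<in> g ` {..<L}"
    then obtain i where i: "i < L" "y = g i" by auto
    show "y \<in> g ` ({..<L} - ?B)"
    proof (cases "i \<in> ?B")
      case True
      then obtain l where l: "l < p" "i = pb l" by auto
      then have "pa l < L" "g (pa l) = g i" "pa l \<notin> ?B" using assms unfolding pairing_def
        by (auto intro: less_trans)
      then show ?thesis using i by (intro image_eqI[of y g "pa l"]) auto
    qed (use i in auto)
  qed
  then have "card (g ` {..<L}) \<le> card (g ` ({..<L} - ?B))" by (intro card_mono) auto
  also have "\<dots> \<le> card ({..<L} - ?B)" by (rule card_image_le) simp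
  finally have "card (g ` {..<L}) \<le> card ({..<L} - ?B)" .
  moreover have "card ({..<L} - ?B) = L - p" using B by (simp add: card_Diff_subset)
  moreover have "p \<le> L" using card_mono[OF _ B(1)] B(2) by simp
  ultimately show ?thesis by linarith
qed

text \<open>A candidate walk: the table cell it competes for, cost, transit time, and the arc to be
  recorded. Its value, cost minus lambda times time, is a linear function of lambda, whence the
  name.\<close>

type_synonym line = "nat \<times> real \<times> real \<times> nat"

definition line :: "store \<Rightarrow> nat \<Rightarrow> line" where
  "line s i = (words s ''lg'' i, reals s ''la'' i, reals s ''lb'' i, words s ''lp'' i)"

definition lines :: "store \<Rightarrow> line list" where
  "lines s = map (line s) [0..<words s ''L'' 0]"

definition lg_rk :: wexp where "lg_rk = WCell ''lg'' (V ''rk'')"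
definition pend_rk :: wexp where "pend_rk = WCell ''pend'' lg_rk"
definition at_a :: "name \<Rightarrow> wexp \<Rightarrow> rexp" where "at_a x k = RCell x (WCell ''pa'' k)"
definition at_b :: "name \<Rightarrow> wexp \<Rightarrow> rexp" where "at_b x k = RCell x (WCell ''pb'' k)"

definition pair_step :: com where
  "pair_step = WAssign ''dead'' (V ''rk'') (WLit 0) ;;
     Cond (WLess pend_rk (WLit 1)) (WAssign ''pend'' lg_rk (WAdd (V ''rk'') (WLit 1)))
       (WAssign ''pa'' (V ''p'') (WSub pend_rk (WLit 1)) ;; WAssign ''pb'' (V ''p'') (V ''rk'') ;;
        RAssign ''xs'' (V ''p'') (RDiv (RSub (at_a ''la'' (V ''p'')) (at_b ''la'' (V ''p'')))
          (RSub (at_a ''lb'' (V ''p'')) (at_b ''lb'' (V ''p'')))) ;;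
        ''p'' ::= WAdd (V ''p'') (WLit 1) ;; WAssign ''pend'' lg_rk (WLit 0))"

definition pair_up :: com where
  "pair_up = For ''rk'' (V ''L'') (WAssign ''pend'' lg_rk (WLit 0)) ;; ''p'' ::= WLit 0 ;; For ''rk'' (V ''L'') pair_step"

text \<open>The lambda at which the two values agree. Parallel lines get the conventional quotient
  0; whichever way that is answered, \<open>loses_a\<close> then orders them by cost.\<close>

definition crossing :: "store \<Rightarrow> nat \<Rightarrow> nat \<Rightarrow> real" where
  "crossing s i j = (reals s ''la'' i - reals s ''la'' j) / (reals s ''lb'' i - reals s ''lb'' j)"

lemma wmod_pair_up [simp]: "wmod pair_up = {''rk'', ''pend'', ''p'', ''dead'', ''pa'', ''pb''}" "rmod pair_up = {''xs''}"
  by (auto simp: pair_up_def pair_step_def)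

lemma pair_up_wp:
  assumes L: "words s ''L'' 0 = L" "L + 1 \<le> W"
  shows "wp W pair_up (\<lambda>\<tau> s'. \<tau> \<le> 150 * (L + 1) \<and> (\<exists>pend. pairing_pend (words s ''lg'') L L (words s' ''p'' 0) (words s' ''pa'') (words s' ''pb'') pend) \<and>
     (\<forall>l < words s' ''p'' 0. reals s' ''xs'' l = crossing s (words s' ''pa'' l) (words s' ''pb'' l)) \<and> (\<forall>i<L. words s' ''dead'' i = 0)) s"
  unfolding pair_up_def
proof (rule wp_seq)
  let ?A = "For ''rk'' (V ''L'') (WAssign ''pend'' lg_rk (WLit 0))"
  let ?B = "For ''rk'' (V ''L'') pair_step"
  let ?g = "words s ''lg''"
  show "wp W ?A (\<lambda>\<tau> s'. \<tau> \<le> 20 * (L + 1) \<and> (\<forall>i<L. words s' ''pend'' (?g i) = 0)) s"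
    by (rule wp_for[where n = L and c = 8 and I = "\<lambda>k s. \<forall>i<k. words s ''pend'' (?g i) = 0"])
      (use L in \<open>auto simp: frm_def lg_rk_def less_Suc_eq\<close>)
  fix \<tau>1 s1 assume f1: "frm ?A s s1" and q1: "\<tau>1 \<le> 20 * (L + 1) \<and> (\<forall>i<L. words s1 ''pend'' (?g i) = 0)"
  define s2 where "s2 = s1\<lparr>words := (words s1)(''p'' := (words s1 ''p'')(0 := 0))\<rparr>"
  have f2: "words s2 ''lg'' = ?g" "words s2 ''L'' 0 = L" "words s2 ''p'' 0 = 0" "words s2 ''pend'' = words s1 ''pend''" "reals s2 = reals s"
    using f1 L by (auto simp: frm_def s2_def)
  have "wp W ?B (\<lambda>\<tau> s'. \<tau> \<le> 122 * (L + 1) \<and> (\<exists>pend. pairing_pend ?g L L (words s' ''p'' 0) (words s' ''pa'') (words s' ''pb'') pend) \<and>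
     (\<forall>l < words s' ''p'' 0. reals s' ''xs'' l = crossing s (words s' ''pa'' l) (words s' ''pb'' l)) \<and> (\<forall>i<L. words s' ''dead'' i = 0)) s2"
  proof (rule wp_for[where n = L and c = 110 and I = "\<lambda>k s'. pairing_pend ?g L k (words s' ''p'' 0) (words s' ''pa'') (words s' ''pb'') (words s' ''pend'') \<and>
     (\<forall>l < words s' ''p'' 0. reals s' ''xs'' l = crossing s (words s' ''pa'' l) (words s' ''pb'' l)) \<and> (\<forall>i<k. words s' ''dead'' i = 0)"], goal_cases)
    case 3
    show ?case using f2 q1 by (simp add: pairing_pend_def pairing_def)
  next
    case (5 k s')
    have r: "words s' ''lg'' = ?g" "reals s' ''la'' = reals s ''la''" "reals s' ''lb'' = reals s ''lb''"
      using 5(2) f2 by (simp_all add: frm_def pair_step_def)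
    let ?p = "words s' ''p'' 0"
    have PP: "pairing_pend ?g L k ?p (words s' ''pa'') (words s' ''pb'') (words s' ''pend'')" using 5(4) by blast
    then have "pairing ?g k ?p (words s' ''pa'') (words s' ''pb'')" by (simp add: pairing_pend_def)
    from card_mono[OF _ pairing_card(2)[OF this]] pairing_card(1)[OF this] have pk: "2 * ?p \<le> k" by simp
    have pe: "words s' ''pend'' (?g k) \<le> k" using PP 5(1) unfolding pairing_pend_def by (metis le0)
    show ?case
    proof (cases "words s' ''pend'' (?g k) = 0")
      case True
      then show ?thesis using 5(1,3,4) r pairing_pend_single[OF PP 5(1) True] L(2)
        by (auto simp: pair_step_def pend_rk_def lg_rk_def less_Suc_eq)
    next
      case False
      have W1: "words s' ''pend'' (?g k) - 1 \<le> W" "k \<le> W" "?p + 1 \<le> W" using L(2) pe pk 5(1) by linarith+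
      show ?thesis using 5(1,3,4) r pairing_pend_pair[OF PP 5(1) False] W1 False
        by (auto simp: pair_step_def pend_rk_def lg_rk_def at_a_def at_b_def crossing_def less_Suc_eq)
    qed
  next
    case (6 \<tau> s')
    then show ?case by (auto simp: pair_step_def)
  qed (use f2 L in \<open>auto simp: frm_def pair_step_def\<close>)
  then have "wp W ?B (\<lambda>\<tau> s'. \<tau>1 + (3 + \<tau>) \<le> 150 * (L + 1) \<and> (\<exists>pend. pairing_pend ?g L L (words s' ''p'' 0) (words s' ''pa'') (words s' ''pb'') pend) \<and>
     (\<forall>l < words s' ''p'' 0. reals s' ''xs'' l = crossing s (words s' ''pa'' l) (words s' ''pb'' l)) \<and> (\<forall>i<L. words s' ''dead'' i = 0)) s2"
    by (rule wp_conseq) (use q1 in auto)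
  then show "wp W (''p'' ::= WLit 0 ;; ?B) (\<lambda>\<tau>. (\<lambda>\<tau> s'. \<tau> \<le> 150 * (L + 1) \<and> (\<exists>pend. pairing_pend ?g L L (words s' ''p'' 0) (words s' ''pa'') (words s' ''pb'') pend) \<and>
     (\<forall>l < words s' ''p'' 0. reals s' ''xs'' l = crossing s (words s' ''pa'' l) (words s' ''pb'' l)) \<and> (\<forall>i<L. words s' ''dead'' i = 0)) (\<tau>1 + \<tau>)) s1"
    by (simp add: s2_def)
qed

text \<open>Decides which line is the larger at lambda once the side of the crossing is known: to
  the right of it (\<open>ok\<close>) the line with the larger time has the smaller value, to the
  left it is the other one. Larger values lose, as minima are sought.\<close>

definition loses_a :: "bool \<Rightarrow> real \<Rightarrow> real \<Rightarrow> real \<Rightarrow> real \<Rightarrow> bool" where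
  "loses_a ok a b a' b' \<longleftrightarrow> (if ok then b < b' else b' < b) \<or> b = b' \<and> a' < a"

definition loser :: "bool \<Rightarrow> store \<Rightarrow> nat \<Rightarrow> nat" where
  "loser ok s l = (let i = words s ''pa'' l; j = words s ''pb'' l in
     if loses_a ok (reals s ''la'' i) (reals s ''lb'' i) (reals s ''la'' j) (reals s ''lb'' j) then i else j)"

text \<open>One answer about \<open>x\<close> settles a whole side: if \<open>x\<close> is at most
  lambda, so is every crossing up to \<open>x\<close>; otherwise every crossing from
  \<open>x\<close> on is at least lambda. With \<open>x\<close> a median this covers at least half
  of the pairs.\<close>

definition decided :: "bool \<Rightarrow> store \<Rightarrow> nat \<Rightarrow> bool" where
  "decided ok s l \<longleftrightarrow> (if ok then reals s ''xs'' l \<le> reals s ''x'' 0 else reals s ''x'' 0 \<le> reals s ''xs'' l)"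

definition test_tie :: bexp where
  "test_tie = RLess (at_b ''la'' (V ''rk'')) (at_a ''la'' (V ''rk''))"
definition lb_ab :: bexp where "lb_ab = RLess (at_a ''lb'' (V ''rk'')) (at_b ''lb'' (V ''rk''))"
definition lb_ba :: bexp where "lb_ba = RLess (at_b ''lb'' (V ''rk'')) (at_a ''lb'' (V ''rk''))"
definition BOr :: "bexp \<Rightarrow> bexp \<Rightarrow> bexp" where "BOr b b' = BNot (BAnd (BNot b) (BNot b'))"

definition kill :: "bexp \<Rightarrow> bexp \<Rightarrow> com" where
  "kill b b' = Cond (BOr b (BAnd (BNot b') test_tie))
     (WAssign ''dead'' (WCell ''pa'' (V ''rk'')) (WLit 1)) (WAssign ''dead'' (WCell ''pb'' (V ''rk'')) (WLit 1))"

definition decide :: com where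
  "decide = For ''rk'' (V ''p'') (Cond (WLess (WLit 0) (V ''ok''))
     (Cond (RLess (RV ''x'') (RCell ''xs'' (V ''rk''))) Skip (kill lb_ab lb_ba))
     (Cond (RLess (RCell ''xs'' (V ''rk'')) (RV ''x'')) Skip (kill lb_ba lb_ab)))"

lemma wmod_decide [simp]: "wmod decide = {''rk'', ''dead''}" "rmod decide = {}"
  by (auto simp: decide_def kill_def)

lemma decide_wp:
  assumes p: "words s ''p'' 0 = p" "p \<le> W" "1 \<le> W"
    and d: "\<forall>i<L. words s ''dead'' i = 0"
  defines "ok \<equiv> 0 < words s ''ok'' 0"
  shows "wp W decide (\<lambda>\<tau> s'. \<tau> \<le> 100 * (p + 1) \<and>
    (\<forall>i<L. words s' ''dead'' i = (if \<exists>l<p. decided ok s l \<and> loser ok s l = i then 1 else 0))) s"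
  unfolding decide_def
proof (rule wp_for[where n = p and c = 85 and
      I = "\<lambda>k s'. \<forall>i<L. words s' ''dead'' i = (if \<exists>l<k. decided ok s l \<and> loser ok s l = i then 1 else 0)"], goal_cases)
  case (5 k s')
  have r: "words s' ''pa'' = words s ''pa''" "words s' ''pb'' = words s ''pb''" "words s' ''ok'' = words s ''ok''"
    "reals s' = reals s" using 5(2) by (auto simp: frm_def kill_def)
  have ex: "(\<exists>l<Suc k. decided ok s l \<and> loser ok s l = i) \<longleftrightarrow> (\<exists>l<k. decided ok s l \<and> loser ok s l = i) \<or> decided ok s k \<and> loser ok s k = i" for i
    by (auto simp: less_Suc_eq)
  let ?i = "words s ''pa'' k" let ?j = "words s ''pb'' k"
  let ?l = "loses_a ok (reals s ''la'' ?i) (reals s ''lb'' ?i) (reals s ''la'' ?j) (reals s ''lb'' ?j)"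
  let ?D = "\<lambda>i. if (\<exists>l<k. decided ok s l \<and> loser ok s l = i) \<or> decided ok s k \<and> loser ok s k = i then 1 else 0"
  have a: "\<forall>i<L. ((words s' ''dead'')(?i := 1)) i = ?D i" if "decided ok s k" ?l
  proof -
    have "loser ok s k = ?i" using that by (simp add: loser_def)
    then show ?thesis using 5(4) that(1) by auto
  qed
  have b: "\<forall>i<L. ((words s' ''dead'')(?j := 1)) i = ?D i" if "decided ok s k" "\<not> ?l"
  proof -
    have "loser ok s k = ?j" using that by (simp add: loser_def)
    then show ?thesis using 5(4) that(1) by auto
  qed
  have c: "\<forall>i<L. words s' ''dead'' i = ?D i" if "\<not> decided ok s k" using 5(4) that by simp
  have okw: "0 < words s ''ok'' 0 \<longleftrightarrow> ok" by (simp add: ok_def)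
  note prog = kill_def BOr_def test_tie_def lb_ab_def lb_ba_def at_a_def at_b_def
  show ?case unfolding ex
  proof (cases "decided ok s k")
    case True
    show "wp W (Cond (WLess (WLit 0) (V ''ok''))
     (Cond (RLess (RV ''x'') (RCell ''xs'' (V ''rk''))) Skip (kill lb_ab lb_ba))
     (Cond (RLess (RCell ''xs'' (V ''rk'')) (RV ''x'')) Skip (kill lb_ba lb_ab)))
     (\<lambda>t s'. t \<le> 85 \<and> (\<forall>i<L. words (s'\<lparr>words := (words s')(''rk'' := (words s' ''rk'')(0 := Suc k))\<rparr>) ''dead'' i = ?D i)) s'"
    proof (cases ?l)
      case t: True
      show ?thesis using 5(3) r p(3) a[OF True t] True t
        by (cases ok) (auto simp: prog okw decided_def loses_a_def not_less)
    next
      case f: False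
      show ?thesis using 5(3) r p(3) b[OF True f] True f
        by (cases ok) (auto simp: prog okw decided_def loses_a_def not_less)
    qed
  next
    case False
    show "wp W (Cond (WLess (WLit 0) (V ''ok''))
     (Cond (RLess (RV ''x'') (RCell ''xs'' (V ''rk''))) Skip (kill lb_ab lb_ba))
     (Cond (RLess (RCell ''xs'' (V ''rk'')) (RV ''x'')) Skip (kill lb_ba lb_ab)))
     (\<lambda>t s'. t \<le> 85 \<and> (\<forall>i<L. words (s'\<lparr>words := (words s')(''rk'' := (words s' ''rk'')(0 := Suc k))\<rparr>) ''dead'' i = ?D i)) s'"
      using 5(3) r c[OF False] False by (cases ok) (simp_all add: okw decided_def)
  qed
qed (use p d in \<open>auto simp: frm_def kill_def\<close>)

lemma line_L: "line (s\<lparr>words := (words s)(''L'' := x)\<rparr>) = line s"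
  by (rule ext) (simp add: line_def)

definition compact :: com where
  "compact = ''w'' ::= WLit 0 ;;
     For ''rk'' (V ''L'') (Cond (WLess (WCell ''dead'' (V ''rk'')) (WLit 1))
       (WAssign ''lg'' (V ''w'') lg_rk ;; RAssign ''la'' (V ''w'') (RCell ''la'' (V ''rk'')) ;;
        RAssign ''lb'' (V ''w'') (RCell ''lb'' (V ''rk'')) ;; WAssign ''lp'' (V ''w'') (WCell ''lp'' (V ''rk'')) ;;
        ''w'' ::= WAdd (V ''w'') (WLit 1)) Skip) ;;
     ''L'' ::= V ''w''"

lemma wmod_compact [simp]: "wmod compact = {''w'', ''rk'', ''lg'', ''lp'', ''L''}" "rmod compact = {''la'', ''lb''}"
  by (auto simp: compact_def)

lemma compact_wp:
  assumes L: "words s ''L'' 0 = L" "L \<le> W" and W: "\<forall>i<L. words s ''lg'' i \<le> W \<and> words s ''lp'' i \<le> W"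
  shows "wp W compact (\<lambda>\<tau> s'. \<tau> \<le> 60 * (L + 1) \<and>
    lines s' = map (line s) (filter (\<lambda>i. words s ''dead'' i = 0) [0..<L])) s"
proof -
  define s1 where "s1 = s\<lparr>words := (words s)(''w'' := (words s ''w'')(0 := 0))\<rparr>"
  let ?F = "\<lambda>k. filter (\<lambda>i. words s ''dead'' i = 0) [0..<k]"
  let ?P = "Cond (WLess (WCell ''dead'' (V ''rk'')) (WLit 1))
       (WAssign ''lg'' (V ''w'') lg_rk ;; RAssign ''la'' (V ''w'') (RCell ''la'' (V ''rk'')) ;;
        RAssign ''lb'' (V ''w'') (RCell ''lb'' (V ''rk'')) ;; WAssign ''lp'' (V ''w'') (WCell ''lp'' (V ''rk'')) ;;
        ''w'' ::= WAdd (V ''w'') (WLit 1)) Skip"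
  have "wp W (For ''rk'' (V ''L'') ?P) (\<lambda>\<tau> s'. \<tau> \<le> 52 * (L + 1) \<and> words s' ''w'' 0 \<le> L \<and>
      map (line s') [0..<words s' ''w'' 0] = map (line s) (?F L)) s1"
  \<comment> \<open>Compaction works in place: the write position never passes the read position,
    and the last clause keeps the unread lines intact.\<close>
  proof (rule wp_for[where n = L and c = 40 and I = "\<lambda>k s'. words s' ''w'' 0 \<le> k \<and> words s' ''w'' 0 = length (?F k) \<and> (\<forall>j<words s' ''w'' 0. line s' j = line s (?F k ! j)) \<and>
      (\<forall>i<L. k \<le> i \<longrightarrow> line s' i = line s i)"], goal_cases)
    case (5 k s')
    let ?w = "words s' ''w'' 0"
    have r: "words s' ''dead'' = words s ''dead''" using 5(2) by (simp add: frm_def s1_def)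
    have l: "words s' ''lg'' k = words s ''lg'' k" "words s' ''lp'' k = words s ''lp'' k"
        "reals s' ''la'' k = reals s ''la'' k" "reals s' ''lb'' k = reals s ''lb'' k"
      using 5(1,4) by (auto simp: line_def)
    have W1: "words s ''lg'' k \<le> W" "words s ''lp'' k \<le> W" "?w + 1 \<le> W" using W L 5(1,4) by (simp, simp, linarith)
    have w: "?w \<le> k" using 5(4) by blast
    show ?case using 5(1,3,4) r l W1 w
      by (auto simp: lg_rk_def line_def nth_append)
  next
    case (6 \<tau> s')
    then show ?case by (auto intro: nth_equalityI)
  qed (use L in \<open>auto simp: frm_def s1_def line_def\<close>)
  then have "wp W (For ''rk'' (V ''L'') ?P) (\<lambda>\<tau> s'. \<tau> + 7 \<le> 60 * (L + 1) \<and> words s' ''w'' 0 \<le> W \<and>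
      map (line s') [0..<words s' ''w'' 0] = map (line s) (?F L)) s1"
    by (rule wp_conseq) (use L in auto)
  then have "wp W (For ''rk'' (V ''L'') ?P ;; ''L'' ::= V ''w'') (\<lambda>\<tau> s'. \<tau> + 3 \<le> 60 * (L + 1) \<and>
      lines s' = map (line s) (?F L)) s1"
    by (rule wp_seq) (simp add: lines_def line_L)
  then show ?thesis using L unfolding compact_def by (simp add: s1_def add.commute)
qed

lemma frm_words: "frm P s s' \<Longrightarrow> a \<notin> wmod P \<Longrightarrow> words s' a = words s a"
  by (simp add: frm_def)

lemma frm_reals: "frm P s s' \<Longrightarrow> a \<notin> rmod P \<Longrightarrow> reals s' a = reals s a"
  by (simp add: frm_def)

text \<open>Three reductions by the factor 3/4 more than halve, since 27 * 2 < 64.\<close>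

lemma pow43_bound:
  assumes "4 ^ it * e \<le> 3 ^ it * (e0 :: nat)" "1 \<le> e" "e0 \<le> 2 ^ k"
  shows "it \<le> 3 * k"
proof (rule ccontr)
  assume "\<not> it \<le> 3 * k"
  then obtain r where r: "it = 3 * k + r" "1 \<le> r" by (metis le_add_diff_inverse not_less less_imp_le_nat zero_less_diff Suc_leI One_nat_def)
  have "4 ^ it * 1 \<le> 4 ^ it * e" using assms(2) by (intro mult_left_mono) auto
  also have "\<dots> \<le> 3 ^ it * 2 ^ k" using assms(1,3) by (meson le_trans mult_le_mono2)
  also have "\<dots> = (27 * 2) ^ k * 3 ^ r" unfolding r power_add power_mult power_mult_distrib by simp
  also have "\<dots> < 64 ^ k * 4 ^ r"
  proof (rule mult_le_less_imp_less)
    show "(27 * 2 :: nat) ^ k \<le> 64 ^ k" by (rule power_mono) auto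
    show "(3 :: nat) ^ r < 4 ^ r" using r(2) by (intro power_strict_mono) auto
  qed auto
  also have "64 ^ k * 4 ^ r = (4 :: nat) ^ it" unfolding r power_add power_mult by simp
  finally show False by simp
qed

text \<open>Clearing the denominator \<open>b - b'\<close> reverses the inequality exactly if it is
  negative, which the cases of \<open>loses_a\<close> mirror. Equal slopes are compared by
  \<open>a\<close> alone.\<close>

lemma loses_a_correct:
  assumes "if ok then (a - a') / (b - b') \<le> lam else lam \<le> (a - a') / (b - b')"
  shows "if loses_a ok a b a' b' then a' - lam * b' \<le> a - lam * b else a - lam * b \<le> a' - lam * b'"
proof (cases "b = b'")
  case True
  then show ?thesis by (auto simp: loses_a_def)
next
  case False
  have "(a - a') / (b - b') \<le> lam \<longleftrightarrow> (if b' < b then a - a' \<le> lam * (b - b') else lam * (b - b') \<le> a - a')"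
    using False by (auto simp: pos_divide_le_eq neg_divide_le_eq)
  moreover have "lam \<le> (a - a') / (b - b') \<longleftrightarrow> (if b' < b then lam * (b - b') \<le> a - a' else a - a' \<le> lam * (b - b'))"
    using False by (auto simp: pos_le_divide_eq neg_le_divide_eq)
  ultimately show ?thesis using assms False by (auto simp: loses_a_def right_diff_distrib split: if_splits)
qed

lemma halve_cost:
  fixes X Y :: nat
  assumes "X \<le> 2 * Y" "e \<le> Y" "t1 \<le> 150 * (G + e + 1)" "t2 \<le> 400 * X + 250 * B + 100 * (q + 1) + 60 * (G + e + 1)" "q \<le> e" "1 \<le> e"
  shows "17 + (t1 + t2) \<le> 210 * (G + 1) + 250 * B + 20 + 1210 * Y"
  using assms by simp

section \<open>Discarding lines that are dominated at the minimum ratio\<close>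

context mrc_ram begin

definition val :: "line \<Rightarrow> real" where
  "val x = fst (snd x) - lam * fst (snd (snd x))"

text \<open>The invariant of pruning. Values are compared under \<open>cyc\<close> only, because
  otherwise the answers of the oracle carry no information about \<open>lam\<close>; the survival of
  groups is unconditional, so filled cells never depend on that assumption.\<close>

definition refines :: "line list \<Rightarrow> line list \<Rightarrow> bool" where
  "refines xs ys \<longleftrightarrow> set ys \<subseteq> set xs \<and> (\<forall>x\<in>set xs. \<exists>y\<in>set ys. fst y = fst x \<and> (cyc \<longrightarrow> val y \<le> val x))"

lemma refines_refl: "refines xs xs"
  by (auto simp: refines_def)

lemma refinesD:
  assumes "refines xs ys"
  shows "set ys \<subseteq> set xs" "x \<in> set xs \<Longrightarrow> \<exists>y\<in>set ys. fst y = fst x \<and> (cyc \<longrightarrow> val y \<le> val x)"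
  using assms unfolding refines_def by blast+

lemma refines_trans:
  assumes "refines xs ys" "refines ys zs"
  shows "refines xs zs"
  unfolding refines_def
proof (intro conjI ballI)
  show "set zs \<subseteq> set xs" using refinesD(1)[OF assms(1)] refinesD(1)[OF assms(2)] by blast
  fix x assume "x \<in> set xs"
  from refinesD(2)[OF assms(1) this] obtain y where y: "y \<in> set ys" "fst y = fst x" "cyc \<longrightarrow> val y \<le> val x" by blast
  from refinesD(2)[OF assms(2) y(1)] obtain z where "z \<in> set zs" "fst z = fst y" "cyc \<longrightarrow> val z \<le> val y" by blast
  with y show "\<exists>z\<in>set zs. fst z = fst x \<and> (cyc \<longrightarrow> val z \<le> val x)" by (intro bexI[of _ z]) auto
qed

lemma refines_groups:
  assumes "refines xs ys"
  shows "fst ` set ys = fst ` set xs"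
proof
  show "fst ` set ys \<subseteq> fst ` set xs" using refinesD(1)[OF assms] by blast
  show "fst ` set xs \<subseteq> fst ` set ys"
  proof
    fix g assume "g \<in> fst ` set xs"
    then obtain x where x: "x \<in> set xs" "g = fst x" by blast
    from refinesD(2)[OF assms x(1)] x(2) show "g \<in> fst ` set ys" by (metis image_eqI)
  qed
qed

lemma set_lines: "set (lines s) = line s ` {..<words s ''L'' 0}"
  by (auto simp: lines_def)

lemma length_lines [simp]: "length (lines s) = words s ''L'' 0"
  by (simp add: lines_def)

definition halve :: com where
  "halve = median ;; BF ;; decide ;; compact"

lemma wmod_halve [simp]: "wmod halve = {''tr'', ''sa'', ''sk'', ''bv'', ''br'', ''be'', ''ok'', ''rk'', ''dead'', ''w'', ''lg'', ''lp'', ''L''}"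
    "rmod halve = {''x'', ''d'', ''la'', ''lb''}"
  by (auto simp: halve_def)

text \<open>Pairs are disjoint, so the losers of decided pairs are distinct lines, and the winner of
  a pair is not the loser of another. By the two median bounds at least half of the pairs are
  decided, whatever the answer of the oracle.\<close>

lemma halve_refines:
  assumes P: "pairing (words s ''lg'') L pn (words s ''pa'') (words s ''pb'')"
    and xs: "\<And>l. l < pn \<Longrightarrow> reals s ''xs'' l = crossing s (words s ''pa'' l) (words s ''pb'' l)"
    and ok: "cyc \<Longrightarrow> ok \<longleftrightarrow> reals s ''x'' 0 \<le> lam"
    and m1: "pn \<le> 2 * card {i. i < pn \<and> reals s ''xs'' i \<le> reals s ''x'' 0}"
    and m2: "pn \<le> 2 * card {i. i < pn \<and> reals s ''x'' 0 \<le> reals s ''xs'' i}"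
  defines "D \<equiv> {i. i < L \<and> (\<exists>l<pn. decided ok s l \<and> loser ok s l = i)}"
    and "alive \<equiv> filter (\<lambda>i. \<not> (\<exists>l<pn. decided ok s l \<and> loser ok s l = i)) [0..<L]"
  shows "pn \<le> 2 * (L - length alive)" "length alive \<le> L" "refines (map (line s) [0..<L]) (map (line s) alive)"
proof -
  let ?i = "words s ''pa''" let ?j = "words s ''pb''"
  let ?dec = "{l. l < pn \<and> decided ok s l}"
  define winner where "winner l = (if loser ok s l = ?i l then ?j l else ?i l)" for l
  have ij: "?i l < L" "?j l < L" "?i l \<noteq> ?j l" "words s ''lg'' (?i l) = words s ''lg'' (?j l)" if "l < pn" for l
    using P that unfolding pairing_def by (auto intro: less_trans)
  have los: "loser ok s l = ?i l \<or> loser ok s l = ?j l" for l by (simp add: loser_def Let_def)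
  have ne: "?i l \<noteq> ?i l'" "?j l \<noteq> ?j l'" "?i l \<noteq> ?j l'" "?j l \<noteq> ?i l'" if "l < pn" "l' < pn" "l \<noteq> l'" for l l'
    using P that unfolding pairing_def inj_on_def by blast+
  have inj: "inj_on (loser ok s) ?dec"
  proof (rule inj_onI, rule ccontr)
    fix l l' assume "l \<in> ?dec" "l' \<in> ?dec" "loser ok s l = loser ok s l'" "l \<noteq> l'"
    then show False using los[of l] los[of l'] ne[of l l'] by (elim disjE) simp_all
  qed
  have "loser ok s l < L" if "l < pn" for l using los[of l] ij(1,2)[OF that] by (elim disjE) simp_all
  then have "D = loser ok s ` ?dec" unfolding D_def by auto
  then have cD: "card D = card ?dec" using inj by (simp add: card_image)
  have "pn \<le> 2 * card ?dec"
  proof (cases ok)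
    case True
    then show ?thesis using m1 by (simp add: decided_def)
  next
    case False
    then show ?thesis using m2 by (simp add: decided_def)
  qed
  moreover have "length alive = card ({..<L} - D)"
    unfolding alive_def length_filter_conv_card by (rule arg_cong[where f = card]) (auto simp: D_def)
  moreover have DL: "D \<subseteq> {..<L}" by (auto simp: D_def)
  moreover have "card ({..<L} - D) = L - card D" using card_Diff_subset[OF finite_subset[OF DL] DL] by simp
  moreover have "card D \<le> L" using card_mono[OF _ DL] by simp
  ultimately show "pn \<le> 2 * (L - length alive)" "length alive \<le> L" using cD by simp_all
  show "refines (map (line s) [0..<L]) (map (line s) alive)"
    unfolding refines_def
  proof (intro conjI ballI)
    show "set (map (line s) alive) \<subseteq> set (map (line s) [0..<L])" by (auto simp: alive_def)
    fix x assume "x \<in> set (map (line s) [0..<L])"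
    then obtain i where i: "i < L" "x = line s i" by auto
    show "\<exists>y\<in>set (map (line s) alive). fst y = fst x \<and> (cyc \<longrightarrow> val y \<le> val x)"
    proof (cases "\<exists>l<pn. decided ok s l \<and> loser ok s l = i")
      case False
      then show ?thesis using i by (intro bexI[of _ x]) (auto simp: alive_def)
    next
      case True
      then obtain l where l: "l < pn" "decided ok s l" "loser ok s l = i" by blast
      have w: "loser ok s l' \<noteq> winner l" if "l' < pn" for l'
        using ne[OF l(1) that] ij(3)[OF l(1)] los[of l'] los[of l] unfolding winner_def by (cases "l = l'") (auto split: if_splits)
      have "winner l < L" using ij[OF l(1)] by (simp add: winner_def)
      then have "winner l \<in> set alive" using w by (simp add: alive_def)
      moreover have "fst (line s (winner l)) = fst x" using ij[OF l(1)] los[of l] l(3) i(2)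
        by (auto simp: winner_def line_def)
      moreover have "val (line s (winner l)) \<le> val x" if cyc
      proof -
        have "if ok then crossing s (?i l) (?j l) \<le> lam else lam \<le> crossing s (?i l) (?j l)"
          using l(2) ok[OF that] xs[OF l(1)] by (auto simp: decided_def split: if_splits)
        from loses_a_correct[OF this[unfolded crossing_def]] ij(3)[OF l(1)] l(3) i(2)
        show ?thesis by (auto simp: winner_def loser_def Let_def val_def line_def split: if_splits)
      qed
      ultimately show ?thesis by (intro bexI[of _ "line s (winner l)"]) auto
    qed
  qed
qed

lemma halve_wp:
  assumes i: "inp s" and L: "words s ''L'' 0 = L" "2 * L + 2 \<le> W" and p: "words s ''p'' 0 = pn" "1 \<le> pn" "pn \<le> 2 ^ k" "2 * pn \<le> W"
    and P: "pairing (words s ''lg'') L pn (words s ''pa'') (words s ''pb'')"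
    and xs: "\<And>l. l < pn \<Longrightarrow> reals s ''xs'' l = crossing s (words s ''pa'' l) (words s ''pb'' l)"
    and d: "\<forall>i<L. words s ''dead'' i = 0" and W: "\<forall>i<L. words s ''lg'' i \<le> W \<and> words s ''lp'' i \<le> W"
  shows "wp W halve (\<lambda>\<tau> s'. \<tau> \<le> 400 * ((pn + 1) * (k + 1)) + 250 * ((N + 1) * (m + 1)) + 100 * (pn + 1) + 60 * (L + 1) \<and>
    refines (lines s) (lines s') \<and> pn \<le> 2 * (L - words s' ''L'' 0) \<and> words s' ''L'' 0 \<le> L) s"
  unfolding halve_def
proof (rule wp_seq[OF median_wp[OF p(1,2,4,3)]], goal_cases)
  case median: (1 \<tau>1 s1)
  have i1: "inp s1" by (rule inp_frm[OF i median(1)]) simp_all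
  show ?case
  proof (rule wp_seq[OF BF_wp[OF i1 refl]], goal_cases)
  case (1 \<tau>2 s2)
  note 2 = median 1
  let ?x = "reals s1 ''x'' 0"
  have f: "words s2 a = words s a" if "a \<in> {''p'', ''L'', ''pa'', ''pb'', ''lg'', ''lp'', ''dead''}" for a
  proof -
    have "a \<notin> wmod median" "a \<notin> wmod BF" using that by auto
    then show ?thesis using frm_words[OF 2(1)] frm_words[OF 2(3)] by simp
  qed
  have g: "reals s2 a = reals s a" if "a \<in> {''xs'', ''la'', ''lb''}" for a
  proof -
    have "a \<notin> rmod median" "a \<notin> rmod BF" using that by auto
    then show ?thesis using frm_reals[OF 2(1)] frm_reals[OF 2(3)] by simp
  qed
  have x2: "reals s2 ''x'' 0 = ?x" using 2(3) by (simp add: frm_def)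
  have l2: "line s2 = line s" by (rule ext) (simp add: line_def f g)
  have W1: "pn \<le> W" "L \<le> W" using p L by linarith+
  define ok where "ok = (0 < words s2 ''ok'' 0)"
  have okn: "ok \<longleftrightarrow> noneg ?x" using 2(4) by (auto simp: ok_def split: if_splits)
  have H: "pn \<le> 2 * (L - length (filter (\<lambda>i. \<not> (\<exists>l<pn. decided ok s2 l \<and> loser ok s2 l = i)) [0..<L]))"
    "length (filter (\<lambda>i. \<not> (\<exists>l<pn. decided ok s2 l \<and> loser ok s2 l = i)) [0..<L]) \<le> L"
    "refines (map (line s2) [0..<L]) (map (line s2) (filter (\<lambda>i. \<not> (\<exists>l<pn. decided ok s2 l \<and> loser ok s2 l = i)) [0..<L]))"
    by (rule halve_refines[where ok = ok]; use P xs 2(2) okn oracle_iff in \<open>simp add: f g x2 crossing_def noneg_def\<close>)+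
  define al where "al = filter (\<lambda>i. \<not> (\<exists>l<pn. decided ok s2 l \<and> loser ok s2 l = i)) [0..<L]"
  note H = H[folded al_def]
  show ?case
  proof (rule wp_seq[OF decide_wp[where p = pn and L = L]])
    show "words s2 ''p'' 0 = pn" "pn \<le> W" "1 \<le> W" "\<forall>i<L. words s2 ''dead'' i = 0"
      using p(1) W1 one_le_W d by (simp_all add: f)
    fix \<tau>3 s3 assume f3: "frm decide s2 s3" and q3: "\<tau>3 \<le> 100 * (pn + 1) \<and>
      (\<forall>i<L. words s3 ''dead'' i = (if \<exists>l<pn. decided (0 < words s2 ''ok'' 0) s2 l \<and> loser (0 < words s2 ''ok'' 0) s2 l = i then 1 else 0))"
    have l3: "line s3 = line s" using f3 l2 by (auto simp: line_def frm_def fun_eq_iff)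
    have "wp W compact (\<lambda>\<tau> s'. \<tau> \<le> 60 * (L + 1) \<and>
      lines s' = map (line s3) (filter (\<lambda>i. words s3 ''dead'' i = 0) [0..<L])) s3"
      using L(1) W1 W f3 by (intro compact_wp) (simp_all add: frm_def f)
    then show "wp W compact
     (\<lambda>\<tau>. (\<lambda>\<tau>. (\<lambda>\<tau>. (\<lambda>\<tau> s'. \<tau> \<le> 400 * ((pn + 1) * (k + 1)) + 250 * ((N + 1) * (m + 1)) + 100 * (pn + 1) + 60 * (L + 1) \<and>
        refines (lines s) (lines s') \<and> pn \<le> 2 * (L - words s' ''L'' 0) \<and> words s' ''L'' 0 \<le> L) (\<tau>1 + \<tau>)) (\<tau>2 + \<tau>)) (\<tau>3 + \<tau>)) s3"
    proof (rule wp_conseq, goal_cases)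
      case (1 \<tau>4 s4)
      have "filter (\<lambda>i. words s3 ''dead'' i = 0) [0..<L] = al"
        using q3 unfolding al_def by (intro filter_cong) (auto simp: ok_def)
      with 1(2) have e: "lines s4 = map (line s) al" by (simp add: l3)
      have e2: "words s4 ''L'' 0 = length al" using arg_cong[OF e, of length] by simp
      have e3: "lines s = map (line s) [0..<L]" using L(1) by (simp add: lines_def)
      have "\<tau>1 + (\<tau>2 + (\<tau>3 + \<tau>4)) \<le> 400 * ((pn + 1) * (k + 1)) + 250 * ((N + 1) * (m + 1)) + 100 * (pn + 1) + 60 * (L + 1)"
        using 2(2,4) q3 1(2) by linarith
      moreover have "refines (lines s) (lines s4)" using H(3) unfolding e e3 l2 .
      ultimately show ?case using H(1,2) unfolding e2 by blast
    qed
  qed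
qed
qed

lemma line_go: "line (s\<lparr>words := (words s)(''go'' := x)\<rparr>) = line s"
  by (rule ext) (simp add: line_def)

definition resolve :: com where
  "resolve = ''go'' ::= WLit 1 ;; While (WLess (WLit 0) (V ''go''))
     (pair_up ;; Cond (WLess (V ''p'') (WLit 1)) (''go'' ::= WLit 0) halve)"

lemma wmod_resolve [simp]: "wmod resolve = {''go'', ''rk'', ''pend'', ''p'', ''dead'', ''pa'', ''pb'', ''tr'', ''sa'', ''sk'', ''bv'', ''br'', ''be'', ''ok'', ''w'', ''lg'', ''lp'', ''L''}"
    "rmod resolve = {''xs'', ''x'', ''d'', ''la'', ''lb''}"
  by (auto simp: resolve_def)

text \<open>With \<open>G\<close> groups the surplus \<open>L - G\<close> is at most twice the
  number of pairs, and at least half of the pairs lose a line: each round leaves at most 3/4 of the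
  surplus. This makes the number of rounds, and with it that of oracle calls, linear in
  \<open>k\<close>.\<close>

lemma resolve_wp:
  assumes i: "inp s" and L: "words s ''L'' 0 = L" "2 * L + 2 \<le> W" "L \<le> 2 ^ k"
    and W: "\<forall>i<L. words s ''lg'' i \<le> W \<and> words s ''lp'' i \<le> W"
  shows "wp W resolve (\<lambda>\<tau> s'. \<tau> \<le> 6000 * ((k + 1) * (L + 1 + (N + 1) * (m + 1))) \<and>
    refines (lines s) (lines s') \<and> distinct (map fst (lines s'))) s"
proof -
  define s1 where "s1 = s\<lparr>words := (words s)(''go'' := (words s ''go'')(0 := 1))\<rparr>"
  have l1: "lines s1 = lines s" "words s1 ''L'' 0 = L" "words s1 ''go'' 0 = 1"
    using L(1) by (simp_all add: s1_def lines_def line_def)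
  have i1: "inp s1" using i by (simp add: s1_def inp_def)
  define G where "G = card (fst ` set (lines s))"
  define B where "B = (N + 1) * (m + 1)"
  \<comment> \<open>\<open>\<alpha>\<close> is charged per round and contains the oracle call.
    \<open>\<beta>\<close> is charged per discarded line and pays for the median: the surplus, which
    bounds the number of pairs, is at most four times the number of lines discarded. Thus the costs
    of selection telescope.\<close>
  define \<alpha> where "\<alpha> = 210 * (G + 1) + 250 * B + 20"
  define \<beta> where "\<beta> = 4840 * (k + 1)"
  have GL: "G \<le> L" unfolding G_def using L(1) by (metis card_image_le card_length le_trans List.finite_set length_lines)
  have W': "fst x \<le> W \<and> snd (snd (snd x)) \<le> W" if "x \<in> set (lines s)" for x
    using that W L(1) by (auto simp: set_lines line_def)
  let ?P = "pair_up ;; Cond (WLess (V ''p'') (WLit 1)) (''go'' ::= WLit 0) halve"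
  define Inv where "Inv = (\<lambda>\<tau> s'. \<exists>it. refines (lines s) (lines s') \<and> words s' ''L'' 0 \<le> L \<and> G \<le> words s' ''L'' 0 \<and> words s' ''go'' 0 \<le> 1 \<and>
     (words s' ''go'' 0 = 0 \<longrightarrow> distinct (map fst (lines s'))) \<and> it \<le> 3 * k + 1 \<and>
     4 ^ it * (words s' ''L'' 0 - G) \<le> 3 ^ it * (L - G) \<and>
     \<tau> \<le> it * \<alpha> + \<beta> * (L - words s' ''L'' 0) + (if words s' ''go'' 0 = 0 then \<alpha> + 100 * L else 0))"
  have "wp W (While (WLess (WLit 0) (V ''go'')) ?P) (\<lambda>\<tau> s'. \<tau> + 3 \<le> 6000 * ((k + 1) * (L + 1 + B)) \<and>
    refines (lines s) (lines s') \<and> distinct (map fst (lines s'))) s1"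
  proof (rule wp_while[where Inv = Inv and \<mu> = "\<lambda>s. words s ''L'' 0 + words s ''go'' 0"], goal_cases)
    case 1
    show ?case unfolding Inv_def using l1 refines_refl GL by (intro exI[of _ 0]) simp
  next
    case (2 \<tau> s2)
    have i2: "inp s2" by (rule inp_frm[OF i1 2(1)]) simp_all
    let ?L = "words s2 ''L'' 0"
    from 2(2,3) obtain it where R: "refines (lines s) (lines s2)" and L2: "?L \<le> L" "G \<le> ?L" and go: "words s2 ''go'' 0 = 1"
      and it: "it \<le> 3 * k + 1" "4 ^ it * (?L - G) \<le> 3 ^ it * (L - G)" and tm: "\<tau> \<le> it * \<alpha> + \<beta> * (L - ?L)"
      unfolding Inv_def by fastforce
    have G2: "card (words s2 ''lg'' ` {..<?L}) = G"
    proof -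
      have "words s2 ''lg'' ` {..<?L} = fst ` set (lines s2)" by (auto simp: set_lines line_def image_image)
      then show ?thesis unfolding G_def refines_groups[OF R] by simp
    qed
    have "?L + 1 \<le> W" using L2 L by linarith
    from pair_up_wp[OF refl this] show ?case
    proof (rule wp_seq, goal_cases)
      case (1 \<tau>1 s3)
      note pu = 1(2)
      let ?p = "words s3 ''p'' 0"
      have f3: "words s3 ''L'' 0 = ?L" "words s3 ''lg'' = words s2 ''lg''" "words s3 ''lp'' = words s2 ''lp''"
        "words s3 ''go'' 0 = 1" "reals s3 ''la'' = reals s2 ''la''" "reals s3 ''lb'' = reals s2 ''lb''"
        using 1(1) go by (simp_all add: frm_def)
      have l3': "line s3 = line s2" using f3 by (simp add: line_def fun_eq_iff)
      then have l3: "lines s3 = lines s2" using f3 by (simp add: lines_def)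
      have i3: "inp s3" by (rule inp_frm[OF i2 1(1)]) simp_all
      from 1(2) obtain pend where PP: "pairing_pend (words s2 ''lg'') ?L ?L ?p (words s3 ''pa'') (words s3 ''pb'') pend" by blast
      then have P: "pairing (words s2 ''lg'') ?L ?p (words s3 ''pa'') (words s3 ''pb'')" by (simp add: pairing_pend_def)
      have b1: "?L \<le> 2 * ?p + G" using pairing_pend_bound[OF PP] G2 by simp
      have b2: "?p + G \<le> ?L" using pairing_le[OF P] G2 by simp
      show ?case
      proof (cases "?p < 1")
        case True
        then have "?L = G" using b1 L2 by simp
        then have "inj_on (words s2 ''lg'') {..<?L}" using G2 by (intro eq_card_imp_inj_on) auto
        then have "distinct (map fst (lines s2))" by (simp add: lines_def line_def distinct_map comp_def atLeast0LessThan)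
        moreover have "\<tau> + (17 + \<tau>1) \<le> it * \<alpha> + \<beta> * (L - ?L) + (\<alpha> + 100 * L)"
          using tm 1(2) \<open>?L = G\<close> by (simp add: \<alpha>_def)
        ultimately show ?thesis using True f3 l3 R L2 it go
          by (auto simp: Inv_def lines_def line_go l3' intro!: exI[of _ it])
      next
        case False
        have p1: "1 \<le> ?p" "?p \<le> 2 ^ k" "2 * ?p \<le> W" using False b2 L2 L by linarith+
        have itk: "it \<le> 3 * k" using pow43_bound[OF it(2), of k] b2 p1 L(3) by linarith
        have W3: "\<forall>i<?L. words s3 ''lg'' i \<le> W \<and> words s3 ''lp'' i \<le> W"
        proof (intro allI impI)
          fix i assume "i < ?L"
          then have "line s2 i \<in> set (lines s2)" by (simp add: set_lines)
          then show "words s3 ''lg'' i \<le> W \<and> words s3 ''lp'' i \<le> W"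
            using R W' unfolding refines_def f3 by (fastforce simp: line_def)
        qed
        have "wp W halve (\<lambda>\<tau> s'. \<tau> \<le> 400 * ((?p + 1) * (k + 1)) + 250 * ((N + 1) * (m + 1)) + 100 * (?p + 1) + 60 * (?L + 1) \<and>
            refines (lines s3) (lines s') \<and> ?p \<le> 2 * (?L - words s' ''L'' 0) \<and> words s' ''L'' 0 \<le> ?L) s3"
          using L2 L(2) 1(2) P f3 by (intro halve_wp[OF i3 f3(1) _ refl p1 _ _ _ W3]) (auto simp: crossing_def)
        then have "wp W halve (\<lambda>\<tau>2 s'. Inv (\<tau> + (10 + (\<tau>1 + \<tau>2))) s' \<and> words s' ''L'' 0 + words s' ''go'' 0 < ?L + 1) s3"
        proof (rule wp_conseq, goal_cases)
          case (1 \<tau>2 s4)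
          let ?L4 = "words s4 ''L'' 0"
          have go4: "words s4 ''go'' 0 = 1" using 1(1) f3 by (simp add: frm_def)
          have R4: "refines (lines s) (lines s4)" using refines_trans[OF R] 1(2) l3 by simp
          have "G = card (fst ` set (lines s4))" unfolding G_def refines_groups[OF R4] by simp
          also have "\<dots> \<le> ?L4" by (metis card_image_le card_length le_trans List.finite_set length_lines)
          finally have G4: "G \<le> ?L4" .
          have pr: "?p \<le> 2 * (?L - ?L4)" "?L4 \<le> ?L" using 1(2) by auto
          have E: "4 * (?L4 - G) \<le> 3 * (?L - G)" using b1 pr L2 G4 by linarith
          have "4 ^ Suc it * (?L4 - G) = 4 ^ it * (4 * (?L4 - G))" by simp
          also have "\<dots> \<le> 4 ^ it * (3 * (?L - G))" using E by (rule mult_le_mono2)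
          also have "\<dots> = 3 * (4 ^ it * (?L - G))" by simp
          also have "\<dots> \<le> 3 ^ Suc it * (L - G)" using it(2) by simp
          finally have E2: "4 ^ Suc it * (?L4 - G) \<le> 3 ^ Suc it * (L - G)" .
          have t1: "10 + (\<tau>1 + \<tau>2) \<le> \<alpha> + \<beta> * (?L - ?L4)"
          proof -
            have t12: "\<tau>1 \<le> 150 * (?L + 1)" "\<tau>2 \<le> 400 * ((?p + 1) * (k + 1)) + 250 * ((N + 1) * (m + 1)) + 100 * (?p + 1) + 60 * (?L + 1)"
              using pu 1(2) by blast+
            define e where "e = ?L - G"
            have Le: "?L = G + e" using L2 by (simp add: e_def)
            have pe: "?p \<le> e" "1 \<le> e" "e \<le> 4 * (?L - ?L4)" using b1 b2 pr p1 by (simp_all add: e_def)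
            have "(?p + 1) * (k + 1) \<le> (2 * e) * (k + 1)" using pe by (intro mult_right_mono) auto
            then have X: "(?p + 1) * (k + 1) \<le> 2 * (e * (k + 1))" by (simp only: mult.assoc)
            have "17 + (\<tau>1 + \<tau>2) \<le> \<alpha> + 1210 * (e * (k + 1))"
              unfolding \<alpha>_def B_def by (rule halve_cost[OF X _ t12[unfolded Le] pe(1,2)]) simp
            also have "1210 * (e * (k + 1)) \<le> 1210 * ((4 * (?L - ?L4)) * (k + 1))" using pe(3) by (intro mult_le_mono) auto
            also have "1210 * ((4 * (?L - ?L4)) * (k + 1)) = \<beta> * (?L - ?L4)" unfolding \<beta>_def by simp
            finally show ?thesis by simp
          qed
          have "L - ?L4 = (L - ?L) + (?L - ?L4)" using pr L2 by simp
          then have "\<tau> + (10 + (\<tau>1 + \<tau>2)) \<le> Suc it * \<alpha> + \<beta> * (L - ?L4)"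
            using t1 tm by (simp add: distrib_left)
          then have "Inv (\<tau> + (10 + (\<tau>1 + \<tau>2))) s4"
            unfolding Inv_def using R4 G4 go4 pr L2 itk E2 by (intro exI[of _ "Suc it"]) simp
          then show ?case using pr p1 go4 by simp
        qed
        then show ?thesis using False go by (simp add: ac_simps)
      qed
    qed
  next
    case (3 \<tau> s2)
    then obtain it where r: "refines (lines s) (lines s2)" "distinct (map fst (lines s2))" and it: "it \<le> 3 * k + 1"
      and tm: "\<tau> \<le> it * \<alpha> + \<beta> * (L - words s2 ''L'' 0) + (\<alpha> + 100 * L)"
      unfolding Inv_def by auto
    have "it * \<alpha> \<le> (3 * k + 1) * \<alpha>" using it by (rule mult_le_mono1)
    moreover have "\<beta> * (L - words s2 ''L'' 0) \<le> \<beta> * L" by (intro mult_le_mono2) simp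
    moreover have "(3 * k + 1) * \<alpha> + \<alpha> \<le> 3 * ((k + 1) * \<alpha>)" by (simp add: algebra_simps)
    moreover have "(k + 1) * \<alpha> \<le> (k + 1) * (210 * (L + 1) + 250 * B + 20)" using GL by (intro mult_le_mono2) (simp add: \<alpha>_def)
    moreover have "1 * 1 \<le> (k + 1) * (L + 1)" by (intro mult_le_mono) auto
    ultimately have "\<tau> + 10 \<le> 6000 * ((k + 1) * (L + 1 + B))"
      using tm by (simp add: \<beta>_def algebra_simps)
    then show ?case using r by simp
  qed
  then show ?thesis unfolding resolve_def using one_le_W by (simp add: s1_def B_def add.commute)
qed

end

section \<open>Collecting candidates and storing the winners\<close>

definition push :: "wexp \<Rightarrow> rexp \<Rightarrow> rexp \<Rightarrow> wexp \<Rightarrow> com" where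
  "push g a b q = WAssign ''lg'' (V ''L'') g ;; RAssign ''la'' (V ''L'') a ;; RAssign ''lb'' (V ''L'') b ;;
     WAssign ''lp'' (V ''L'') q ;; ''L'' ::= WAdd (V ''L'') (WLit 1)"

lemma wmod_push [simp]: "wmod (push g a b q) = {''lg'', ''lp'', ''L''}" "rmod (push g a b q) = {''la'', ''lb''}"
  by (auto simp: push_def)

text \<open>The fields are written one after another, so later expressions are evaluated when
  earlier fields are already set. Therefore \<open>ev\<close> asks for the values in all stores that
  differ in these four arrays at most; \<open>L\<close> itself is increased last.\<close>

lemma push_wp:
  assumes ev: "\<And>s'. (\<And>x. x \<notin> {''lg'', ''lp''} \<Longrightarrow> words s' x = words s x) \<Longrightarrow> (\<And>x. x \<notin> {''la'', ''lb''} \<Longrightarrow> reals s' x = reals s x) \<Longrightarrow>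
      wval s' g = G \<and> rval s' a = A \<and> rval s' b = B \<and> wval s' q = Q"
    and W: "G \<le> W" "Q \<le> W" "words s ''L'' 0 + 1 \<le> W"
  shows "wp W (push g a b q) (\<lambda>\<tau> s'. \<tau> \<le> 20 + wcost g + rcost a + rcost b + wcost q \<and>
    lines s' = lines s @ [(G, A, B, Q)]) s"
proof -
  let ?L = "words s ''L'' 0"
  define s1 where "s1 = s\<lparr>words := (words s)(''lg'' := (words s ''lg'')(?L := G))\<rparr>"
  define s2 where "s2 = s1\<lparr>reals := (reals s1)(''la'' := (reals s1 ''la'')(?L := A))\<rparr>"
  define s3 where "s3 = s2\<lparr>reals := (reals s2)(''lb'' := (reals s2 ''lb'')(?L := B))\<rparr>"
  define s4 where "s4 = s3\<lparr>words := (words s3)(''lp'' := (words s3 ''lp'')(?L := Q))\<rparr>"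
  define s5 where "s5 = s4\<lparr>words := (words s4)(''L'' := (words s4 ''L'')(0 := ?L + 1))\<rparr>"
  have L: "words s1 ''L'' 0 = ?L" "words s2 ''L'' 0 = ?L" "words s3 ''L'' 0 = ?L" "words s4 ''L'' 0 = ?L"
    by (simp_all add: s1_def s2_def s3_def s4_def)
  have e0: "wval s g = G" using ev[of s] by simp
  have e1: "rval s1 a = A" using ev[of s1] by (simp add: s1_def)
  have e2: "rval s2 b = B" using ev[of s2] by (simp add: s2_def s1_def)
  have e3: "wval s3 q = Q" using ev[of s3] by (simp add: s3_def s2_def s1_def)
  have "wp W (push g a b q) (\<lambda>\<tau> s'. \<tau> \<le> 20 + wcost g + rcost a + rcost b + wcost q \<and> s' = s5) s"
  proof -
    have w: "wp W (WAssign ''lg'' (V ''L'') g) (\<lambda>\<tau> s'. \<tau> = 3 + wcost g \<and> s' = s1) s"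
      "wp W (RAssign ''la'' (V ''L'') a) (\<lambda>\<tau> s'. \<tau> = 3 + rcost a \<and> s' = s2) s1"
      "wp W (RAssign ''lb'' (V ''L'') b) (\<lambda>\<tau> s'. \<tau> = 3 + rcost b \<and> s' = s3) s2"
      "wp W (WAssign ''lp'' (V ''L'') q) (\<lambda>\<tau> s'. \<tau> = 3 + wcost q \<and> s' = s4) s3"
      "wp W (''L'' ::= WAdd (V ''L'') (WLit 1)) (\<lambda>\<tau> s'. \<tau> = 6 \<and> s' = s5) s4"
      using W e0 e1 e2 e3 L by (simp_all add: s1_def s2_def s3_def s4_def s5_def)
    show ?thesis unfolding push_def
      by (rule wp_seq[OF w(1)], clarify, rule wp_seq[OF w(2)], clarify, rule wp_seq[OF w(3)], clarify,
          rule wp_seq[OF w(4)], clarify, rule wp_conseq[OF w(5)], clarify, simp)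
  qed
  moreover have "lines s5 = lines s @ [(G, A, B, Q)]"
  proof (rule nth_equalityI)
    show "length (lines s5) = length (lines s @ [(G, A, B, Q)])" by (simp add: lines_def s5_def)
    fix i assume "i < length (lines s5)"
    then have "i < ?L + 1" by (simp add: lines_def s5_def)
    then show "lines s5 ! i = (lines s @ [(G, A, B, Q)]) ! i"
      by (auto simp: lines_def nth_append line_def s5_def s4_def s3_def s2_def s1_def simp del: upt_Suc)
  qed
  ultimately show ?thesis by (auto elim: wp_conseq)
qed

lemma lines_cong:
  "words s' ''L'' = words s ''L'' \<Longrightarrow> words s' ''lg'' = words s ''lg'' \<Longrightarrow> words s' ''lp'' = words s ''lp'' \<Longrightarrow>
   reals s' ''la'' = reals s ''la'' \<Longrightarrow> reals s' ''lb'' = reals s ''lb'' \<Longrightarrow> lines s' = lines s"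
  by (simp add: lines_def line_def)

text \<open>Loop rule for programs that append lines: round \<open>i\<close> contributes
  \<open>A i\<close> and at most \<open>l\<close> lines. Tracking the set is enough because
  domination is a property of sets of lines.\<close>

lemma collect_for:
  assumes x: "x \<notin> wmod P" "x \<notin> {''L'', ''lg'', ''lp''}" and nW: "n \<le> W"
    and bnd: "\<And>s. frm (For x B P) s0 s \<Longrightarrow> wval s B = n"
    and step: "\<And>i s. i < n \<Longrightarrow> frm (For x B P) s0 s \<Longrightarrow> words s x 0 = i \<Longrightarrow> words s ''L'' 0 + l \<le> words s0 ''L'' 0 + n * l \<Longrightarrow>
      wp W P (\<lambda>\<tau> s'. \<tau> \<le> K \<and> set (lines s') = set (lines s) \<union> A i \<and> words s' ''L'' 0 \<le> words s ''L'' 0 + l) s"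
  shows "wp W (For x B P) (\<lambda>\<tau> s'. \<tau> \<le> (n + 1) * (K + wcost B + 10) \<and>
     set (lines s') = set (lines s0) \<union> (\<Union>i<n. A i) \<and> words s' ''L'' 0 \<le> words s0 ''L'' 0 + n * l) s0"
proof -
  have lx: "lines (s\<lparr>words := (words s)(x := f)\<rparr>) = lines s" "words (s\<lparr>words := (words s)(x := f)\<rparr>) ''L'' = words s ''L''" for s f
    using x(2) by (auto intro: lines_cong)
  show ?thesis
  proof (rule wp_for[where n = n and c = K and I = "\<lambda>k s. set (lines s) = set (lines s0) \<union> (\<Union>i<k. A i) \<and> words s ''L'' 0 \<le> words s0 ''L'' 0 + k * l"], goal_cases)
    case 3
    show ?case using lx by simp
  next
    case (4 k s)
    then show ?case using bnd by blast
  next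
    case (5 k s)
    have "Suc k * l \<le> n * l" using 5(1) by (intro mult_le_mono) auto
    then have "words s ''L'' 0 + l \<le> words s0 ''L'' 0 + n * l" using 5(4) by simp
    from step[OF 5(1-3) this] show ?case
    proof (rule wp_conseq, goal_cases)
      case (1 \<tau> s')
      then show ?case using 5(4) x(2) by (auto simp: lx lessThan_Suc)
    qed
  next
    case (6 \<tau> s)
    then show ?case by simp
  qed (use x nW in auto)
qed

definition commit :: com where
  "commit = For ''rk'' (V ''L'') (WAssign ''tv'' lg_rk (WLit 1) ;; RAssign ''tc'' lg_rk (RCell ''la'' (V ''rk'')) ;;
     RAssign ''tt'' lg_rk (RCell ''lb'' (V ''rk'')) ;; WAssign ''tp'' lg_rk (WCell ''lp'' (V ''rk'')))"

lemma wmod_commit [simp]: "wmod commit = {''rk'', ''tv'', ''tp''}" "rmod commit = {''tc'', ''tt''}"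
  by (auto simp: commit_def)

text \<open>A table cell in the format of a line whose group is its own address, so that a committed
  winner is literally equal to its candidate.\<close>

definition entry :: "store \<Rightarrow> nat \<Rightarrow> line" where
  "entry s g = (g, reals s ''tc'' g, reals s ''tt'' g, words s ''tp'' g)"

lemma commit_wp:
  assumes L: "words s ''L'' 0 = L" "L \<le> W" "1 \<le> W" and W: "\<forall>i<L. words s ''lp'' i \<le> W" and d: "distinct (map fst (lines s))"
  shows "wp W commit (\<lambda>\<tau> s'. \<tau> \<le> 60 * (L + 1) \<and> (\<forall>x\<in>set (lines s). words s' ''tv'' (fst x) = 1 \<and> entry s' (fst x) = x) \<and>
    (\<forall>g. g \<notin> fst ` set (lines s) \<longrightarrow> words s' ''tv'' g = words s ''tv'' g \<and> entry s' g = entry s g)) s"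
  unfolding commit_def
proof (rule wp_for[where n = L and c = 40 and I = "\<lambda>k s'. (\<forall>i<k. words s' ''tv'' (fst (line s i)) = 1 \<and> entry s' (fst (line s i)) = line s i) \<and>
    (\<forall>g. (\<forall>i<k. g \<noteq> fst (line s i)) \<longrightarrow> words s' ''tv'' g = words s ''tv'' g \<and> entry s' g = entry s g)"], goal_cases)
  case (5 k s')
  have r: "words s' ''lg'' = words s ''lg''" "words s' ''lp'' = words s ''lp''" "reals s' ''la'' = reals s ''la''" "reals s' ''lb'' = reals s ''lb''"
    using 5(2) by (simp_all add: frm_def)
  have dist: "words s ''lg'' i \<noteq> words s ''lg'' k" if "i < k" for i
    using d that 5(1) L(1) by (auto simp: distinct_conv_nth lines_def line_def)
  show ?case using 5(1,3,4) r W L dist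
    by (auto simp: lg_rk_def entry_def line_def less_Suc_eq)
next
  case (6 \<tau> s')
  have "set (lines s) = line s ` {..<L}" using L(1) by (auto simp: lines_def)
  moreover have "words s' ''tv'' g = words s ''tv'' g \<and> entry s' g = entry s g" if "g \<notin> fst ` line s ` {..<L}" for g
  proof -
    have "\<forall>i<L. g \<noteq> fst (line s i)" using that by blast
    then show ?thesis using 6(3) by blast
  qed
  ultimately show ?case using 6(3,4) by auto
qed (use L in \<open>auto simp: frm_def entry_def\<close>)

context mrc_ram begin

definition settle :: com where "settle = resolve ;; commit"

lemma wmod_settle [simp]: "wmod settle = {''go'', ''rk'', ''pend'', ''p'', ''dead'', ''pa'', ''pb'', ''tr'', ''sa'', ''sk'', ''bv'', ''br'', ''be'', ''ok'', ''w'', ''lg'', ''lp'', ''L'', ''tv'', ''tp''}"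
    "rmod settle = {''xs'', ''x'', ''d'', ''la'', ''lb'', ''tc'', ''tt''}"
  by (auto simp: settle_def)

text \<open>The interface to the parametric search for all that follows: cells without candidates
  are untouched, the others receive one of their candidates, and under \<open>cyc\<close> one that
  is best at \<open>lam\<close>.\<close>

lemma settle_wp:
  assumes i: "inp s" and L: "words s ''L'' 0 \<le> L" "2 * L + 2 \<le> W" "L \<le> 2 ^ k"
    and W: "\<forall>x \<in> set (lines s). fst x \<le> W \<and> snd (snd (snd x)) \<le> W"
  shows "wp W settle (\<lambda>\<tau> s'. \<tau> \<le> 7000 * ((k + 1) * (L + 1 + (N + 1) * (m + 1))) \<and>
    (\<forall>g. g \<notin> fst ` set (lines s) \<longrightarrow> words s' ''tv'' g = words s ''tv'' g \<and> entry s' g = entry s g) \<and>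
    (\<forall>g \<in> fst ` set (lines s). words s' ''tv'' g = 1 \<and> entry s' g \<in> set (lines s)) \<and>
    (cyc \<longrightarrow> (\<forall>x \<in> set (lines s). val (entry s' (fst x)) \<le> val x))) s"
  unfolding settle_def
proof (rule wp_seq)
  let ?L = "words s ''L'' 0"
  have Wi: "\<forall>i<?L. words s ''lg'' i \<le> W \<and> words s ''lp'' i \<le> W"
  proof (intro allI impI)
    fix i assume "i < ?L"
    then have "line s i \<in> set (lines s)" by (simp add: set_lines)
    from bspec[OF W this] show "words s ''lg'' i \<le> W \<and> words s ''lp'' i \<le> W" by (simp add: line_def)
  qed
  have L2: "2 * ?L + 2 \<le> W" "?L \<le> 2 ^ k" using L by simp_all
  show "wp W resolve (\<lambda>\<tau> s'. \<tau> \<le> 6000 * ((k + 1) * (?L + 1 + (N + 1) * (m + 1))) \<and>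
    refines (lines s) (lines s') \<and> distinct (map fst (lines s'))) s"
    by (rule resolve_wp[OF i refl L2 Wi])
  fix \<tau>1 s1 assume f1: "frm resolve s s1" and q1: "\<tau>1 \<le> 6000 * ((k + 1) * (?L + 1 + (N + 1) * (m + 1))) \<and>
    refines (lines s) (lines s1) \<and> distinct (map fst (lines s1))"
  let ?L1 = "words s1 ''L'' 0"
  have sub: "set (lines s1) \<subseteq> set (lines s)" using q1 refinesD(1) by blast
  have gr: "fst ` set (lines s1) = fst ` set (lines s)" using q1 refines_groups by blast
  have "?L1 = card (fst ` set (lines s1))" using q1 by (metis distinct_card length_lines length_map list.set_map)
  also have "\<dots> = card (fst ` set (lines s))" by (simp only: gr)
  also have "\<dots> \<le> ?L" by (metis card_image_le card_length le_trans List.finite_set length_lines)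
  finally have L1: "?L1 \<le> ?L" .
  have W1: "\<forall>i<?L1. words s1 ''lp'' i \<le> W"
  proof (intro allI impI)
    fix i assume "i < ?L1"
    then have "line s1 i \<in> set (lines s1)" by (simp add: set_lines)
    then have "line s1 i \<in> set (lines s)" using sub by blast
    from bspec[OF W this] show "words s1 ''lp'' i \<le> W" by (simp add: line_def)
  qed
  have u: "words s1 ''tv'' = words s ''tv''" "entry s1 = entry s"
    using f1 by (auto simp: frm_def entry_def fun_eq_iff)
  have "wp W commit (\<lambda>\<tau> s'. \<tau> \<le> 60 * (?L1 + 1) \<and> (\<forall>x\<in>set (lines s1). words s' ''tv'' (fst x) = 1 \<and> entry s' (fst x) = x) \<and>
    (\<forall>g. g \<notin> fst ` set (lines s1) \<longrightarrow> words s' ''tv'' g = words s1 ''tv'' g \<and> entry s' g = entry s1 g)) s1"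
    using L1 L2 one_le_W W1 q1 by (intro commit_wp) auto
  then show "wp W commit (\<lambda>\<tau>. (\<lambda>\<tau> s'. \<tau> \<le> 7000 * ((k + 1) * (L + 1 + (N + 1) * (m + 1))) \<and>
    (\<forall>g. g \<notin> fst ` set (lines s) \<longrightarrow> words s' ''tv'' g = words s ''tv'' g \<and> entry s' g = entry s g) \<and>
    (\<forall>g \<in> fst ` set (lines s). words s' ''tv'' g = 1 \<and> entry s' g \<in> set (lines s)) \<and>
    (cyc \<longrightarrow> (\<forall>x \<in> set (lines s). val (entry s' (fst x)) \<le> val x))) (\<tau>1 + \<tau>)) s1"
  proof (rule wp_conseq, goal_cases)
    case (1 \<tau>2 s2)
    let ?B = "(N + 1) * (m + 1)"
    have a: "words s2 ''tv'' g = 1 \<and> entry s2 g \<in> set (lines s)" if "g \<in> fst ` set (lines s)" for g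
    proof -
      from that gr obtain x where "x \<in> set (lines s1)" "g = fst x" by (metis imageE)
      then show ?thesis using 1(2) sub by auto
    qed
    have b: "val (entry s2 (fst x)) \<le> val x" if cyc "x \<in> set (lines s)" for x
    proof -
      from refinesD(2)[of "lines s" "lines s1" x] q1 that obtain y where "y \<in> set (lines s1)" "fst y = fst x" "val y \<le> val x" by blast
      moreover then have "entry s2 (fst y) = y" using 1(2) by blast
      ultimately show ?thesis by simp
    qed
    have "(k + 1) * (?L + 1 + ?B) \<le> (k + 1) * (L + 1 + ?B)" using L(1) by (intro mult_le_mono2) simp
    moreover have "1 * (?L1 + 1) \<le> (k + 1) * (L + 1 + ?B)" using L1 L(1) by (intro mult_le_mono) auto
    ultimately have "\<tau>1 + \<tau>2 \<le> 7000 * ((k + 1) * (L + 1 + ?B))" using q1 1(2) by linarith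
    moreover have "\<forall>g. g \<notin> fst ` set (lines s) \<longrightarrow> words s2 ''tv'' g = words s ''tv'' g \<and> entry s2 g = entry s g"
      using 1(2) unfolding gr u by blast
    ultimately show ?case using a b by blast
  qed
qed

end

section \<open>Cheapest walks of every length\<close>

definition W3 :: "wexp \<Rightarrow> wexp \<Rightarrow> wexp \<Rightarrow> wexp \<Rightarrow> wexp" where
  "W3 n j u v = WAdd (WMul (WAdd (WMul j n) u) n) v"

lemma wval_W3 [simp]: "wval s (W3 n j u v) = (wval s j * wval s n + wval s u) * wval s n + wval s v"
  by (simp add: W3_def)

lemma wcost_W3 [simp]: "wcost (W3 n j u v) = 4 + wcost j + 2 * wcost n + wcost u + wcost v"
  by (simp add: W3_def)

lemma pair_index_inj:
  assumes "(x :: nat) * n + v = x' * n + v'" "v < n" "v' < n"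
  shows "x = x' \<and> v = v'"
proof -
  have "(x * n + v) div n = x" "(x * n + v) mod n = v" "(x' * n + v') div n = x'" "(x' * n + v') mod n = v'"
    using assms(2,3) by simp_all
  then show ?thesis using assms(1) by metis
qed

lemma pair_index_less: "u < n \<Longrightarrow> v < k \<Longrightarrow> u * k + v < n * (k :: nat)"
proof -
  assume "u < n" "v < k"
  then have "u * k + v < Suc u * k" by simp
  also have "\<dots> \<le> n * k" using \<open>u < n\<close> by (intro mult_le_mono1) simp
  finally show ?thesis .
qed

section \<open>The table of walks, indexed by length, start and end\<close>

context mrc_ram begin

definition idx :: "nat \<Rightarrow> nat \<Rightarrow> nat \<Rightarrow> nat" where
  "idx j u v = (j * N + u) * N + v"

lemma idx_inj: "idx j u v = idx j' u' v' \<Longrightarrow> u < N \<Longrightarrow> v < N \<Longrightarrow> u' < N \<Longrightarrow> v' < N \<Longrightarrow> j = j' \<and> u = u' \<and> v = v'"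
  unfolding idx_def using pair_index_inj by blast

lemma idx_less: "u < N \<Longrightarrow> v < N \<Longrightarrow> idx j u v < (j + 1) * N * N"
  unfolding idx_def by (rule pair_index_less) (simp_all add: add_mult_distrib)

lemma idx_Suc_less: "u < N \<Longrightarrow> v < N \<Longrightarrow> idx (j + 1) u v < (j + 2) * N * N"
  using idx_less[of u v "j + 1"] by (simp only: add.assoc one_add_one)

lemma idx_ge: "j * N * N \<le> idx j u v"
  by (simp add: idx_def algebra_simps)

definition tight_at :: "store \<Rightarrow> nat \<Rightarrow> nat \<Rightarrow> nat \<Rightarrow> bool" where
  "tight_at s g u v \<longleftrightarrow> 0 < words s ''tv'' g \<and> val (entry s g) = p v - p u"

definition walk_at :: "store \<Rightarrow> nat \<Rightarrow> nat \<Rightarrow> nat list \<Rightarrow> nat \<Rightarrow> bool" where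
  "walk_at s g u es v \<longleftrightarrow> walk u es v \<and> reals s ''tc'' g = wt c es \<and> reals s ''tt'' g = wt t es"

lemma walk_at_ge: "walk_at s g u es v \<Longrightarrow> p v - p u \<le> val (entry s g)"
  using walk_ge by (simp add: walk_at_def val_def entry_def)

lemma tight_at_walk: "tight_at s g u v \<Longrightarrow> walk_at s g u es v \<Longrightarrow> tight u es v"
  by (simp add: tight_at_def walk_at_def tight_def val_def entry_def)

text \<open>Completeness is promised for tight walks alone, where it follows by induction on the
  length. The predecessor clause is about values, so that the slack of a cell can be split between
  its last arc and the cell one level down.\<close>

definition cell :: "store \<Rightarrow> nat \<Rightarrow> nat \<Rightarrow> nat \<Rightarrow> bool" where
  "cell s j u v \<longleftrightarrow> (let g = idx j u v; e = words s ''tp'' g; g' = idx (j - 1) u (sr e) in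
     (0 < words s ''tv'' g \<longrightarrow> (\<exists>es. walk_at s g u es v \<and> length es = j)) \<and>
     (0 < j \<longrightarrow> 0 < words s ''tv'' g \<longrightarrow> e < m \<and> ds e = v \<and> 0 < words s ''tv'' g' \<and>
        val (entry s g) = val (entry s g') + (c e - lam * t e)) \<and>
     (cyc \<longrightarrow> (\<exists>es. tight u es v \<and> length es = j) \<longrightarrow> tight_at s g u v))"

definition levels :: "nat \<Rightarrow> store \<Rightarrow> bool" where
  "levels j s \<longleftrightarrow> (\<forall>i\<le>j. \<forall>u<N. \<forall>v<N. cell s i u v)"

text \<open>Levels, and later the matrices, go to fresh blocks of increasing addresses; facts about
  finished blocks then persist.\<close>

definition same_below :: "nat \<Rightarrow> store \<Rightarrow> store \<Rightarrow> bool" where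
  "same_below b s s' \<longleftrightarrow> (\<forall>g<b. words s' ''tv'' g = words s ''tv'' g \<and> entry s' g = entry s g)"

definition fresh_from :: "nat \<Rightarrow> store \<Rightarrow> bool" where
  "fresh_from b s \<longleftrightarrow> (\<forall>g\<ge>b. words s ''tv'' g = 0)"

lemma entry_eqD: "entry s' g = entry s g \<Longrightarrow> words s' ''tp'' g = words s ''tp'' g \<and> reals s' ''tc'' g = reals s ''tc'' g \<and> reals s' ''tt'' g = reals s ''tt'' g"
  by (simp add: entry_def)

text \<open>A cell refers to that of its predecessor, which lies no higher than level
  \<open>i\<close> and so also below \<open>b\<close>.\<close>

lemma cell_same:
  assumes "same_below b s s'" "(i + 1) * N * N \<le> b" "u < N" "v < N" "cell s i u v"
  shows "cell s' i u v"
proof -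
  let ?g = "idx i u v" let ?e = "words s ''tp'' ?g" let ?g' = "idx (i - 1) u (sr ?e)"
  have "?g < b" using idx_less[OF assms(3,4), of i] assms(2) by simp
  then have g: "words s' ''tv'' ?g = words s ''tv'' ?g" "entry s' ?g = entry s ?g" using assms(1) by (auto simp: same_below_def)
  note g2 = entry_eqD[OF g(2)]
  have g': "words s' ''tv'' ?g' = words s ''tv'' ?g'" "entry s' ?g' = entry s ?g'" if "?e < m"
  proof -
    have "?g' < (i - 1 + 1) * N * N" by (rule idx_less[OF assms(3) sr_less[OF that]])
    also have "\<dots> \<le> (i + 1) * N * N" by (intro mult_le_mono1) simp
    also have "\<dots> \<le> b" by (rule assms(2))
    finally show "words s' ''tv'' ?g' = words s ''tv'' ?g'" "entry s' ?g' = entry s ?g'"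
      using assms(1) by (auto simp: same_below_def)
  qed
  have wa: "walk_at s' ?g u es v \<longleftrightarrow> walk_at s ?g u es v" for es using g2 by (simp add: walk_at_def)
  have ta: "tight_at s' ?g u v \<longleftrightarrow> tight_at s ?g u v" using g by (simp add: tight_at_def)
  have tp: "words s' ''tp'' ?g = ?e" using g2 by blast
  note C = assms(5)[unfolded cell_def Let_def]
  show ?thesis
    unfolding cell_def Let_def tp wa ta g
  proof (intro conjI)
    show "0 < i \<longrightarrow> 0 < words s ''tv'' ?g \<longrightarrow> ?e < m \<and> ds ?e = v \<and> 0 < words s' ''tv'' ?g' \<and>
        val (entry s ?g) = val (entry s' ?g') + (c ?e - lam * t ?e)"
    proof (intro impI)
      assume "0 < i" "0 < words s ''tv'' ?g"
      with C have "?e < m \<and> ds ?e = v \<and> 0 < words s ''tv'' ?g' \<and> val (entry s ?g) = val (entry s ?g') + (c ?e - lam * t ?e)"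
        by blast
      then show "?e < m \<and> ds ?e = v \<and> 0 < words s' ''tv'' ?g' \<and> val (entry s ?g) = val (entry s' ?g') + (c ?e - lam * t ?e)"
        using g' by simp
    qed
  qed (use C in blast)+
qed

definition src_e :: wexp where "src_e = W3 (V ''N'') (V ''lv'') (V ''u'') (WCell ''tl'' (V ''e''))"

definition grow_e :: com where
  "grow_e = Cond (WLess (WLit 0) (WCell ''tv'' src_e))
    (push (W3 (V ''N'') (WAdd (V ''lv'') (WLit 1)) (V ''u'') (WCell ''hd'' (V ''e'')))
      (RAdd (RCell ''tc'' src_e) (RCell ''cost'' (V ''e''))) (RAdd (RCell ''tt'' src_e) (RCell ''time'' (V ''e''))) (V ''e'')) Skip"

definition grow :: com where
  "grow = ''L'' ::= WLit 0 ;; For ''u'' (V ''N'') (For ''e'' (V ''m'') grow_e)"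

definition grow_cand :: "store \<Rightarrow> nat \<Rightarrow> nat \<Rightarrow> nat \<Rightarrow> line set" where
  "grow_cand s j u e = (if 0 < words s ''tv'' (idx j u (sr e)) then
     {(idx (j + 1) u (ds e), reals s ''tc'' (idx j u (sr e)) + c e, reals s ''tt'' (idx j u (sr e)) + t e, e)} else {})"

lemma wmod_grow_e [simp]: "wmod grow_e = {''lg'', ''lp'', ''L''}" "rmod grow_e = {''la'', ''lb''}"
  by (auto simp: grow_e_def)

lemma wmod_grow [simp]: "wmod grow = {''u'', ''e'', ''lg'', ''lp'', ''L''}" "rmod grow = {''la'', ''lb''}"
  by (auto simp: grow_def)

lemma grow_e_wp:
  assumes i: "inp s" and j: "words s ''lv'' 0 = j" "words s ''u'' 0 = u" "words s ''e'' 0 = e" "u < N" "e < m"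
    and W: "(j + 2) * N * N \<le> W" "words s ''L'' 0 + 1 \<le> W"
  shows "wp W grow_e (\<lambda>\<tau> s'. \<tau> \<le> 120 \<and> set (lines s') = set (lines s) \<union> grow_cand s j u e \<and> words s' ''L'' 0 \<le> words s ''L'' 0 + 1) s"
proof -
  let ?g = "idx j u (sr e)"
  have v: "wval s' src_e = ?g" if "\<And>x. x \<notin> {''lg'', ''lp''} \<Longrightarrow> words s' x = words s x" for s'
    using i j that by (simp add: src_e_def idx_def inp_def)
  have vs: "wval s src_e = ?g" using v[of s] by simp
  have g: "idx (j + 1) u (ds e) \<le> W" using idx_less[OF j(4) ds_less[OF j(5)], of "j + 1"] W(1) by (simp add: algebra_simps)
  have e: "e \<le> W" using j(5) m_le_W by simp
  show ?thesis
  proof (cases "0 < words s ''tv'' ?g")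
    case True
    let ?P = "push (W3 (V ''N'') (WAdd (V ''lv'') (WLit 1)) (V ''u'') (WCell ''hd'' (V ''e'')))
      (RAdd (RCell ''tc'' src_e) (RCell ''cost'' (V ''e''))) (RAdd (RCell ''tt'' src_e) (RCell ''time'' (V ''e''))) (V ''e'')"
    have "wp W ?P (\<lambda>\<tau> s'. \<tau> \<le> 96 \<and>
      lines s' = lines s @ [(idx (j + 1) u (ds e), reals s ''tc'' ?g + c e, reals s ''tt'' ?g + t e, e)]) s"
      by (rule wp_conseq[OF push_wp[where G = "idx (j + 1) u (ds e)" and A = "reals s ''tc'' ?g + c e" and B = "reals s ''tt'' ?g + t e" and Q = e]])
        (use i j v g e W in \<open>auto simp: idx_def inp_def src_e_def\<close>)
    then have "wp W ?P (\<lambda>\<tau> s'. 1 + bcost (WLess (WLit 0) (WCell ''tv'' src_e)) + \<tau> \<le> 120 \<and> set (lines s') = set (lines s) \<union> grow_cand s j u e \<and> words s' ''L'' 0 \<le> words s ''L'' 0 + 1) s"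
    proof (rule wp_conseq, goal_cases)
      case (1 \<tau> s')
      have "length (lines s') = length (lines s) + 1" using 1(2) by (simp del: length_lines)
      then have "words s' ''L'' 0 \<le> words s ''L'' 0 + 1" by simp
      then show ?case using 1(2) True by (simp add: grow_cand_def src_e_def)
    qed
    then show ?thesis using True by (simp add: grow_e_def vs)
  next
    case False
    then show ?thesis by (simp add: grow_e_def vs grow_cand_def) (simp add: src_e_def)
  qed
qed

lemma grow_cand_cong: "words s' ''tv'' = words s ''tv'' \<Longrightarrow> reals s' ''tc'' = reals s ''tc'' \<Longrightarrow> reals s' ''tt'' = reals s ''tt'' \<Longrightarrow>
    grow_cand s' j u e = grow_cand s j u e"
  by (simp add: grow_cand_def)

lemma grow_wp:
  assumes i: "inp s" and j: "words s ''lv'' 0 = j" and W: "(j + 2) * N * N \<le> W" "N * m + 1 \<le> W"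
  shows "wp W grow (\<lambda>\<tau> s'. \<tau> \<le> 200 * ((N + 1) * (m + 1)) \<and> set (lines s') = (\<Union>u<N. \<Union>e<m. grow_cand s j u e) \<and> words s' ''L'' 0 \<le> N * m) s"
proof -
  define s1 where "s1 = s\<lparr>words := (words s)(''L'' := (words s ''L'')(0 := 0))\<rparr>"
  have i1: "inp s1" using i by (simp add: s1_def inp_def)
  have l1: "lines s1 = []" by (simp add: s1_def lines_def)
  have "wp W (For ''u'' (V ''N'') (For ''e'' (V ''m'') grow_e)) (\<lambda>\<tau> s'. \<tau> \<le> (N + 1) * ((m + 1) * 132 + wcost (V ''N'') + 10) \<and>
      set (lines s') = set (lines s1) \<union> (\<Union>u<N. \<Union>e<m. grow_cand s j u e) \<and> words s' ''L'' 0 \<le> words s1 ''L'' 0 + N * m) s1"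
  proof (rule collect_for, goal_cases)
    case (4 s2)
    have "inp s2" by (rule inp_frm[OF i1 4]) simp_all
    then show ?case by (simp add: inp_def)
  next
    case (5 u s2)
    have i2: "inp s2" by (rule inp_frm[OF i1 5(2)]) simp_all
    have L2: "words s2 ''L'' 0 + m \<le> N * m" using 5(4) by (simp add: s1_def)
    have c2: "grow_cand s2 j u e = grow_cand s j u e" for e using 5(2) by (intro grow_cand_cong) (simp_all add: frm_def s1_def)
    have lv2: "words s2 ''lv'' 0 = j" using 5(2) j by (simp add: frm_def s1_def)
    have "wp W (For ''e'' (V ''m'') grow_e) (\<lambda>\<tau> s'. \<tau> \<le> (m + 1) * (120 + wcost (V ''m'') + 10) \<and>
      set (lines s') = set (lines s2) \<union> (\<Union>e<m. grow_cand s j u e) \<and> words s' ''L'' 0 \<le> words s2 ''L'' 0 + m * 1) s2"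
    proof (rule collect_for, goal_cases)
      case (4 s3)
      have "inp s3" by (rule inp_frm[OF i2 4]) simp_all
      then show ?case by (simp add: inp_def)
    next
      case (5 e s3)
      have i3: "inp s3" by (rule inp_frm[OF i2 5(2)]) simp_all
      have "grow_cand s3 j u e = grow_cand s2 j u e" using 5(2) by (intro grow_cand_cong) (simp_all add: frm_def)
      then have c3: "grow_cand s3 j u e = grow_cand s j u e" using c2 by simp
      have lv3: "words s3 ''lv'' 0 = j" "words s3 ''u'' 0 = u" using 5(2) lv2 \<open>words s2 ''u'' 0 = u\<close> by (simp_all add: frm_def)
      have "words s3 ''L'' 0 + 1 \<le> W" using 5(4) L2 W(2) by simp
      from grow_e_wp[OF i3 lv3 5(3) \<open>u < N\<close> \<open>e < m\<close> W(1) this] show ?case by (simp only: c3)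
    qed (use m_le_W in auto)
    then show ?case by simp
  qed (use N_le_W in auto)
  then have "wp W (For ''u'' (V ''N'') (For ''e'' (V ''m'') grow_e)) (\<lambda>\<tau> s'. 3 + \<tau> \<le> 200 * ((N + 1) * (m + 1)) \<and>
      set (lines s') = (\<Union>u<N. \<Union>e<m. grow_cand s j u e) \<and> words s' ''L'' 0 \<le> N * m) s1"
    using l1 by (elim wp_conseq) (simp add: algebra_simps, simp add: s1_def)
  then show ?thesis unfolding grow_def by (simp add: s1_def)
qed

definition level :: com where "level = grow ;; settle"

lemma wmod_level [simp]: "wmod level = {''u'', ''e'', ''go'', ''rk'', ''pend'', ''p'', ''dead'', ''pa'', ''pb'', ''tr'', ''sa'', ''sk'', ''bv'', ''br'', ''be'', ''ok'', ''w'', ''lg'', ''lp'', ''L'', ''tv'', ''tp''}"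
    "rmod level = {''xs'', ''x'', ''d'', ''la'', ''lb'', ''tc'', ''tt''}"
  by (auto simp: level_def)

text \<open>A tight walk of \<open>j + 1\<close> arcs has a tight prefix of \<open>j\<close> arcs,
  whose cell is tight by the assumption on level \<open>j\<close>. So a candidate of value
  \<open>p v - p u\<close> competes for the new cell; the winner is no larger, and being the value
  of a walk it is no smaller. The batch has at most \<open>N * m\<close> lines, the order of one
  oracle call.\<close>

lemma level_wp:
  assumes i: "inp s" and j: "words s ''lv'' 0 = j" and W: "(j + 2) * N * N \<le> W" "2 * (N * m) + 2 \<le> W" and k: "N * m \<le> 2 ^ k"
    and lev: "levels j s" "fresh_from ((j + 1) * N * N) s"
  shows "wp W level (\<lambda>\<tau> s'. \<tau> \<le> 15000 * ((k + 1) * ((N + 1) * (m + 1))) \<and> levels (j + 1) s' \<and> fresh_from ((j + 2) * N * N) s') s"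
  unfolding level_def
proof (rule wp_seq[OF grow_wp[OF i j W(1)]], goal_cases)
  case 1
  show ?case using W(2) by simp
next
  case (2 \<tau>1 s1)
  have i1: "inp s1" by (rule inp_frm[OF i 2(1)]) simp_all
  have e1: "entry s1 = entry s" "words s1 ''tv'' = words s ''tv''" using 2(1) by (auto simp: frm_def entry_def fun_eq_iff)
  let ?A = "\<Union>u<N. \<Union>e<m. grow_cand s j u e"
  have A: "x \<in> ?A \<longleftrightarrow> (\<exists>u<N. \<exists>e<m. 0 < words s ''tv'' (idx j u (sr e)) \<and>
      x = (idx (j + 1) u (ds e), reals s ''tc'' (idx j u (sr e)) + c e, reals s ''tt'' (idx j u (sr e)) + t e, e))" for x
    by (auto simp: grow_cand_def split: if_splits)
  have lA: "set (lines s1) = ?A" and lL: "words s1 ''L'' 0 \<le> N * m" using 2(2) by blast+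
  have AW: "\<forall>x \<in> set (lines s1). fst x \<le> W \<and> snd (snd (snd x)) \<le> W"
  proof
    fix x assume xA: "x \<in> set (lines s1)"
    from xA[unfolded lA] A[of x] obtain u e where ue: "u < N" "e < m" "fst x = idx (j + 1) u (ds e)" "snd (snd (snd x)) = e" by auto
    have "idx (j + 1) u (ds e) < (j + 2) * N * N" using ue by (intro idx_Suc_less ds_less)
    then show "fst x \<le> W \<and> snd (snd (snd x)) \<le> W" using ue W(1) m_le_W by linarith
  qed
  from settle_wp[OF i1 lL W(2) k AW] show ?case
  proof (rule wp_conseq, goal_cases)
    case (1 \<tau>2 s2)
    note same = 1(2)[THEN conjunct2, THEN conjunct1, unfolded lA e1, rule_format]
    note new = 1(2)[THEN conjunct2, THEN conjunct2, THEN conjunct1, unfolded lA, rule_format]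
    note opt = 1(2)[THEN conjunct2, THEN conjunct2, THEN conjunct2, unfolded lA, rule_format]
    have grp: "\<exists>u e. u < N \<and> e < m \<and> g = idx (j + 1) u (ds e)" if "g \<in> fst ` ?A" for g
    proof -
      from that obtain x where x: "x \<in> ?A" "g = fst x" by blast
      from x(1)[unfolded A] obtain u e where "u < N" "e < m" "fst x = idx (j + 1) u (ds e)" by (elim exE conjE) simp
      then show ?thesis using x(2) by blast
    qed
    have sb: "same_below ((j + 1) * N * N) s s2"
      unfolding same_below_def
    proof (intro allI impI)
      fix g assume g: "g < (j + 1) * N * N"
      have "g \<notin> fst ` ?A"
      proof
        assume "g \<in> fst ` ?A"
        from grp[OF this] idx_ge[of "j + 1"] g show False by (auto simp: not_le[symmetric])
      qed
      from same[OF this] show "words s2 ''tv'' g = words s ''tv'' g \<and> entry s2 g = entry s g" .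
    qed
    have fr: "fresh_from ((j + 2) * N * N) s2"
      unfolding fresh_from_def
    proof (intro allI impI)
      fix g assume g: "(j + 2) * N * N \<le> g"
      have "g \<notin> fst ` ?A"
      proof
        assume "g \<in> fst ` ?A"
        from grp[OF this] obtain u e where "u < N" "e < m" "g = idx (j + 1) u (ds e)" by blast
        then have "g < (j + 2) * N * N" using idx_Suc_less ds_less by simp
        then show False using g by simp
      qed
      then have e: "words s2 ''tv'' g = words s ''tv'' g" using same by blast
      have "(j + 1) * N * N \<le> (j + 2) * N * N" by (intro mult_le_mono) auto
      then have "(j + 1) * N * N \<le> g" using g by (rule le_trans)
      then have "words s ''tv'' g = 0" using lev(2) unfolding fresh_from_def by blast
      then show "words s2 ''tv'' g = 0" using e by simp
    qed
    have cell1: "cell s2 (j + 1) u v" if uv: "u < N" "v < N" for u v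
    proof -
      let ?g = "idx (j + 1) u v"
      have old0: "words s ''tv'' ?g = 0" using lev(2) idx_ge[of "j + 1" u v] unfolding fresh_from_def by blast
      have cand: "\<exists>es e. e < m \<and> ds e = v \<and> walk_at s (idx j u (sr e)) u es (sr e) \<and> length es = j \<and> 0 < words s ''tv'' (idx j u (sr e)) \<and>
          entry s2 ?g = (?g, reals s ''tc'' (idx j u (sr e)) + c e, reals s ''tt'' (idx j u (sr e)) + t e, e)"
        if "?g \<in> fst ` ?A"
      proof -
        have "entry s2 ?g \<in> ?A" using new[OF that] by blast
        then obtain u' e where ue: "u' < N" "e < m" "0 < words s ''tv'' (idx j u' (sr e))"
          "entry s2 ?g = (idx (j + 1) u' (ds e), reals s ''tc'' (idx j u' (sr e)) + c e, reals s ''tt'' (idx j u' (sr e)) + t e, e)"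
          unfolding A by blast
        then have "idx (j + 1) u v = idx (j + 1) u' (ds e)" by (simp add: entry_def)
        from idx_inj[OF this uv ue(1) ds_less[OF ue(2)]] have uv': "u' = u" "ds e = v" by auto
        have "cell s j u (sr e)" using lev(1) uv sr_less[OF ue(2)] by (simp add: levels_def)
        then obtain es where "walk_at s (idx j u (sr e)) u es (sr e)" "length es = j"
          using ue(3) unfolding cell_def Let_def uv' by blast
        then show ?thesis using ue uv' by blast
      qed
      have walk1: "\<exists>es. walk_at s2 ?g u es v \<and> length es = j + 1" if tv: "0 < words s2 ''tv'' ?g"
      proof -
        have "?g \<in> fst ` ?A" using same[of ?g] old0 tv by force
        from cand[OF this] obtain es e where ee: "e < m" "ds e = v" "walk_at s (idx j u (sr e)) u es (sr e)" "length es = j"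
          "entry s2 ?g = (?g, reals s ''tc'' (idx j u (sr e)) + c e, reals s ''tt'' (idx j u (sr e)) + t e, e)" by blast
        then show ?thesis by (intro exI[of _ "es @ [e]"]) (simp add: walk_at_def walk_snoc entry_def)
      qed
      moreover have "words s2 ''tp'' ?g < m \<and> ds (words s2 ''tp'' ?g) = v \<and> 0 < words s2 ''tv'' (idx j u (sr (words s2 ''tp'' ?g))) \<and>
          val (entry s2 ?g) = val (entry s2 (idx j u (sr (words s2 ''tp'' ?g)))) + (c (words s2 ''tp'' ?g) - lam * t (words s2 ''tp'' ?g))"
        if tv: "0 < words s2 ''tv'' ?g"
      proof -
        have "?g \<in> fst ` ?A" using same[of ?g] old0 tv by force
        from cand[OF this] obtain e where ee: "e < m" "ds e = v" "0 < words s ''tv'' (idx j u (sr e))"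
          "entry s2 ?g = (?g, reals s ''tc'' (idx j u (sr e)) + c e, reals s ''tt'' (idx j u (sr e)) + t e, e)" by blast
        have tp: "words s2 ''tp'' ?g = e" using ee(4) by (simp add: entry_def)
        have "words s2 ''tv'' (idx j u (sr e)) = words s ''tv'' (idx j u (sr e)) \<and> entry s2 (idx j u (sr e)) = entry s (idx j u (sr e))"
          using sb idx_less[OF uv(1) sr_less[OF ee(1)], of j] by (simp add: same_below_def)
        then show ?thesis unfolding tp using ee by (simp add: val_def entry_def algebra_simps)
      qed
      moreover have "tight_at s2 ?g u v" if cy: cyc and te: "\<exists>es. tight u es v \<and> length es = j + 1"
      proof -
        from te obtain fs where fs: "tight u fs v" "length fs = j + 1" by blast
        then obtain es e where es: "fs = es @ [e]" "length es = j" by (cases fs rule: rev_cases) auto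
        from fs(1) es(1) obtain x where x: "tight u es x" "tight x [e] v" by (auto simp: tight_append)
        then have ev: "e < m" "sr e = x" "ds e = v" "c e - lam * t e = p v - p x" by (auto simp: tight_def)
        have "cell s j u x" using lev(1) uv sr_less[OF ev(1)] ev(2) by (simp add: levels_def)
        then have ta: "tight_at s (idx j u x) u x" using cy x(1) es(2) unfolding cell_def Let_def by blast
        let ?y = "(?g, reals s ''tc'' (idx j u x) + c e, reals s ''tt'' (idx j u x) + t e, e)"
        have yA: "?y \<in> ?A" unfolding A using uv ev ta by (intro exI[of _ u] conjI exI[of _ e]) (auto simp: tight_at_def)
        have "val ?y = p v - p u" using ta ev(4) by (simp add: tight_at_def val_def entry_def algebra_simps)
        then have le: "val (entry s2 ?g) \<le> p v - p u" using opt[OF cy yA] by simp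
        have "?g \<in> fst ` ?A" using yA by force
        then have tv: "0 < words s2 ''tv'' ?g" using new by simp
        from walk1[OF tv] walk_at_ge le tv show ?thesis unfolding tight_at_def by force
      qed
      ultimately show ?thesis unfolding cell_def Let_def by simp
    qed
    have "levels (j + 1) s2" unfolding levels_def
    proof (intro allI impI)
      fix i u v assume iuv: "i \<le> j + 1" "u < N" "v < N"
      show "cell s2 i u v"
      proof (cases "i = j + 1")
        case True then show ?thesis using cell1 iuv by simp
      next
        case False
        then have ij: "i \<le> j" using iuv(1) by simp
        then have "(i + 1) * N * N \<le> (j + 1) * N * N" by (intro mult_le_mono) auto
        from cell_same[OF sb this iuv(2,3)] show ?thesis using lev(1) ij iuv by (simp add: levels_def)
      qed
    qed
    moreover have "\<tau>1 + \<tau>2 \<le> 15000 * ((k + 1) * ((N + 1) * (m + 1)))"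
    proof -
      define B where "B = (N + 1) * (m + 1)"
      have B: "N * m + 1 + B \<le> 2 * B" by (simp add: B_def algebra_simps)
      have "1 * B \<le> (k + 1) * B" by (intro mult_le_mono) auto
      moreover have "(k + 1) * (N * m + 1 + B) \<le> (k + 1) * (2 * B)" using B by (rule mult_le_mono2)
      then have "(k + 1) * (N * m + 1 + B) \<le> 2 * ((k + 1) * B)" by (simp only: mult.left_commute)
      moreover have "\<tau>1 \<le> 200 * B" "\<tau>2 \<le> 7000 * ((k + 1) * (N * m + 1 + B))" using 2(2) 1(2) unfolding B_def by blast+
      ultimately show ?thesis unfolding B_def[symmetric] by linarith
    qed
    ultimately show ?case using fr by simp
  qed
qed

lemma levels_same:
  assumes "same_below b s s'" "(j + 1) * N * N \<le> b" "levels j s"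
  shows "levels j s'"
  unfolding levels_def
proof (intro allI impI)
  fix i u v assume iuv: "i \<le> j" "u < N" "v < N"
  then have "(i + 1) * N * N \<le> (j + 1) * N * N" by (intro mult_le_mono) auto
  then have "(i + 1) * N * N \<le> b" using assms(2) by (rule le_trans)
  from cell_same[OF assms(1) this iuv(2,3)] show "cell s' i u v" using assms(3) iuv by (simp add: levels_def)
qed

lemma same_below_tables:
  "words s' ''tv'' = words s ''tv'' \<Longrightarrow> words s' ''tp'' = words s ''tp'' \<Longrightarrow> reals s' ''tc'' = reals s ''tc'' \<Longrightarrow>
   reals s' ''tt'' = reals s ''tt'' \<Longrightarrow> same_below b s s'"
  by (simp add: same_below_def entry_def)

text \<open>Level 0 consists of empty walks, so only the flags on the diagonal are set; their costs
  and times are the zeros of the initial store.\<close>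

definition stage1 :: com where
  "stage1 = For ''u'' (V ''N'') (WAssign ''tv'' (W3 (V ''N'') (WLit 0) (V ''u'') (V ''u'')) (WLit 1)) ;; For ''lv'' (V ''h'') level"

lemma wmod_stage1 [simp]: "wmod stage1 = {''lv'', ''u'', ''e'', ''go'', ''rk'', ''pend'', ''p'', ''dead'', ''pa'', ''pb'', ''tr'', ''sa'', ''sk'', ''bv'', ''br'', ''be'', ''ok'', ''w'', ''lg'', ''lp'', ''L'', ''tv'', ''tp''}"
    "rmod stage1 = {''xs'', ''x'', ''d'', ''la'', ''lb'', ''tc'', ''tt''}"
  by (auto simp: stage1_def)

lemma stage1_wp:
  assumes i: "inp s" and h: "words s ''h'' 0 = h" "h \<le> W" "(h + 1) * N * N \<le> W" "2 * (N * m) + 2 \<le> W" and k: "N * m \<le> 2 ^ k"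
    and z: "words s ''tv'' = (\<lambda>_. 0)" "reals s ''tc'' = (\<lambda>_. 0)" "reals s ''tt'' = (\<lambda>_. 0)"
  shows "wp W stage1 (\<lambda>\<tau> s'. \<tau> \<le> (h + 1) * (16000 * ((k + 1) * ((N + 1) * (m + 1)))) \<and> levels h s' \<and> fresh_from ((h + 1) * N * N) s') s"
  unfolding stage1_def
proof (rule wp_seq)
  let ?P = "For ''u'' (V ''N'') (WAssign ''tv'' (W3 (V ''N'') (WLit 0) (V ''u'') (V ''u'')) (WLit 1))"
  let ?B = "(N + 1) * (m + 1)"
  show "wp W ?P (\<lambda>\<tau> s'. \<tau> \<le> (N + 1) * 40 \<and> levels 0 s' \<and> fresh_from (1 * N * N) s') s"
  proof (rule wp_for[where n = N and c = 28 and I = "\<lambda>k s'. \<forall>g. words s' ''tv'' g = (if \<exists>u<k. g = idx 0 u u then 1 else 0)"], goal_cases)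
    case (5 k s')
    have "words s' ''N'' 0 = N" using 5(2) i by (simp add: frm_def inp_def)
    then show ?case using 5(1,3,4) one_le_W by (auto simp: idx_def less_Suc_eq)
  next
    case (6 \<tau> s')
    have T: "words s' ''tv'' (idx 0 u v) = (if u = v then 1 else 0)" if uv: "u < N" "v < N" for u v
    proof -
      have "(\<exists>u'<N. idx 0 u v = idx 0 u' u') \<longleftrightarrow> u = v"
      proof
        assume "\<exists>u'<N. idx 0 u v = idx 0 u' u'"
        then obtain u' where "u' < N" "idx 0 u v = idx 0 u' u'" by blast
        from idx_inj[OF this(2) uv this(1,1)] show "u = v" by simp
      next
        assume "u = v" then show "\<exists>u'<N. idx 0 u v = idx 0 u' u'" using uv by blast
      qed
      then show ?thesis using 6(3) by simp
    qed
    have e: "reals s' ''tc'' = (\<lambda>_. 0)" "reals s' ''tt'' = (\<lambda>_. 0)" using 6(1) z by (simp_all add: frm_def)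
    have "levels 0 s'" unfolding levels_def
      using T e by (auto simp: cell_def walk_at_def tight_at_def val_def entry_def Let_def)
    moreover have "fresh_from (1 * N * N) s'" unfolding fresh_from_def
    proof (intro allI impI)
      fix g assume "1 * N * N \<le> g"
      then have "\<not> (\<exists>u<N. g = idx 0 u u)" using idx_less[of _ _ 0] by (metis add_0 not_less)
      then show "words s' ''tv'' g = 0" using 6(3) by simp
    qed
    ultimately show ?case using 6(4) by simp
  next
    case (4 k s')
    then show ?case using i by (simp add: frm_def inp_def)
  qed (use N_le_W z in auto)
  fix \<tau>1 s1 assume f1: "frm ?P s s1" and q1: "\<tau>1 \<le> (N + 1) * 40 \<and> levels 0 s1 \<and> fresh_from (1 * N * N) s1"
  have i1: "inp s1" by (rule inp_frm[OF i f1]) simp_all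
  have h1: "words s1 ''h'' 0 = h" using f1 h(1) by (simp add: frm_def)
  let ?K = "15000 * ((k + 1) * ?B)"
  show "wp W (For ''lv'' (V ''h'') level) (\<lambda>\<tau>. (\<lambda>\<tau> s'. \<tau> \<le> (h + 1) * (16000 * ((k + 1) * ?B)) \<and> levels h s' \<and>
      fresh_from ((h + 1) * N * N) s') (\<tau>1 + \<tau>)) s1"
  proof (rule wp_for[where n = h and c = ?K and I = "\<lambda>j s. levels j s \<and> fresh_from ((j + 1) * N * N) s"], goal_cases)
    case 3
    let ?s = "s1\<lparr>words := (words s1)(''lv'' := (words s1 ''lv'')(0 := 0))\<rparr>"
    have "same_below (1 * N * N) s1 ?s" by (intro same_below_tables) simp_all
    from levels_same[OF this, of 0] show ?case using q1 by (simp add: fresh_from_def)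
  next
    case (4 j s')
    then show ?case using h1 by (simp add: frm_def)
  next
    case (5 j s')
    have i': "inp s'" by (rule inp_frm[OF i1 5(2)]) simp_all
    have "(j + 2) * N * N \<le> (h + 1) * N * N" using 5(1) by (intro mult_le_mono) auto
    then have W1: "(j + 2) * N * N \<le> W" using h(3) by (rule le_trans)
    from level_wp[OF i' 5(3) W1 h(4) k conjunct1[OF 5(4)] conjunct2[OF 5(4)]] show ?case
    proof (rule wp_conseq, goal_cases)
      case (1 \<tau> s2)
      let ?s = "s2\<lparr>words := (words s2)(''lv'' := (words s2 ''lv'')(0 := Suc j))\<rparr>"
      have e: "Suc j + 1 = j + 2" "j + 1 = Suc j" by simp_all
      have "same_below ((Suc j + 1) * N * N) s2 ?s" by (intro same_below_tables) simp_all
      from levels_same[OF this order_refl] have "levels (Suc j) ?s" using 1(2) unfolding e(2) by blast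
      moreover have "fresh_from ((Suc j + 1) * N * N) ?s" using 1(2) unfolding e(1) by (simp add: fresh_from_def)
      ultimately show ?case using 1(2) by blast
    qed
  next
    case (6 \<tau> s')
    have "1 * 1 * ((N + 1) * 1) \<le> (h + 1) * (k + 1) * ((N + 1) * (m + 1))" by (intro mult_le_mono) auto
    moreover have "1 * 1 * 1 \<le> (k + 1) * ((N + 1) * (m + 1))" by (simp add: algebra_simps)
    then have "(h + 1) * 1 \<le> (h + 1) * ((k + 1) * ((N + 1) * (m + 1)))" by (intro mult_le_mono2) simp
    ultimately have "\<tau>1 + \<tau> \<le> (h + 1) * (16000 * ((k + 1) * ?B))"
    proof -
      assume a: "1 * 1 * ((N + 1) * 1) \<le> (h + 1) * (k + 1) * ?B" "(h + 1) * 1 \<le> (h + 1) * ((k + 1) * ?B)"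
      define X where "X = (h + 1) * ((k + 1) * ?B)"
      have "\<tau> \<le> (h + 1) * (15000 * ((k + 1) * ?B) + 12)" using 6(4) by (simp add: add.commute)
      also have "\<dots> = 15000 * X + 12 * (h + 1)" unfolding X_def distrib_left by simp
      finally have "\<tau> \<le> 15000 * X + 12 * (h + 1)" .
      moreover have X: "h + 1 \<le> X" "N + 1 \<le> X" using a unfolding X_def by (simp_all only: mult.assoc mult_1_left mult_1_right)
      ultimately have "\<tau> \<le> 15000 * X + 12 * X" by (meson add_left_mono le_trans mult_le_mono2)
      moreover have "\<tau>1 \<le> X * 40" using conjunct1[OF q1] mult_le_mono1[OF X(2), of 40] by (rule le_trans)
      moreover have e: "(h + 1) * (16000 * ((k + 1) * ?B)) = 16000 * X" unfolding X_def by (rule mult.left_commute)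
      ultimately show ?thesis unfolding e by linarith
    qed
    then show ?case using 6(3) by blast
  qed (use h in simp_all)
qed

end

section \<open>Hitting sets\<close>

definition WEq :: "wexp \<Rightarrow> wexp \<Rightarrow> bexp" where
  "WEq x y = BAnd (BNot (WLess x y)) (BNot (WLess y x))"

lemma bval_WEq [simp]: "bval s (WEq x y) \<longleftrightarrow> wval s x = wval s y"
  by (auto simp: WEq_def)

lemma bcost_WEq [simp]: "bcost (WEq x y) = 5 + 2 * wcost x + 2 * wcost y"
  by (simp add: WEq_def)

text \<open>Path \<open>q\<close> occupies \<open>h\<close> consecutive positions from
  \<open>q * h\<close> on. Of the \<open>h + 1\<close> vertices of a traced walk the start is left
  out, so that the part leading to a hit vertex has at least one arc.\<close>

definition path_set :: "(nat \<Rightarrow> nat) \<Rightarrow> nat \<Rightarrow> nat \<Rightarrow> nat set" where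
  "path_set pv h q = (\<lambda>l. pv (q * h + l)) ` {..<h}"

definition family :: "nat \<Rightarrow> (nat \<Rightarrow> nat) \<Rightarrow> nat \<Rightarrow> nat \<Rightarrow> bool" where
  "family n pv h k \<longleftrightarrow> (\<forall>q<k. inj_on (\<lambda>l. pv (q * h + l)) {..<h} \<and> path_set pv h q \<subseteq> {..<n})"

text \<open>\<open>st\<close> is a stamp that belongs to the pair of ends alone; a mark equal to it
  means visited on this walk, so marks are never reset. A repeated vertex clears \<open>gd\<close>,
  and then \<open>pc\<close> does not advance: the block is overwritten by the next walk.\<close>

definition trace_path :: com where
  "trace_path = ''st'' ::= WAdd (WAdd (WMul (V ''u'') (V ''N'')) (V ''v'')) (WLit 1) ;; ''cx'' ::= V ''v'' ;; ''gd'' ::= WLit 1 ;;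
     For ''j'' (V ''h'') (Cond (WEq (WCell ''mk'' (V ''cx'')) (V ''st'')) (''gd'' ::= WLit 0) Skip ;;
       WAssign ''mk'' (V ''cx'') (V ''st'') ;; WAssign ''pv'' (WAdd (WMul (V ''pc'') (V ''h'')) (V ''j'')) (V ''cx'') ;;
       ''cx'' ::= WCell ''tl'' (WCell ''tp'' (W3 (V ''N'') (WSub (V ''h'') (V ''j'')) (V ''u'') (V ''cx'')))) ;;
     Cond (WLess (WLit 0) (V ''gd'')) (''pc'' ::= WAdd (V ''pc'') (WLit 1)) Skip"

definition trace :: com where
  "trace = For ''u'' (V ''N'') (For ''v'' (V ''N'') (Cond (WLess (WLit 0) (WCell ''tv'' (W3 (V ''N'') (V ''h'') (V ''u'') (V ''v'')))) trace_path Skip))"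

lemma wmod_trace_path [simp]: "wmod trace_path = {''st'', ''cx'', ''gd'', ''j'', ''mk'', ''pv'', ''pc''}" "rmod trace_path = {}"
  by (auto simp: trace_path_def)

lemma wmod_trace [simp]: "wmod trace = {''u'', ''v'', ''st'', ''cx'', ''gd'', ''j'', ''mk'', ''pv'', ''pc''}" "rmod trace = {}"
  by (auto simp: trace_def)

section \<open>Tracing walks back through the table\<close>

context mrc_ram begin

primrec tr :: "(nat \<Rightarrow> nat) \<Rightarrow> nat \<Rightarrow> nat \<Rightarrow> nat \<Rightarrow> nat \<Rightarrow> nat" where
  "tr tp h u v 0 = v"
| "tr tp h u v (Suc j) = sr (tp (idx (h - j) u (tr tp h u v j)))"

lemma tr_valid:
  assumes lev: "levels h s" and uv: "u < N" "v < N" "0 < words s ''tv'' (idx h u v)" and j: "j \<le> h"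
  shows "tr (words s ''tp'') h u v j < N \<and> 0 < words s ''tv'' (idx (h - j) u (tr (words s ''tp'') h u v j))"
  using j
proof (induction j)
  case 0
  then show ?case using uv by simp
next
  case (Suc j)
  let ?x = "tr (words s ''tp'') h u v j"
  have IH: "?x < N" "0 < words s ''tv'' (idx (h - j) u ?x)" using Suc by auto
  have "cell s (h - j) u ?x" using lev uv IH by (simp add: levels_def)
  then have "words s ''tp'' (idx (h - j) u ?x) < m" "0 < words s ''tv'' (idx (h - j - 1) u (sr (words s ''tp'' (idx (h - j) u ?x))))"
    using IH(2) Suc.prems unfolding cell_def Let_def by auto
  moreover have "h - j - 1 = h - Suc j" by simp
  ultimately show ?case using sr_less by (simp only: tr.simps)
qed

text \<open>\<open>r\<close> counts the pairs processed in the order of \<open>u * N + v\<close>.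
  The bound on \<open>mk\<close> says that all stamps used so far are smaller than the next one,
  \<open>r + 1\<close>.\<close>

definition traced :: "nat \<Rightarrow> (nat \<Rightarrow> nat) \<Rightarrow> (nat \<Rightarrow> nat) \<Rightarrow> nat \<Rightarrow> store \<Rightarrow> bool" where
  "traced h tv tp r s \<longleftrightarrow> words s ''pc'' 0 \<le> r \<and> (\<forall>x. words s ''mk'' x \<le> r) \<and> family N (words s ''pv'') h (words s ''pc'' 0) \<and>
     (\<forall>u<N. \<forall>v<N. u * N + v < r \<longrightarrow> 0 < tv (idx h u v) \<longrightarrow> inj_on (tr tp h u v) {..<h} \<longrightarrow>
        (\<exists>q<words s ''pc'' 0. \<forall>l<h. words s ''pv'' (q * h + l) = tr tp h u v l))"

lemma block_lt: "q < k \<Longrightarrow> l < h \<Longrightarrow> q * h + l < k * (h :: nat)"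
  by (rule pair_index_less)

lemma trace_path_wp:
  assumes i: "inp s" and lev: "levels h s" and h: "words s ''h'' 0 = h" "h \<le> W" and uv: "words s ''u'' 0 = u" "words s ''v'' 0 = v" "u < N" "v < N"
    and tv: "0 < words s ''tv'' (idx h u v)" and W: "N * N + 1 \<le> W"
    and T: "traced h (words s ''tv'') (words s ''tp'') (u * N + v) s"
  shows "wp W trace_path (\<lambda>\<tau> s'. \<tau> \<le> 140 * (h + 1) \<and> traced h (words s ''tv'') (words s ''tp'') (u * N + v + 1) s') s"
proof -
  let ?tp = "words s ''tp''" let ?tv = "words s ''tv''" let ?st = "u * N + v + 1" let ?pc = "words s ''pc'' 0"
  let ?t = "tr ?tp h u v"
  define s1 where "s1 = s\<lparr>words := (words s)(''st'' := (words s ''st'')(0 := ?st), ''cx'' := (words s ''cx'')(0 := v), ''gd'' := (words s ''gd'')(0 := 1))\<rparr>"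
  have st: "?st \<le> N * N" using pair_index_less[OF uv(3,4)] by simp
  have trv: "?t j < N" if "j \<le> h" for j using tr_valid[OF lev uv(3,4) tv that] by blast
  let ?P = "Cond (WEq (WCell ''mk'' (V ''cx'')) (V ''st'')) (''gd'' ::= WLit 0) Skip ;;
       WAssign ''mk'' (V ''cx'') (V ''st'') ;; WAssign ''pv'' (WAdd (WMul (V ''pc'') (V ''h'')) (V ''j'')) (V ''cx'') ;;
       ''cx'' ::= WCell ''tl'' (WCell ''tp'' (W3 (V ''N'') (WSub (V ''h'') (V ''j'')) (V ''u'') (V ''cx'')))"
  have "wp W (For ''j'' (V ''h'') ?P) (\<lambda>\<tau> s'. \<tau> \<le> (h + 1) * 82 \<and> words s' ''pc'' 0 = ?pc \<and> (\<forall>x. words s' ''mk'' x \<le> ?st) \<and>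
      (\<forall>y. y < ?pc * h \<longrightarrow> words s' ''pv'' y = words s ''pv'' y) \<and> (\<forall>l<h. words s' ''pv'' (?pc * h + l) = ?t l) \<and>
      words s' ''gd'' 0 = (if inj_on ?t {..<h} then 1 else 0)) s1"
  proof (rule wp_for[where n = h and c = 70 and I = "\<lambda>j s'. words s' ''cx'' 0 = ?t j \<and> (\<forall>x. words s' ''mk'' x \<le> ?st) \<and> (\<forall>x. words s' ''mk'' x = ?st \<longleftrightarrow> x \<in> ?t ` {..<j}) \<and>
      (\<forall>y. y < ?pc * h \<longrightarrow> words s' ''pv'' y = words s ''pv'' y) \<and> (\<forall>l<j. words s' ''pv'' (?pc * h + l) = ?t l) \<and>
      words s' ''gd'' 0 = (if inj_on ?t {..<j} then 1 else 0)"], goal_cases)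
    case 3
    \<comment> \<open>No mark carries the current stamp yet, so none of the vertices counts as
      visited at the start.\<close>
    have mk: "words s ''mk'' x \<le> u * N + v" for x using T by (simp add: traced_def)
    have "words s ''mk'' x \<le> ?st" "words s ''mk'' x \<noteq> ?st" for x using mk[of x] by simp_all
    then show ?case by (auto simp: s1_def)
  next
    case (4 k s')
    then show ?case using h by (simp add: frm_def s1_def)
  next
    case (5 j s')
    have r: "words s' ''h'' 0 = h" "words s' ''st'' 0 = ?st" "words s' ''pc'' 0 = ?pc" "words s' ''u'' 0 = u" "words s' ''tp'' = ?tp"
      using 5(2) h uv by (simp_all add: frm_def s1_def)
    have "inp s1" using i by (simp add: s1_def inp_def)
    then have i': "inp s'" by (rule inp_frm[OF _ 5(2)]) simp_all
    have cellj: "?tp (idx (h - j) u (?t j)) < m"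
    proof -
      have "j \<le> h" using 5(1) by simp
      from tr_valid[OF lev uv(3,4) tv this] have "cell s (h - j) u (?t j)" "0 < ?tv (idx (h - j) u (?t j))" using lev uv by (auto simp: levels_def)
      then show ?thesis using 5(1) by (simp add: cell_def Let_def)
    qed
    have nx: "words s' ''tl'' (?tp ((((h - j) * N) + u) * N + ?t j)) = ?t (Suc j)" "words s' ''N'' 0 = N"
      using i' cellj by (simp_all add: inp_def idx_def)
    have W1: "?t j \<le> W" "?t (Suc j) \<le> W" "?st \<le> W" "0 \<le> W" using trv[of j] trv[of "Suc j"] 5(1) N_le_W st W by simp_all
    have inj: "inj_on ?t {..<Suc j} \<longleftrightarrow> inj_on ?t {..<j} \<and> ?t j \<notin> ?t ` {..<j}"
      by (auto simp: lessThan_Suc)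
    have mk: "\<forall>x. words s' ''mk'' x = ?st \<longleftrightarrow> x \<in> ?t ` {..<j}" using 5(4) by blast
    have "(words s' ''mk'' (?t j) = ?st) \<longleftrightarrow> ?t j \<in> ?t ` {..<j}" using mk by blast
    moreover have "\<forall>x. ((words s' ''mk'')(?t j := ?st)) x = ?st \<longleftrightarrow> x \<in> ?t ` {..<Suc j}" using mk by (auto simp: lessThan_Suc)
    moreover have "\<forall>x. ((words s' ''mk'')(?t j := ?st)) x \<le> ?st" using 5(4) by simp
    moreover have "\<forall>l<Suc j. ((words s' ''pv'')(?pc * h + j := ?t j)) (?pc * h + l) = ?t l" using 5(4) by (auto simp: less_Suc_eq)
    moreover have "\<forall>y. y < ?pc * h \<longrightarrow> ((words s' ''pv'')(?pc * h + j := ?t j)) y = words s ''pv'' y" using 5(4) by simp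
    ultimately show ?case using r nx W1 5(3) 5(4) inj
      by (simp del: tr.simps fun_upd_apply add: fun_upd_other fun_upd_same)
  next
    case (6 \<tau> s')
    then show ?case by (simp add: frm_def s1_def)
  qed (use h in auto)
  then have "wp W (For ''j'' (V ''h'') ?P ;; Cond (WLess (WLit 0) (V ''gd'')) (''pc'' ::= WAdd (V ''pc'') (WLit 1)) Skip)
     (\<lambda>\<tau> s'. \<tau> + 19 \<le> 140 * (h + 1) \<and> traced h ?tv ?tp (u * N + v + 1) s') s1"
  proof (rule wp_seq, goal_cases)
    case (1 \<tau> s')
    let ?pv = "words s' ''pv''"
    have pcW: "?pc + 1 \<le> W" "?pc \<le> u * N + v" using T st W by (auto simp: traced_def)
    have old: "?pv (q * h + l) = words s ''pv'' (q * h + l)" if "q < ?pc" "l < h" for q l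
      using 1(2) block_lt[OF that] by blast
    have new: "?pv (?pc * h + l) = ?t l" if "l < h" for l using 1(2) that by blast
    have ps: "path_set ?pv h q = path_set (words s ''pv'') h q" "inj_on (\<lambda>l. ?pv (q * h + l)) {..<h} \<longleftrightarrow> inj_on (\<lambda>l. words s ''pv'' (q * h + l)) {..<h}"
      if "q < ?pc" for q
      using old[OF that] by (auto simp: path_set_def intro!: inj_on_cong)
    have fam: "family N ?pv h ?pc" using T ps by (simp add: traced_def family_def)
    have mk: "\<forall>x. words s' ''mk'' x \<le> ?st" using 1(2) by blast
    have prev: "\<exists>q<?pc. \<forall>l<h. ?pv (q * h + l) = tr ?tp h u' v' l"
      if uv': "u' < N" "v' < N" "u' * N + v' < u * N + v" "0 < ?tv (idx h u' v')" "inj_on (tr ?tp h u' v') {..<h}" for u' v'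
    proof -
      from T that obtain q where "q < ?pc" "\<forall>l<h. words s ''pv'' (q * h + l) = tr ?tp h u' v' l" unfolding traced_def by blast
      then show ?thesis using old by (intro exI[of _ q]) simp
    qed
    have here: "u' = u \<and> v' = v" if "u' < N" "v' < N" "\<not> u' * N + v' < u * N + v" "u' * N + v' < u * N + v + 1" for u' v'
    proof -
      have "u' * N + v' = u * N + v" using that by simp
      then show ?thesis using pair_index_inj that uv by blast
    qed
    show ?case
    proof (cases "inj_on ?t {..<h}")
      case True
      have "family N ?pv h (?pc + 1)" unfolding family_def
      proof (intro allI impI)
        fix q assume q: "q < ?pc + 1"
        show "inj_on (\<lambda>l. ?pv (q * h + l)) {..<h} \<and> path_set ?pv h q \<subseteq> {..<N}"
        proof (cases "q < ?pc")
          case False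
          then have "q = ?pc" using q by simp
          then show ?thesis using True new trv by (auto simp: path_set_def inj_on_def)
        qed (use fam in \<open>auto simp: family_def\<close>)
      qed
      moreover have "\<exists>q<?pc + 1. \<forall>l<h. ?pv (q * h + l) = tr ?tp h u' v' l"
        if uv': "u' < N" "v' < N" "u' * N + v' < u * N + v + 1" "0 < ?tv (idx h u' v')" "inj_on (tr ?tp h u' v') {..<h}" for u' v'
      proof (cases "u' * N + v' < u * N + v")
        case True
        from prev[OF uv'(1,2) True uv'(4,5)] obtain q where "q < ?pc" "\<forall>l<h. ?pv (q * h + l) = tr ?tp h u' v' l" by blast
        then show ?thesis by (intro exI[of _ q]) simp
      next
        case False
        from here[OF uv'(1,2) False uv'(3)] show ?thesis using new by (intro exI[of _ ?pc]) simp
      qed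
      ultimately show ?thesis using 1(2) True pcW mk by (auto simp: traced_def)
    next
      case False
      have "\<exists>q<?pc. \<forall>l<h. ?pv (q * h + l) = tr ?tp h u' v' l"
        if uv': "u' < N" "v' < N" "u' * N + v' < u * N + v + 1" "0 < ?tv (idx h u' v')" "inj_on (tr ?tp h u' v') {..<h}" for u' v'
      proof (cases "u' * N + v' < u * N + v")
        case True
        from prev[OF uv'(1,2) True uv'(4,5)] show ?thesis .
      next
        case f: False
        from here[OF uv'(1,2) f uv'(3)] False uv'(5) show ?thesis by simp
      qed
      then show ?thesis using 1(2) False pcW mk fam by (auto simp: traced_def)
    qed
  qed
  then have "wp W (For ''j'' (V ''h'') ?P ;; Cond (WLess (WLit 0) (V ''gd'')) (''pc'' ::= WAdd (V ''pc'') (WLit 1)) Skip)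
     (\<lambda>\<tau> s'. 19 + \<tau> \<le> 140 * (h + 1) \<and> traced h ?tv ?tp (u * N + v + 1) s') s1"
    by (rule wp_conseq) (simp add: add.commute)
  moreover have "?st \<le> W" "v \<le> W" "words s ''N'' 0 = N" using st W uv N_le_W i by (simp_all add: inp_def)
  ultimately show ?thesis unfolding trace_path_def using uv one_le_W
    by (simp add: s1_def)
qed

lemma traced_upd [simp]:
  "traced h tv tp r (s\<lparr>words := (words s)(''v'' := f)\<rparr>) = traced h tv tp r s"
  "traced h tv tp r (s\<lparr>words := (words s)(''u'' := f)\<rparr>) = traced h tv tp r s"
  by (simp_all add: traced_def)

lemma trace_wp:
  assumes i: "inp s" and lev: "levels h s" and h: "words s ''h'' 0 = h" "h \<le> W" and W: "N * N + 1 \<le> W"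
    and z: "words s ''pc'' 0 = 0" "words s ''mk'' = (\<lambda>_. 0)"
  shows "wp W trace (\<lambda>\<tau> s'. \<tau> \<le> 200 * ((N + 1) * (N + 1) * (h + 1)) \<and> traced h (words s ''tv'') (words s ''tp'') (N * N) s') s"
  unfolding trace_def
proof (rule wp_for[where n = N and c = "(N + 1) * (140 * (h + 1) + 35)" and I = "\<lambda>u. traced h (words s ''tv'') (words s ''tp'') (u * N)"], goal_cases)
  case 3
  show ?case using z by (simp add: traced_def family_def)
next
  case (4 k s')
  then show ?case using i by (simp add: frm_def inp_def)
next
  case (5 u s1)
  let ?C = "Cond (WLess (WLit 0) (WCell ''tv'' (W3 (V ''N'') (V ''h'') (V ''u'') (V ''v'')))) trace_path Skip"
  have i1: "inp s1" by (rule inp_frm[OF i 5(2)]) simp_all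
  have t1: "words s1 ''tv'' = words s ''tv''" "words s1 ''tp'' = words s ''tp''" "reals s1 = reals s" "words s1 ''h'' 0 = h"
    using 5(2) h by (auto simp: frm_def)
  show ?case
  proof (rule wp_for[where n = N and c = "140 * (h + 1) + 23" and I = "\<lambda>v. traced h (words s ''tv'') (words s ''tp'') (u * N + v)"], goal_cases)
    case 3
    show ?case using 5(4) by simp
  next
    case (4 k s')
    then show ?case using i1 by (simp add: frm_def inp_def)
  next
    case inner: (5 v s2)
    have i2: "inp s2" by (rule inp_frm[OF i1 inner(2)]) simp_all
    have t2: "words s2 ''tv'' = words s ''tv''" "words s2 ''tp'' = words s ''tp''" "reals s2 = reals s" "words s2 ''h'' 0 = h" "words s2 ''u'' 0 = u"
      using inner(2) t1 5(3) by (auto simp: frm_def)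
    have N2: "words s2 ''N'' 0 = N" using i2 by (simp add: inp_def)
    have "same_below ((h + 1) * N * N) s s2" using t2 by (intro same_below_tables) simp_all
    from levels_same[OF this order_refl lev] have lev2: "levels h s2" .
    have g: "wval s2 (W3 (V ''N'') (V ''h'') (V ''u'') (V ''v'')) = idx h u v" using t2 N2 inner(3) by (simp add: idx_def)
    show ?case
    proof (cases "0 < words s ''tv'' (idx h u v)")
      case True
      then have tv: "0 < words s2 ''tv'' (idx h u v)" using t2 by simp
      have T: "traced h (words s2 ''tv'') (words s2 ''tp'') (u * N + v) s2" using inner(4) t2 by simp
      have e: "u * N + v + 1 = u * N + Suc v" by simp
      have "wp W trace_path (\<lambda>\<tau> s'. \<tau> \<le> 140 * (h + 1) \<and> traced h (words s ''tv'') (words s ''tp'') (u * N + Suc v) s') s2"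
        using trace_path_wp[OF i2 lev2 t2(4) h(2) t2(5) inner(3) 5(1) inner(1) tv W T] unfolding e t2 .
      then have "wp W trace_path (\<lambda>\<tau> s'. \<tau> + 18 \<le> 140 * (h + 1) + 23 \<and> traced h (words s ''tv'') (words s ''tp'') (u * N + Suc v) (s'\<lparr>words := (words s')(''v'' := (words s' ''v'')(0 := Suc v))\<rparr>)) s2"
        by (rule wp_conseq) simp
      then show ?thesis using True t2 g by (simp add: add.commute del: wval_W3) 
    next
      case False
      have "traced h (words s ''tv'') (words s ''tp'') (u * N + Suc v) s2"
        unfolding traced_def
      proof (intro conjI allI impI)
        fix u' v' assume uv': "u' < N" "v' < N" "u' * N + v' < u * N + Suc v" "0 < words s ''tv'' (idx h u' v')"
            "inj_on (tr (words s ''tp'') h u' v') {..<h}"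
        have "u' * N + v' \<noteq> u * N + v"
        proof
          assume "u' * N + v' = u * N + v"
          then have "u' = u \<and> v' = v" using pair_index_inj uv' inner(1) by blast
          then show False using False uv' by simp
        qed
        then have "u' * N + v' < u * N + v" using uv'(3) by simp
        then show "\<exists>q<words s2 ''pc'' 0. \<forall>l<h. words s2 ''pv'' (q * h + l) = tr (words s ''tp'') h u' v' l"
          using inner(4) uv' unfolding traced_def by blast
      qed (use inner(4) in \<open>auto simp: traced_def intro: le_SucI\<close>)
      then show ?thesis using False t2 g by (simp del: wval_W3)
    qed
  next
    case (6 \<tau> s2)
    have "traced h (words s ''tv'') (words s ''tp'') (Suc u * N) s2" using 6(3) by (simp add: add.commute)
    moreover have "\<tau> \<le> (N + 1) * (140 * (h + 1) + 35)" using 6(4) by (simp add: add.commute)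
    ultimately show ?case by simp
  qed (use N_le_W in auto)
next
  case (6 \<tau> s')
  have "\<tau> \<le> (N + 1) * ((N + 1) * (140 * (h + 1) + 35) + 12)" using 6(4) by (simp add: add.commute)
  also have "\<dots> \<le> (N + 1) * ((N + 1) * (200 * (h + 1)))"
  proof (rule mult_le_mono2)
    have "12 \<le> (N + 1) * 12" by simp
    then have "(N + 1) * (140 * (h + 1) + 35) + 12 \<le> (N + 1) * (140 * (h + 1) + 35) + (N + 1) * 12" by simp
    also have "\<dots> = (N + 1) * (140 * (h + 1) + 35 + 12)" by (simp only: distrib_left)
    also have "\<dots> \<le> (N + 1) * (200 * (h + 1))" by (rule mult_le_mono2) simp
    finally show "(N + 1) * (140 * (h + 1) + 35) + 12 \<le> (N + 1) * (200 * (h + 1))" .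
  qed
  also have "\<dots> = 200 * ((N + 1) * (N + 1) * (h + 1))" by simp
  finally show ?case using 6(3) by simp
qed (use N_le_W in auto)

end

section \<open>The greedy choice of a hitting set\<close>

primrec last_occ :: "(nat \<Rightarrow> nat) \<Rightarrow> nat \<Rightarrow> nat \<Rightarrow> nat" where
  "last_occ f v 0 = 0"
| "last_occ f v (Suc k) = (if f k = v then Suc k else last_occ f v k)"

lemma last_occ_pos:
  "0 < last_occ f v k \<Longrightarrow> last_occ f v k - 1 < k \<and> f (last_occ f v k - 1) = v \<and> (\<forall>e. last_occ f v k \<le> e \<and> e < k \<longrightarrow> f e \<noteq> v)"
  by (induction k) (auto simp: less_Suc_eq)

lemma last_occ_zero: "last_occ f v k = 0 \<Longrightarrow> e < k \<Longrightarrow> f e \<noteq> v"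
  by (induction k) (auto simp: less_Suc_eq split: if_splits)

lemma last_occ_le: "last_occ f v k \<le> k"
  by (induction k) auto

lemma path_set_alt: "q < k \<Longrightarrow> v \<in> path_set pv h q \<longleftrightarrow> (\<exists>e < k * h. e div h = q \<and> pv e = v)"
proof
  assume q: "q < k" and "v \<in> path_set pv h q"
  then obtain l where l: "l < h" "v = pv (q * h + l)" by (auto simp: path_set_def)
  then show "\<exists>e < k * h. e div h = q \<and> pv e = v"
    using pair_index_less[OF q l(1)] by (intro exI[of _ "q * h + l"]) auto
next
  assume "\<exists>e < k * h. e div h = q \<and> pv e = v"
  then obtain e where e: "e < k * h" "e div h = q" "pv e = v" by blast
  then have h: "0 < h" by (cases h) auto
  have "e = q * h + e mod h" using e(2) by (metis div_mult_mod_eq)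
  moreover have "e mod h < h" using h by simp
  ultimately show "v \<in> path_set pv h q" using e(3) unfolding path_set_def by (metis image_eqI lessThan_iff)
qed

text \<open>Double counting: each stored path has exactly \<open>h\<close> distinct vertices. By
  averaging, some vertex lies on at least the fraction \<open>h / n\<close> of the paths in
  \<open>A\<close>.\<close>

lemma incidences:
  assumes "family n pv h k" "A \<subseteq> {..<k}"
  shows "(\<Sum>v<n. card {q\<in>A. v \<in> path_set pv h q}) = card A * h"
proof -
  have fin: "finite A" using assms(2) finite_subset by blast
  have "(\<Sum>v<n. card {q\<in>A. v \<in> path_set pv h q}) = (\<Sum>v<n. \<Sum>q\<in>A. if v \<in> path_set pv h q then 1 else 0)"
    using fin by (intro sum.cong refl) (simp add: sum.If_cases Int_def)
  also have "\<dots> = (\<Sum>q\<in>A. \<Sum>v<n. if v \<in> path_set pv h q then 1 else 0)" by (rule sum.swap)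
  also have "\<dots> = (\<Sum>q\<in>A. h)"
  proof (rule sum.cong[OF refl])
    fix q assume "q \<in> A"
    then have q: "inj_on (\<lambda>l. pv (q * h + l)) {..<h}" "path_set pv h q \<subseteq> {..<n}" using assms by (auto simp: family_def)
    have "(\<Sum>v<n. if v \<in> path_set pv h q then 1 else (0::nat)) = card ({..<n} \<inter> path_set pv h q)"
      by (simp add: sum.If_cases)
    also have "{..<n} \<inter> path_set pv h q = path_set pv h q" using q(2) by blast
    also have "card \<dots> = h" using q(1) by (simp add: path_set_def card_image)
    finally show "(\<Sum>v<n. if v \<in> path_set pv h q then 1 else (0::nat)) = h" .
  qed
  finally show ?thesis by simp
qed

text \<open>Threads the occurrences of each vertex into a linked list: \<open>fs\<close> gives the
  latest position and \<open>nx\<close> the previous one with the same vertex, both as one plus the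
  position, with 0 for the end of the list (\<open>last_occ\<close>).\<close>

definition link_up :: com where
  "link_up = For ''j'' (WMul (V ''pc'') (V ''h'')) (
     WAssign ''cnt'' (WCell ''pv'' (V ''j'')) (WAdd (WCell ''cnt'' (WCell ''pv'' (V ''j''))) (WLit 1)) ;;
     WAssign ''nx'' (V ''j'') (WCell ''fs'' (WCell ''pv'' (V ''j''))) ;;
     WAssign ''fs'' (WCell ''pv'' (V ''j'')) (WAdd (V ''j'') (WLit 1)))"

lemma wmod_link_up [simp]: "wmod link_up = {''j'', ''cnt'', ''nx'', ''fs''}" "rmod link_up = {}"
  by (auto simp: link_up_def)

lemma link_up_wp:
  assumes p: "words s ''pc'' 0 = k" "words s ''h'' 0 = h" "k * h + 1 \<le> W" and z: "words s ''cnt'' = (\<lambda>_. 0)" "words s ''fs'' = (\<lambda>_. 0)"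
  defines "pv \<equiv> words s ''pv''"
  shows "wp W link_up (\<lambda>\<tau> s'. \<tau> \<le> 60 * (k * h + 1) \<and> (\<forall>v. words s' ''fs'' v = last_occ pv v (k * h)) \<and>
     (\<forall>e < k * h. words s' ''nx'' e = last_occ pv (pv e) e) \<and> (\<forall>v. words s' ''cnt'' v = card {e. e < k * h \<and> pv e = v})) s"
  unfolding link_up_def
proof (rule wp_for[where n = "k * h" and c = 40 and I = "\<lambda>i s'. (\<forall>v. words s' ''fs'' v = last_occ pv v i) \<and>
     (\<forall>e < i. words s' ''nx'' e = last_occ pv (pv e) e) \<and> (\<forall>v. words s' ''cnt'' v = card {e. e < i \<and> pv e = v})"], goal_cases)
  case (5 i s')
  have r: "words s' ''pv'' = pv" using 5(2) by (simp add: frm_def pv_def)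
  have c: "card {e. e < Suc i \<and> pv e = v} = card {e. e < i \<and> pv e = v} + (if pv i = v then 1 else 0)" for v
  proof (cases "pv i = v")
    case True
    then have "{e. e < Suc i \<and> pv e = v} = insert i {e. e < i \<and> pv e = v}" by auto
    then show ?thesis using True by simp
  next
    case False
    then have "{e. e < Suc i \<and> pv e = v} = {e. e < i \<and> pv e = v}" by (auto simp: less_Suc_eq)
    then show ?thesis using False by simp
  qed
  have "{e. e < i \<and> pv e = v} \<subseteq> {..<i}" for v by auto
  then have le: "card {e. e < i \<and> pv e = v} \<le> i" for v by (metis card_lessThan card_mono finite_lessThan)
  have W1: "card {e. e < i \<and> pv e = pv i} + 1 \<le> W" "last_occ pv (pv i) i \<le> W" "i + 1 \<le> W"
    using le[of "pv i"] last_occ_le[of pv "pv i" i] 5(1) p(3) by linarith+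
  show ?case using 5(3,4) r c W1 by (simp add: less_Suc_eq)
qed (use p z in \<open>auto simp: frm_def\<close>)

definition scan_max :: com where
  "scan_max = ''b'' ::= WLit 0 ;; For ''v'' (V ''N'') (Cond (WLess (WCell ''cnt'' (V ''b'')) (WCell ''cnt'' (V ''v''))) (''b'' ::= V ''v'') Skip)"

definition drop_path :: com where
  "drop_path = ''pi'' ::= WDiv (WSub (V ''cu'') (WLit 1)) (V ''h'') ;;
     Cond (WLess (WCell ''gone'' (V ''pi'')) (WLit 1))
       (WAssign ''gone'' (V ''pi'') (WLit 1) ;;
        For ''j'' (V ''h'') (WAssign ''cnt'' (WCell ''pv'' (WAdd (WMul (V ''pi'') (V ''h'')) (V ''j'')))
          (WSub (WCell ''cnt'' (WCell ''pv'' (WAdd (WMul (V ''pi'') (V ''h'')) (V ''j'')))) (WLit 1)))) Skip"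

definition traverse :: com where
  "traverse = While (WLess (WLit 0) (V ''cu'')) (drop_path ;; ''cu'' ::= WCell ''nx'' (WSub (V ''cu'') (WLit 1)))"

text \<open>The occurrence list of the chosen vertex leads to the paths through it, including those
  removed earlier. Each path is removed once, with \<open>h\<close> corrections of counts, so
  keeping the counts up to date costs about the total length of all paths.\<close>

definition greedy :: com where
  "greedy = link_up ;; ''gg'' ::= WLit 1 ;;
     While (WLess (WLit 0) (V ''gg'')) (scan_max ;; Cond (WLess (WCell ''cnt'' (V ''b'')) (WLit 1)) (''gg'' ::= WLit 0)
       (WAssign ''hs'' (V ''q'') (V ''b'') ;; ''q'' ::= WAdd (V ''q'') (WLit 1) ;; ''cu'' ::= WCell ''fs'' (V ''b'') ;;
        traverse))"

lemma wmod_scan_max [simp]: "wmod scan_max = {''b'', ''v''}" "rmod scan_max = {}"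
  by (auto simp: scan_max_def)

lemma wmod_drop_path [simp]: "wmod drop_path = {''pi'', ''gone'', ''j'', ''cnt''}" "rmod drop_path = {}"
  by (auto simp: drop_path_def)

lemma wmod_traverse [simp]: "wmod traverse = {''pi'', ''gone'', ''j'', ''cnt'', ''cu''}" "rmod traverse = {}"
  by (auto simp: traverse_def)

lemma wmod_greedy [simp]: "wmod greedy = {''j'', ''cnt'', ''nx'', ''fs'', ''gg'', ''b'', ''v'', ''hs'', ''q'', ''cu'', ''pi'', ''gone''}" "rmod greedy = {}"
  by (auto simp: greedy_def)

lemma scan_max_wp:
  assumes "words s ''N'' 0 = n" "n \<le> W"
  shows "wp W scan_max (\<lambda>\<tau> s'. \<tau> \<le> 40 * (n + 1) \<and> (\<forall>v<n. words s ''cnt'' v \<le> words s ''cnt'' (words s' ''b'' 0)) \<and> (0 < n \<longrightarrow> words s' ''b'' 0 < n)) s"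
proof -
  define s1 where "s1 = s\<lparr>words := (words s)(''b'' := (words s ''b'')(0 := 0))\<rparr>"
  have "wp W (For ''v'' (V ''N'') (Cond (WLess (WCell ''cnt'' (V ''b'')) (WCell ''cnt'' (V ''v''))) (''b'' ::= V ''v'') Skip))
    (\<lambda>\<tau> s'. 3 + \<tau> \<le> 40 * (n + 1) \<and> (\<forall>v<n. words s ''cnt'' v \<le> words s ''cnt'' (words s' ''b'' 0)) \<and> (0 < n \<longrightarrow> words s' ''b'' 0 < n)) s1"
  proof (rule wp_for[where n = n and c = 20 and I = "\<lambda>k s'. (\<forall>v<k. words s ''cnt'' v \<le> words s ''cnt'' (words s' ''b'' 0)) \<and> (0 < n \<longrightarrow> words s' ''b'' 0 < n)"], goal_cases)
    case (5 k s')
    have r: "words s' ''cnt'' = words s ''cnt''" using 5(2) by (simp add: frm_def s1_def)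
    show ?case
    proof (cases "words s ''cnt'' (words s' ''b'' 0) < words s ''cnt'' k")
      case True
      have "words s ''cnt'' v \<le> words s ''cnt'' k" if "v < Suc k" for v
      proof (cases "v = k")
        case False
        then have "words s ''cnt'' v \<le> words s ''cnt'' (words s' ''b'' 0)" using 5(4) that by simp
        then show ?thesis using True by simp
      qed simp
      then show ?thesis using True r 5(1,3) assms(2) by simp
    next
      case False
      have "words s ''cnt'' v \<le> words s ''cnt'' (words s' ''b'' 0)" if "v < Suc k" for v
        using 5(4) that False by (cases "v = k") simp_all
      then show ?thesis using False r 5(3,4) by simp
    qed
  qed (use assms in \<open>simp_all add: frm_def s1_def\<close>)
  then show ?thesis by (simp add: scan_max_def s1_def)
qed

definition alive :: "nat \<Rightarrow> store \<Rightarrow> nat set" where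
  "alive k s = {q. q < k \<and> words s ''gone'' q = 0}"

definition counted :: "nat \<Rightarrow> nat \<Rightarrow> store \<Rightarrow> bool" where
  "counted h k s \<longleftrightarrow> (\<forall>v. words s ''cnt'' v = card {q \<in> alive k s. v \<in> path_set (words s ''pv'') h q})"

lemma finite_alive [simp]: "finite (alive k s)"
  by (simp add: alive_def)

text \<open>Amortization: a path not yet hit carries \<open>45 * (h + 1)\<close> units, released on
  its removal, which pay for the loop over its vertices. A path already gone costs a
  constant.\<close>

lemma drop_path_wp:
  assumes p: "words s ''h'' 0 = h" "words s ''cu'' 0 = e + 1" "e < k * h" "k * h + 1 \<le> W"
    and fam: "family n (words s ''pv'') h k" and c: "counted h k s"
  shows "wp W drop_path (\<lambda>\<tau> s'. \<tau> + 45 * (h + 1) * card (alive k s') \<le> 30 + 45 * (h + 1) * card (alive k s) \<and>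
     alive k s' = alive k s - {e div h} \<and> counted h k s') s"
proof -
  let ?pv = "words s ''pv''" let ?i = "e div h"
  have h: "0 < h" using p(3) by (cases h) auto
  have ik: "?i < k" using p(3) h by (simp add: div_less_iff_less_mult)
  have iW: "?i \<le> W" using p(3,4) div_le_dividend[of e h] by linarith
  define s1 where "s1 = s\<lparr>words := (words s)(''pi'' := (words s ''pi'')(0 := ?i))\<rparr>"
  have al1: "alive k s1 = alive k s" by (simp add: alive_def s1_def)
  show ?thesis
  proof (cases "?i \<in> alive k s")
    case False
    then have "words s ''gone'' ?i \<noteq> 0" using ik by (simp add: alive_def)
    then show ?thesis using False p iW al1 c unfolding drop_path_def by (simp add: s1_def counted_def alive_def)
  next
    case True
    then have g: "words s ''gone'' ?i = 0" by (simp add: alive_def)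
    define s2 where "s2 = s1\<lparr>words := (words s1)(''gone'' := (words s1 ''gone'')(?i := 1))\<rparr>"
    have al2: "alive k s2 = alive k s - {?i}" by (auto simp: alive_def s2_def s1_def)
    have cA: "card (alive k s) = Suc (card (alive k s2))" unfolding al2 by (rule card.remove[OF finite_alive True])
    have inj: "inj_on (\<lambda>l. ?pv (?i * h + l)) {..<h}" using fam ik by (simp add: family_def)
    have cnt: "words s ''cnt'' v = card {q \<in> alive k s2. v \<in> path_set ?pv h q} + (if v \<in> path_set ?pv h ?i then 1 else 0)" for v
    proof (cases "v \<in> path_set ?pv h ?i")
      case t: True
      have "{q \<in> alive k s. v \<in> path_set ?pv h q} = insert ?i {q \<in> alive k s2. v \<in> path_set ?pv h q}" using t True al2 by auto
      moreover have "?i \<notin> {q \<in> alive k s2. v \<in> path_set ?pv h q}" using al2 by simp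
      ultimately show ?thesis using c t by (simp add: counted_def)
    next
      case f: False
      then have "{q \<in> alive k s. v \<in> path_set ?pv h q} = {q \<in> alive k s2. v \<in> path_set ?pv h q}" using al2 by auto
      then show ?thesis using c f by (simp add: counted_def)
    qed
    let ?x = "WCell ''pv'' (WAdd (WMul (V ''pi'') (V ''h'')) (V ''j''))"
    have "wp W (For ''j'' (V ''h'') (WAssign ''cnt'' ?x (WSub (WCell ''cnt'' ?x) (WLit 1))))
      (\<lambda>\<tau> s'. \<tau> \<le> (h + 1) * 40 \<and> (\<forall>v. words s' ''cnt'' v = words s ''cnt'' v - (if v \<in> path_set ?pv h ?i then 1 else 0))) s2"
    proof (rule wp_for[where n = h and c = 28 and I = "\<lambda>j s'. \<forall>v. words s' ''cnt'' v = words s ''cnt'' v - (if v \<in> (\<lambda>l. ?pv (?i * h + l)) ` {..<j} then 1 else 0)"], goal_cases)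
      case 2
      have "1 * h \<le> k * h" using ik by (intro mult_le_mono1) simp
      then show ?case using p(4) by linarith
    next
      case 3
      then show ?case by (simp add: s2_def s1_def)
    next
      case (4 j s')
      then show ?case using p by (simp add: frm_def s1_def s2_def)
    next
      case (5 j s')
      have r: "words s' ''h'' 0 = h" "words s' ''pi'' 0 = ?i" "words s' ''pv'' = ?pv" using 5(2) p by (simp_all add: frm_def s2_def s1_def)
      let ?v = "?pv (?i * h + j)"
      have nv: "?v \<notin> (\<lambda>l. ?pv (?i * h + l)) ` {..<j}"
      proof
        assume "?v \<in> (\<lambda>l. ?pv (?i * h + l)) ` {..<j}"
        then obtain l where l: "l < j" "?v = ?pv (?i * h + l)" by blast
        have "j = l" using inj_onD[OF inj l(2)] l(1) 5(1) by simp
        then show False using l(1) by simp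
      qed
      have "{q \<in> alive k s. ?v \<in> path_set ?pv h q} \<subseteq> {..<k}" by (auto simp: alive_def)
      from card_mono[OF finite_lessThan this] have "words s ''cnt'' ?v \<le> k" using c by (simp add: counted_def)
      moreover have "k * 1 \<le> k * h" using h by (intro mult_le_mono2) simp
      ultimately have "words s ''cnt'' ?v \<le> W" using p(4) by linarith
      then show ?case using 5(3,4) r nv by (auto simp: lessThan_Suc)
    next
      case (6 \<tau> s')
      then show ?case by (simp add: path_set_def add.commute)
    qed simp
    then have "wp W (For ''j'' (V ''h'') (WAssign ''cnt'' ?x (WSub (WCell ''cnt'' ?x) (WLit 1))))
      (\<lambda>\<tau> s'. \<tau> + 19 + 45 * (h + 1) * card (alive k s') \<le> 30 + 45 * (h + 1) * card (alive k s) \<and> alive k s' = alive k s - {?i} \<and> counted h k s') s2"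
    proof (rule wp_conseq, goal_cases)
      case (1 \<tau> s')
      have f: "alive k s' = alive k s2" "words s' ''pv'' = ?pv" using 1(1) by (simp_all add: frm_def alive_def s2_def s1_def)
      have "counted h k s'" unfolding counted_def f using 1(2) cnt by simp
      moreover have "45 * (h + 1) * card (alive k s) = 45 * (h + 1) + 45 * (h + 1) * card (alive k s2)" unfolding cA by simp
      then have "\<tau> + 19 + 45 * (h + 1) * card (alive k s2) \<le> 30 + 45 * (h + 1) * card (alive k s)" using 1(2) by simp
      ultimately show ?case using f(1) al2 by simp
    qed
    then show ?thesis using p iW g h unfolding drop_path_def
      by (simp add: s1_def s2_def ac_simps)
  qed
qed

definition occs :: "(nat \<Rightarrow> nat) \<Rightarrow> nat \<Rightarrow> nat \<Rightarrow> nat \<Rightarrow> nat set" where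
  "occs f b i j = {e. i \<le> e \<and> e < j \<and> f e = b}"

lemma finite_occs [simp]: "finite (occs f b i j)"
  by (rule finite_subset[of _ "{..<j}"]) (auto simp: occs_def)

lemma occs_empty [simp]: "occs f b i i = {}"
  by (auto simp: occs_def)

lemma traverse_wp:
  assumes p: "words s ''h'' 0 = h" "k * h + 1 \<le> W" and pv: "words s ''pv'' = pv" and cu: "words s ''cu'' 0 = last_occ pv b (k * h)"
    and nx: "\<forall>e < k * h. words s ''nx'' e = last_occ pv (pv e) e" and fam: "family n pv h k" and c: "counted h k s"
  shows "wp W traverse (\<lambda>\<tau> s'. \<tau> + 45 * (h + 1) * card (alive k s') \<le> 60 * card (occs pv b 0 (k * h)) + 45 * (h + 1) * card (alive k s) + 10 \<and>
     alive k s' = {q \<in> alive k s. b \<notin> path_set pv h q} \<and> counted h k s') s"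
  unfolding traverse_def
\<comment> \<open>\<open>i\<close> measures the progress: occurrences of \<open>b\<close> at
  positions from \<open>i\<close> on are done, and \<open>cu\<close> points to the last one before
  \<open>i\<close>.\<close>
proof (rule wp_while[where \<mu> = "\<lambda>s. words s ''cu'' 0" and Inv = "\<lambda>\<tau> s'. \<exists>i\<le>k * h. words s' ''cu'' 0 = last_occ pv b i \<and>
    alive k s' = alive k s - (\<lambda>e. e div h) ` occs pv b i (k * h) \<and> counted h k s' \<and>
    \<tau> + 45 * (h + 1) * card (alive k s') \<le> 60 * card (occs pv b i (k * h)) + 45 * (h + 1) * card (alive k s)"], goal_cases)
  case 1
  show ?case using cu c by (intro exI[of _ "k * h"]) simp
next
  case (2 \<tau> s')
  then obtain i where i: "i \<le> k * h" "words s' ''cu'' 0 = last_occ pv b i" "alive k s' = alive k s - (\<lambda>e. e div h) ` occs pv b i (k * h)"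
    "counted h k s'" "\<tau> + 45 * (h + 1) * card (alive k s') \<le> 60 * card (occs pv b i (k * h)) + 45 * (h + 1) * card (alive k s)" by blast
  have pos: "0 < last_occ pv b i" using 2(3) i(2) by simp
  define e where "e = last_occ pv b i - 1"
  have e4: "last_occ pv b i = e + 1" using pos by (simp add: e_def)
  have e: "e < i" "pv e = b" using last_occ_pos[OF pos] by (simp_all add: e4)
  have e3: "pv e' \<noteq> b" if "e < e'" "e' < i" for e'
  proof -
    have "e + 1 \<le> e'" using that(1) by simp
    then show ?thesis using last_occ_pos[OF pos] that(2) unfolding e4 by blast
  qed
  have eK: "e < k * h" using e(1) i(1) by simp
  have oc: "occs pv b e (k * h) = insert e (occs pv b i (k * h))"
  proof -
    have "x \<in> occs pv b e (k * h) \<longleftrightarrow> x \<in> insert e (occs pv b i (k * h))" for x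
      using e e3[of x] eK by (cases "x < i"; cases "x = e") (auto simp: occs_def)
    then show ?thesis by blast
  qed
  have ne: "e \<notin> occs pv b i (k * h)" using e(1) by (simp add: occs_def)
  have r: "words s' ''pv'' = pv" "words s' ''nx'' = words s ''nx''" "words s' ''h'' 0 = h" using 2(1) pv p by (simp_all add: frm_def)
  have cu': "words s' ''cu'' 0 = e + 1" using i(2) e4 by simp
  have "wp W drop_path (\<lambda>\<tau> s''. \<tau> + 45 * (h + 1) * card (alive k s'') \<le> 30 + 45 * (h + 1) * card (alive k s') \<and>
     alive k s'' = alive k s' - {e div h} \<and> counted h k s'') s'"
    using drop_path_wp[OF r(3) cu' eK p(2) _ i(4), of n] fam r by simp
  then show ?case
  proof (rule wp_seq, goal_cases)
    case (1 \<tau>1 s1)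
    have r1: "words s1 ''nx'' e = last_occ pv b e" "words s1 ''cu'' 0 = e + 1" using 1(1) r nx eK e(2) cu' by (simp_all add: frm_def)
    have W1: "last_occ pv b e \<le> W" "last_occ pv b e < e + 1" using last_occ_le[of pv b e] eK p(2) by linarith+
    have al: "alive k (s1\<lparr>words := (words s1)(''cu'' := f)\<rparr>) = alive k s1" "counted h k (s1\<lparr>words := (words s1)(''cu'' := f)\<rparr>) = counted h k s1" for f
      by (simp_all add: alive_def counted_def)
    have A: "alive k s1 = alive k s - (\<lambda>e. e div h) ` occs pv b e (k * h)" using 1(2) i(3) unfolding oc by blast
    have T: "\<tau> + (13 + \<tau>1) + 45 * (h + 1) * card (alive k s1) \<le> 60 * card (occs pv b e (k * h)) + 45 * (h + 1) * card (alive k s)"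
    proof -
      have "card (occs pv b e (k * h)) = card (occs pv b i (k * h)) + 1" unfolding oc using ne by simp
      moreover have "\<tau>1 + 45 * (h + 1) * card (alive k s1) \<le> 30 + 45 * (h + 1) * card (alive k s')" using 1(2) by blast
      ultimately show ?thesis using i(5) by linarith
    qed
    show ?case using r1 W1 al A T 1(2) eK cu' by (auto intro!: exI[of _ e] simp: ac_simps)
  qed
next
  case (3 \<tau> s')
  then obtain i where i: "i \<le> k * h" "words s' ''cu'' 0 = last_occ pv b i" "alive k s' = alive k s - (\<lambda>e. e div h) ` occs pv b i (k * h)"
    "counted h k s'" "\<tau> + 45 * (h + 1) * card (alive k s') \<le> 60 * card (occs pv b i (k * h)) + 45 * (h + 1) * card (alive k s)" by blast
  have "last_occ pv b i = 0" using 3(3) i(2) by simp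
  from last_occ_zero[OF this] have "occs pv b i (k * h) = occs pv b 0 (k * h)" by (auto simp: occs_def not_less[symmetric])
  moreover have "q \<in> (\<lambda>e. e div h) ` occs pv b 0 (k * h) \<longleftrightarrow> b \<in> path_set pv h q" if "q < k" for q
    unfolding path_set_alt[OF that] by (auto simp: occs_def)
  then have "alive k s - (\<lambda>e. e div h) ` occs pv b 0 (k * h) = {q \<in> alive k s. b \<notin> path_set pv h q}" by (auto simp: alive_def)
  ultimately show ?case using i by simp
qed

lemma greedy_cost:
  fixes t :: nat
  assumes "t3 + C1 \<le> 60 * d + C0 + 10" "t2 \<le> X" "t + C0 \<le> Q + 60 * D + K"
  shows "t + (t2 + (t3 + 27)) + C1 \<le> Q + (X + 80) + 60 * (D + d) + K"
  using assms by simp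

lemma greedy_total:
  fixes t :: nat
  assumes "t1 \<le> 60 * (K + 1)" "t \<le> A + 60 * D + E" "A \<le> 120 * B" "E \<le> 90 * K" "D \<le> K"
  shows "t1 + (3 + (t + 5)) \<le> 400 * (K + 1) + 200 * B"
  using assms by simp

text \<open>By averaging, each choice hits at least the fraction \<open>h / n\<close> of the paths
  left, so at most \<open>k * (1 - h / n) ^ q\<close> remain after \<open>q\<close> choices. Before
  the last choice some path was left, which gives the inequality with exponent
  \<open>q - 1\<close>.\<close>

lemma greedy_wp:
  assumes n: "words s ''N'' 0 = n" "n \<le> W" "1 \<le> W" and p: "words s ''pc'' 0 = k" "words s ''h'' 0 = h" "k * h + 1 \<le> W" "1 \<le> h"
    and z: "words s ''cnt'' = (\<lambda>_. 0)" "words s ''fs'' = (\<lambda>_. 0)" "words s ''gone'' = (\<lambda>_. 0)" "words s ''q'' 0 = 0"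
    and fam: "family n (words s ''pv'') h k"
  shows "wp W greedy (\<lambda>\<tau> s'. \<tau> \<le> 400 * (k * h + 1) + 200 * ((n + 1) * (n + 1)) \<and>
     words s' ''q'' 0 \<le> n \<and> (\<forall>i<words s' ''q'' 0. words s' ''hs'' i < n) \<and>
     (\<forall>l<k. \<exists>i<words s' ''q'' 0. words s' ''hs'' i \<in> path_set (words s ''pv'') h l) \<and>
     (words s' ''q'' 0 = 0 \<or> 1 \<le> real k * (1 - real h / real n) ^ (words s' ''q'' 0 - 1) \<and> h \<le> n)) s"
  unfolding greedy_def
proof (rule wp_seq[OF link_up_wp[OF p(1-3) z(1,2)]], goal_cases)
  case link: (1 \<tau>1 s1)
  let ?pv = "words s ''pv''" let ?K = "k * h"
  define s2 where "s2 = s1\<lparr>words := (words s1)(''gg'' := (words s1 ''gg'')(0 := 1))\<rparr>"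
  have r2: "words s2 ''N'' 0 = n" "words s2 ''h'' 0 = h" "words s2 ''pv'' = ?pv" "words s2 ''gone'' = (\<lambda>_. 0)" "words s2 ''q'' 0 = 0" "words s2 ''gg'' 0 = 1"
    "words s2 ''cnt'' = words s1 ''cnt''" "words s2 ''fs'' = words s1 ''fs''" "words s2 ''nx'' = words s1 ''nx''"
    using link(1) n p z by (simp_all add: s2_def frm_def)
  have al2: "alive k s2 = {..<k}" using r2 by (auto simp: alive_def)
  have c2: "counted h k s2" unfolding counted_def al2 r2
  proof
    fix v
    \<comment> \<open>A path visits \<open>v\<close> at most once, so the positions holding
      \<open>v\<close> correspond to the paths through \<open>v\<close>, and the numbers of
      occurrences are the right initial counts.\<close>
    have "inj_on (\<lambda>e. e div h) {e. e < ?K \<and> ?pv e = v}"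
    proof (rule inj_onI)
      fix e e' assume ee: "e \<in> {e. e < ?K \<and> ?pv e = v}" "e' \<in> {e. e < ?K \<and> ?pv e = v}" "e div h = e' div h"
      have q: "e div h < k" using ee(1) p(4) by (simp add: div_less_iff_less_mult)
      have e: "e = e div h * h + e mod h" "e' = e div h * h + e' mod h" using ee(3) by (metis div_mult_mod_eq)+
      have "e mod h < h" "e' mod h < h" using p(4) by simp_all
      moreover have "?pv (e div h * h + e mod h) = ?pv (e div h * h + e' mod h)" using ee e by auto
      ultimately have "e mod h = e' mod h" using fam q unfolding family_def inj_on_def by blast
      then show "e = e'" using e by simp
    qed
    moreover have "(\<lambda>e. e div h) ` {e. e < ?K \<and> ?pv e = v} = {q \<in> {..<k}. v \<in> path_set ?pv h q}"
    proof -
      have "q \<in> (\<lambda>e. e div h) ` {e. e < ?K \<and> ?pv e = v} \<longleftrightarrow> q \<in> {q \<in> {..<k}. v \<in> path_set ?pv h q}" for q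
      proof (cases "q < k")
        case True
        then show ?thesis using path_set_alt[OF True, of v ?pv h] by auto
      next
        case False
        then show ?thesis using p(4) by (auto simp: div_less_iff_less_mult)
      qed
      then show ?thesis by blast
    qed
    ultimately have "bij_betw (\<lambda>e. e div h) {e. e < ?K \<and> ?pv e = v} {q \<in> {..<k}. v \<in> path_set ?pv h q}" by (rule bij_betw_imageI)
    then have "card {e. e < ?K \<and> ?pv e = v} = card {q \<in> {..<k}. v \<in> path_set ?pv h q}" by (rule bij_betw_same_card)
    then show "words s1 ''cnt'' v = card {q \<in> {..<k}. v \<in> path_set ?pv h q}" using link(2) by simp
  qed
  let ?deg = "\<lambda>b. card (occs ?pv b 0 ?K)"
  let ?x = "1 - real h / real n"
  \<comment> \<open>Chosen vertices have count 0 from then on and are not chosen again. Hence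
    \<open>q\<close> stays at most \<open>n\<close>, and the lengths of the traversed occurrence
    lists add up to at most \<open>k * h\<close>.\<close>
  define Inv where "Inv = (\<lambda>\<tau> s'. let q = words s' ''q'' 0; A = alive k s' in counted h k s' \<and> words s' ''gg'' 0 \<le> 1 \<and>
     inj_on (words s' ''hs'') {..<q} \<and> (\<forall>i<q. words s' ''hs'' i < n \<and> words s' ''cnt'' (words s' ''hs'' i) = 0) \<and>
     (\<forall>l<k. l \<notin> A \<longrightarrow> (\<exists>i<q. words s' ''hs'' i \<in> path_set ?pv h l)) \<and>
     real (card A) \<le> real k * ?x ^ q \<and> (q = 0 \<or> 1 \<le> real k * ?x ^ (q - 1) \<and> h \<le> n) \<and> (words s' ''gg'' 0 = 0 \<longrightarrow> A = {}) \<and>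
     \<tau> + 45 * (h + 1) * card A \<le> (q + (1 - words s' ''gg'' 0)) * (40 * (n + 1) + 80) + 60 * (\<Sum>i<q. ?deg (words s' ''hs'' i)) + 45 * (h + 1) * k)"
  let ?G = "WAssign ''hs'' (V ''q'') (V ''b'') ;; ''q'' ::= WAdd (V ''q'') (WLit 1) ;; ''cu'' ::= WCell ''fs'' (V ''b'') ;; traverse"
  let ?P = "scan_max ;; Cond (WLess (WCell ''cnt'' (V ''b'')) (WLit 1)) (''gg'' ::= WLit 0) ?G"
  have "wp W (While (WLess (WLit 0) (V ''gg'')) ?P) (\<lambda>\<tau> s'. \<tau>1 + (3 + \<tau>) \<le> 400 * (k * h + 1) + 200 * ((n + 1) * (n + 1)) \<and>
     words s' ''q'' 0 \<le> n \<and> (\<forall>i<words s' ''q'' 0. words s' ''hs'' i < n) \<and>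
     (\<forall>l<k. \<exists>i<words s' ''q'' 0. words s' ''hs'' i \<in> path_set ?pv h l) \<and>
     (words s' ''q'' 0 = 0 \<or> 1 \<le> real k * ?x ^ (words s' ''q'' 0 - 1) \<and> h \<le> n)) s2"
  proof (rule wp_while[where Inv = Inv and \<mu> = "\<lambda>s. card (alive k s) + words s ''gg'' 0"], goal_cases)
    case 1
    show ?case using r2 c2 al2 by (simp add: Inv_def Let_def)
  next
    case (2 \<tau> s3)
    let ?q = "words s3 ''q'' 0" let ?A = "alive k s3"
    have gg: "words s3 ''gg'' 0 = 1" using 2(2,3) by (simp add: Inv_def Let_def)
    have r3: "words s3 ''N'' 0 = n" "words s3 ''h'' 0 = h" "words s3 ''pv'' = ?pv" "words s3 ''fs'' = words s1 ''fs''" "words s3 ''nx'' = words s1 ''nx''"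
      using 2(1) r2 by (simp_all add: frm_def)
    have I: "counted h k s3" "inj_on (words s3 ''hs'') {..<?q}" "\<forall>i<?q. words s3 ''hs'' i < n \<and> words s3 ''cnt'' (words s3 ''hs'' i) = 0"
      "\<forall>l<k. l \<notin> ?A \<longrightarrow> (\<exists>i<?q. words s3 ''hs'' i \<in> path_set ?pv h l)" "real (card ?A) \<le> real k * ?x ^ ?q"
      "?q = 0 \<or> 1 \<le> real k * ?x ^ (?q - 1) \<and> h \<le> n"
      "\<tau> + 45 * (h + 1) * card ?A \<le> ?q * (40 * (n + 1) + 80) + 60 * (\<Sum>i<?q. ?deg (words s3 ''hs'' i)) + 45 * (h + 1) * k"
      using 2(2) gg by (simp_all add: Inv_def Let_def)
    have cntA: "words s3 ''cnt'' v = card {q \<in> ?A. v \<in> path_set ?pv h q}" for v using I(1) r3 by (simp add: counted_def)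
    have Ak: "?A \<subseteq> {..<k}" by (auto simp: alive_def)
    from scan_max_wp[OF r3(1) n(2)] show ?case
    proof (rule wp_seq, goal_cases)
      case (1 \<tau>2 s4)
      let ?b = "words s4 ''b'' 0"
      have r4: "words s4 ''cnt'' = words s3 ''cnt''" "words s4 ''q'' = words s3 ''q''" "words s4 ''hs'' = words s3 ''hs''" "words s4 ''gg'' = words s3 ''gg''"
        "words s4 ''gone'' = words s3 ''gone''" "words s4 ''pv'' = ?pv" "words s4 ''fs'' = words s1 ''fs''" "words s4 ''nx'' = words s1 ''nx''" "words s4 ''h'' 0 = h"
        using 1(1) r3 by (simp_all add: frm_def)
      have A4: "alive k s4 = ?A" using r4 by (simp add: alive_def)
      have "card ?A * h = (\<Sum>v<n. words s3 ''cnt'' v)" using incidences[OF fam Ak] cntA by simp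
      also have "\<dots> \<le> (\<Sum>v<n. words s3 ''cnt'' ?b)" using 1(2) by (intro sum_mono) auto
      finally have av: "card ?A * h \<le> n * words s3 ''cnt'' ?b" by simp
      show ?case
      proof (cases "words s3 ''cnt'' ?b < 1")
        case True
        then have "card ?A = 0" using av p(4) by auto
        then have A0: "?A = {}" by (simp add: alive_def)
        have "counted h k (s4\<lparr>words := (words s4)(''gg'' := f)\<rparr>)" "alive k (s4\<lparr>words := (words s4)(''gg'' := f)\<rparr>) = {}" for f
          using I(1) A4 A0 r3 r4 by (simp_all add: counted_def alive_def)
        moreover have "\<tau> + (\<tau>2 + 14) \<le> (?q + 1) * (40 * (n + 1) + 80) + 60 * (\<Sum>i<?q. ?deg (words s3 ''hs'' i)) + 45 * (h + 1) * k"
        proof -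
          have "(?q + 1) * (40 * (n + 1) + 80) = ?q * (40 * (n + 1) + 80) + (40 * (n + 1) + 80)" by (simp only: distrib_right mult_1_left)
          moreover have "\<tau>2 \<le> 40 * (n + 1)" using 1(2) by blast
          ultimately show ?thesis using I(7) by linarith
        qed
        ultimately show ?thesis using True r4 I gg A0 by (simp add: Inv_def Let_def ac_simps)
      next
        case False
        then have pos: "1 \<le> words s3 ''cnt'' ?b" by simp
        then have "{q \<in> ?A. ?b \<in> path_set ?pv h q} \<noteq> {}" unfolding cntA by (metis card.empty not_one_le_zero)
        then obtain l where l: "l \<in> ?A" "?b \<in> path_set ?pv h l" by blast
        have lk: "l < k" using l Ak by blast
        have bn: "?b < n" using l(2) fam lk by (auto simp: family_def)
        have "card (path_set ?pv h l) = h" using fam lk by (simp add: path_set_def family_def card_image)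
        then have hn: "h \<le> n" using fam lk card_mono[of "{..<n}" "path_set ?pv h l"] by (simp add: family_def)
        have bnew: "?b \<notin> words s3 ''hs'' ` {..<?q}" using I(3) pos by auto
        have "card (words s3 ''hs'' ` {..<?q}) = ?q" using I(2) by (simp add: card_image)
        moreover have "words s3 ''hs'' ` {..<?q} \<subseteq> {..<n}" using I(3) by auto
        ultimately have qn: "?q \<le> n" using card_mono[of "{..<n}" "words s3 ''hs'' ` {..<?q}"] by simp
        have qlt: "?q < n"
        proof (rule ccontr)
          assume "\<not> ?q < n"
          then have "words s3 ''hs'' ` {..<?q} = {..<n}" using \<open>card (words s3 ''hs'' ` {..<?q}) = ?q\<close> \<open>words s3 ''hs'' ` {..<?q} \<subseteq> {..<n}\<close> qn
            by (intro card_subset_eq) auto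
          then show False using bnew bn by simp
        qed
        define s5 where "s5 = s4\<lparr>words := (words s4)(''hs'' := (words s4 ''hs'')(?q := ?b), ''q'' := (words s4 ''q'')(0 := ?q + 1),
            ''cu'' := (words s4 ''cu'')(0 := last_occ ?pv ?b ?K))\<rparr>"
        have r5: "words s5 ''h'' 0 = h" "words s5 ''pv'' = ?pv" "words s5 ''cu'' 0 = last_occ ?pv ?b ?K" "\<forall>e<?K. words s5 ''nx'' e = last_occ ?pv (?pv e) e"
          using r4 link(2) by (simp_all add: s5_def)
        have A5: "alive k s5 = ?A" "counted h k s5" using A4 I(1) r3 r4 by (simp_all add: s5_def alive_def counted_def)
        have W1: "?q + 1 \<le> W" "?b \<le> W" "last_occ ?pv ?b ?K \<le> W" using qlt bn n(2) last_occ_le[of ?pv ?b ?K] p(3) by linarith+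
        have fam5: "family n ?pv h k" by (rule fam)
        have "wp W traverse (\<lambda>\<tau>' s'. Inv (\<tau> + (\<tau>2 + (\<tau>' + 27))) s' \<and> card (alive k s') + words s' ''gg'' 0 < card ?A + 1) s5"
        proof (rule wp_conseq[OF traverse_wp[OF r5(1) p(3) r5(2,3,4) fam5 A5(2)]], goal_cases)
          case trav: (1 \<tau>3 s6)
          let ?A' = "alive k s6"
          have r6: "words s6 ''q'' 0 = ?q + 1" "words s6 ''hs'' = (words s3 ''hs'')(?q := ?b)" "words s6 ''gg'' 0 = 1" "words s6 ''pv'' = ?pv"
            using trav(1) r4 gg by (simp_all add: frm_def s5_def)
          have A': "?A' = ?A - {q \<in> ?A. ?b \<in> path_set ?pv h q}" using trav(2) A5(1) by auto
          have "card ?A' = card ?A - words s3 ''cnt'' ?b" unfolding A' cntA by (rule card_Diff_subset) auto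
          moreover have "words s3 ''cnt'' ?b \<le> card ?A" unfolding cntA by (rule card_mono) auto
          ultimately have cA: "card ?A' + words s3 ''cnt'' ?b = card ?A" by simp
          have x0: "0 \<le> ?x" using hn bn by simp
          have "real (card ?A) * real h \<le> real n * real (words s3 ''cnt'' ?b)" using av by (metis of_nat_le_iff of_nat_mult)
          then have "real (card ?A) * (real h / real n) \<le> real (words s3 ''cnt'' ?b)" using bn by (simp add: field_simps)
          moreover have "real (card ?A') + real (words s3 ''cnt'' ?b) = real (card ?A)" using cA by (metis of_nat_add)
          ultimately have "real (card ?A') \<le> real (card ?A) * ?x" by (simp add: right_diff_distrib)
          also have "\<dots> \<le> real k * ?x ^ ?q * ?x" using I(5) x0 by (rule mult_right_mono)
          finally have b1: "real (card ?A') \<le> real k * ?x ^ (?q + 1)" by (simp add: mult.assoc power_add)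
          have "1 \<le> card ?A" using cA pos by simp
          then have b2: "1 \<le> real k * ?x ^ ?q" using I(5) by linarith
          have i1: "inj_on ((words s3 ''hs'')(?q := ?b)) {..<?q + 1}" by (rule inj_on_upd_less[OF I(2) bnew])
          have cnt6: "words s6 ''cnt'' v = card {q \<in> ?A'. v \<in> path_set ?pv h q}" for v using trav(2) r6 by (simp add: counted_def)
          have cz: "words s6 ''cnt'' v \<le> words s3 ''cnt'' v" for v unfolding cnt6 cntA A' by (intro card_mono) auto
          have cb: "words s6 ''cnt'' ?b = 0" unfolding cnt6 A' by (simp add: card_eq_0_iff)
          have i2: "\<forall>i<?q + 1. ((words s3 ''hs'')(?q := ?b)) i < n \<and> words s6 ''cnt'' (((words s3 ''hs'')(?q := ?b)) i) = 0"
          proof (intro allI impI)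
            fix i assume i: "i < ?q + 1"
            show "((words s3 ''hs'')(?q := ?b)) i < n \<and> words s6 ''cnt'' (((words s3 ''hs'')(?q := ?b)) i) = 0"
            proof (cases "i = ?q")
              case False
              then have "i < ?q" using i by simp
              then show ?thesis using I(3) cz[of "words s3 ''hs'' i"] False by simp
            qed (use bn cb in simp)
          qed
          have i3: "\<forall>l<k. l \<notin> ?A' \<longrightarrow> (\<exists>i<?q + 1. ((words s3 ''hs'')(?q := ?b)) i \<in> path_set ?pv h l)"
          proof (intro allI impI)
            fix l assume l: "l < k" "l \<notin> ?A'"
            show "\<exists>i<?q + 1. ((words s3 ''hs'')(?q := ?b)) i \<in> path_set ?pv h l"
            proof (cases "l \<in> ?A")
              case True
              then have "?b \<in> path_set ?pv h l" using l A' by blast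
              then show ?thesis by (intro exI[of _ ?q]) simp
            next
              case False
              with I(4) l obtain i where "i < ?q" "words s3 ''hs'' i \<in> path_set ?pv h l" by blast
              then show ?thesis by (intro exI[of _ i]) simp
            qed
          qed
          have sm: "(\<Sum>i<?q + 1. ?deg (((words s3 ''hs'')(?q := ?b)) i)) = (\<Sum>i<?q. ?deg (words s3 ''hs'' i)) + ?deg ?b"
            by (simp add: Suc_eq_plus1[symmetric] del: Suc_eq_plus1)
          have tm: "\<tau> + (\<tau>2 + (\<tau>3 + 27)) + 45 * (h + 1) * card ?A' \<le> (?q + 1) * (40 * (n + 1) + 80) +
             60 * (\<Sum>i<?q + 1. ?deg (((words s3 ''hs'')(?q := ?b)) i)) + 45 * (h + 1) * k"
          proof -
            have a: "\<tau>3 + 45 * (h + 1) * card ?A' \<le> 60 * ?deg ?b + 45 * (h + 1) * card ?A + 10" using conjunct1[OF trav(2)] unfolding A5(1) .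
            have b: "\<tau>2 \<le> 40 * (n + 1)" using 1(2) by blast
            have e: "(?q + 1) * (40 * (n + 1) + 80) = ?q * (40 * (n + 1) + 80) + (40 * (n + 1) + 80)" by (simp only: distrib_right mult_1_left)
            show ?thesis unfolding sm e by (rule greedy_cost[OF a b I(7)])
          qed
          have "Inv (\<tau> + (\<tau>2 + (\<tau>3 + 27))) s6"
            unfolding Inv_def Let_def r6 using trav(2) i1 i2 i3 b1 b2 hn tm by simp
          then show ?case using cA pos r6 by simp
        qed
        then show ?thesis using False W1 r4 gg link(2) by (simp add: s5_def ac_simps)
      qed
    qed
  next
    case (3 \<tau> s3)
    let ?q = "words s3 ''q'' 0" let ?A = "alive k s3"
    have A0: "?A = {}" and I: "inj_on (words s3 ''hs'') {..<?q}" "\<forall>i<?q. words s3 ''hs'' i < n"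
      "\<forall>l<k. l \<notin> ?A \<longrightarrow> (\<exists>i<?q. words s3 ''hs'' i \<in> path_set ?pv h l)"
      "?q = 0 \<or> 1 \<le> real k * ?x ^ (?q - 1) \<and> h \<le> n"
      "\<tau> \<le> (?q + 1) * (40 * (n + 1) + 80) + 60 * (\<Sum>i<?q. ?deg (words s3 ''hs'' i)) + 45 * (h + 1) * k"
      using 3(2,3) by (simp_all add: Inv_def Let_def)
    have sub: "words s3 ''hs'' ` {..<?q} \<subseteq> {..<n}" using I(2) by auto
    have qn: "?q \<le> n" using card_mono[OF _ sub] I(1) by (simp add: card_image)
    have "(\<Sum>i<?q. ?deg (words s3 ''hs'' i)) = (\<Sum>v \<in> words s3 ''hs'' ` {..<?q}. ?deg v)" using I(1) by (simp add: sum.reindex)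
    also have "\<dots> = card (\<Union>v \<in> words s3 ''hs'' ` {..<?q}. occs ?pv v 0 ?K)"
      by (rule card_UN_disjoint[symmetric]) (auto simp: occs_def)
    also have "\<dots> \<le> card {..<?K}" by (rule card_mono) (auto simp: occs_def)
    finally have dg: "(\<Sum>i<?q. ?deg (words s3 ''hs'' i)) \<le> ?K" by simp
    have "(?q + 1) * (40 * (n + 1) + 80) \<le> (n + 1) * (120 * (n + 1))" using qn by (intro mult_le_mono) auto
    then have q120: "(?q + 1) * (40 * (n + 1) + 80) \<le> 120 * ((n + 1) * (n + 1))" by (simp only: mult.left_commute)
    have "k * 1 \<le> k * h" using p(4) by (rule mult_le_mono2)
    then have k90: "45 * (h + 1) * k \<le> 90 * (k * h)" by (simp add: algebra_simps)
    have "\<tau>1 + (3 + (\<tau> + (1 + bcost (WLess (WLit 0) (V ''gg''))))) \<le> 400 * (k * h + 1) + 200 * ((n + 1) * (n + 1))"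
      using greedy_total[OF conjunct1[OF link(2)] I(5) q120 k90 dg] by simp
    then show ?case using qn I A0 by simp
  qed
  then show ?case using n(3) by (simp add: s2_def)
qed

section \<open>Min-plus powers\<close>

lemma cond_push_wp:
  assumes b: "bval s b = C"
    and ev: "\<And>s'. C \<Longrightarrow> (\<And>x. x \<notin> {''lg'', ''lp''} \<Longrightarrow> words s' x = words s x) \<Longrightarrow> (\<And>x. x \<notin> {''la'', ''lb''} \<Longrightarrow> reals s' x = reals s x) \<Longrightarrow>
      wval s' g = G \<and> rval s' a = A \<and> rval s' b' = B \<and> wval s' q = Q"
    and W: "C \<Longrightarrow> G \<le> W \<and> Q \<le> W \<and> words s ''L'' 0 + 1 \<le> W"
    and K: "22 + bcost b + wcost g + rcost a + rcost b' + wcost q \<le> K"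
  shows "wp W (Cond b (push g a b' q) Skip) (\<lambda>\<tau> s'. \<tau> \<le> K \<and>
    set (lines s') = set (lines s) \<union> (if C then {(G, A, B, Q)} else {}) \<and> words s' ''L'' 0 \<le> words s ''L'' 0 + 1) s"
proof (cases C)
  case True
  have "wp W (push g a b' q) (\<lambda>\<tau> s'. \<tau> \<le> 20 + wcost g + rcost a + rcost b' + wcost q \<and>
    lines s' = lines s @ [(G, A, B, Q)]) s"
    using W True by (intro push_wp) (use ev in blast)+
  then have "wp W (push g a b' q) (\<lambda>\<tau> s'. 1 + bcost b + \<tau> \<le> K \<and>
    set (lines s') = set (lines s) \<union> (if C then {(G, A, B, Q)} else {}) \<and> words s' ''L'' 0 \<le> words s ''L'' 0 + 1) s"
  proof (rule wp_conseq, goal_cases)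
    case (1 \<tau> s')
    have "length (lines s') = length (lines s) + 1" using 1(2) by (simp del: length_append add: length_append)
    then have "words s' ''L'' 0 = words s ''L'' 0 + 1" by (simp add: lines_def)
    then show ?case using 1(2) K True by simp
  qed
  then show ?thesis using b True by simp
next
  case False
  then show ?thesis using b K by simp
qed

definition mat_ix :: "wexp \<Rightarrow> wexp \<Rightarrow> wexp \<Rightarrow> wexp" where
  "mat_ix b i k = WAdd b (WAdd (WMul i (V ''q'')) k)"

lemma mat_ix_simps [simp]:
  "wval s (mat_ix b i k) = wval s b + (wval s i * words s ''q'' 0 + wval s k)"
  "wcost (mat_ix b i k) = 5 + wcost b + wcost i + wcost k"
  by (simp_all add: mat_ix_def)

definition hs_src :: wexp where
  "hs_src = W3 (V ''N'') (WAdd (V ''j'') (WLit 1)) (WCell ''hs'' (V ''i'')) (WCell ''hs'' (V ''k''))"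

text \<open>The levels read are \<open>j + 1\<close> for \<open>j < h\<close>. Leaving out level 0
  makes every entry a nonempty walk, so a filled diagonal entry exhibits a closed walk with a
  ratio.\<close>

definition first :: com where
  "first = ''L'' ::= WLit 0 ;; For ''i'' (V ''q'') (For ''k'' (V ''q'') (For ''j'' (V ''h'')
     (Cond (WLess (WLit 0) (WCell ''tv'' hs_src)) (push (mat_ix (V ''mb'') (V ''i'') (V ''k'')) (RCell ''tc'' hs_src) (RCell ''tt'' hs_src) (WLit 0)) Skip)))"

definition next_mb :: wexp where "next_mb = WAdd (V ''mb'') (WMul (V ''q'') (V ''q''))"
definition ik :: wexp where "ik = mat_ix (V ''mb'') (V ''i'') (V ''k'')"
definition iz :: wexp where "iz = mat_ix (V ''mb'') (V ''i'') (V ''z'')"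
definition zk :: wexp where "zk = mat_ix (V ''mb'') (V ''z'') (V ''k'')"

text \<open>The old entry competes as well, so the new matrix covers all numbers of hops up to twice
  the old bound instead of a few exact ones. The result goes to the next block of
  \<open>q * q\<close> cells.\<close>

definition square :: com where
  "square = ''L'' ::= WLit 0 ;; For ''i'' (V ''q'') (For ''k'' (V ''q'') (
     For ''z'' (V ''q'') (Cond (BAnd (WLess (WLit 0) (WCell ''tv'' iz)) (WLess (WLit 0) (WCell ''tv'' zk)))
       (push (mat_ix next_mb (V ''i'') (V ''k'')) (RAdd (RCell ''tc'' iz) (RCell ''tc'' zk)) (RAdd (RCell ''tt'' iz) (RCell ''tt'' zk)) (WLit 0)) Skip) ;;
     Cond (WLess (WLit 0) (WCell ''tv'' ik)) (push (mat_ix next_mb (V ''i'') (V ''k'')) (RCell ''tc'' ik) (RCell ''tt'' ik) (WLit 0)) Skip))"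

lemma wmod_first [simp]: "wmod first = {''i'', ''k'', ''j'', ''lg'', ''lp'', ''L''}" "rmod first = {''la'', ''lb''}"
  by (auto simp: first_def)

lemma wmod_square [simp]: "wmod square = {''i'', ''k'', ''z'', ''lg'', ''lp'', ''L''}" "rmod square = {''la'', ''lb''}"
  by (auto simp: square_def)

definition copy_cand :: "store \<Rightarrow> nat \<Rightarrow> nat \<Rightarrow> line set" where
  "copy_cand s g g' = (if 0 < words s ''tv'' g' then {(g, reals s ''tc'' g', reals s ''tt'' g', 0)} else {})"

definition join_cand :: "store \<Rightarrow> nat \<Rightarrow> nat \<Rightarrow> nat \<Rightarrow> line set" where
  "join_cand s g a b = (if 0 < words s ''tv'' a \<and> 0 < words s ''tv'' b then
     {(g, reals s ''tc'' a + reals s ''tc'' b, reals s ''tt'' a + reals s ''tt'' b, 0)} else {})"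

lemma square_wp:
  assumes q: "words s ''q'' 0 = q" and mb: "words s ''mb'' 0 = b" and W: "b + 2 * (q * q) \<le> W" "q * (q * (q + 1)) + 1 \<le> W" "q \<le> W"
  shows "wp W square (\<lambda>\<tau> s'. \<tau> \<le> 400 * ((q + 1) * ((q + 1) * (q + 1))) \<and>
     set (lines s') = (\<Union>i<q. \<Union>k<q. (\<Union>z<q. join_cand s (b + q * q + (i * q + k)) (b + (i * q + z)) (b + (z * q + k))) \<union>
        copy_cand s (b + q * q + (i * q + k)) (b + (i * q + k))) \<and> words s' ''L'' 0 \<le> q * (q * (q + 1))) s"
proof -
  define s1 where "s1 = s\<lparr>words := (words s)(''L'' := (words s ''L'')(0 := 0))\<rparr>"
  have l1: "set (lines s1) = {}" "words s1 ''L'' 0 = 0" by (simp_all add: s1_def lines_def)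
  let ?J = "\<lambda>i k z. join_cand s (b + q * q + (i * q + k)) (b + (i * q + z)) (b + (z * q + k))"
  let ?C = "\<lambda>i k. copy_cand s (b + q * q + (i * q + k)) (b + (i * q + k))"
  let ?PZ = "Cond (BAnd (WLess (WLit 0) (WCell ''tv'' iz)) (WLess (WLit 0) (WCell ''tv'' zk)))
       (push (mat_ix next_mb (V ''i'') (V ''k'')) (RAdd (RCell ''tc'' iz) (RCell ''tc'' zk)) (RAdd (RCell ''tt'' iz) (RCell ''tt'' zk)) (WLit 0)) Skip"
  let ?Z = "For ''z'' (V ''q'') ?PZ"
  let ?D = "Cond (WLess (WLit 0) (WCell ''tv'' ik)) (push (mat_ix next_mb (V ''i'') (V ''k'')) (RCell ''tc'' ik) (RCell ''tt'' ik) (WLit 0)) Skip"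
  let ?I = "For ''i'' (V ''q'') (For ''k'' (V ''q'') (?Z ;; ?D))"
  have fr: "words s2 ''q'' 0 = q \<and> words s2 ''mb'' 0 = b \<and> words s2 ''tv'' = words s ''tv'' \<and> reals s2 ''tc'' = reals s ''tc'' \<and> reals s2 ''tt'' = reals s ''tt''"
    if "frm ?I s1 s2" for s2 using that q mb by (simp add: frm_def s1_def)
  have gW: "b + q * q + (i * q + k) \<le> W" if "i < q" "k < q" for i k using pair_index_less[OF that] W(1) by linarith
  have "wp W ?I (\<lambda>\<tau> s'. \<tau> \<le> (q + 1) * ((q + 1) * ((q + 1) * 162 + 100 + 12) + 12) \<and>
     set (lines s') = set (lines s1) \<union> (\<Union>i<q. \<Union>k<q. (\<Union>z<q. ?J i k z) \<union> ?C i k) \<and> words s' ''L'' 0 \<le> words s1 ''L'' 0 + q * (q * (q + 1))) s1"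
  proof (rule wp_conseq[OF collect_for[where n = q and K = "(q + 1) * ((q + 1) * 162 + 100 + 12)" and l = "q * (q + 1)" and A = "\<lambda>i. \<Union>k<q. (\<Union>z<q. ?J i k z) \<union> ?C i k"]], goal_cases)
    case (4 s2)
    then show ?case using fr by simp
  next
    case (5 i s2)
    note f2 = 5(2)
    have L2: "words s2 ''L'' 0 + q * (q + 1) \<le> q * (q * (q + 1))" using 5(4) l1 by simp
    have i: "words s2 ''i'' 0 = i" "i < q" using 5 by blast+
    show ?case
    proof (rule wp_conseq[OF collect_for[where n = q and K = "(q + 1) * 162 + 100" and l = "q + 1" and A = "\<lambda>k. (\<Union>z<q. ?J i k z) \<union> ?C i k"]], goal_cases)
      case (4 s3)
      have "words s3 ''q'' = words s2 ''q''" using 4 by (simp add: frm_def)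
      then show ?case using fr[OF f2] by simp
    next
      case (5 k s3)
      have r3: "words s3 ''q'' 0 = q" "words s3 ''mb'' 0 = b" "words s3 ''i'' 0 = i" "words s3 ''tv'' = words s ''tv''" "reals s3 ''tc'' = reals s ''tc''" "reals s3 ''tt'' = reals s ''tt''"
        using 5(2) fr[OF f2] i by (simp_all add: frm_def)
      have k: "words s3 ''k'' 0 = k" "k < q" using 5 by blast+
      have L3: "words s3 ''L'' 0 + (q + 1) \<le> q * (q * (q + 1))" using 5(4) L2 by linarith
      have "wp W ?Z (\<lambda>\<tau> s'. \<tau> \<le> (q + 1) * (150 + wcost (V ''q'') + 10) \<and> set (lines s') = set (lines s3) \<union> (\<Union>z<q. ?J i k z) \<and>
          words s' ''L'' 0 \<le> words s3 ''L'' 0 + q * 1) s3"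
      proof (rule collect_for, goal_cases)
        case (4 s4)
        then show ?case using r3 by (simp add: frm_def)
      next
        case (5 z s4)
        have r4: "words s4 ''q'' 0 = q" "words s4 ''mb'' 0 = b" "words s4 ''i'' 0 = i" "words s4 ''k'' 0 = k" "words s4 ''z'' 0 = z"
          "words s4 ''tv'' = words s ''tv''" "reals s4 ''tc'' = reals s ''tc''" "reals s4 ''tt'' = reals s ''tt''"
          using 5(2,3) r3 k by (simp_all add: frm_def)
        have L4: "words s4 ''L'' 0 + 1 \<le> W" using 5(4) L3 W(2) by simp
        show ?case unfolding join_cand_def
          by (rule cond_push_wp) (use r4 gW[OF i(2) k(2)] L4 in \<open>simp_all add: iz_def zk_def next_mb_def\<close>)
      qed (use W(3) in \<open>auto simp: add.commute\<close>)
      then show ?case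
      proof (rule wp_seq, goal_cases)
        case (1 \<tau> s4)
        have r4: "words s4 ''q'' 0 = q" "words s4 ''mb'' 0 = b" "words s4 ''i'' 0 = i" "words s4 ''k'' 0 = k"
          "words s4 ''tv'' = words s ''tv''" "reals s4 ''tc'' = reals s ''tc''" "reals s4 ''tt'' = reals s ''tt''"
          using 1(1) r3 k by (simp_all add: frm_def)
        have L4: "words s4 ''L'' 0 + 1 \<le> W" using 1(2) L3 W(2) by simp
        have "wp W ?D (\<lambda>\<tau> s'. \<tau> \<le> 100 \<and> set (lines s') = set (lines s4) \<union> ?C i k \<and> words s' ''L'' 0 \<le> words s4 ''L'' 0 + 1) s4"
          unfolding copy_cand_def
          by (rule cond_push_wp) (use r4 gW[OF i(2) k(2)] L4 in \<open>simp_all add: ik_def next_mb_def\<close>)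
        then show ?case by (rule wp_conseq) (use 1(2) in auto)
      qed
    qed (use W(3) in \<open>auto simp: add.commute\<close>)
  qed (use W(3) in \<open>auto simp: add.commute\<close>)
  then have "wp W ?I (\<lambda>\<tau> s'. 3 + \<tau> \<le> 400 * ((q + 1) * ((q + 1) * (q + 1))) \<and>
     set (lines s') = (\<Union>i<q. \<Union>k<q. (\<Union>z<q. ?J i k z) \<union> ?C i k) \<and> words s' ''L'' 0 \<le> q * (q * (q + 1))) s1"
    using l1 by (elim wp_conseq) (simp add: algebra_simps)
  then show ?thesis unfolding square_def by (simp add: s1_def)
qed

lemma first_wp:
  assumes q: "words s ''q'' 0 = q" and mb: "words s ''mb'' 0 = b" and h: "words s ''h'' 0 = h" "words s ''N'' 0 = n"
    and W: "b + q * q \<le> W" "q * (q * h) + 1 \<le> W" "q \<le> W" "h \<le> W"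
  shows "wp W first (\<lambda>\<tau> s'. \<tau> \<le> 300 * ((q + 1) * ((q + 1) * (h + 1))) \<and>
     set (lines s') = (\<Union>i<q. \<Union>k<q. \<Union>j<h. copy_cand s (b + (i * q + k)) (((j + 1) * n + words s ''hs'' i) * n + words s ''hs'' k)) \<and>
     words s' ''L'' 0 \<le> q * (q * h)) s"
proof -
  define s1 where "s1 = s\<lparr>words := (words s)(''L'' := (words s ''L'')(0 := 0))\<rparr>"
  have l1: "set (lines s1) = {}" "words s1 ''L'' 0 = 0" by (simp_all add: s1_def lines_def)
  let ?C = "\<lambda>i k j. copy_cand s (b + (i * q + k)) (((j + 1) * n + words s ''hs'' i) * n + words s ''hs'' k)"
  let ?D = "Cond (WLess (WLit 0) (WCell ''tv'' hs_src)) (push (mat_ix (V ''mb'') (V ''i'') (V ''k'')) (RCell ''tc'' hs_src) (RCell ''tt'' hs_src) (WLit 0)) Skip"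
  let ?I = "For ''i'' (V ''q'') (For ''k'' (V ''q'') (For ''j'' (V ''h'') ?D))"
  have fr: "words s2 ''q'' 0 = q \<and> words s2 ''mb'' 0 = b \<and> words s2 ''h'' 0 = h \<and> words s2 ''N'' 0 = n \<and> words s2 ''hs'' = words s ''hs'' \<and>
     words s2 ''tv'' = words s ''tv'' \<and> reals s2 ''tc'' = reals s ''tc'' \<and> reals s2 ''tt'' = reals s ''tt''"
    if "frm ?I s1 s2" for s2 using that q mb h by (simp add: frm_def s1_def)
  have gW: "b + (i * q + k) \<le> W" if "i < q" "k < q" for i k using pair_index_less[OF that] W(1) by linarith
  have "wp W ?I (\<lambda>\<tau> s'. \<tau> \<le> (q + 1) * ((q + 1) * ((h + 1) * 162 + 12) + 12) \<and>
     set (lines s') = set (lines s1) \<union> (\<Union>i<q. \<Union>k<q. \<Union>j<h. ?C i k j) \<and> words s' ''L'' 0 \<le> words s1 ''L'' 0 + q * (q * h)) s1"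
  proof (rule wp_conseq[OF collect_for[where n = q and K = "(q + 1) * ((h + 1) * 162 + 12)" and l = "q * h" and A = "\<lambda>i. \<Union>k<q. \<Union>j<h. ?C i k j"]], goal_cases)
    case (4 s2)
    then show ?case using fr by simp
  next
    case (5 i s2)
    note f2 = 5(2)
    have L2: "words s2 ''L'' 0 + q * h \<le> q * (q * h)" using 5(4) l1 by simp
    have i: "words s2 ''i'' 0 = i" "i < q" using 5 by blast+
    show ?case
    proof (rule wp_conseq[OF collect_for[where n = q and K = "(h + 1) * 162" and l = h and A = "\<lambda>k. \<Union>j<h. ?C i k j"]], goal_cases)
      case (4 s3)
      have "words s3 ''q'' = words s2 ''q''" using 4 by (simp add: frm_def)
      then show ?case using fr[OF f2] by simp
    next
      case (5 k s3)
      have r3: "words s3 ''q'' 0 = q" "words s3 ''mb'' 0 = b" "words s3 ''i'' 0 = i" "words s3 ''h'' 0 = h" "words s3 ''N'' 0 = n" "words s3 ''hs'' = words s ''hs''"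
        "words s3 ''tv'' = words s ''tv''" "reals s3 ''tc'' = reals s ''tc''" "reals s3 ''tt'' = reals s ''tt''"
        using 5(2) fr[OF f2] i by (simp_all add: frm_def)
      have k: "words s3 ''k'' 0 = k" "k < q" using 5 by blast+
      have L3: "words s3 ''L'' 0 + h \<le> q * (q * h)" using 5(4) L2 by linarith
      have "wp W (For ''j'' (V ''h'') ?D) (\<lambda>\<tau> s'. \<tau> \<le> (h + 1) * (150 + wcost (V ''h'') + 10) \<and> set (lines s') = set (lines s3) \<union> (\<Union>j<h. ?C i k j) \<and>
          words s' ''L'' 0 \<le> words s3 ''L'' 0 + h * 1) s3"
      proof (rule collect_for, goal_cases)
        case (4 s4)
        then show ?case using r3 by (simp add: frm_def)
      next
        case (5 j s4)
        have r4: "words s4 ''q'' 0 = q" "words s4 ''mb'' 0 = b" "words s4 ''i'' 0 = i" "words s4 ''k'' 0 = k" "words s4 ''j'' 0 = j" "words s4 ''N'' 0 = n" "words s4 ''hs'' = words s ''hs''"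
          "words s4 ''tv'' = words s ''tv''" "reals s4 ''tc'' = reals s ''tc''" "reals s4 ''tt'' = reals s ''tt''"
          using 5(2,3) r3 k by (simp_all add: frm_def)
        have L4: "words s4 ''L'' 0 + 1 \<le> W" using 5(4) L3 W(2) by simp
        show ?case unfolding copy_cand_def
          by (rule cond_push_wp) (use r4 gW[OF i(2) k(2)] L4 in \<open>simp_all add: hs_src_def\<close>)
      qed (use W(4) in auto)
      then show ?case by (rule wp_conseq) simp
    qed (use W(3) in \<open>auto simp: add.commute\<close>)
  qed (use W(3) in \<open>auto simp: add.commute\<close>)
  then have "wp W ?I (\<lambda>\<tau> s'. 3 + \<tau> \<le> 300 * ((q + 1) * ((q + 1) * (h + 1))) \<and>
     set (lines s') = (\<Union>i<q. \<Union>k<q. \<Union>j<h. ?C i k j) \<and> words s' ''L'' 0 \<le> q * (q * h)) s1"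
    using l1 by (elim wp_conseq) (simp add: algebra_simps)
  then show ?thesis unfolding first_def by (simp add: s1_def)
qed

lemma cost_sum:
  fixes X :: nat
  assumes "t1 \<le> 400 * Q" "t2 \<le> 7000 * Y" "Y \<le> X" "1 * Q \<le> X"
  shows "t1 + t2 \<le> 8000 * X"
  using assms by simp

section \<open>Tight hops and repeated squaring\<close>

context mrc_ram begin

text \<open>\<open>settle_wp\<close> for a batch aimed at an empty block: whatever is filled there
  afterwards comes from the batch.\<close>

lemma settle_block_wp:
  assumes i: "inp s" and L: "words s ''L'' 0 \<le> L" "2 * L + 2 \<le> W" "L \<le> 2 ^ k" and b: "b' \<le> W" "b \<le> b'"
    and A: "\<forall>x \<in> set (lines s). b \<le> fst x \<and> fst x < b' \<and> snd (snd (snd x)) = 0" and fr: "fresh_from b s"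
  shows "wp W settle (\<lambda>\<tau> s'. \<tau> \<le> 7000 * ((k + 1) * (L + 1 + (N + 1) * (m + 1))) \<and> same_below b s s' \<and> fresh_from b' s' \<and>
    (\<forall>g\<ge>b. 0 < words s' ''tv'' g \<longrightarrow> entry s' g \<in> set (lines s)) \<and>
    (cyc \<longrightarrow> (\<forall>x \<in> set (lines s). 0 < words s' ''tv'' (fst x) \<and> val (entry s' (fst x)) \<le> val x))) s"
proof -
  have AW: "\<forall>x \<in> set (lines s). fst x \<le> W \<and> snd (snd (snd x)) \<le> W"
  proof
    fix x assume "x \<in> set (lines s)"
    then show "fst x \<le> W \<and> snd (snd (snd x)) \<le> W" using bspec[OF A, of x] b(1) by simp
  qed
  from settle_wp[OF i L AW] show ?thesis
  proof (rule wp_conseq, goal_cases)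
    case (1 \<tau> s')
    note same = 1(2)[THEN conjunct2, THEN conjunct1, rule_format]
    note new = 1(2)[THEN conjunct2, THEN conjunct2, THEN conjunct1, rule_format]
    have a: "same_below b s s'" unfolding same_below_def
    proof (intro allI impI)
      fix g assume "g < b"
      then have "g \<notin> fst ` set (lines s)" using A by force
      then show "words s' ''tv'' g = words s ''tv'' g \<and> entry s' g = entry s g" by (rule same)
    qed
    have c: "fresh_from b' s'" unfolding fresh_from_def
    proof (intro allI impI)
      fix g assume g: "b' \<le> g"
      then have "g \<notin> fst ` set (lines s)" using A by force
      from same[OF this] show "words s' ''tv'' g = 0" using fr g b(2) by (simp add: fresh_from_def)
    qed
    have d: "entry s' g \<in> set (lines s)" if "b \<le> g" "0 < words s' ''tv'' g" for g
    proof -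
      have "words s ''tv'' g = 0" using fr that(1) by (simp add: fresh_from_def)
      then have "g \<in> fst ` set (lines s)" using same[of g] that(2) by (cases "g \<in> fst ` set (lines s)") auto
      then show ?thesis using new by blast
    qed
    have e: "0 < words s' ''tv'' (fst x)" if "x \<in> set (lines s)" for x using new[of "fst x"] that by force
    show ?case using 1(2) a c d e by blast
  qed
qed

definition hop :: "store \<Rightarrow> nat \<Rightarrow> (nat \<Rightarrow> nat) \<Rightarrow> nat \<Rightarrow> (nat \<times> nat) set" where
  "hop s h hs q = {(i, k). i < q \<and> k < q \<and> (\<exists>l\<in>{1..h}. tight_at s (idx l (hs i) (hs k)) (hs i) (hs k))}"

text \<open>Counterpart of \<open>cell\<close> with hops in place of arcs: powers of the relation
  \<open>R\<close> describe chains of tight hops, and completeness is required for chains of up to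
  \<open>r\<close> of them. No predecessors are kept, as only the values on the diagonal will be
  read.\<close>

definition mat :: "(nat \<times> nat) set \<Rightarrow> (nat \<Rightarrow> nat) \<Rightarrow> nat \<Rightarrow> nat \<Rightarrow> nat \<Rightarrow> store \<Rightarrow> bool" where
  "mat R hs q b r s \<longleftrightarrow> (\<forall>i<q. \<forall>k<q. (0 < words s ''tv'' (b + (i * q + k)) \<longrightarrow> (\<exists>es. es \<noteq> [] \<and> walk_at s (b + (i * q + k)) (hs i) es (hs k))) \<and>
     (cyc \<longrightarrow> (\<exists>l\<in>{1..r}. (i, k) \<in> R ^^ l) \<longrightarrow> tight_at s (b + (i * q + k)) (hs i) (hs k)))"

lemma mat_walk:
  assumes "mat R hs q b r s" "i < q" "k < q" "0 < words s ''tv'' (b + (i * q + k))"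
  obtains es where "es \<noteq> []" "walk_at s (b + (i * q + k)) (hs i) es (hs k)"
  using assms unfolding mat_def by blast

lemma mat_tight:
  assumes "mat R hs q b r s" "i < q" "k < q" cyc "(i, k) \<in> R ^^ l" "1 \<le> l" "l \<le> r"
  shows "tight_at s (b + (i * q + k)) (hs i) (hs k)"
proof -
  have "\<exists>l\<in>{1..r}. (i, k) \<in> R ^^ l" using assms(5-7) by (intro bexI[of _ l]) auto
  then show ?thesis using assms(1-4) unfolding mat_def by blast
qed

lemma mat_index: "(b :: nat) + (i * q + k) = b + (i' * q + k') \<Longrightarrow> k < q \<Longrightarrow> k' < q \<Longrightarrow> i = i' \<and> k = k'"
  using pair_index_inj[of i q k i' k'] by simp

lemma first_step_wp:
  assumes i: "inp s" and q: "words s ''q'' 0 = q" "words s ''mb'' 0 = b" "words s ''h'' 0 = h" "words s ''hs'' = hs"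
    and W: "b + q * q \<le> W" "2 * (q * (q * h)) + 2 \<le> W" "q \<le> W" "h \<le> W" and k: "q * (q * h) \<le> 2 ^ k"
    and lev: "levels h s" "fresh_from b s" "(h + 1) * N * N \<le> b" and hs: "\<And>i. i < q \<Longrightarrow> hs i < N"
  shows "wp W (first ;; settle) (\<lambda>\<tau> s'. \<tau> \<le> 8000 * ((k + 1) * ((q + 1) * ((q + 1) * (h + 1)) + (N + 1) * (m + 1))) \<and> same_below b s s' \<and> fresh_from (b + q * q) s' \<and>
    mat (hop s h hs q) hs q b 1 s') s"
proof -
  have Nw: "words s ''N'' 0 = N" "q * (q * h) + 1 \<le> W" using i W(2) by (simp_all add: inp_def)
  show ?thesis
proof (rule wp_seq[OF first_wp[OF q(1,2,3) Nw(1) W(1) Nw(2) W(3,4)]], goal_cases)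
  case (1 \<tau>1 s1)
  note 6 = 1
  have i1: "inp s1" by (rule inp_frm[OF i 6(1)]) simp_all
  have t1: "words s1 ''tv'' = words s ''tv''" "entry s1 = entry s" using 6(1) by (auto simp: frm_def entry_def fun_eq_iff)
  have A: "x \<in> set (lines s1) \<longleftrightarrow> (\<exists>i<q. \<exists>k<q. \<exists>j<h. 0 < words s ''tv'' (idx (j + 1) (hs i) (hs k)) \<and>
      x = (b + (i * q + k), reals s ''tc'' (idx (j + 1) (hs i) (hs k)), reals s ''tt'' (idx (j + 1) (hs i) (hs k)), 0))" for x
    using 6(2) q(4) by (auto simp: copy_cand_def idx_def split: if_splits)
  have bd: "\<forall>x \<in> set (lines s1). b \<le> fst x \<and> fst x < b + q * q \<and> snd (snd (snd x)) = 0"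
    using A pair_index_less by fastforce
  have fr1: "fresh_from b s1" using lev(2) t1 by (simp add: fresh_from_def)
  have L1: "words s1 ''L'' 0 \<le> q * (q * h)" using 6(2) by blast
  from settle_block_wp[OF i1 L1 W(2) k W(1) _ bd fr1] have S: "wp W settle (\<lambda>\<tau> s'. \<tau> \<le> 7000 * ((k + 1) * (q * (q * h) + 1 + (N + 1) * (m + 1))) \<and> same_below b s1 s' \<and> fresh_from (b + q * q) s' \<and>
    (\<forall>g\<ge>b. 0 < words s' ''tv'' g \<longrightarrow> entry s' g \<in> set (lines s1)) \<and>
    (cyc \<longrightarrow> (\<forall>x \<in> set (lines s1). 0 < words s' ''tv'' (fst x) \<and> val (entry s' (fst x)) \<le> val x))) s1" by simp
  show ?case
  proof (rule wp_conseq[OF S], goal_cases)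
    case (1 \<tau>2 s2)
    have sb: "same_below b s s2" using 1(2) t1 by (simp add: same_below_def)
    have new: "entry s2 g \<in> set (lines s1)" if "b \<le> g" "0 < words s2 ''tv'' g" for g using 1(2) that by blast
    have opt: "0 < words s2 ''tv'' (fst x) \<and> val (entry s2 (fst x)) \<le> val x" if cyc "x \<in> set (lines s1)" for x using 1(2) that by blast
    have wk: "\<exists>es. es \<noteq> [] \<and> walk_at s2 (b + (i * q + k)) (hs i) es (hs k)" if ik: "i < q" "k < q" "0 < words s2 ''tv'' (b + (i * q + k))" for i k
    proof -
      let ?g = "b + (i * q + k)"
      have "entry s2 ?g \<in> set (lines s1)" using new ik(3) by simp
      then obtain i' k' j where x: "i' < q" "k' < q" "j < h" "0 < words s ''tv'' (idx (j + 1) (hs i') (hs k'))"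
        "entry s2 ?g = (b + (i' * q + k'), reals s ''tc'' (idx (j + 1) (hs i') (hs k')), reals s ''tt'' (idx (j + 1) (hs i') (hs k')), 0)" unfolding A by blast
      then have "?g = b + (i' * q + k')" by (simp add: entry_def)
      from mat_index[OF this ik(2) x(2)] have e: "i' = i" "k' = k" by simp_all
      have "cell s (j + 1) (hs i) (hs k)" using lev(1) x(3) hs ik by (simp add: levels_def)
      then obtain es where es: "walk_at s (idx (j + 1) (hs i) (hs k)) (hs i) es (hs k)" "length es = j + 1"
        using x(4) unfolding e cell_def Let_def by blast
      have "walk_at s2 ?g (hs i) es (hs k)" using es(1) x(5) unfolding e by (simp add: entry_def walk_at_def)
      then show ?thesis using es(2) by (intro exI[of _ es]) auto
    qed
    have tg: "tight_at s2 (b + (i * q + k)) (hs i) (hs k)" if ik: "i < q" "k < q" and cy: cyc and R: "(i, k) \<in> hop s h hs q" for i k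
    proof -
      from R obtain l where l: "l \<in> {1..h}" "tight_at s (idx l (hs i) (hs k)) (hs i) (hs k)" by (auto simp: hop_def)
      define j where "j = l - 1"
      have j: "l = j + 1" "j < h" using l(1) by (auto simp: j_def)
      let ?x = "(b + (i * q + k), reals s ''tc'' (idx l (hs i) (hs k)), reals s ''tt'' (idx l (hs i) (hs k)), 0)"
      have "?x \<in> set (lines s1)" unfolding A using ik j l(2) by (intro exI[of _ i] conjI exI[of _ k] exI[of _ j]) (auto simp: tight_at_def)
      from opt[OF cy this] have o: "0 < words s2 ''tv'' (b + (i * q + k))" "val (entry s2 (b + (i * q + k))) \<le> p (hs k) - p (hs i)"
        using l(2) by (auto simp: tight_at_def val_def entry_def)
      from wk[OF ik o(1)] walk_at_ge o show ?thesis unfolding tight_at_def by force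
    qed
    have "mat (hop s h hs q) hs q b 1 s2" unfolding mat_def using wk tg by (auto simp: relpow_1)
    moreover have "\<tau>1 + \<tau>2 \<le> 8000 * ((k + 1) * ((q + 1) * ((q + 1) * (h + 1)) + (N + 1) * (m + 1)))"
    proof -
      let ?Q = "(q + 1) * ((q + 1) * (h + 1))" let ?B = "(N + 1) * (m + 1)"
      have "q * (q * h) + 1 \<le> ?Q" by (simp add: algebra_simps)
      then have "(k + 1) * (q * (q * h) + 1 + ?B) \<le> (k + 1) * (?Q + ?B)" by (intro mult_le_mono2) simp
      moreover have "1 * ?Q \<le> (k + 1) * (?Q + ?B)" by (intro mult_le_mono) auto
      moreover have "\<tau>1 \<le> 300 * ?Q" "\<tau>2 \<le> 7000 * ((k + 1) * (q * (q * h) + 1 + ?B))" using 6(2) 1(2) by blast+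
      moreover from this(1) have "\<tau>1 \<le> 400 * ?Q" by simp
      ultimately show ?thesis using cost_sum by blast
    qed
    ultimately show ?case using sb 1(2) by blast
  qed
qed
qed

lemma square_step_wp:
  assumes i: "inp s" and q: "words s ''q'' 0 = q" "words s ''mb'' 0 = b"
    and W: "b + 2 * (q * q) \<le> W" "2 * (q * (q * (q + 1))) + 2 \<le> W" "q \<le> W" and k: "q * (q * (q + 1)) \<le> 2 ^ k"
    and M: "mat R hs q b r s" "fresh_from (b + q * q) s" and R: "R \<subseteq> {..<q} \<times> {..<q}" and r: "1 \<le> r"
  shows "wp W (square ;; settle) (\<lambda>\<tau> s'. \<tau> \<le> 8000 * ((k + 1) * ((q + 1) * ((q + 1) * (q + 1)) + (N + 1) * (m + 1))) \<and> same_below (b + q * q) s s' \<and>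
     fresh_from (b + 2 * (q * q)) s' \<and> mat R hs q (b + q * q) (r * 2) s') s"
proof (rule wp_seq[OF square_wp[OF q W(1)]], goal_cases)
  case (3 \<tau>1 s1)
  have i1: "inp s1" by (rule inp_frm[OF i 3(1)]) simp_all
  have t1: "words s1 ''tv'' = words s ''tv''" "entry s1 = entry s" using 3(1) by (auto simp: frm_def entry_def fun_eq_iff)
  let ?b = "b + q * q"
  have A: "x \<in> set (lines s1) \<longleftrightarrow> (\<exists>i<q. \<exists>k<q. (\<exists>z<q. x \<in> join_cand s (?b + (i * q + k)) (b + (i * q + z)) (b + (z * q + k))) \<or>
      x \<in> copy_cand s (?b + (i * q + k)) (b + (i * q + k)))" for x
    using 3(2) by auto
  have gx: "fst x = ?b + (i * q + k) \<and> snd (snd (snd x)) = 0"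
    if "x \<in> join_cand s (?b + (i * q + k)) a a' \<or> x \<in> copy_cand s (?b + (i * q + k)) a" for x i k a a'
    using that by (auto simp: join_cand_def copy_cand_def split: if_splits)
  have bd: "\<forall>x \<in> set (lines s1). ?b \<le> fst x \<and> fst x < b + 2 * (q * q) \<and> snd (snd (snd x)) = 0"
  proof
    fix x assume "x \<in> set (lines s1)"
    then obtain i k where ik: "i < q" "k < q" "fst x = ?b + (i * q + k)" "snd (snd (snd x)) = 0" unfolding A using gx by blast
    then show "?b \<le> fst x \<and> fst x < b + 2 * (q * q) \<and> snd (snd (snd x)) = 0" using pair_index_less[OF ik(1,2)] by simp
  qed
  have fr1: "fresh_from ?b s1" using M(2) t1 by (simp add: fresh_from_def)
  have L1: "words s1 ''L'' 0 \<le> q * (q * (q + 1))" using 3(2) by blast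
  have bb: "?b \<le> b + 2 * (q * q)" by simp
  show ?case
  proof (rule wp_conseq[OF settle_block_wp[OF i1 L1 W(2) k W(1) bb bd fr1]], goal_cases)
    case (1 \<tau>2 s2)
    have sb: "same_below ?b s s2" using 1(2) t1 by (simp add: same_below_def)
    have new: "entry s2 g \<in> set (lines s1)" if "?b \<le> g" "0 < words s2 ''tv'' g" for g using 1(2) that by blast
    have opt: "0 < words s2 ''tv'' (fst x) \<and> val (entry s2 (fst x)) \<le> val x" if cyc "x \<in> set (lines s1)" for x using 1(2) that by blast
    have wk: "\<exists>es. es \<noteq> [] \<and> walk_at s2 (?b + (i * q + k)) (hs i) es (hs k)" if ik: "i < q" "k < q" "0 < words s2 ''tv'' (?b + (i * q + k))" for i k
    proof -
      let ?g = "?b + (i * q + k)"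
      have "entry s2 ?g \<in> set (lines s1)" using new ik(3) by simp
      then obtain i' k' where x: "i' < q" "k' < q" "(\<exists>z<q. entry s2 ?g \<in> join_cand s (?b + (i' * q + k')) (b + (i' * q + z)) (b + (z * q + k'))) \<or>
        entry s2 ?g \<in> copy_cand s (?b + (i' * q + k')) (b + (i' * q + k'))" unfolding A by blast
      then have "fst (entry s2 ?g) = ?b + (i' * q + k')" using gx by blast
      then have "?g = ?b + (i' * q + k')" by (simp add: entry_def)
      from mat_index[OF this ik(2) x(2)] have e: "i' = i" "k' = k" by simp_all
      from x(3)[unfolded e] show ?thesis
      proof
        assume "\<exists>z<q. entry s2 ?g \<in> join_cand s ?g (b + (i * q + z)) (b + (z * q + k))"
        then obtain z where z: "z < q" "0 < words s ''tv'' (b + (i * q + z))" "0 < words s ''tv'' (b + (z * q + k))"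
          "entry s2 ?g = (?g, reals s ''tc'' (b + (i * q + z)) + reals s ''tc'' (b + (z * q + k)), reals s ''tt'' (b + (i * q + z)) + reals s ''tt'' (b + (z * q + k)), 0)"
          by (auto simp: join_cand_def split: if_splits)
        from mat_walk[OF M(1) ik(1) z(1,2)] obtain es where e1: "es \<noteq> []" "walk_at s (b + (i * q + z)) (hs i) es (hs z)" .
        from mat_walk[OF M(1) z(1) ik(2) z(3)] obtain es' where e2: "walk_at s (b + (z * q + k)) (hs z) es' (hs k)" .
        note es = e1 e2
        have "walk_at s2 ?g (hs i) (es @ es') (hs k)" using es using z(4) by (auto simp: entry_def walk_at_def walk_append)
        then show ?thesis using es(1) by (intro exI[of _ "es @ es'"]) simp
      next
        assume "entry s2 ?g \<in> copy_cand s ?g (b + (i * q + k))"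
        then have z: "0 < words s ''tv'' (b + (i * q + k))" "entry s2 ?g = (?g, reals s ''tc'' (b + (i * q + k)), reals s ''tt'' (b + (i * q + k)), 0)"
          by (auto simp: copy_cand_def split: if_splits)
        from mat_walk[OF M(1) ik(1,2) z(1)] obtain es where es: "es \<noteq> []" "walk_at s (b + (i * q + k)) (hs i) es (hs k)" .
        then have "walk_at s2 ?g (hs i) es (hs k)" using z(2) by (simp add: entry_def walk_at_def)
        then show ?thesis using es(1) by blast
      qed
    qed
    have tg: "tight_at s2 (?b + (i * q + k)) (hs i) (hs k)" if ik: "i < q" "k < q" and cy: cyc and l: "l \<in> {1..r * 2}" "(i, k) \<in> R ^^ l" for i k l
    proof -
      let ?g = "?b + (i * q + k)"
      have "\<exists>x \<in> set (lines s1). fst x = ?g \<and> val x = p (hs k) - p (hs i)"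
      proof (cases "l \<le> r")
        case True
        have T: "tight_at s (b + (i * q + k)) (hs i) (hs k)" by (rule mat_tight[OF M(1) ik cy l(2)]) (use l(1) True in auto)
        let ?x = "(?g, reals s ''tc'' (b + (i * q + k)), reals s ''tt'' (b + (i * q + k)), 0)"
        have "?x \<in> copy_cand s ?g (b + (i * q + k))" using T by (simp add: copy_cand_def tight_at_def)
        then have "?x \<in> set (lines s1)" unfolding A using ik by blast
        then show ?thesis using T by (intro bexI[of _ ?x]) (auto simp: tight_at_def val_def entry_def)
      next
        case False
        \<comment> \<open>More than \<open>r\<close> hops split into \<open>r\<close> hops and a
          rest of 1 to \<open>r\<close>. As the rest is nonempty, the vertex \<open>z\<close>
          between them lies in the domain of \<open>R\<close> and is a valid index.\<close>
        define l' where "l' = l - r"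
        have l': "l = r + l'" "1 \<le> l'" "l' \<le> r" using False l(1) by (simp_all add: l'_def)
        from l(2) obtain z where z: "(i, z) \<in> R ^^ r" "(z, k) \<in> R ^^ l'" unfolding l'(1) relpow_add by auto
        from l'(2) obtain l0 where "l' = Suc l0" by (cases l') auto
        from relpow_Suc_D2[OF z(2)[unfolded this]] have "\<exists>y. (z, y) \<in> R" by blast
        then have zq: "z < q" using R by blast
        have T: "tight_at s (b + (i * q + z)) (hs i) (hs z)" "tight_at s (b + (z * q + k)) (hs z) (hs k)"
          by (rule mat_tight[OF M(1) ik(1) zq cy z(1) r order_refl], rule mat_tight[OF M(1) zq ik(2) cy z(2) l'(2,3)])
        let ?x = "(?g, reals s ''tc'' (b + (i * q + z)) + reals s ''tc'' (b + (z * q + k)), reals s ''tt'' (b + (i * q + z)) + reals s ''tt'' (b + (z * q + k)), 0)"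
        have "?x \<in> join_cand s ?g (b + (i * q + z)) (b + (z * q + k))" using T by (simp add: join_cand_def tight_at_def)
        then have "?x \<in> set (lines s1)" unfolding A using ik zq by blast
        then show ?thesis using T by (intro bexI[of _ ?x]) (auto simp: tight_at_def val_def entry_def algebra_simps)
      qed
      then obtain x where x: "x \<in> set (lines s1)" "fst x = ?g" "val x = p (hs k) - p (hs i)" by blast
      from opt[OF cy x(1)] x have o: "0 < words s2 ''tv'' ?g" "val (entry s2 ?g) \<le> p (hs k) - p (hs i)" by simp_all
      from wk[OF ik o(1)] walk_at_ge o show ?thesis unfolding tight_at_def by force
    qed
    have "mat R hs q ?b (r * 2) s2" unfolding mat_def using wk tg by blast
    moreover have "\<tau>1 + \<tau>2 \<le> 8000 * ((k + 1) * ((q + 1) * ((q + 1) * (q + 1)) + (N + 1) * (m + 1)))"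
    proof -
      let ?Q = "(q + 1) * ((q + 1) * (q + 1))" let ?B = "(N + 1) * (m + 1)"
      have "q * (q * (q + 1)) + 1 \<le> ?Q" by (simp add: algebra_simps)
      then have "(k + 1) * (q * (q * (q + 1)) + 1 + ?B) \<le> (k + 1) * (?Q + ?B)" by (intro mult_le_mono2) simp
      moreover have "1 * ?Q \<le> (k + 1) * (?Q + ?B)" by (intro mult_le_mono) auto
      moreover have "\<tau>1 \<le> 400 * ?Q" "\<tau>2 \<le> 7000 * ((k + 1) * (q * (q * (q + 1)) + 1 + ?B))" using 3(2) 1(2) by blast+
      ultimately show ?thesis using cost_sum by blast
    qed
    ultimately show ?case using sb 1(2) by blast
  qed
qed (use W in auto)

definition matrix :: com where
  "matrix = ''mb'' ::= WMul (WMul (WAdd (V ''h'') (WLit 1)) (V ''N'')) (V ''N'') ;; (first ;; settle) ;; ''pw'' ::= WLit 1 ;;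
     While (WLess (V ''pw'') (V ''q'')) ((square ;; settle) ;; ''mb'' ::= next_mb ;; ''pw'' ::= WMul (V ''pw'') (WLit 2))"

lemma wmod_matrix [simp]: "wmod matrix = {''mb'', ''pw'', ''z'', ''i'', ''k'', ''j'', ''go'', ''rk'', ''pend'', ''p'', ''dead'', ''pa'', ''pb'', ''tr'', ''sa'', ''sk'', ''bv'', ''br'', ''be'', ''ok'', ''w'', ''lg'', ''lp'', ''L'', ''tv'', ''tp''}"
    "rmod matrix = {''xs'', ''x'', ''d'', ''la'', ''lb'', ''tc'', ''tt''}"
  by (auto simp: matrix_def)

lemma mat_same_tables:
  "words s' ''tv'' = words s ''tv'' \<Longrightarrow> entry s' = entry s \<Longrightarrow> mat R hs q b r s \<Longrightarrow> mat R hs q b r s'"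
  unfolding mat_def walk_at_def tight_at_def by (metis entry_eqD)

lemma hop_sub: "hop s h hs q \<subseteq> {..<q} \<times> {..<q}"
  by (auto simp: hop_def)

text \<open>Chains of \<open>q\<close> hops are enough, since \<open>tight_core\<close> supplies a
  closed one of at most that length. The number of hops doubles with each squaring, so at most
  \<open>\<kappa>\<close> squarings are made, each in a block of its own.\<close>

lemma matrix_wp:
  assumes i: "inp s" and q: "words s ''q'' 0 = q" "words s ''h'' 0 = h" "words s ''hs'' = hs" and \<kappa>: "q \<le> 2 ^ \<kappa>" "2 * q + 1 \<le> W"
    and W: "(h + 1) * N * N + (\<kappa> + 2) * (q * q) \<le> W" "2 * (q * (q * h)) + 2 \<le> W" "2 * (q * (q * (q + 1))) + 2 \<le> W" "h \<le> W"
    and k: "q * (q * h) \<le> 2 ^ k" "q * (q * (q + 1)) \<le> 2 ^ k"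
    and lev: "levels h s" "fresh_from ((h + 1) * N * N) s" and hs: "\<And>i. i < q \<Longrightarrow> hs i < N"
  shows "wp W matrix (\<lambda>\<tau> s'. \<tau> \<le> 10000 * ((\<kappa> + 2) * ((k + 1) * ((q + 1) * ((q + 1) * (q + h + 1)) + (N + 1) * (m + 1)))) \<and>
     same_below ((h + 1) * N * N) s s' \<and> (\<exists>r\<ge>q. mat (hop s h hs q) hs q (words s' ''mb'' 0) r s')) s"
proof -
  let ?base = "(h + 1) * N * N" let ?R = "hop s h hs q"
  define X where "X = (k + 1) * ((q + 1) * ((q + 1) * (q + h + 1)) + (N + 1) * (m + 1))"
  have X1: "1 * (1 * (1 * 1) + 0) \<le> X" unfolding X_def by (intro mult_le_mono add_mono) auto
  have Xa: "(k + 1) * ((q + 1) * ((q + 1) * (h + 1)) + (N + 1) * (m + 1)) \<le> X" unfolding X_def by (intro mult_le_mono2 add_mono order_refl) simp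
  have Xb: "(k + 1) * ((q + 1) * ((q + 1) * (q + 1)) + (N + 1) * (m + 1)) \<le> X" unfolding X_def by (intro mult_le_mono2 add_mono order_refl) simp
  define s1 where "s1 = s\<lparr>words := (words s)(''mb'' := (words s ''mb'')(0 := ?base))\<rparr>"
  have i1: "inp s1" using i by (simp add: s1_def inp_def)
  have q1: "words s1 ''q'' 0 = q" "words s1 ''mb'' 0 = ?base" "words s1 ''h'' 0 = h" "words s1 ''hs'' = hs" using q by (simp_all add: s1_def)
  have t1: "words s1 ''tv'' = words s ''tv''" "entry s1 = entry s" by (simp_all add: s1_def entry_def fun_eq_iff)
  have sb1: "same_below ?base s s1" using t1 by (simp add: same_below_def)
  have lev1: "levels h s1" by (rule levels_same[OF sb1 order_refl lev(1)])
  have fr1: "fresh_from ?base s1" using lev(2) t1 by (simp add: fresh_from_def)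
  have R1: "hop s1 h hs q = ?R" using t1 by (simp add: hop_def tight_at_def)
  have W1: "?base + q * q \<le> W" "q \<le> W" using W(1) \<kappa>(2) by simp_all
  let ?P = "(square ;; settle) ;; ''mb'' ::= next_mb ;; ''pw'' ::= WMul (V ''pw'') (WLit 2)"
  have F: "wp W (first ;; settle) (\<lambda>\<tau> s'. \<tau> \<le> 8000 * X \<and> same_below ?base s s' \<and> fresh_from (?base + q * q) s' \<and> mat ?R hs q ?base 1 s') s1"
  proof (rule wp_conseq[OF first_step_wp[OF i1 q1 W1(1) W(2) W1(2) W(4) k(1) lev1 fr1 order_refl hs]], goal_cases)
    case (2 \<tau> s')
    then have "\<tau> \<le> 8000 * X" using Xa by (meson le_trans mult_le_mono2)
    then show ?case using 2(2) sb1 R1 by (simp add: same_below_def)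
  qed
  have L: "wp W (While (WLess (V ''pw'') (V ''q'')) ?P) (\<lambda>\<tau> s'. \<tau> \<le> \<kappa> * (8000 * X + 50) + 10 \<and> same_below ?base s s' \<and> (\<exists>r\<ge>q. mat ?R hs q (words s' ''mb'' 0) r s')) s3"
    if s3: "inp s3" "words s3 ''q'' 0 = q" "words s3 ''mb'' 0 = ?base" "words s3 ''pw'' 0 = 1" "same_below ?base s s3" "fresh_from (?base + q * q) s3" "mat ?R hs q ?base 1 s3" for s3
  proof (rule wp_while[where \<mu> = "\<lambda>s. q - words s ''pw'' 0" and Inv = "\<lambda>\<tau> s'. \<exists>it\<le>\<kappa>. words s' ''pw'' 0 = 2 ^ it \<and> words s' ''mb'' 0 = ?base + it * (q * q) \<and>
      mat ?R hs q (words s' ''mb'' 0) (2 ^ it) s' \<and> fresh_from (words s' ''mb'' 0 + q * q) s' \<and> same_below ?base s s' \<and> \<tau> \<le> it * (8000 * X + 50)"], goal_cases)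
    case 1
    show ?case using s3 by (intro exI[of _ 0]) simp
  next
    case (2 \<tau> s4)
    then obtain it where it: "it \<le> \<kappa>" "words s4 ''pw'' 0 = 2 ^ it" "words s4 ''mb'' 0 = ?base + it * (q * q)"
      "mat ?R hs q (words s4 ''mb'' 0) (2 ^ it) s4" "fresh_from (words s4 ''mb'' 0 + q * q) s4" "same_below ?base s s4" "\<tau> \<le> it * (8000 * X + 50)" by blast
    have i4: "inp s4" by (rule inp_frm[OF s3(1) 2(1)]) simp_all
    have q4: "words s4 ''q'' 0 = q" using 2(1) s3(2) by (simp add: frm_def)
    have lt: "2 ^ it < q" using 2(3) it(2) q4 by simp
    then have "(2::nat) ^ it < 2 ^ \<kappa>" using \<kappa>(1) by linarith
    then have itk: "it < \<kappa>" by (rule power_less_imp_less_exp[rotated]) simp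
    let ?b = "words s4 ''mb'' 0"
    have "(it + 2) * (q * q) \<le> (\<kappa> + 2) * (q * q)" using it(1) by (intro mult_le_mono1) simp
    then have "?base + (it + 2) * (q * q) \<le> W" using W(1) by (meson add_left_mono le_trans)
    moreover have "?b + 2 * (q * q) = ?base + (it + 2) * (q * q)" by (simp only: it(3) distrib_right add.assoc)
    ultimately have bW: "?b + 2 * (q * q) \<le> W" by simp
    have one: "1 \<le> (2::nat) ^ it" by simp
    have "?base \<le> ?b + q * q" using it(3) by simp
    show ?case
    proof (rule wp_seq[OF square_step_wp[OF i4 q4 refl bW W(3) W1(2) k(2) it(4,5) hop_sub one]], goal_cases)
      case (1 \<tau>1 s5)
      have r5: "words s5 ''q'' 0 = q" "words s5 ''mb'' 0 = ?b" "words s5 ''pw'' 0 = 2 ^ it" using 1(1) q4 it(2) by (simp_all add: frm_def)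
      define s6 where "s6 = s5\<lparr>words := (words s5)(''mb'' := (words s5 ''mb'')(0 := ?b + q * q), ''pw'' := (words s5 ''pw'')(0 := 2 ^ it * 2))\<rparr>"
      have t6: "words s6 ''tv'' = words s5 ''tv''" "entry s6 = entry s5" by (simp_all add: s6_def entry_def fun_eq_iff)
      have v6: "words s6 ''mb'' 0 = ?b + q * q" "words s6 ''pw'' 0 = 2 ^ Suc it" by (simp_all add: s6_def)
      have m6: "mat ?R hs q (?b + q * q) (2 ^ Suc it) s6" using mat_same_tables[OF t6] 1(2) by (simp add: mult.commute)
      have f6: "fresh_from (?b + q * q + q * q) s6" using 1(2) t6 by (simp add: fresh_from_def)
      have sb6: "same_below ?base s s6" using it(6) 1(2) t6 \<open>?base \<le> ?b + q * q\<close> by (simp add: same_below_def)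
      have "\<tau>1 \<le> 8000 * X" using 1(2) Xb by (meson le_trans mult_le_mono2)
      then have tm: "\<tau> + (22 + \<tau>1) \<le> Suc it * (8000 * X + 50)" using it(7) by simp
      have b6: "?b + q * q = ?base + Suc it * (q * q)" using it(3) by simp
      have J: "\<exists>it'\<le>\<kappa>. words s6 ''pw'' 0 = 2 ^ it' \<and> words s6 ''mb'' 0 = ?base + it' * (q * q) \<and>
         mat ?R hs q (words s6 ''mb'' 0) (2 ^ it') s6 \<and> fresh_from (words s6 ''mb'' 0 + q * q) s6 \<and> same_below ?base s s6 \<and> \<tau> + (22 + \<tau>1) \<le> it' * (8000 * X + 50)"
        using itk v6 m6 f6 sb6 tm b6 by (intro exI[of _ "Suc it"]) (simp del: power_Suc mult_Suc)
      have dec: "q - 2 ^ Suc it < q - 2 ^ it" by (rule diff_less_mono2[OF _ lt]) simp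
      have "2 ^ it * 2 \<le> W" using lt \<kappa>(2) by linarith
      then have U: "wp W (''mb'' ::= next_mb ;; ''pw'' ::= WMul (V ''pw'') (WLit 2)) (\<lambda>t s'. t = 16 \<and> s' = s6) s5"
        using r5 bW q4 by (simp add: next_mb_def s6_def)
      show ?case
      proof (rule wp_conseq[OF U], goal_cases)
        case (1 t s')
        have e: "\<tau> + (1 + bcost (WLess (V ''pw'') (V ''q'')) + (\<tau>1 + t)) = \<tau> + (22 + \<tau>1)" using 1(2) by simp
        show ?case unfolding e using 1(2) J dec v6(2) it(2) by metis
      qed
    qed
  next
    case (3 \<tau> s4)
    then obtain it where it: "it \<le> \<kappa>" "words s4 ''pw'' 0 = 2 ^ it" "mat ?R hs q (words s4 ''mb'' 0) (2 ^ it) s4" "same_below ?base s s4" "\<tau> \<le> it * (8000 * X + 50)" by blast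
    have q4: "words s4 ''q'' 0 = q" using 3(1) s3(2) by (simp add: frm_def)
    have "q \<le> 2 ^ it" using 3(3) q4 it(2) by simp
    moreover have "it * (8000 * X + 50) \<le> \<kappa> * (8000 * X + 50)" using it(1) by (rule mult_le_mono1)
    moreover have "\<tau> \<le> \<kappa> * (8000 * X + 50)" by (rule le_trans[OF it(5) mult_le_mono1[OF it(1)]])
    moreover have "1 + bcost (WLess (V ''pw'') (V ''q'')) \<le> 10" by simp
    ultimately have "\<tau> + (1 + bcost (WLess (V ''pw'') (V ''q''))) \<le> \<kappa> * (8000 * X + 50) + 10" by (intro add_mono)
    then show ?case using it(3,4) \<open>q \<le> 2 ^ it\<close> by blast
  qed
  have "wp W ((first ;; settle) ;; ''pw'' ::= WLit 1 ;; While (WLess (V ''pw'') (V ''q'')) ?P) (\<lambda>\<tau> s'. 12 + \<tau> \<le> 10000 * ((\<kappa> + 2) * X) \<and>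
     same_below ?base s s' \<and> (\<exists>r\<ge>q. mat ?R hs q (words s' ''mb'' 0) r s')) s1"
  proof (rule wp_seq[OF F], goal_cases)
    case (1 \<tau>1 s2)
    define s3 where "s3 = s2\<lparr>words := (words s2)(''pw'' := (words s2 ''pw'')(0 := 1))\<rparr>"
    have t3: "words s3 ''tv'' = words s2 ''tv''" "entry s3 = entry s2" by (simp_all add: s3_def entry_def fun_eq_iff)
    have i2: "inp s2" by (rule inp_frm[OF i1 1(1)]) simp_all
    have "inp s3" using i2 by (simp add: s3_def inp_def)
    moreover have "words s3 ''q'' 0 = q" "words s3 ''mb'' 0 = ?base" "words s3 ''pw'' 0 = 1" using 1(1) q1 by (simp_all add: frm_def s3_def)
    moreover have "same_below ?base s s3" "fresh_from (?base + q * q) s3" using 1(2) t3 by (simp_all add: same_below_def fresh_from_def)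
    moreover have "mat ?R hs q ?base 1 s3" using mat_same_tables[OF t3] 1(2) by blast
    ultimately have "wp W (While (WLess (V ''pw'') (V ''q'')) ?P) (\<lambda>\<tau> s'. \<tau> \<le> \<kappa> * (8000 * X + 50) + 10 \<and> same_below ?base s s' \<and> (\<exists>r\<ge>q. mat ?R hs q (words s' ''mb'' 0) r s')) s3" by (rule L)
    then have "wp W (While (WLess (V ''pw'') (V ''q'')) ?P) (\<lambda>\<tau> s'. 12 + (\<tau>1 + (3 + \<tau>)) \<le> 10000 * ((\<kappa> + 2) * X) \<and> same_below ?base s s' \<and> (\<exists>r\<ge>q. mat ?R hs q (words s' ''mb'' 0) r s')) s3"
    proof (rule wp_conseq, goal_cases)
      case (1 \<tau> s')
      have a: "\<tau>1 \<le> 8000 * X" "\<tau> \<le> \<kappa> * (8000 * X + 50) + 10" using \<open>\<tau>1 \<le> 8000 * X \<and> _\<close> 1(2) by blast+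
      define Y where "Y = \<kappa> * X"
      have "8000 * X + 50 \<le> 8050 * X" using X1 by simp
      then have "\<kappa> * (8000 * X + 50) \<le> \<kappa> * (8050 * X)" by (rule mult_le_mono2)
      also have "\<dots> = 8050 * Y" by (simp add: Y_def)
      finally have "\<kappa> * (8000 * X + 50) + 10 \<le> 8050 * Y + 10" by (rule add_le_mono1)
      then have b: "\<tau> \<le> 8050 * Y + 10" by (rule le_trans[OF a(2)])
      have "10000 * ((\<kappa> + 2) * X) = 10000 * Y + 20000 * X" by (simp add: Y_def algebra_simps)
      then have "12 + (\<tau>1 + (3 + \<tau>)) \<le> 10000 * ((\<kappa> + 2) * X)" using a(1) b X1 by simp
      then show ?case using 1(2) by blast
    qed
    then show ?case using one_le_W by (simp add: s3_def)
  qed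
  moreover have "?base \<le> W" "words s ''N'' 0 = N" using W(1) i by (simp_all add: inp_def)
  ultimately show ?thesis unfolding matrix_def X_def[symmetric] using q by (simp add: s1_def)
qed

end

section \<open>The minimum ratio\<close>

context mrc_ram begin

text \<open>The value of the cell is that of a walk plus the cost of an arc, and each term is at
  least the corresponding difference of potentials. If the sum meets its bound, so do both
  terms.\<close>

lemma tight_pred:
  assumes lev: "levels h s" and uv: "u < N" "v < N" "tight_at s (idx i u v) u v" and i: "0 < i" "i \<le> h"
  shows "tight (sr (words s ''tp'' (idx i u v))) [words s ''tp'' (idx i u v)] v \<and> sr (words s ''tp'' (idx i u v)) < N \<and>
    tight_at s (idx (i - 1) u (sr (words s ''tp'' (idx i u v)))) u (sr (words s ''tp'' (idx i u v)))"
proof -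
  let ?e = "words s ''tp'' (idx i u v)"
  have tv: "0 < words s ''tv'' (idx i u v)" "val (entry s (idx i u v)) = p v - p u" using uv(3) by (simp_all add: tight_at_def)
  have "cell s i u v" using lev uv(1,2) i(2) by (simp add: levels_def)
  then have e: "?e < m" "ds ?e = v" "0 < words s ''tv'' (idx (i - 1) u (sr ?e))"
    "val (entry s (idx i u v)) = val (entry s (idx (i - 1) u (sr ?e))) + (c ?e - lam * t ?e)"
    using tv(1) i(1) unfolding cell_def Let_def by blast+
  have sN: "sr ?e < N" by (rule sr_less[OF e(1)])
  have "cell s (i - 1) u (sr ?e)" using lev uv(1) sN i by (simp add: levels_def)
  then obtain es where "walk_at s (idx (i - 1) u (sr ?e)) u es (sr ?e)" using e(3) unfolding cell_def Let_def by blast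
  then have "p (sr ?e) - p u \<le> val (entry s (idx (i - 1) u (sr ?e)))" by (rule walk_at_ge)
  moreover have "p (ds ?e) \<le> p (sr ?e) + (c ?e - lam * t ?e)" using feas e(1) by (simp add: feasible_def)
  ultimately have "val (entry s (idx (i - 1) u (sr ?e))) = p (sr ?e) - p u" "c ?e - lam * t ?e = p v - p (sr ?e)"
    using tv(2) e(2,4) by simp_all
  then show ?thesis using e sN by (simp add: tight_at_def tight_def)
qed

lemma tr_tight:
  assumes lev: "levels h s" and uv: "u < N" "v < N" "tight_at s (idx h u v) u v" and j: "j \<le> h"
  shows "tr (words s ''tp'') h u v j < N \<and> tight_at s (idx (h - j) u (tr (words s ''tp'') h u v j)) u (tr (words s ''tp'') h u v j)"
  using j
proof (induction j)
  case 0
  then show ?case using uv by simp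
next
  case (Suc j)
  then have IH: "tr (words s ''tp'') h u v j < N" "tight_at s (idx (h - j) u (tr (words s ''tp'') h u v j)) u (tr (words s ''tp'') h u v j)" "0 < h - j" "h - j \<le> h" by auto
  have "h - Suc j = h - j - 1" by simp
  then show ?case using tight_pred[OF lev uv(1) IH] by (simp only: tr.simps)
qed

text \<open>Instance of \<open>tight_core\<close> in which \<open>E\<close> is tightness of a cell
  and \<open>tr\<close> follows the recorded last arcs.\<close>

lemma tight_loop:
  assumes cyc and lev: "levels h s" and h: "1 \<le> h" and hs: "\<And>i. i < q \<Longrightarrow> hs i < N"
    and hit: "\<And>u v. u < N \<Longrightarrow> v < N \<Longrightarrow> 0 < words s ''tv'' (idx h u v) \<Longrightarrow> inj_on (tr (words s ''tp'') h u v) {..<h} \<Longrightarrow>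
      \<exists>j<h. \<exists>i<q. tr (words s ''tp'') h u v j = hs i"
  shows "(\<exists>l\<in>{1..h}. \<exists>v<N. tight_at s (idx l v v) v v) \<or> (\<exists>i<q. \<exists>k\<in>{1..q}. (i, i) \<in> hop s h hs q ^^ k)"
  unfolding hop_def
proof (rule tight_core[where E = "\<lambda>l u v. tight_at s (idx l u v) u v" and tr = "tr (words s ''tp'') h", OF assms(1)], goal_cases)
  case (1 l u v es)
  have "v < N" using 1(2,3) walk_end_less[of u es v] by (cases "es = []") (auto simp: tight_def)
  then have "cell s l u v" using lev 1(1,2) by (simp add: levels_def)
  then show ?case using assms(1) 1(3,4) unfolding cell_def Let_def by blast
next
  case (3 u v j)
  then show ?case using tr_tight[OF lev] by blast
next
  case (4 u v j)
  have a: "tr (words s ''tp'') h u v j < N" "tight_at s (idx (h - j) u (tr (words s ''tp'') h u v j)) u (tr (words s ''tp'') h u v j)"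
    using tr_tight[OF lev 4(1-3), of j] 4(4) by simp_all
  have "0 < h - j" "h - j \<le> h" using 4(4) by auto
  from tight_pred[OF lev 4(1) a this] show ?case by (auto simp: tr.simps)
next
  case (5 u v)
  have "0 < words s ''tv'' (idx h u v)" using 5(3) by (simp add: tight_at_def)
  then show ?case by (rule hit[OF 5(1,2) _ 5(4)])
qed (use h hs in auto)

section \<open>The minimum of the diagonal entries\<close>

definition ratios :: "store \<Rightarrow> nat \<Rightarrow> real set" where
  "ratios s g = (if 0 < words s ''tv'' g then {reals s ''tc'' g / reals s ''tt'' g} else {})"

text \<open>The flag \<open>has\<close> is needed because no real number can stand for the minimum
  of the empty set.\<close>

definition best :: "store \<Rightarrow> real set \<Rightarrow> bool" where
  "best s B \<longleftrightarrow> (if words s ''has'' 0 = 0 then B = {} else reals s ''x'' 0 \<in> B \<and> (\<forall>b\<in>B. reals s ''x'' 0 \<le> b))"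

lemma bestD:
  assumes "best s B"
  shows "words s ''has'' 0 \<noteq> 0 \<Longrightarrow> reals s ''x'' 0 \<in> B" and "b \<in> B \<Longrightarrow> 0 < words s ''has'' 0 \<and> reals s ''x'' 0 \<le> b"
  using assms by (auto simp: best_def split: if_splits)

definition improve :: "wexp \<Rightarrow> com" where
  "improve g = Cond (WLess (WLit 0) (WCell ''tv'' g))
     (Cond (BAnd (WLess (WLit 0) (V ''has'')) (BNot (RLess (RDiv (RCell ''tc'' g) (RCell ''tt'' g)) (RV ''x'')))) Skip
       (RAssign ''x'' (WLit 0) (RDiv (RCell ''tc'' g) (RCell ''tt'' g)) ;; ''has'' ::= WLit 1)) Skip"

lemma wmod_improve [simp]: "wmod (improve g) = {''has''}" "rmod (improve g) = {''x''}"
  by (auto simp: improve_def)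

lemma best_insert:
  assumes "best s B" and "b = reals s ''tc'' g / reals s ''tt'' g"
  shows "0 < words s ''has'' 0 \<and> \<not> b < reals s ''x'' 0 \<Longrightarrow> best s (B \<union> {b})"
    and "\<not> (0 < words s ''has'' 0 \<and> \<not> b < reals s ''x'' 0) \<Longrightarrow> words s' ''has'' 0 = 1 \<Longrightarrow> reals s' ''x'' 0 = b \<Longrightarrow> best s' (B \<union> {b})"
  using assms unfolding best_def by (auto split: if_splits simp: not_less intro: less_imp_le)

lemma improve_wp:
  assumes b: "best s B"
  shows "wp W (improve g) (\<lambda>\<tau> s'. \<tau> \<le> 40 + 5 * wcost g \<and> best s' (B \<union> ratios s (wval s g))) s"
proof (cases "0 < words s ''tv'' (wval s g)")
  case False
  then show ?thesis using b by (simp add: improve_def ratios_def)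
next
  case True
  let ?b = "reals s ''tc'' (wval s g) / reals s ''tt'' (wval s g)"
  show ?thesis
  proof (cases "0 < words s ''has'' 0 \<and> \<not> ?b < reals s ''x'' 0")
    case t: True
    then show ?thesis using True best_insert(1)[OF b refl t] by (simp add: improve_def ratios_def)
  next
    case f: False
    define s' where "s' = s\<lparr>reals := (reals s)(''x'' := (reals s ''x'')(0 := ?b)), words := (words s)(''has'' := (words s ''has'')(0 := 1))\<rparr>"
    have "best s' (B \<union> {?b})" by (rule best_insert(2)[OF b refl f]) (simp_all add: s'_def)
    then show ?thesis using True f one_le_W unfolding improve_def ratios_def s'_def by (auto simp: not_less)
  qed
qed

definition scan_walks :: com where
  "scan_walks = For ''j'' (V ''h'') (For ''v'' (V ''N'') (improve (W3 (V ''N'') (WAdd (V ''j'') (WLit 1)) (V ''v'') (V ''v''))))"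

definition scan_matrix :: com where
  "scan_matrix = For ''i'' (V ''q'') (improve (mat_ix (V ''mb'') (V ''i'') (V ''i'')))"

definition scan :: com where "scan = ''has'' ::= WLit 0 ;; scan_walks ;; scan_matrix"

lemma wmod_scan [simp]: "wmod scan_walks = {''j'', ''v'', ''has''}" "rmod scan_walks = {''x''}"
    "wmod scan_matrix = {''i'', ''has''}" "rmod scan_matrix = {''x''}" "wmod scan = {''j'', ''v'', ''i'', ''has''}" "rmod scan = {''x''}"
  by (auto simp: scan_walks_def scan_matrix_def scan_def)

lemma best_upd [simp]: "x \<noteq> ''has'' \<Longrightarrow> best (s\<lparr>words := (words s)(x := f)\<rparr>) B = best s B"
  by (simp add: best_def)

lemma ratios_frm: "words s' ''tv'' = words s ''tv'' \<Longrightarrow> reals s' ''tc'' = reals s ''tc'' \<Longrightarrow> reals s' ''tt'' = reals s ''tt'' \<Longrightarrow> ratios s' = ratios s"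
  by (simp add: ratios_def fun_eq_iff)

lemma scan_walks_wp:
  assumes i: "inp s" and h: "words s ''h'' 0 = h" "h \<le> W" and b: "best s {}"
  shows "wp W scan_walks (\<lambda>\<tau> s'. \<tau> \<le> 300 * ((h + 1) * (N + 1)) \<and> best s' (\<Union>j<h. \<Union>v<N. ratios s (idx (j + 1) v v))) s"
  unfolding scan_walks_def
proof (rule wp_for[where n = h and c = "(N + 1) * 160" and I = "\<lambda>k s'. best s' (\<Union>j<k. \<Union>v<N. ratios s (idx (j + 1) v v))"], goal_cases)
  case (5 k s1)
  let ?B = "\<Union>j<k. \<Union>v<N. ratios s (idx (j + 1) v v)"
  have r1: "ratios s1 = ratios s" by (rule ratios_frm) (use 5(2) in \<open>simp_all add: frm_def\<close>)
  have i1: "inp s1" by (rule inp_frm[OF i 5(2)]) simp_all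
  show ?case
  proof (rule wp_for[where n = N and c = 145 and I = "\<lambda>q s'. best s' (?B \<union> (\<Union>v<q. ratios s (idx (k + 1) v v)))"], goal_cases)
    case (3) then show ?case using 5(4) by simp
  next
    case (4 q s2) then show ?case using i1 by (simp add: frm_def inp_def)
  next
    case inner: (5 q s2)
    have r2: "ratios s2 = ratios s" using r1 ratios_frm[of s2 s1] inner(2) by (simp add: frm_def)
    have v: "words s2 ''N'' 0 = N" "words s2 ''j'' 0 = k" "words s2 ''v'' 0 = q" using inner(2,3) i1 5(3) by (simp_all add: frm_def inp_def)
    show ?case
    proof (rule wp_conseq[OF improve_wp[OF inner(4)]], goal_cases)
      case (1 \<tau> s3)
      have e: "wval s2 (W3 (V ''N'') (WAdd (V ''j'') (WLit 1)) (V ''v'') (V ''v'')) = idx (k + 1) q q" using v by (simp add: idx_def)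
      have "?B \<union> (\<Union>v<q. ratios s (idx (k + 1) v v)) \<union> ratios s2 (idx (k + 1) q q) = ?B \<union> (\<Union>v<Suc q. ratios s (idx (k + 1) v v))"
        by (simp only: r2 lessThan_Suc UN_insert Un_ac)
      then show ?case using 1(2) unfolding e by simp
    qed
  next
    case inner: (6 \<tau> s2)
    have "?B \<union> (\<Union>v<N. ratios s (idx (k + 1) v v)) = (\<Union>j<Suc k. \<Union>v<N. ratios s (idx (j + 1) v v))"
      by (simp only: lessThan_Suc UN_insert Un_ac)
    then show ?case using inner(3,4) by simp
  qed (use N_le_W in simp_all)
next
  case (6 \<tau> s')
  have "(N + 1) * 160 + wcost (V ''h'') + 10 \<le> 300 * (N + 1)" by simp
  then have "(h + 1) * ((N + 1) * 160 + wcost (V ''h'') + 10) \<le> (h + 1) * (300 * (N + 1))" by (rule mult_le_mono2)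
  also have "\<dots> = 300 * ((h + 1) * (N + 1))" by (simp only: mult.left_commute)
  finally show ?case using 6(3,4) le_trans by blast
qed (use h b in \<open>simp_all add: frm_def\<close>)

lemma scan_matrix_wp:
  assumes h: "words s ''q'' 0 = q" "words s ''mb'' 0 = mb" "q \<le> W" and b: "best s B"
  shows "wp W scan_matrix (\<lambda>\<tau> s'. \<tau> \<le> 150 * (q + 1) \<and> best s' (B \<union> (\<Union>i<q. ratios s (mb + (i * q + i))))) s"
  unfolding scan_matrix_def
proof (rule wp_for[where n = q and c = "110" and I = "\<lambda>k s'. best s' (B \<union> (\<Union>i<k. ratios s (mb + (i * q + i))))"], goal_cases)
  case (5 k s1)
  have r1: "ratios s1 = ratios s" by (rule ratios_frm) (use 5(2) in \<open>simp_all add: frm_def\<close>)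
  show ?case
  proof (rule wp_conseq[OF improve_wp[OF 5(4)]], goal_cases)
    case (1 \<tau> s3)
    have e: "wval s1 (mat_ix (V ''mb'') (V ''i'') (V ''i'')) = mb + (k * q + k)" using h 5(2,3) by (simp add: frm_def)
    have "B \<union> (\<Union>i<k. ratios s (mb + (i * q + i))) \<union> ratios s1 (mb + (k * q + k)) = B \<union> (\<Union>i<Suc k. ratios s (mb + (i * q + i)))"
      by (simp only: r1 lessThan_Suc UN_insert Un_ac)
    then show ?case using 1(2) unfolding e by simp
  qed
next
  case (6 \<tau> s')
  then show ?case by simp
qed (use h b in \<open>simp_all add: frm_def\<close>)

lemma ratio_of_walk:
  assumes "walk_at s g u es u" "es \<noteq> []" "0 < words s ''tv'' g"
  shows "ratios s g = {wt c es / wt t es}" "lam \<le> wt c es / wt t es" "cyc" "tight_at s g u u \<Longrightarrow> wt c es / wt t es = lam"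
proof -
  have w: "walk u es u" "reals s ''tc'' g = wt c es" "reals s ''tt'' g = wt t es" using assms(1) by (simp_all add: walk_at_def)
  show "ratios s g = {wt c es / wt t es}" using w assms(3) by (simp add: ratios_def)
  show cyc using w(1) assms(2) unfolding cyc_def by blast
  have pos: "0 < wt t es" by (rule tpos[OF w(1) assms(2)])
  show "lam \<le> wt c es / wt t es" using lam_le[OF w(1)] pos by (simp add: le_divide_eq)
  assume "tight_at s g u u"
  then have "tight u es u" using tight_at_walk assms(1) by blast
  then show "wt c es / wt t es = lam" using pos unfolding tight_closed_iff by (simp add: divide_eq_eq)
qed

text \<open>Filled diagonal entries are nonempty closed walks, so no ratio lies below
  \<open>lam\<close>, and a single entry already proves \<open>cyc\<close>. Under \<open>cyc\<close>
  some entry is tight by \<open>tight_loop\<close> and has ratio \<open>lam\<close>. Only at this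
  point does \<open>lam\<close> become a computed number.\<close>

lemma scan_wp:
  assumes i: "inp s" and h: "words s ''h'' 0 = h" "h \<le> W" "1 \<le> h" and q: "words s ''q'' 0 = q" "q \<le> W" and mb: "words s ''mb'' 0 = mb" and hs: "\<And>i. i < q \<Longrightarrow> hs i < N"
    and lev: "levels h s" and mat: "mat (hop s h hs q) hs q mb r s" "q \<le> r"
    and hit: "\<And>u v. u < N \<Longrightarrow> v < N \<Longrightarrow> 0 < words s ''tv'' (idx h u v) \<Longrightarrow> inj_on (tr (words s ''tp'') h u v) {..<h} \<Longrightarrow>
      \<exists>j<h. \<exists>i<q. tr (words s ''tp'') h u v j = hs i"
  shows "wp W scan (\<lambda>\<tau> s'. \<tau> \<le> 500 * ((h + 1) * (N + 1) + (q + 1)) \<and> words s' ''has'' 0 = (if cyc then words s' ''has'' 0 else 0) \<and>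
    (cyc \<longrightarrow> 0 < words s' ''has'' 0 \<and> reals s' ''x'' 0 = lam)) s"
proof -
  let ?B = "(\<Union>j<h. \<Union>v<N. ratios s (idx (j + 1) v v)) \<union> (\<Union>i<q. ratios s (mb + (i * q + i)))"
  have src: "\<exists>g u es. walk_at s g u es u \<and> es \<noteq> [] \<and> 0 < words s ''tv'' g \<and> b \<in> ratios s g" if "b \<in> ?B" for b
    using that
  proof
    assume "b \<in> (\<Union>j<h. \<Union>v<N. ratios s (idx (j + 1) v v))"
    then obtain j v where j: "j < h" "v < N" "b \<in> ratios s (idx (j + 1) v v)" by blast
    then have tv: "0 < words s ''tv'' (idx (j + 1) v v)" by (simp add: ratios_def split: if_splits)
    have "cell s (j + 1) v v" using lev j by (simp add: levels_def)
    then obtain es where "walk_at s (idx (j + 1) v v) v es v" "length es = j + 1" using tv unfolding cell_def Let_def by blast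
    then show ?thesis using tv j(3) by (intro exI[of _ "idx (j + 1) v v"] exI[of _ v] exI[of _ es]) auto
  next
    assume "b \<in> (\<Union>i<q. ratios s (mb + (i * q + i)))"
    then obtain i where i: "i < q" "b \<in> ratios s (mb + (i * q + i))" by blast
    then have tv: "0 < words s ''tv'' (mb + (i * q + i))" by (simp add: ratios_def split: if_splits)
    from mat_walk[OF mat(1) i(1) i(1) tv] obtain es where "es \<noteq> []" "walk_at s (mb + (i * q + i)) (hs i) es (hs i)" .
    then show ?thesis using tv i(2) by blast
  qed
  have ge: "lam \<le> b \<and> cyc" if "b \<in> ?B" for b
    using src[OF that] ratio_of_walk(1-3) by fastforce
  have hits: "lam \<in> ?B" if cyc
    using tight_loop[OF that lev h(3) hs hit]
  proof
    assume "\<exists>l\<in>{1..h}. \<exists>v<N. tight_at s (idx l v v) v v"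
    then obtain l v where l: "1 \<le> l" "l \<le> h" "v < N" "tight_at s (idx l v v) v v" by auto
    have "cell s l v v" "0 < words s ''tv'' (idx l v v)" using lev l by (simp_all add: levels_def tight_at_def)
    then obtain es where es: "walk_at s (idx l v v) v es v" "length es = l" "0 < words s ''tv'' (idx l v v)" unfolding cell_def Let_def by blast
    then have "es \<noteq> []" using l(1) by auto
    then have "lam \<in> ratios s (idx l v v)" using ratio_of_walk(1,4)[OF es(1) _ es(3)] l(4) by simp
    moreover have "l = (l - 1) + 1" "l - 1 < h" using l by auto
    ultimately show ?thesis using l(3) by (metis (no_types, lifting) UN_iff UnI1 lessThan_iff)
  next
    assume "\<exists>i<q. \<exists>k\<in>{1..q}. (i, i) \<in> hop s h hs q ^^ k"
    then obtain i k where i: "i < q" "1 \<le> k" "k \<le> q" "(i, i) \<in> hop s h hs q ^^ k" by auto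
    have "k \<le> r" using i(3) mat(2) by (rule le_trans)
    from mat_tight[OF mat(1) i(1) i(1) that i(4,2) this] have ta: "tight_at s (mb + (i * q + i)) (hs i) (hs i)" .
    then have tv: "0 < words s ''tv'' (mb + (i * q + i))" by (simp add: tight_at_def)
    from mat_walk[OF mat(1) i(1) i(1) tv] obtain es where es: "es \<noteq> []" "walk_at s (mb + (i * q + i)) (hs i) es (hs i)" .
    then have "lam \<in> ratios s (mb + (i * q + i))" using ratio_of_walk(1,4)[OF es(2,1) tv] ta by simp
    then show ?thesis using i(1) by blast
  qed
  define s1 where "s1 = s\<lparr>words := (words s)(''has'' := (words s ''has'')(0 := 0))\<rparr>"
  have i1: "inp s1" using i by (simp add: s1_def inp_def)
  have r1: "ratios s1 = ratios s" by (rule ratios_frm) (simp_all add: s1_def)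
  have h1: "words s1 ''h'' 0 = h" "best s1 {}" using h by (simp_all add: s1_def best_def)
  have "wp W (scan_walks ;; scan_matrix) (\<lambda>\<tau> s'. 3 + \<tau> \<le> 500 * ((h + 1) * (N + 1) + (q + 1)) \<and> words s' ''has'' 0 = (if cyc then words s' ''has'' 0 else 0) \<and>
    (cyc \<longrightarrow> 0 < words s' ''has'' 0 \<and> reals s' ''x'' 0 = lam)) s1"
  proof (rule wp_seq[OF scan_walks_wp[OF i1 h1(1) h(2) h1(2)]], goal_cases)
    case (1 \<tau>1 s2)
    have q2: "words s2 ''q'' 0 = q" "words s2 ''mb'' 0 = mb" using 1(1) q mb by (simp_all add: frm_def s1_def)
    have r2: "ratios s2 = ratios s" using r1 ratios_frm[of s2 s1] 1(1) by (simp add: frm_def)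
    show ?case
    proof (rule wp_conseq[OF scan_matrix_wp[OF q2 q(2) conjunct2[OF 1(2)]]], goal_cases)
      case fin: (1 \<tau>2 s3)
      have b: "best s3 ?B" using fin(2) unfolding r1 r2 by blast
      have "3 + (\<tau>1 + \<tau>2) \<le> 500 * ((h + 1) * (N + 1) + (q + 1))" using fin(2) 1(2) by simp
      moreover have "words s3 ''has'' 0 = 0" if "\<not> cyc"
        by (rule ccontr) (use bestD(1)[OF b] ge that in auto)
      moreover have "0 < words s3 ''has'' 0 \<and> reals s3 ''x'' 0 = lam" if cyc
        using bestD(2)[OF b hits[OF that]] bestD(1)[OF b] ge by force
      ultimately show ?case by simp
    qed
  qed
  then show ?thesis unfolding scan_def using one_le_W by (simp add: s1_def)
qed

end

section \<open>Reading off a cycle\<close>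

context mrc_ram begin

definition crit :: "nat \<Rightarrow> bool" where
  "crit v \<longleftrightarrow> (\<exists>es. walk v es v \<and> es \<noteq> [] \<and> wt c es = lam * wt t es)"

text \<open>Tightness of a single arc for a potential \<open>d\<close> computed by Bellman-Ford, in
  contrast to the potential \<open>p\<close> of the locale.\<close>

definition sharp :: "(nat \<Rightarrow> real) \<Rightarrow> nat \<Rightarrow> bool" where
  "sharp d e \<longleftrightarrow> e < m \<and> d (ds e) = d (sr e) + (c e - lam * t e)"

text \<open>Around a closed walk of value 0 the potential differences cancel, so the first arc meets
  its bound with equality; rotating the walk by this arc shows that its head is critical
  again.\<close>

lemma crit_succ:
  assumes f: "feasible (\<lambda>e. c e - lam * t e) d" and v: "crit v"
  shows "\<exists>e. sharp d e \<and> sr e = v \<and> crit (ds e)"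
proof -
  from v obtain es where es: "walk v es v" "es \<noteq> []" "wt c es = lam * wt t es" by (auto simp: crit_def)
  then obtain e fs where e: "es = e # fs" "e < m" "sr e = v" "walk (ds e) fs v" by (cases es) auto
  have "d v - d (ds e) \<le> wt (\<lambda>e. c e - lam * t e) fs" by (rule feasible_walk[OF f e(4)])
  moreover have "d (ds e) \<le> d (sr e) + (c e - lam * t e)" using f e(2) by (simp add: feasible_def)
  ultimately have "d (ds e) = d (sr e) + (c e - lam * t e)" using es(3) e(1,3) by (simp add: wt_diff algebra_simps)
  moreover have "walk (ds e) (fs @ [e]) (ds e)" using e by (simp add: walk_snoc)
  moreover have "wt c (fs @ [e]) = lam * wt t (fs @ [e])" using es(3) e(1) by (simp add: algebra_simps)
  ultimately show ?thesis using e by (intro exI[of _ e]) (auto simp: sharp_def crit_def)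
qed

lemma sharp_walk: "walk u es v \<Longrightarrow> (\<And>e. e \<in> set es \<Longrightarrow> sharp d e) \<Longrightarrow> wt c es - lam * wt t es = d v - d u"
proof (induction es arbitrary: u)
  case (Cons e es)
  then have "wt c es - lam * wt t es = d v - d (ds e)" by simp
  moreover have "sharp d e" "sr e = u" using Cons.prems by simp_all
  ultimately show ?case by (simp add: sharp_def algebra_simps)
qed simp

section \<open>Vertices that start long sharp walks\<close>

definition live :: wexp where "live = WAdd (WMul (V ''r'') (V ''N'')) (WCell ''hd'' (V ''e''))"
definition live' :: wexp where "live' = WAdd (WMul (WAdd (V ''r'') (WLit 1)) (V ''N'')) (WCell ''tl'' (V ''e''))"

definition live_arc :: com where
  "live_arc = Cond (BAnd (WLess (WLit 0) (WCell ''al'' live)) (BNot (RLess (RCell ''d'' (WCell ''hd'' (V ''e'')))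
      (RAdd (RCell ''d'' (WCell ''tl'' (V ''e''))) (RSub (RCell ''cost'' (V ''e'')) (RMul (RV ''x'') (RCell ''time'' (V ''e''))))))))
     (WAssign ''al'' live' (WAdd (V ''e'') (WLit 1))) Skip"

text \<open>Following sharp arcs blindly may run into a dead end. A vertex alive in row
  \<open>i\<close> starts a sharp walk of \<open>i\<close> arcs, and \<open>N\<close> arcs force a
  repetition of vertices. Critical vertices are alive in every row, so row \<open>N\<close> offers a
  start whenever a cycle exists.\<close>

definition rows :: com where
  "rows = For ''v'' (V ''N'') (WAssign ''al'' (V ''v'') (WLit 1)) ;; For ''r'' (V ''N'') (For ''e'' (V ''m'') live_arc)"

lemma wmod_rows [simp]: "wmod live_arc = {''al''}" "rmod live_arc = {}" "wmod rows = {''v'', ''r'', ''e'', ''al''}" "rmod rows = {}"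
  by (auto simp: live_arc_def rows_def)

text \<open>Row 0 of the array al is all ones; in a later row an entry is one more than the number of a sharp arc
  whose head is alive in the row before.\<close>

definition rows_upto :: "(nat \<Rightarrow> real) \<Rightarrow> nat \<Rightarrow> nat \<Rightarrow> (nat \<Rightarrow> nat) \<Rightarrow> bool" where
  "rows_upto d r k al \<longleftrightarrow> (\<forall>i\<le>r. \<forall>v<N. crit v \<longrightarrow> 0 < al (i * N + v)) \<and>
     (\<forall>i\<le>r. \<forall>v<N. 0 < al ((i + 1) * N + v) \<longrightarrow> sharp d (al ((i + 1) * N + v) - 1) \<and> sr (al ((i + 1) * N + v) - 1) = v \<and>
        0 < al (i * N + ds (al ((i + 1) * N + v) - 1))) \<and>
     (\<forall>e<k. sharp d e \<longrightarrow> crit (ds e) \<longrightarrow> 0 < al ((r + 1) * N + sr e)) \<and> (\<forall>g\<ge>(r + 2) * N. al g = 0)"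

lemma rows_uptoD:
  assumes "rows_upto d r k al"
  shows "i \<le> r \<Longrightarrow> v < N \<Longrightarrow> crit v \<Longrightarrow> 0 < al (i * N + v)"
    and "i \<le> r \<Longrightarrow> v < N \<Longrightarrow> 0 < al ((i + 1) * N + v) \<Longrightarrow> sharp d (al ((i + 1) * N + v) - 1) \<and> sr (al ((i + 1) * N + v) - 1) = v \<and>
        0 < al (i * N + ds (al ((i + 1) * N + v) - 1))"
    and "e < k \<Longrightarrow> sharp d e \<Longrightarrow> crit (ds e) \<Longrightarrow> 0 < al ((r + 1) * N + sr e)"
    and "(r + 2) * N \<le> g \<Longrightarrow> al g = 0"
  using assms unfolding rows_upto_def by blast+

lemma rows_step:
  assumes r: "rows_upto d r k al" and k: "k < m" and a: "0 < al (r * N + ds k)" "sharp d k"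
  shows "rows_upto d r (Suc k) (al((r + 1) * N + sr k := k + 1))"
proof -
  let ?g = "(r + 1) * N + sr k" let ?al = "al(?g := k + 1)"
  have pos: "0 < ?al g" if "0 < al g" for g using that by simp
  have s: "sr k < N" by (rule sr_less[OF k])
  have D: "?al g = 0" if "(r + 2) * N \<le> g" for g
  proof -
    have "?g < (r + 2) * N" using s by (simp add: add_mult_distrib)
    then show ?thesis using rows_uptoD(4)[OF r that] that by simp
  qed
  have B: "sharp d (?al ((i + 1) * N + v) - 1) \<and> sr (?al ((i + 1) * N + v) - 1) = v \<and> 0 < ?al (i * N + ds (?al ((i + 1) * N + v) - 1))"
    if i: "i \<le> r" "v < N" "0 < ?al ((i + 1) * N + v)" for i v
  proof (cases "(i + 1) * N + v = ?g")
    case True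
    then have e: "i + 1 = r + 1" "v = sr k" using pair_index_inj[of "i + 1" N v "r + 1" "sr k"] i(2) s by simp_all
    have "?al ((i + 1) * N + v) - 1 = k" unfolding True by simp
    moreover have "0 < ?al (i * N + ds k)" by (rule pos) (use e(1) a(1) in simp)
    ultimately show ?thesis using a(2) e(2) by simp
  next
    case False
    then have e: "?al ((i + 1) * N + v) = al ((i + 1) * N + v)" by simp
    show ?thesis unfolding e using rows_uptoD(2)[OF r i(1,2)] i(3) pos unfolding e by blast
  qed
  show ?thesis unfolding rows_upto_def
  proof (intro conjI allI impI, goal_cases)
    case (1 i v) then show ?case by (intro pos rows_uptoD(1)[OF r])
  next
    case (2 i v) then show ?case using B by blast
  next
    case (3 i v) then show ?case using B by blast
  next
    case (4 i v) then show ?case using B by blast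
  next
    case (5 e)
    show ?case
    proof (cases "e = k")
      case False
      then have "e < k" using 5(1) by simp
      then show ?thesis using 5 by (intro pos rows_uptoD(3)[OF r])
    qed simp
  next
    case (6 g) then show ?case by (rule D)
  qed
qed

text \<open>An arc is skipped if it is not sharp or its head is dead in row \<open>r\<close>;
  critical vertices are alive there, so the clause about arcs with critical heads is
  unaffected.\<close>

lemma rows_skip:
  assumes r: "rows_upto d r k al" and k: "k < m" and a: "\<not> (0 < al (r * N + ds k) \<and> sharp d k)"
  shows "rows_upto d r (Suc k) al"
proof -
  have "\<not> (sharp d k \<and> crit (ds k))" using a rows_uptoD(1)[OF r order_refl ds_less[OF k]] by blast
  then show ?thesis using r unfolding rows_upto_def less_Suc_eq by blast
qed

lemma rows_new:
  assumes r: "rows_upto d r k al" and i: "i \<le> Suc r" "v < N" "0 < al ((i + 1) * N + v)"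
  shows "sharp d (al ((i + 1) * N + v) - 1) \<and> sr (al ((i + 1) * N + v) - 1) = v \<and> 0 < al (i * N + ds (al ((i + 1) * N + v) - 1))"
proof (cases "i \<le> r")
  case True
  then show ?thesis using rows_uptoD(2)[OF r] i by blast
next
  case False
  then have "(r + 2) * N \<le> (i + 1) * N + v" using i(1) by (simp add: le_Suc_eq add_mult_distrib)
  then show ?thesis using rows_uptoD(4)[OF r] i(3) by simp
qed

text \<open>Critical vertices stay alive: each has a sharp arc to a critical head by
  \<open>crit_succ\<close>, and all arcs have been processed.\<close>

lemma rows_next:
  assumes f: "feasible (\<lambda>e. c e - lam * t e) d" and r: "rows_upto d r m al"
  shows "rows_upto d (Suc r) 0 al"
  unfolding rows_upto_def
proof (intro conjI allI impI, goal_cases)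
  case (1 i v)
  show ?case
  proof (cases "i \<le> r")
    case True then show ?thesis using rows_uptoD(1)[OF r] 1 by blast
  next
    case False
    then have i: "i = r + 1" using 1 by simp
    from crit_succ[OF f 1(3)] obtain e where e: "sharp d e" "sr e = v" "crit (ds e)" by blast
    then have "e < m" by (simp add: sharp_def)
    then show ?thesis using rows_uptoD(3)[OF r _ e(1,3)] e(2) i by simp
  qed
next
  case (2 i v) then show ?case using rows_new[OF r] by blast
next
  case (3 i v) then show ?case using rows_new[OF r] by blast
next
  case (4 i v) then show ?case using rows_new[OF r] by blast
next
  case (6 g)
  have "(r + 2) * N \<le> (Suc r + 2) * N" by simp
  then show ?case using 6 rows_uptoD(4)[OF r] by (meson le_trans)
qed simp

lemma Suc_le_W: "x \<le> S \<Longrightarrow> x + 1 \<le> W"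
proof (rule le_W)
  assume "x \<le> S"
  then have "x + 1 \<le> 2 * S" using S2 by simp
  also have "\<dots> \<le> S * S" by (rule mult_le_mono1[OF S2])
  finally show "x + 1 \<le> S ^ 2" by (simp add: power2_eq_square)
qed simp

lemma live_arc_wp:
  assumes i: "inp s" and v: "words s ''r'' 0 = r" "words s ''e'' 0 = k" "reals s ''x'' 0 = lam" "reals s ''d'' = d" and k: "k < m"
    and f: "feasible (\<lambda>e. c e - lam * t e) d" and I: "rows_upto d r k (words s ''al'')"
  shows "wp W live_arc (\<lambda>\<tau> s'. \<tau> \<le> 100 \<and> rows_upto d r (Suc k) (words s' ''al'')) s"
proof -
  have vals: "words s ''N'' 0 = N" "words s ''tl'' k = sr k" "words s ''hd'' k = ds k" "reals s ''cost'' k = c k" "reals s ''time'' k = t k"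
    using i k by (simp_all add: inp_def)
  have sh: "\<not> d (ds k) < d (sr k) + (c k - lam * t k) \<longleftrightarrow> sharp d k" using f k unfolding feasible_def sharp_def by force
  have kW: "k + 1 \<le> W" using Suc_le_W[OF mS] k by simp
  show ?thesis
  proof (cases "0 < words s ''al'' (r * N + ds k) \<and> sharp d k")
    case True
    then have b: "bval s (BAnd (WLess (WLit 0) (WCell ''al'' live)) (BNot (RLess (RCell ''d'' (WCell ''hd'' (V ''e'')))
      (RAdd (RCell ''d'' (WCell ''tl'' (V ''e''))) (RSub (RCell ''cost'' (V ''e'')) (RMul (RV ''x'') (RCell ''time'' (V ''e''))))))))"
      using v vals sh by (simp add: live_def)
    show ?thesis unfolding live_arc_def wp_Cond if_P[OF b]
      using rows_step[OF I k] True kW v vals by (simp add: live_def live'_def)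
  next
    case False
    then have b: "\<not> bval s (BAnd (WLess (WLit 0) (WCell ''al'' live)) (BNot (RLess (RCell ''d'' (WCell ''hd'' (V ''e'')))
      (RAdd (RCell ''d'' (WCell ''tl'' (V ''e''))) (RSub (RCell ''cost'' (V ''e'')) (RMul (RV ''x'') (RCell ''time'' (V ''e''))))))))"
      using v vals sh by (simp add: live_def)
    show ?thesis unfolding live_arc_def wp_Cond if_not_P[OF b]
      using rows_skip[OF I k False] by (simp add: live_def live'_def)
  qed
qed

lemma rows_wp:
  assumes i: "inp s" and v: "reals s ''x'' 0 = lam" "reals s ''d'' = d" "words s ''al'' = (\<lambda>_. 0)"
    and f: "feasible (\<lambda>e. c e - lam * t e) d"
  shows "wp W rows (\<lambda>\<tau> s'. \<tau> \<le> 500 * ((N + 1) * (m + 1)) \<and> rows_upto d N 0 (words s' ''al'')) s"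
  unfolding rows_def
proof (rule wp_seq)
  show "wp W (For ''v'' (V ''N'') (WAssign ''al'' (V ''v'') (WLit 1))) (\<lambda>\<tau> s'. \<tau> \<le> (N + 1) * 30 \<and> rows_upto d 0 0 (words s' ''al'')) s"
  proof (rule wp_for[where n = N and c = 18 and I = "\<lambda>k s'. \<forall>g. words s' ''al'' g = (if g < k then 1 else 0)"], goal_cases)
    case (4 k s')
    then show ?case using i by (simp add: frm_def inp_def)
  next
    case (5 k s')
    then show ?case using one_le_W by (auto simp: less_Suc_eq)
  next
    case (6 \<tau> s')
    then have g: "words s' ''al'' g = (if g < N then 1 else 0)" for g by blast
    have "rows_upto d 0 0 (words s' ''al'')" unfolding rows_upto_def g by auto
    then show ?case using 6(4) by simp
  qed (use v N_le_W in simp_all)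
next
  fix \<tau>0 s1 assume fr: "frm (For ''v'' (V ''N'') (WAssign ''al'' (V ''v'') (WLit 1))) s s1" and q: "\<tau>0 \<le> (N + 1) * 30 \<and> rows_upto d 0 0 (words s1 ''al'')"
  have i1: "inp s1" by (rule inp_frm[OF i fr]) simp_all
  have v1: "reals s1 ''x'' 0 = lam" "reals s1 ''d'' = d" using v fr by (simp_all add: frm_def)
  show "wp W (For ''r'' (V ''N'') (For ''e'' (V ''m'') live_arc)) (\<lambda>\<tau>. (\<lambda>\<tau> s'. \<tau> \<le> 500 * ((N + 1) * (m + 1)) \<and> rows_upto d N 0 (words s' ''al'')) (\<tau>0 + \<tau>)) s1"
  proof (rule wp_for[where n = N and c = "(m + 1) * 130" and I = "\<lambda>r s'. rows_upto d r 0 (words s' ''al'')"], goal_cases)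
    case (3) then show ?case using q by simp
  next
    case (4 r s2) then show ?case using i1 by (simp add: frm_def inp_def)
  next
    case (5 r s2)
    have i2: "inp s2" by (rule inp_frm[OF i1 5(2)]) simp_all
    have v2: "reals s2 ''x'' 0 = lam" "reals s2 ''d'' = d" using v1 5(2) by (simp_all add: frm_def)
    show ?case
    proof (rule wp_for[where n = m and c = 100 and I = "\<lambda>k s'. rows_upto d r k (words s' ''al'')"], goal_cases)
      case 3 then show ?case using 5(4) by simp
    next
      case (4 k s3) then show ?case using i2 by (simp add: frm_def inp_def)
    next
      case inner: (5 k s3)
      have i3: "inp s3" by (rule inp_frm[OF i2 inner(2)]) simp_all
      have v3: "words s3 ''r'' 0 = r" "reals s3 ''x'' 0 = lam" "reals s3 ''d'' = d" using v2 5(3) inner(2) by (simp_all add: frm_def)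
      show ?case by (rule wp_conseq[OF live_arc_wp[OF i3 v3(1) inner(3) v3(2,3) inner(1) f inner(4)]]) simp
    next
      case inner: (6 \<tau> s3)
      then show ?case using rows_next[OF f inner(3)] by simp
    qed (use m_le_W in simp_all)
  next
    case (6 \<tau> s')
    have "(m + 1) * 130 + wcost (V ''N'') + 10 \<le> 400 * (m + 1)" by simp
    then have "(N + 1) * ((m + 1) * 130 + wcost (V ''N'') + 10) \<le> (N + 1) * (400 * (m + 1))" by (rule mult_le_mono2)
    moreover have "(N + 1) * (400 * (m + 1)) = 400 * ((N + 1) * (m + 1))" by (simp only: mult.left_commute)
    moreover have "(N + 1) * 1 \<le> (N + 1) * (m + 1)" by (intro mult_le_mono2) simp
    ultimately have "\<tau>0 + \<tau> \<le> 500 * ((N + 1) * (m + 1))" using q 6(4) by linarith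
    then show ?case using 6(3) by blast
  qed (use N_le_W in simp_all)
qed

section \<open>Following sharp arcs to a repetition\<close>

definition start :: com where
  "start = For ''v'' (V ''N'') (Cond (WLess (WLit 0) (WCell ''al'' (WAdd (WMul (V ''N'') (V ''N'')) (V ''v'')))) (''a'' ::= V ''v'') Skip)"

text \<open>After \<open>r\<close> steps the current vertex is alive in row \<open>N - r\<close>,
  which supplies the next arc. \<open>ps\<close> stores one plus the step of a visit, so 0 means
  unvisited and the loop ends at the first repetition.\<close>

definition follow :: com where
  "follow = ''r'' ::= WLit 0 ;; While (WLess (WCell ''ps'' (V ''a'')) (WLit 1))
     (WAssign ''ps'' (V ''a'') (WAdd (V ''r'') (WLit 1)) ;;
      WAssign ''pe'' (V ''r'') (WSub (WCell ''al'' (WAdd (WMul (WSub (V ''N'') (V ''r'')) (V ''N'')) (V ''a''))) (WLit 1)) ;;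
      ''a'' ::= WCell ''hd'' (WCell ''pe'' (V ''r'')) ;; ''r'' ::= WAdd (V ''r'') (WLit 1))"

definition emit :: com where
  "emit = ''b'' ::= WSub (WCell ''ps'' (V ''a'')) (WLit 1) ;; ''length'' ::= WSub (V ''r'') (V ''b'') ;;
     For ''i'' (V ''length'') (WAssign ''cycle'' (V ''i'') (WCell ''pe'' (WAdd (V ''b'') (V ''i''))))"

definition emit_cycle :: com where "emit_cycle = rows ;; start ;; follow ;; emit"

lemma wmod_emit_cycle [simp]: "wmod start = {''v'', ''a''}" "rmod start = {}" "wmod follow = {''r'', ''ps'', ''pe'', ''a''}" "rmod follow = {}"
    "wmod emit = {''b'', ''length'', ''i'', ''cycle''}" "rmod emit = {}"
    "wmod emit_cycle = {''v'', ''r'', ''e'', ''al'', ''a'', ''ps'', ''pe'', ''b'', ''length'', ''i'', ''cycle''}" "rmod emit_cycle = {}"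
  by (auto simp: start_def follow_def emit_def emit_cycle_def)

lemma start_wp:
  assumes i: "inp s" and x: "\<exists>v<N. 0 < words s ''al'' (N * N + v)"
  shows "wp W start (\<lambda>\<tau> s'. \<tau> \<le> (N + 1) * 50 \<and> words s' ''a'' 0 < N \<and> 0 < words s ''al'' (N * N + words s' ''a'' 0)) s"
  unfolding start_def
proof (rule wp_for[where n = N and c = 30 and I = "\<lambda>k s'. (\<exists>v<k. 0 < words s ''al'' (N * N + v)) \<longrightarrow> words s' ''a'' 0 < N \<and> 0 < words s ''al'' (N * N + words s' ''a'' 0)"], goal_cases)
  case (4 k s') then show ?case using i by (simp add: frm_def inp_def)
next
  case (5 k s')
  have w: "words s' ''N'' 0 = N" "words s' ''al'' = words s ''al''" using i 5(2) by (simp_all add: frm_def inp_def)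
  have "k \<le> W" using 5(1) N_le_W by simp
  show ?case
  proof (cases "0 < words s ''al'' (N * N + k)")
    case True
    then show ?thesis using 5(1,3) w \<open>k \<le> W\<close> by simp
  next
    case False
    then have "(\<exists>v<Suc k. 0 < words s ''al'' (N * N + v)) \<longleftrightarrow> (\<exists>v<k. 0 < words s ''al'' (N * N + v))" by (auto simp: less_Suc_eq)
    then show ?thesis using 5(3,4) w False by simp
  qed
next
  case (6 \<tau> s') then show ?case using x by simp
qed (use N_le_W in simp_all)

definition trail :: "(nat \<Rightarrow> real) \<Rightarrow> nat list \<Rightarrow> nat \<Rightarrow> store \<Rightarrow> bool" where
  "trail d es u s \<longleftrightarrow> walk u es (words s ''a'' 0) \<and> words s ''r'' 0 = length es \<and> (\<forall>i<length es. words s ''pe'' i = es ! i \<and> words s ''ps'' (sr (es ! i)) = i + 1) \<and>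
     (\<forall>e\<in>set es. sharp d e) \<and> distinct (map sr es) \<and> (\<forall>v<N. v \<notin> sr ` set es \<longrightarrow> words s ''ps'' v = 0) \<and> words s ''a'' 0 < N \<and>
     length es \<le> N \<and> 0 < words s ''al'' ((N - length es) * N + words s ''a'' 0)"

lemma trail_step:
  assumes T: "trail d es u s" and R: "rows_upto d N 0 (words s ''al'')" and z: "words s ''ps'' (words s ''a'' 0) = 0"
    and e: "e = words s ''al'' ((N - length es) * N + words s ''a'' 0) - 1"
    and s': "words s' ''ps'' = (words s ''ps'')(words s ''a'' 0 := length es + 1)" "words s' ''pe'' = (words s ''pe'')(length es := e)"
      "words s' ''a'' 0 = ds e" "words s' ''r'' 0 = length es + 1" "words s' ''al'' = words s ''al''"
  shows "trail d (es @ [e]) u s' \<and> length es < N \<and> sharp d e"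
proof -
  let ?a = "words s ''a'' 0"
  have t: "walk u es ?a" "\<forall>i<length es. words s ''pe'' i = es ! i \<and> words s ''ps'' (sr (es ! i)) = i + 1"
     "\<forall>e\<in>set es. sharp d e" "distinct (map sr es)" "\<forall>v<N. v \<notin> sr ` set es \<longrightarrow> words s ''ps'' v = 0" "?a < N"
     "length es \<le> N" "0 < words s ''al'' ((N - length es) * N + ?a)"
    using T by (simp_all add: trail_def)
  have new: "?a \<notin> sr ` set es"
  proof
    assume "?a \<in> sr ` set es"
    then obtain i where "i < length es" "?a = sr (es ! i)" by (auto simp: in_set_conv_nth)
    then show False using t(2) z by auto
  qed
  have "sr e < N" if "e \<in> set es" for e using that t(3) sr_less by (auto simp: sharp_def)
  \<comment> \<open>The sources so far and the current vertex are \<open>length es + 1\<close>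
    distinct numbers below \<open>N\<close>. So the row index \<open>N - length es\<close> is still
    positive and the entry names an arc, not one of the ones of row 0.\<close>
  then have "insert ?a (sr ` set es) \<subseteq> {..<N}" using t(6) by auto
  then have "card (insert ?a (sr ` set es)) \<le> N" by (metis card_lessThan card_mono finite_lessThan)
  moreover have "card (sr ` set es) = length es" using distinct_card[OF t(4)] by simp
  ultimately have lt: "length es < N" using new by simp
  have "\<exists>j. N = length es + 1 + j" by (rule le_Suc_ex) (use lt in simp)
  then obtain j where jN: "N = length es + 1 + j" ..
  have j: "N - length es = j + 1" "N - (length es + 1) = j" "j \<le> N" unfolding jN by simp_all
  have "sharp d e \<and> sr e = ?a \<and> 0 < words s ''al'' (j * N + ds e)"
    using rows_uptoD(2)[OF R j(3) t(6)] t(8) unfolding e j(1) by blast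
  then have E: "sharp d e" "sr e = ?a" "0 < words s ''al'' ((N - (length es + 1)) * N + ds e)" "e < m" unfolding j(2) by (simp_all add: sharp_def)
  have ne: "sr (es ! i) \<noteq> ?a" if "i < length es" for i using new imageI[OF nth_mem[OF that], of sr] by metis
  have "\<forall>i<length (es @ [e]). words s' ''pe'' i = (es @ [e]) ! i \<and> words s' ''ps'' (sr ((es @ [e]) ! i)) = i + 1"
    using t(2) E(2) ne by (auto simp: nth_append less_Suc_eq s')
  moreover have "walk u (es @ [e]) (ds e)" using t(1) E by (simp add: walk_snoc)
  moreover have "distinct (map sr (es @ [e]))" using t(4) new E(2) by simp
  moreover have "\<forall>v<N. v \<notin> sr ` set (es @ [e]) \<longrightarrow> words s' ''ps'' v = 0" using t(5) E(2) by (auto simp: s')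
  moreover have "\<forall>x\<in>set (es @ [e]). sharp d x" using t(3) E(1) by auto
  ultimately show ?thesis unfolding trail_def using s'(3-5) E E(3)[folded Suc_eq_plus1] lt ds_less[OF E(4)] by simp
qed

lemma follow_wp:
  assumes i: "inp s" and a: "words s ''a'' 0 < N" "0 < words s ''al'' (N * N + words s ''a'' 0)" and R: "rows_upto d N 0 (words s ''al'')"
    and z: "words s ''ps'' = (\<lambda>_. 0)"
  shows "wp W follow (\<lambda>\<tau> s'. \<tau> \<le> 100 * (N + 1) \<and> 0 < words s' ''ps'' (words s' ''a'' 0) \<and> (\<exists>es u. trail d es u s')) s"
proof -
  let ?s = "s\<lparr>words := (words s)(''r'' := (words s ''r'')(0 := 0))\<rparr>"
  have i0: "inp ?s" using i by (simp add: inp_def)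
  let ?b = "WLess (WCell ''ps'' (V ''a'')) (WLit 1)"
  let ?P = "WAssign ''ps'' (V ''a'') (WAdd (V ''r'') (WLit 1)) ;;
      WAssign ''pe'' (V ''r'') (WSub (WCell ''al'' (WAdd (WMul (WSub (V ''N'') (V ''r'')) (V ''N'')) (V ''a''))) (WLit 1)) ;;
      ''a'' ::= WCell ''hd'' (WCell ''pe'' (V ''r'')) ;; ''r'' ::= WAdd (V ''r'') (WLit 1)"
  have NW: "N + 1 \<le> W" by (rule Suc_le_W[OF NS])
  have "wp W (While ?b ?P) (\<lambda>\<tau> s'. 3 + \<tau> \<le> 100 * (N + 1) \<and> 0 < words s' ''ps'' (words s' ''a'' 0) \<and> (\<exists>es u. trail d es u s')) ?s"
  proof (rule wp_while[where \<mu> = "\<lambda>s. N - words s ''r'' 0" and Inv = "\<lambda>\<tau> s'. \<tau> \<le> words s' ''r'' 0 * 60 \<and> (\<exists>es u. trail d es u s')"], goal_cases)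
    case 1
    have "trail d [] (words s ''a'' 0) ?s" using a z by (simp add: trail_def)
    then show ?case by auto
  next
    case (2 \<tau> s1)
    then obtain es u where T: "trail d es u s1" by blast
    have i1: "inp s1" by (rule inp_frm[OF i0 2(1)]) simp_all
    have al: "words s1 ''al'' = words s ''al''" using 2(1) by (simp add: frm_def)
    have z1: "words s1 ''ps'' (words s1 ''a'' 0) = 0" using 2(3) by simp
    have r: "words s1 ''r'' 0 = length es" "words s1 ''N'' 0 = N" using T i1 by (simp_all add: trail_def inp_def)
    have R1: "rows_upto d N 0 (words s1 ''al'')" using R al by simp
    define e where "e = words s1 ''al'' ((N - length es) * N + words s1 ''a'' 0) - 1"
    define s2 where "s2 = s1\<lparr>words := (words s1)(''ps'' := (words s1 ''ps'')(words s1 ''a'' 0 := length es + 1), ''pe'' := (words s1 ''pe'')(length es := e),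
       ''a'' := (words s1 ''a'')(0 := ds e), ''r'' := (words s1 ''r'')(0 := length es + 1))\<rparr>"
    have T2: "trail d (es @ [e]) u s2 \<and> length es < N \<and> sharp d e" by (rule trail_step[OF T R1 z1 e_def]) (simp_all add: s2_def)
    then have e: "e < m" "words s1 ''hd'' e = ds e" "e \<le> W" "ds e \<le> W"
      using i1 m_le_W ds_less[of e] N_le_W by (auto simp: sharp_def inp_def)
    have "wp W ?P (\<lambda>t s'. t = 36 \<and> s' = s2) s1"
      using r e NW T2 by (simp add: e_def[symmetric] s2_def)
    then show ?case
    proof (rule wp_conseq, goal_cases)
      case (1 t s')
      have r2: "words s2 ''r'' 0 = length es + 1" by (simp add: s2_def)
      have "\<tau> + (1 + bcost ?b + t) \<le> words s' ''r'' 0 * 60" using 1(2) 2(2) r r2 by simp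
      moreover have "N - (length es + 1) < N - length es" by (rule diff_less_mono2) (use T2 in simp_all)
      then have "N - words s' ''r'' 0 < N - words s1 ''r'' 0" using 1(2) r r2 by simp
      ultimately show ?case using 1(2) T2 by blast
    qed
  next
    case (3 \<tau> s1)
    then obtain es u where T: "trail d es u s1" by blast
    then have "words s1 ''r'' 0 \<le> N" by (simp add: trail_def)
    then have "words s1 ''r'' 0 * 60 \<le> N * 60" by (rule mult_le_mono1)
    then show ?case using 3(2,3) T by auto
  qed
  then show ?thesis unfolding follow_def by simp
qed

text \<open>The arcs from the first visit of the repeated vertex on form a closed walk with distinct
  sources. Along sharp arcs the potential differences telescope to 0, which says that its ratio is
  \<open>lam\<close>.\<close>

lemma emit_wp:
  assumes T: "trail d es u s" and p: "0 < words s ''ps'' (words s ''a'' 0)"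
  shows "wp W emit (\<lambda>\<tau> s'. \<tau> \<le> 100 * (N + 1) \<and> simple_closed (read_cycle s') \<and> wt c (read_cycle s') = lam * wt t (read_cycle s')) s"
proof -
  let ?a = "words s ''a'' 0"
  have t: "walk u es ?a" "\<forall>i<length es. words s ''pe'' i = es ! i \<and> words s ''ps'' (sr (es ! i)) = i + 1"
     "\<forall>e\<in>set es. sharp d e" "distinct (map sr es)" "\<forall>v<N. v \<notin> sr ` set es \<longrightarrow> words s ''ps'' v = 0" "?a < N" "length es \<le> N" "words s ''r'' 0 = length es"
    using T by (simp_all add: trail_def)
  then have "?a \<in> sr ` set es" using p by auto
  then obtain k where k: "k < length es" "sr (es ! k) = ?a" by (auto simp: in_set_conv_nth)
  then have ps: "words s ''ps'' ?a = k + 1" using t(2) by auto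
  let ?C = "drop k es"
  have ne: "?C \<noteq> []" "sr (hd ?C) = ?a" using k by (simp_all add: hd_drop_conv_nth)
  have "walk u (take k es @ ?C) ?a" using t(1) by simp
  then obtain x where x: "walk x ?C ?a" unfolding walk_append by blast
  have cl: "walk ?a ?C ?a" using x walk_hd[OF x ne(1)] ne(2) by simp
  have "distinct (map sr (take k es @ ?C))" using t(4) by simp
  then have "distinct (map sr ?C)" unfolding map_append distinct_append by blast
  then have sc: "simple_closed ?C" using cl ne(1) unfolding simple_closed_def by blast
  have "wt c ?C - lam * wt t ?C = d ?a - d ?a" by (rule sharp_walk[OF cl]) (use t(3) in_set_dropD in fast)
  then have eq: "wt c ?C = lam * wt t ?C" by simp
  have lW: "length es \<le> W" using t(7) N_le_W by (rule le_trans)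
  have peW: "es ! i \<le> W" if "i < length es" for i
  proof -
    have "es ! i < m" using t(3) that by (simp add: sharp_def)
    then show ?thesis using m_le_W by simp
  qed
  define s1 where "s1 = s\<lparr>words := (words s)(''b'' := (words s ''b'')(0 := k), ''length'' := (words s ''length'')(0 := length es - k))\<rparr>"
  have w1: "words s1 ''b'' 0 = k" "words s1 ''length'' 0 = length es - k" "words s1 ''pe'' = words s ''pe''" by (simp_all add: s1_def)
  have "wp W (For ''i'' (V ''length'') (WAssign ''cycle'' (V ''i'') (WCell ''pe'' (WAdd (V ''b'') (V ''i'')))))
     (\<lambda>\<tau> s'. 14 + \<tau> \<le> 100 * (N + 1) \<and> simple_closed (read_cycle s') \<and> wt c (read_cycle s') = lam * wt t (read_cycle s')) s1"
  proof (rule wp_for[where n = "length es - k" and c = 20 and I = "\<lambda>i s'. \<forall>j<i. words s' ''cycle'' j = es ! (k + j)"], goal_cases)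
    case (5 i s2)
    have w2: "words s2 ''b'' 0 = k" "words s2 ''pe'' = words s ''pe''" using 5(2) w1 by (simp_all add: frm_def)
    have "words s ''pe'' (k + i) = es ! (k + i)" "es ! (k + i) \<le> W" using t(2) peW 5(1) by simp_all
    then show ?case using w2 5(3,4) by (simp add: less_Suc_eq)
  next
    case (6 \<tau> s2)
    have "words s2 ''length'' 0 = length es - k" using 6(1) w1 by (simp add: frm_def)
    then have "read_cycle s2 = ?C" unfolding read_cycle_def using 6(3) k(1) by (intro nth_equalityI) auto
    moreover have "(length es - k + 1) * (20 + wcost (V ''length'') + 10) \<le> (N + 1) * 32" using t(7) by (intro mult_le_mono) auto
    ultimately show ?case using sc eq 6(4) by simp
  qed (use w1 lW in \<open>simp_all add: frm_def\<close>)
  then show ?thesis unfolding emit_def using t(8) ps k(1) lW by (simp add: s1_def)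
qed

lemma emit_cycle_wp:
  assumes i: "inp s" and v: "reals s ''x'' 0 = lam" "reals s ''d'' = d" "words s ''al'' = (\<lambda>_. 0)" "words s ''ps'' = (\<lambda>_. 0)"
    and f: "feasible (\<lambda>e. c e - lam * t e) d" and cy: cyc
  shows "wp W emit_cycle (\<lambda>\<tau> s'. \<tau> \<le> 800 * ((N + 1) * (m + 1)) \<and> simple_closed (read_cycle s') \<and> wt c (read_cycle s') = lam * wt t (read_cycle s')) s"
  unfolding emit_cycle_def
proof (rule wp_seq[OF rows_wp[OF i v(1-3) f]], goal_cases)
  case rows: (1 \<tau>1 s1)
  have i1: "inp s1" by (rule inp_frm[OF i rows(1)]) simp_all
  have R1: "rows_upto d N 0 (words s1 ''al'')" using rows(2) by blast
  from ex_tight_closed[OF cy] obtain z es where z: "tight z es z" "es \<noteq> []" by blast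
  then have "crit z" "z < N" using walk_end_less unfolding tight_closed_iff crit_def by blast+
  then have ex: "\<exists>v<N. 0 < words s1 ''al'' (N * N + v)" using rows_uptoD(1)[OF R1 order_refl] by blast
  show ?case
  proof (rule wp_seq[OF start_wp[OF i1 ex]], goal_cases)
    case st: (1 \<tau>2 s2)
    have i2: "inp s2" by (rule inp_frm[OF i1 st(1)]) simp_all
    have w2: "words s2 ''al'' = words s1 ''al''" "words s2 ''ps'' = (\<lambda>_. 0)" using st(1) rows(1) v(4) by (simp_all add: frm_def)
    have a2: "words s2 ''a'' 0 < N" "0 < words s2 ''al'' (N * N + words s2 ''a'' 0)" "rows_upto d N 0 (words s2 ''al'')" using st(2) w2(1) R1 by simp_all
    show ?case
    proof (rule wp_seq[OF follow_wp[OF i2 a2 w2(2)]], goal_cases)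
      case fo: (1 \<tau>3 s3)
      then obtain es u where T: "trail d es u s3" by blast
      have p: "0 < words s3 ''ps'' (words s3 ''a'' 0)" using fo(2) by blast
      show ?case
      proof (rule wp_conseq[OF emit_wp[OF T p]], goal_cases)
        case (1 \<tau>4 s4)
        have "(N + 1) * 1 \<le> (N + 1) * (m + 1)" by (intro mult_le_mono2) simp
        moreover have "\<tau>1 \<le> 500 * ((N + 1) * (m + 1))" "\<tau>2 \<le> (N + 1) * 50" "\<tau>3 \<le> 100 * (N + 1)" "\<tau>4 \<le> 100 * (N + 1)" using rows(2) st(2) fo(2) 1(2) by blast+
        ultimately have "\<tau>1 + (\<tau>2 + (\<tau>3 + \<tau>4)) \<le> 800 * ((N + 1) * (m + 1))" by linarith
        then show ?case using 1(2) by blast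
      qed
    qed
  qed
qed

end

section \<open>Assembling the search\<close>

context mrc_ram begin

lemma tr_same:
  assumes sb: "same_below ((h + 1) * N * N) s s'" and lev: "levels h s" and uv: "u < N" "v < N" "0 < words s ''tv'' (idx h u v)" and j: "j \<le> h"
  shows "tr (words s' ''tp'') h u v j = tr (words s ''tp'') h u v j"
  using j
proof (induction j)
  case (Suc j)
  let ?x = "tr (words s ''tp'') h u v j"
  have x: "?x < N" using tr_valid[OF lev uv, of j] Suc.prems by simp
  have "(h - j + 1) * N * N \<le> (h + 1) * N * N" by (intro mult_le_mono1) simp
  then have "idx (h - j) u ?x < (h + 1) * N * N" using idx_less[OF uv(1) x, of "h - j"] by (rule less_le_trans[rotated])
  then have "words s' ''tp'' (idx (h - j) u ?x) = words s ''tp'' (idx (h - j) u ?x)" using sb entry_eqD unfolding same_below_def by blast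
  then show ?case using Suc by simp
qed simp

lemma tight_at_same:
  assumes "same_below b s s'" "g < b"
  shows "tight_at s' g u v = tight_at s g u v"
  using assms by (simp add: same_below_def tight_at_def)

lemma hop_same:
  assumes sb: "same_below ((h + 1) * N * N) s s'" and hs: "\<And>i. i < q \<Longrightarrow> hs i < N"
  shows "hop s' h hs q = hop s h hs q"
proof -
  have "tight_at s' (idx l (hs i) (hs k)) (hs i) (hs k) = tight_at s (idx l (hs i) (hs k)) (hs i) (hs k)" if "i < q" "k < q" "l \<in> {1..h}" for i k l
  proof (rule tight_at_same[OF sb])
    have "(l + 1) * N * N \<le> (h + 1) * N * N" using that(3) by (intro mult_le_mono1) simp
    then show "idx l (hs i) (hs k) < (h + 1) * N * N" by (rule less_le_trans[OF idx_less[OF hs[OF that(1)] hs[OF that(2)]]])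
  qed
  then show ?thesis unfolding hop_def by blast
qed

text \<open>Traced walks without repetition were stored, and stored paths are hit; together this is
  the assumption \<open>hit\<close> of \<open>tight_loop\<close>.\<close>

lemma traced_hit:
  assumes T: "traced h tv tp (N * N) s" and g: "\<And>l. l < words s ''pc'' 0 \<Longrightarrow> \<exists>i<q. hs i \<in> path_set (words s ''pv'') h l"
    and uv: "u < N" "v < N" "0 < tv (idx h u v)" "inj_on (tr tp h u v) {..<h}"
  shows "\<exists>j<h. \<exists>i<q. tr tp h u v j = hs i"
proof -
  have "u * N + v < N * N" by (rule pair_index_less[OF uv(1,2)])
  then obtain k where k: "k < words s ''pc'' 0" "\<And>l. l < h \<Longrightarrow> words s ''pv'' (k * h + l) = tr tp h u v l"
    using T uv unfolding traced_def by meson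
  from g[OF k(1)] obtain i l where "i < q" "l < h" "hs i = words s ''pv'' (k * h + l)" by (auto simp: path_set_def)
  then have "tr tp h u v l = hs i" using k(2) by simp
  then show ?thesis using \<open>l < h\<close> \<open>i < q\<close> by blast
qed

lemma mult_le_power: "a \<le> S ^ i \<Longrightarrow> b \<le> S ^ j \<Longrightarrow> a * b \<le> S ^ (i + j)"
  unfolding power_add by (rule mult_le_mono)

lemma add_le_power: "a \<le> S ^ i \<Longrightarrow> b \<le> S ^ i \<Longrightarrow> a + b \<le> S ^ (i + 1)"
proof -
  assume "a \<le> S ^ i" "b \<le> S ^ i"
  then have "a + b \<le> 2 * S ^ i" by simp
  also have "\<dots> \<le> S * S ^ i" by (rule mult_le_mono1[OF S2])
  finally show "a + b \<le> S ^ (i + 1)" by (simp add: power_add mult.commute)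
qed

lemma le_power_mono: "a \<le> S ^ i \<Longrightarrow> i \<le> j \<Longrightarrow> a \<le> S ^ j"
  using S2 by (meson le_trans power_increasing one_le_numeral)

definition solve :: com where
  "solve = stage1 ;; trace ;; greedy ;; matrix ;; scan ;;
     Cond (WLess (WLit 0) (V ''has'')) (BF ;; emit_cycle) (''length'' ::= WLit 0)"

text \<open>\<open>4 * L\<close> bounds the binary logarithm of every batch size, namely of
  \<open>N * m\<close>, \<open>q * (q * h)\<close> and \<open>q * (q * (q + 1))\<close>. The
  summands stand for the matrix powers, for the levels, and for the quadratic work of tracing,
  choosing and scanning; smaller costs are absorbed.\<close>

definition solve_time :: "nat \<Rightarrow> nat \<Rightarrow> nat \<Rightarrow> nat" where
  "solve_time L h q = 40000 * ((L + 2) * ((4 * L + 1) * ((q + 1) * ((q + 1) * (q + h + 1)) + (N + 1) * (m + 1)))) +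
     40000 * ((h + 1) * ((4 * L + 1) * ((N + 1) * (m + 1)))) + 4000 * ((N + 1) * (N + 1) * (h + 1))"

lemma solve_time_ge:
  assumes "\<tau>1 \<le> (h + 1) * (16000 * ((4 * L + 1) * ((N + 1) * (m + 1))))" "\<tau>2 \<le> 200 * ((N + 1) * (N + 1) * (h + 1))"
    "\<tau>3 \<le> 400 * (k * h + 1) + 200 * ((N + 1) * (N + 1))" "k \<le> N * N"
    "\<tau>4 \<le> 10000 * ((L + 2) * ((4 * L + 1) * ((q + 1) * ((q + 1) * (q + h + 1)) + (N + 1) * (m + 1))))"
    "\<tau>5 \<le> 500 * ((h + 1) * (N + 1) + (q + 1))" "q \<le> N" "\<tau>6 \<le> 1100 * ((N + 1) * (m + 1))"
  shows "\<tau>1 + (\<tau>2 + (\<tau>3 + (\<tau>4 + (\<tau>5 + \<tau>6)))) \<le> solve_time L h q"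
proof -
  let ?M = "(N + 1) * (m + 1)"
  define A where "A = (h + 1) * ((4 * L + 1) * ?M)"
  define Z where "Z = (N + 1) * (N + 1) * (h + 1)"
  have "?M = 1 * (1 * ?M)" by simp
  also have "\<dots> \<le> A" unfolding A_def by (intro mult_le_mono) simp_all
  finally have MA: "?M \<le> A" .
  have "k * h \<le> N * N * h" by (rule mult_le_mono1[OF assms(4)])
  also have "\<dots> \<le> Z" unfolding Z_def by (intro mult_le_mono) simp_all
  finally have kZ: "k * h \<le> Z" .
  have "(N + 1) * (N + 1) * 1 \<le> Z" unfolding Z_def by (intro mult_le_mono2) simp
  then have nZ: "(N + 1) * (N + 1) \<le> Z" by simp
  have "1 * 1 * 1 \<le> Z" unfolding Z_def by (intro mult_le_mono) simp_all
  then have oZ: "1 \<le> Z" by simp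
  have "(h + 1) * (N + 1) = 1 * (N + 1) * (h + 1)" by simp
  also have "\<dots> \<le> Z" unfolding Z_def by (intro mult_le_mono1) simp
  finally have hZ: "(h + 1) * (N + 1) \<le> Z" .
  have "(N + 1) * 1 \<le> (N + 1) * (N + 1)" by (intro mult_le_mono2) simp
  then have "N + 1 \<le> Z" using nZ unfolding mult_1_right by (rule le_trans)
  then have qZ: "q + 1 \<le> Z" using assms(7) by simp
  have t1: "\<tau>1 \<le> 16000 * A" using assms(1) unfolding A_def by (simp only: mult.left_commute)
  have "x \<le> 1000 * z" if "x \<le> 400 * (a + 1) + 200 * b" "a \<le> z" "b \<le> z" "1 \<le> z" for x a b z :: nat using that by simp
  from this[OF assms(3) kZ nZ oZ] have t3: "\<tau>3 \<le> 1000 * Z" .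
  have "x \<le> 1000 * z" if "x \<le> 500 * (a + b)" "a \<le> z" "b \<le> z" for x a b z :: nat using that by simp
  from this[OF assms(6) hZ qZ] have t5: "\<tau>5 \<le> 1000 * Z" .
  have t6: "\<tau>6 \<le> 1100 * A" using assms(8) MA by linarith
  show ?thesis unfolding solve_time_def A_def[symmetric] Z_def[symmetric]
    using t1 assms(2)[folded Z_def] t3 assms(5) t5 t6 by linarith
qed

lemma solve_wp:
  assumes i: "inp s" and h: "words s ''h'' 0 = h" "1 \<le> h" "h \<le> S ^ 3" "h \<le> 2 ^ (2 * L)"
    and L: "N + 1 \<le> 2 ^ L" "m \<le> 2 ^ (2 * L)" "L \<le> S"
    and zw: "\<And>a. a \<in> {''tv'', ''mk'', ''cnt'', ''fs'', ''gone'', ''al'', ''ps''} \<Longrightarrow> words s a = (\<lambda>_. 0)" "words s ''pc'' 0 = 0" "words s ''q'' 0 = 0"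
    and zr: "reals s ''tc'' = (\<lambda>_. 0)" "reals s ''tt'' = (\<lambda>_. 0)"
  shows "wp W solve (\<lambda>\<tau> s'. (\<exists>q. \<tau> \<le> solve_time L h q \<and> q \<le> N \<and> (q = 0 \<or> h \<le> N \<and> 1 \<le> real N * real N * (1 - real h / real N) ^ (q - 1))) \<and>
    (if cyc then simple_closed (read_cycle s') \<and> wt c (read_cycle s') = lam * wt t (read_cycle s') else read_cycle s' = [])) s"
proof -
  \<comment> \<open>Quantities are bounded by powers of \<open>S\<close>:
    \<open>mult_le_power\<close> adds degrees and \<open>add_le_power\<close> spends one degree on a
    sum. The degrees stay well below 16.\<close>
  have NS1: "N \<le> S ^ 1" and mS1: "m \<le> S ^ 1" and LS1: "L \<le> S ^ 1" and o0: "1 \<le> S ^ 0" and two: "2 \<le> S ^ 1" using NS mS L S2 by simp_all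
  have o: "1 \<le> S ^ i" for i using S2 by simp
  have h1: "h + 1 \<le> S ^ 4" using add_le_power[OF h(3) o] by simp
  have B6: "(h + 1) * N * N \<le> S ^ 6" using mult_le_power[OF mult_le_power[OF h1 NS1] NS1] by simp
  have hW: "h \<le> W" by (rule le_W[OF h(3)]) simp
  have W6: "(h + 1) * N * N \<le> W" by (rule le_W[OF B6]) simp
  have "2 * (N * m) \<le> S ^ 3" using mult_le_power[OF two mult_le_power[OF NS1 mS1]] by simp
  then have "2 * (N * m) + 2 \<le> S ^ 4" using add_le_power[of _ 3, OF _ le_power_mono[OF two]] by simp
  then have W4: "2 * (N * m) + 2 \<le> W" by (rule le_W) simp
  have NN2: "N * N \<le> S ^ 2" using mult_le_power[OF NS1 NS1] by simp
  have "N * N + 1 \<le> S ^ 3" using add_le_power[OF NN2 o] by simp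
  then have WN: "N * N + 1 \<le> W" by (rule le_W) simp
  have NL: "N \<le> 2 ^ L" "q + 1 \<le> 2 ^ L" if "q \<le> N" for q using L(1) that by simp_all
  have kNm: "N * m \<le> 2 ^ (4 * L)"
  proof -
    have "N * m \<le> 2 ^ L * 2 ^ (2 * L)" using NL(1)[OF order_refl] L(2) by (rule mult_le_mono)
    also have "\<dots> = 2 ^ (L + 2 * L)" by (simp only: power_add)
    also have "\<dots> \<le> (2 :: nat) ^ (4 * L)" by (rule power_increasing) simp_all
    finally show ?thesis .
  qed
  have z1: "words s ''tv'' = (\<lambda>_. 0)" using zw(1) by simp
  show ?thesis unfolding solve_def
  proof (rule wp_seq[OF stage1_wp[OF i h(1) hW W6 W4 kNm z1 zr]], goal_cases)
    case s1: (1 \<tau>1 s1)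
    have i1: "inp s1" by (rule inp_frm[OF i s1(1)]) simp_all
    have lev1: "levels h s1" and fr1: "fresh_from ((h + 1) * N * N) s1" using s1(2) by blast+
    have w1: "words s1 ''h'' 0 = h" "words s1 ''pc'' 0 = 0" "words s1 ''mk'' = (\<lambda>_. 0)" using s1(1) h(1) zw by (simp_all add: frm_def)
    show ?case
    proof (rule wp_seq[OF trace_wp[OF i1 lev1 w1(1) hW WN w1(2,3)]], goal_cases)
      case s2: (1 \<tau>2 s2)
      have i2: "inp s2" by (rule inp_frm[OF i1 s2(1)]) simp_all
      define k where "k = words s2 ''pc'' 0"
      have T2: "traced h (words s1 ''tv'') (words s1 ''tp'') (N * N) s2" using s2(2) by blast
      then have k: "k \<le> N * N" "family N (words s2 ''pv'') h k" by (simp_all add: traced_def k_def)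
      have w2: "words s2 ''N'' 0 = N" "words s2 ''h'' 0 = h" using i2 s2(1) w1 by (simp_all add: inp_def frm_def)
      have z2: "words s2 ''cnt'' = (\<lambda>_. 0)" "words s2 ''fs'' = (\<lambda>_. 0)" "words s2 ''gone'' = (\<lambda>_. 0)" "words s2 ''q'' 0 = 0"
        using s2(1) s1(1) zw by (simp_all add: frm_def)
      have "k * h \<le> S ^ 5" using mult_le_power[OF le_trans[OF k(1) NN2] h(3)] by simp
      then have "k * h + 1 \<le> S ^ 6" using add_le_power[OF _ o] by fastforce
      then have khW: "k * h + 1 \<le> W" by (rule le_W) simp
      show ?case
      proof (rule wp_seq[OF greedy_wp[OF w2(1) N_le_W one_le_W k_def[symmetric] w2(2) khW h(2) z2 k(2)]], goal_cases)
        case s3: (1 \<tau>3 s3)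
        have i3: "inp s3" by (rule inp_frm[OF i2 s3(1)]) simp_all
        define q where "q = words s3 ''q'' 0"
        define hs where "hs = words s3 ''hs''"
        have q: "q \<le> N" "\<And>i. i < q \<Longrightarrow> hs i < N" and hit: "\<And>l. l < k \<Longrightarrow> \<exists>i<q. hs i \<in> path_set (words s2 ''pv'') h l"
          and qb: "q = 0 \<or> 1 \<le> real k * (1 - real h / real N) ^ (q - 1) \<and> h \<le> N"
          using s3(2) by (simp_all add: q_def hs_def)
        have t3: "words s3 ''tv'' = words s1 ''tv''" "entry s3 = entry s1" using s2(1) s3(1) by (simp_all add: frm_def entry_def fun_eq_iff)
        have sb3: "same_below ((h + 1) * N * N) s1 s3" using t3 by (simp add: same_below_def)
        have lev3: "levels h s3" by (rule levels_same[OF sb3 order_refl lev1])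
        have fr3: "fresh_from ((h + 1) * N * N) s3" using fr1 t3 by (simp add: fresh_from_def)
        have w3: "words s3 ''h'' 0 = h" using s3(1) w2 by (simp add: frm_def)
        have q1: "q \<le> S ^ 1" using q(1) NS1 by (rule le_trans)
        have qq: "q * q \<le> S ^ 2" using mult_le_power[OF q1 q1] by simp
        have qp: "q + 1 \<le> S ^ 2" using add_le_power[OF q1 o] by simp
        have "2 * q \<le> S ^ 2" using mult_le_power[OF two q1] by simp
        then have "2 * q + 1 \<le> S ^ 3" using add_le_power[OF _ o] by fastforce
        then have A1: "2 * q + 1 \<le> W" by (rule le_W) simp
        have "(L + 2) * (q * q) \<le> S ^ 4" using mult_le_power[OF add_le_power[OF LS1 two] qq] by simp
        then have "(L + 2) * (q * q) \<le> S ^ 6" by (rule le_power_mono) simp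
        then have "(h + 1) * N * N + (L + 2) * (q * q) \<le> S ^ 7" using add_le_power[OF B6] by fastforce
        then have A2: "(h + 1) * N * N + (L + 2) * (q * q) \<le> W" by (rule le_W) simp
        have "2 * (q * (q * h)) \<le> S ^ 6" using mult_le_power[OF two mult_le_power[OF q1 mult_le_power[OF q1 h(3)]]] by simp
        then have "2 * (q * (q * h)) + 2 \<le> S ^ 7" using add_le_power[of _ 6, OF _ le_power_mono[OF two]] by simp
        then have A3: "2 * (q * (q * h)) + 2 \<le> W" by (rule le_W) simp
        have "2 * (q * (q * (q + 1))) \<le> S ^ 5" using mult_le_power[OF two mult_le_power[OF q1 mult_le_power[OF q1 qp]]] by simp
        then have "2 * (q * (q * (q + 1))) + 2 \<le> S ^ 6" using add_le_power[of _ 5, OF _ le_power_mono[OF two]] by simp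
        then have A4: "2 * (q * (q * (q + 1))) + 2 \<le> W" by (rule le_W) simp
        have qL: "q \<le> 2 ^ L" "q + 1 \<le> 2 ^ L" using L(1) q(1) by simp_all
        have "q * (q * h) \<le> 2 ^ L * (2 ^ L * 2 ^ (2 * L))" by (intro mult_le_mono qL h(4))
        also have "\<dots> = 2 ^ (L + (L + 2 * L))" by (simp only: power_add)
        also have "L + (L + 2 * L) = 4 * L" by simp
        finally have k1: "q * (q * h) \<le> 2 ^ (4 * L)" .
        have "q * (q * (q + 1)) \<le> 2 ^ L * (2 ^ L * 2 ^ L)" by (intro mult_le_mono qL)
        also have "\<dots> = 2 ^ (L + (L + L))" by (simp only: power_add)
        also have "\<dots> \<le> (2 :: nat) ^ (4 * L)" by (rule power_increasing) simp_all
        finally have k2: "q * (q * (q + 1)) \<le> 2 ^ (4 * L)" .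
        have qW: "q \<le> W" using A1 by simp
        show ?case
        proof (rule wp_seq[OF matrix_wp[OF i3 q_def[symmetric] w3 hs_def[symmetric] qL(1) A1 A2 A3 A4 hW k1 k2 lev3 fr3 q(2)]], goal_cases)
          case (1 i) then show ?case .
        next
          case s4: (2 \<tau>4 s4)
          have sb4: "same_below ((h + 1) * N * N) s3 s4" using s4(2) by blast
          obtain r where r: "q \<le> r" "mat (hop s3 h hs q) hs q (words s4 ''mb'' 0) r s4" using s4(2) by blast
          have i4: "inp s4" by (rule inp_frm[OF i3 s4(1)]) simp_all
          have lev4: "levels h s4" by (rule levels_same[OF sb4 order_refl lev3])
          have m4: "mat (hop s4 h hs q) hs q (words s4 ''mb'' 0) r s4" using r(2) hop_same[OF sb4 q(2)] by simp
          have w4: "words s4 ''h'' 0 = h" "words s4 ''q'' 0 = q" using s4(1) w3 by (simp_all add: frm_def q_def)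
          have hit4: "\<exists>j<h. \<exists>i<q. tr (words s4 ''tp'') h u v j = hs i"
            if uv: "u < N" "v < N" "0 < words s4 ''tv'' (idx h u v)" "inj_on (tr (words s4 ''tp'') h u v) {..<h}" for u v
          proof -
            have sb: "same_below ((h + 1) * N * N) s1 s4" using sb3 sb4 by (simp add: same_below_def)
            have "idx h u v < (h + 1) * N * N" by (rule idx_less[OF uv(1,2)])
            then have tv: "0 < words s1 ''tv'' (idx h u v)" using uv(3) sb by (simp add: same_below_def)
            have eq: "tr (words s4 ''tp'') h u v j = tr (words s1 ''tp'') h u v j" if "j \<le> h" for j
              by (rule tr_same[OF sb lev1 uv(1,2) tv that])
            have "inj_on (tr (words s1 ''tp'') h u v) {..<h}" using uv(4) eq inj_on_cong[of "{..<h}" "tr (words s4 ''tp'') h u v" "tr (words s1 ''tp'') h u v"] by simp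
            from traced_hit[OF T2 hit[unfolded k_def] uv(1,2) tv this] obtain j i where "j < h" "i < q" "tr (words s1 ''tp'') h u v j = hs i" by blast
            then show ?thesis using eq[of j] by auto
          qed
          show ?case
          proof (rule wp_seq[OF scan_wp[OF i4 w4(1) hW h(2) w4(2) qW refl q(2) lev4 m4 r(1) hit4]], goal_cases)
            case (1 i) then show ?case .
          next
            case (2 u v) then show ?case by blast
          next
            case (3 u v) then show ?case by blast
          next
            case (4 u v) then show ?case by blast
          next
            case (5 u v) then show ?case by blast
          next
            case s5: (6 \<tau>5 s5)
            have i5: "inp s5" by (rule inp_frm[OF i4 s5(1)]) simp_all
            \<comment> \<open>At most one path was stored per pair of vertices, so \<open>k\<close>
              can be replaced by \<open>N * N\<close>.\<close>
            have Q: "q = 0 \<or> h \<le> N \<and> 1 \<le> real N * real N * (1 - real h / real N) ^ (q - 1)"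
            proof (cases "q = 0")
              case False
              then have b: "1 \<le> real k * (1 - real h / real N) ^ (q - 1)" "h \<le> N" using qb by blast+
              have "real h / real N \<le> 1" using b(2) h(2) by (simp add: divide_le_eq)
              then have "0 \<le> (1 - real h / real N) ^ (q - 1)" by simp
              moreover have "real k \<le> real N * real N" using k(1) by (metis of_nat_le_iff of_nat_mult)
              ultimately have "real k * (1 - real h / real N) ^ (q - 1) \<le> real N * real N * (1 - real h / real N) ^ (q - 1)" by (rule mult_right_mono[rotated])
              then show ?thesis using b by linarith
            qed simp
            have time: "\<tau>1 + (\<tau>2 + (\<tau>3 + (\<tau>4 + (\<tau>5 + \<tau>6)))) \<le> solve_time L h q" if "\<tau>6 \<le> 1100 * ((N + 1) * (m + 1))" for \<tau>6
              by (rule solve_time_ge[OF conjunct1[OF s1(2)] conjunct1[OF s2(2)] conjunct1[OF s3(2)] k(1) conjunct1[OF s4(2)] conjunct1[OF s5(2)] q(1) that])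
            have M: "1 * 1 \<le> (N + 1) * (m + 1)" by (intro mult_le_mono) simp_all
            show ?case
            proof (cases cyc)
              case False
              then have "words s5 ''has'' 0 = 0" using s5(2) by simp
              moreover have "8 \<le> 1100 * ((N + 1) * (m + 1))" using M by simp
              then have "\<tau>1 + (\<tau>2 + (\<tau>3 + (\<tau>4 + (\<tau>5 + 8)))) \<le> solve_time L h q" by (rule time)
              ultimately show ?thesis using False Q q(1) by (simp add: read_cycle_def) blast
            next
              case True
              then have x5: "0 < words s5 ''has'' 0" "reals s5 ''x'' 0 = lam" using s5(2) by blast+
              have b: "bval s5 (WLess (WLit 0) (V ''has''))" using x5 by simp
              \<comment> \<open>At \<open>lam\<close> itself the oracle answers yes, and then it
                leaves a feasible potential in \<open>d\<close>, from which the sharp arcs are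
                read.\<close>
              have nn: "noneg lam" using oracle_iff[OF True, of lam] by (simp add: noneg_def)
              show ?thesis unfolding wp_Cond if_P[OF b]
              proof (rule wp_seq[OF BF_wp[OF i5 x5(2)]], goal_cases)
                case s6: (1 \<tau>6 s6)
                have i6: "inp s6" by (rule inp_frm[OF i5 s6(1)]) simp_all
                have f6: "feasible (\<lambda>e. c e - lam * t e) (reals s6 ''d'')" using s6(2) nn by blast
                have w6: "reals s6 ''x'' 0 = lam" "words s6 ''al'' = (\<lambda>_. 0)" "words s6 ''ps'' = (\<lambda>_. 0)"
                  using x5(2) zw(1) s6(1) s5(1) s4(1) s3(1) s2(1) s1(1) by (simp_all add: frm_def)
                show ?case
                proof (rule wp_conseq[OF emit_cycle_wp[OF i6 w6(1) refl w6(2,3) f6 True]], goal_cases)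
                  case (1 \<tau>7 s7)
                  have "1 + bcost (WLess (WLit 0) (V ''has'')) + (\<tau>6 + \<tau>7) \<le> 1100 * ((N + 1) * (m + 1))" using 1(2) s6(2) M by simp
                  from time[OF this] show ?case using 1(2) True Q q(1) by auto
                qed
              qed
            qed
          qed
        qed
      qed
    qed
  qed
qed

end

section \<open>Numbering the vertices\<close>

text \<open>Only ends of arcs receive a number, from 1 on, and 0 marks the other vertices; the graph
  arrays use the number minus one. Leaving out isolated vertices gives \<open>N \<le> 2 * m\<close>.
  Otherwise quadratic terms in the number of vertices would break the time bound when arcs are
  few.\<close>

definition numbering :: "nat \<Rightarrow> (nat \<Rightarrow> nat) \<Rightarrow> nat \<Rightarrow> bool" where
  "numbering n f N \<longleftrightarrow> inj_on f {v. 0 < f v} \<and> {v. 0 < f v} \<subseteq> {..<n} \<and> (\<forall>v. f v \<le> N) \<and> N \<le> card {v. 0 < f v}"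

lemma numbering_le: "numbering n f N \<Longrightarrow> N \<le> n"
  unfolding numbering_def by (metis card_lessThan card_mono finite_lessThan le_trans)

lemma numbering_new:
  assumes f: "numbering n f N" and x: "f x = 0" "x < n"
  shows "numbering n (f(x := N + 1)) (N + 1)"
proof -
  let ?A = "{v. 0 < f v}"
  have A: "{v. 0 < (f(x := N + 1)) v} = insert x ?A" by auto
  have F: "inj_on f ?A" "?A \<subseteq> {..<n}" "\<And>v. f v \<le> N" "N \<le> card ?A" using f by (simp_all add: numbering_def)
  have "finite ?A" using F(2) by (rule finite_subset) simp
  then have "card (insert x ?A) = card ?A + 1" using x(1) by simp
  moreover have "inj_on (f(x := N + 1)) (insert x ?A)"
  proof (rule inj_onI)
    fix a b assume ab: "a \<in> insert x ?A" "b \<in> insert x ?A" "(f(x := N + 1)) a = (f(x := N + 1)) b"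
    have "f v \<noteq> N + 1" for v using F(3)[of v] by simp
    then show "a = b" using ab inj_onD[OF F(1), of a b] by (auto split: if_splits)
  qed
  moreover have "(f(x := N + 1)) v \<le> N + 1" for v using F(3)[of v] by simp
  ultimately show ?thesis unfolding numbering_def A using F(2,4) x(2) by auto
qed

definition number :: "name \<Rightarrow> name \<Rightarrow> com" where
  "number a b = Cond (WLess (WCell ''id'' (WCell a (V ''e''))) (WLit 1))
     (''N'' ::= WAdd (V ''N'') (WLit 1) ;; WAssign ''id'' (WCell a (V ''e'')) (V ''N'')) Skip ;;
   WAssign b (V ''e'') (WSub (WCell ''id'' (WCell a (V ''e''))) (WLit 1))"

lemma wmod_number [simp]: "wmod (number a b) = {''N'', ''id'', b}" "rmod (number a b) = {}"
  by (auto simp: number_def)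

lemma number_wp:
  assumes f: "numbering n (words s ''id'') (words s ''N'' 0)" and e: "words s ''e'' 0 = e" "words s a e = x" "x < n" and W: "words s ''N'' 0 + 1 \<le> W"
    and ab: "a \<notin> {''id'', ''N'', ''e''}" "b \<notin> {''id'', ''N'', ''e''}"
  shows "wp W (number a b) (\<lambda>\<tau> s'. \<tau> \<le> 80 \<and> numbering n (words s' ''id'') (words s' ''N'' 0) \<and> words s' ''N'' 0 \<le> words s ''N'' 0 + 1 \<and>
     (\<forall>v. 0 < words s ''id'' v \<longrightarrow> words s' ''id'' v = words s ''id'' v) \<and> 0 < words s' ''id'' x \<and> words s' b = (words s b)(e := words s' ''id'' x - 1)) s"
proof (cases "words s ''id'' x = 0")
  case True
  show ?thesis using True numbering_new[OF f True e(3)] ab e W unfolding number_def by (auto simp: fun_eq_iff)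
next
  case False
  have "words s ''id'' x \<le> words s ''N'' 0" using f by (simp add: numbering_def)
  then show ?thesis using False ab e W f unfolding number_def by (auto simp: fun_eq_iff)
qed

definition setup_graph :: com where
  "setup_graph = For ''e'' (V ''m'') (number ''tail'' ''tl'' ;; number ''head'' ''hd'')"

lemma wmod_setup_graph [simp]: "wmod setup_graph = {''e'', ''N'', ''id'', ''tl'', ''hd''}" "rmod setup_graph = {}"
  by (auto simp: setup_graph_def)

definition renamed :: "nat \<Rightarrow> store \<Rightarrow> nat \<Rightarrow> store \<Rightarrow> bool" where
  "renamed n s k s' \<longleftrightarrow> numbering n (words s' ''id'') (words s' ''N'' 0) \<and> words s' ''N'' 0 \<le> 2 * k \<and>
     (\<forall>e<k. 0 < words s' ''id'' (words s ''tail'' e) \<and> words s' ''tl'' e = words s' ''id'' (words s ''tail'' e) - 1 \<and>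
        0 < words s' ''id'' (words s ''head'' e) \<and> words s' ''hd'' e = words s' ''id'' (words s ''head'' e) - 1)"

text \<open>A number is never changed once given, so the entries written for earlier arcs stay
  valid, and each arc introduces at most two new numbers.\<close>

lemma setup_graph_wp:
  assumes m: "words s ''m'' 0 = m" "2 * m + 1 \<le> W" and e: "\<And>e. e < m \<Longrightarrow> words s ''tail'' e < n \<and> words s ''head'' e < n"
    and z: "words s ''id'' = (\<lambda>_. 0)" "words s ''N'' 0 = 0"
  shows "wp W setup_graph (\<lambda>\<tau> s'. \<tau> \<le> 200 * (m + 1) \<and> renamed n s m s') s"
  unfolding setup_graph_def
proof (rule wp_for[where n = m and c = 160 and I = "renamed n s"], goal_cases)
  case 3
  then show ?case using z by (simp add: renamed_def numbering_def)
next
  case (4 k s1) then show ?case using m by (simp add: frm_def)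
next
  case (5 k s1)
  have fr: "words s1 ''tail'' = words s ''tail''" "words s1 ''head'' = words s ''head''" using 5(2) by (simp_all add: frm_def)
  have R: "numbering n (words s1 ''id'') (words s1 ''N'' 0)" "words s1 ''N'' 0 \<le> 2 * k"
     "\<And>e. e < k \<Longrightarrow> 0 < words s1 ''id'' (words s ''tail'' e) \<and> words s1 ''tl'' e = words s1 ''id'' (words s ''tail'' e) - 1 \<and>
        0 < words s1 ''id'' (words s ''head'' e) \<and> words s1 ''hd'' e = words s1 ''id'' (words s ''head'' e) - 1"
    using 5(4) by (simp_all add: renamed_def)
  have W1: "words s1 ''N'' 0 + 1 \<le> W" using R(2) 5(1) m(2) by simp
  have t: "words s1 ''tail'' k = words s ''tail'' k" "words s ''tail'' k < n" using fr e[OF 5(1)] by simp_all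
  have ab: "''tail'' \<notin> {''id'', ''N'', ''e''}" "''tl'' \<notin> {''id'', ''N'', ''e''}" "''head'' \<notin> {''id'', ''N'', ''e''}" "''hd'' \<notin> {''id'', ''N'', ''e''}" by simp_all
  show ?case
  proof (rule wp_seq[OF number_wp[OF R(1) 5(3) t W1 ab(1,2)]], goal_cases)
    case s2: (1 \<tau>1 s2)
    have W2: "words s2 ''N'' 0 + 1 \<le> W" using s2(2) R(2) 5(1) m(2) by simp
    have h: "words s2 ''e'' 0 = k" "words s2 ''head'' k = words s ''head'' k" "words s ''head'' k < n" using s2(1) fr e[OF 5(1)] 5(3) by (simp_all add: frm_def)
    have n2: "numbering n (words s2 ''id'') (words s2 ''N'' 0)" using s2(2) by blast
    show ?case
    proof (rule wp_conseq[OF number_wp[OF n2 h W2 ab(3,4)]], goal_cases)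
      case (1 \<tau>2 s3)
      have tl: "words s3 ''tl'' = words s2 ''tl''" "words s2 ''hd'' = words s1 ''hd''" using 1(1) s2(1) by (simp_all add: frm_def)
      have id2: "words s2 ''id'' v = words s1 ''id'' v" if "0 < words s1 ''id'' v" for v using s2(2) that by blast
      have id3: "words s3 ''id'' v = words s2 ''id'' v" if "0 < words s2 ''id'' v" for v using 1(2) that by blast
      have id13: "words s3 ''id'' v = words s1 ''id'' v" if "0 < words s1 ''id'' v" for v using id2[OF that] id3[of v] that by simp
      have pk: "0 < words s2 ''id'' (words s ''tail'' k)" "0 < words s3 ''id'' (words s ''head'' k)"
        "words s2 ''tl'' = (words s1 ''tl'')(k := words s2 ''id'' (words s ''tail'' k) - 1)" "words s3 ''hd'' = (words s2 ''hd'')(k := words s3 ''id'' (words s ''head'' k) - 1)"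
        using s2(2) 1(2) by blast+
      have new: "0 < words s3 ''id'' (words s ''tail'' e) \<and> words s3 ''tl'' e = words s3 ''id'' (words s ''tail'' e) - 1 \<and>
        0 < words s3 ''id'' (words s ''head'' e) \<and> words s3 ''hd'' e = words s3 ''id'' (words s ''head'' e) - 1" if "e < Suc k" for e
      proof (cases "e = k")
        case True
        then show ?thesis using pk id3[OF pk(1)] tl by simp
      next
        case False
        then have "e < k" using that by simp
        from R(3)[OF this] show ?thesis using False id13 pk tl by simp
      qed
      have "words s3 ''N'' 0 \<le> 2 * Suc k" using 1(2) s2(2) R(2) by simp
      then have "renamed n s (Suc k) s3" unfolding renamed_def using 1(2) new by blast
      then show ?case using 1(2) s2(2) by (simp add: renamed_def)
    qed
  qed
next
  case (6 \<tau> s') then show ?case by simp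
qed (use m in simp_all)

text \<open>\<open>lb\<close> receives the bit length of \<open>N\<close>. This word array is
  unrelated to the real array \<open>lb\<close> of the candidates: words and reals have separate
  name spaces.\<close>

definition logs :: com where
  "logs = ''pw'' ::= WLit 1 ;; ''lb'' ::= WLit 0 ;;
     While (BNot (WLess (V ''N'') (V ''pw''))) (''pw'' ::= WMul (V ''pw'') (WLit 2) ;; ''lb'' ::= WAdd (V ''lb'') (WLit 1))"

lemma wmod_logs [simp]: "wmod logs = {''pw'', ''lb''}" "rmod logs = {}"
  by (auto simp: logs_def)

lemma logs_wp:
  assumes N: "words s ''N'' 0 = N" "2 * N + 1 \<le> W"
  shows "wp W logs (\<lambda>\<tau> s'. \<tau> \<le> 40 * (words s' ''lb'' 0 + 1) \<and> N + 1 \<le> 2 ^ words s' ''lb'' 0 \<and>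
     (words s' ''lb'' 0 = 0 \<or> 2 ^ (words s' ''lb'' 0 - 1) \<le> N)) s"
proof -
  let ?s = "s\<lparr>words := (words s)(''pw'' := (words s ''pw'')(0 := 1), ''lb'' := (words s ''lb'')(0 := 0))\<rparr>"
  let ?b = "BNot (WLess (V ''N'') (V ''pw''))" let ?P = "''pw'' ::= WMul (V ''pw'') (WLit 2) ;; ''lb'' ::= WAdd (V ''lb'') (WLit 1)"
  have "wp W (While ?b ?P) (\<lambda>\<tau> s'. 6 + \<tau> \<le> 40 * (words s' ''lb'' 0 + 1) \<and> N + 1 \<le> 2 ^ words s' ''lb'' 0 \<and>
     (words s' ''lb'' 0 = 0 \<or> 2 ^ (words s' ''lb'' 0 - 1) \<le> N)) ?s"
  proof (rule wp_while[where \<mu> = "\<lambda>s. N + 1 - words s ''pw'' 0" and Inv = "\<lambda>\<tau> s'. \<tau> \<le> 30 * words s' ''lb'' 0 \<and> words s' ''pw'' 0 = 2 ^ words s' ''lb'' 0 \<and>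
      (words s' ''lb'' 0 = 0 \<or> 2 ^ (words s' ''lb'' 0 - 1) \<le> N)"], goal_cases)
    case 1 show ?case by simp
  next
    case (2 \<tau> s1)
    let ?l = "words s1 ''lb'' 0"
    have v: "words s1 ''N'' 0 = N" using 2(1) N by (simp add: frm_def)
    have le: "2 ^ ?l \<le> N" using 2(2,3) v by simp
    have "?l < N" by (rule less_le_trans[OF less_exp le])
    then have lW: "?l + 1 \<le> W" "2 * 2 ^ ?l \<le> W" using le N(2) by simp_all
    have dec: "N + 1 - 2 * 2 ^ ?l < N + 1 - 2 ^ ?l" by (rule diff_less_mono2) (use le in simp_all)
    show ?case using 2(2) v le lW dec by (simp add: mult.commute power_add)
  next
    case (3 \<tau> s1)
    have v: "words s1 ''N'' 0 = N" using 3(1) N by (simp add: frm_def)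
    then show ?case using 3(2,3) by simp
  qed
  then show ?thesis using N(2) unfolding logs_def by simp
qed

section \<open>The choice of the length bound\<close>

definition pow4 :: "wexp \<Rightarrow> wexp" where "pow4 x = WMul (WMul x x) (WMul x x)"

text \<open>The least positive integer that is at least \<open>N^(1/2) m^(-1/4) L\<close> when
  \<open>m\<close> is positive, with fourth powers in place of roots. Linear search is affordable,
  as its cost is proportional to the result.\<close>

definition choose_h :: com where
  "choose_h = ''h'' ::= WLit 1 ;;
     While (WLess (WMul (pow4 (V ''h'')) (V ''m'')) (WMul (WMul (V ''N'') (V ''N'')) (pow4 (V ''lb'')))) (''h'' ::= WAdd (V ''h'') (WLit 1))"

lemma wmod_choose_h [simp]: "wmod choose_h = {''h''}" "rmod choose_h = {}"
  by (auto simp: choose_h_def)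

lemma choose_h_wp:
  assumes v: "words s ''N'' 0 = N" "words s ''m'' 0 = m" "words s ''lb'' 0 = L" and N: "N \<le> 2 * m" and W: "N * L + 1 \<le> W"
  shows "wp W choose_h (\<lambda>\<tau> s'. \<tau> \<le> 100 * (words s' ''h'' 0 + 1) \<and> 1 \<le> words s' ''h'' 0 \<and> N * N * L ^ 4 \<le> words s' ''h'' 0 ^ 4 * m \<and>
     (words s' ''h'' 0 = 1 \<or> (words s' ''h'' 0 - 1) ^ 4 * m < N * N * L ^ 4 \<and> words s' ''h'' 0 \<le> N * L)) s"
proof -
  let ?s = "s\<lparr>words := (words s)(''h'' := (words s ''h'')(0 := 1))\<rparr>"
  let ?b = "WLess (WMul (pow4 (V ''h'')) (V ''m'')) (WMul (WMul (V ''N'') (V ''N'')) (pow4 (V ''lb'')))" let ?P = "''h'' ::= WAdd (V ''h'') (WLit 1)"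
  have p4: "x * x * (x * x) = x ^ 4" for x :: nat by (simp add: power4_eq_xxxx)
  \<comment> \<open>The hypothesis makes \<open>N\<close> positive, so \<open>N \<le> 2 * m\<close>
    excludes \<open>m = 0\<close>; then \<open>N * L\<close> already passes the test. This bounds
    the result of the search.\<close>
  have small: "k < N * L" if "k ^ 4 * m < N * N * L ^ 4" for k
  proof (rule ccontr)
    assume "\<not> k < N * L"
    then have "(N * L) ^ 4 \<le> k ^ 4" by (intro power_mono) simp_all
    moreover have "N * N * L ^ 4 \<le> (N * L) ^ 4"
    proof -
      have "N * N * 1 \<le> N * N * (N * N)" if "1 \<le> N" using that by (intro mult_le_mono2) (metis mult_le_mono nat_mult_1)
      then have "N * N \<le> N ^ 4" by (cases "N = 0") (simp_all add: power4_eq_xxxx mult.assoc)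
      then show ?thesis by (simp add: power_mult_distrib)
    qed
    moreover have "m \<noteq> 0" using that N by (cases "m = 0") simp_all
    then have "k ^ 4 * 1 \<le> k ^ 4 * m" by (intro mult_le_mono2) simp
    ultimately have "N * N * L ^ 4 \<le> k ^ 4 * m" unfolding mult_1_right by (meson le_trans)
    then show False using that by simp
  qed
  have "wp W (While ?b ?P) (\<lambda>\<tau> s'. 3 + \<tau> \<le> 100 * (words s' ''h'' 0 + 1) \<and> 1 \<le> words s' ''h'' 0 \<and> N * N * L ^ 4 \<le> words s' ''h'' 0 ^ 4 * m \<and>
     (words s' ''h'' 0 = 1 \<or> (words s' ''h'' 0 - 1) ^ 4 * m < N * N * L ^ 4 \<and> words s' ''h'' 0 \<le> N * L)) ?s"
  proof (rule wp_while[where \<mu> = "\<lambda>s. N * L + 1 - words s ''h'' 0" and Inv = "\<lambda>\<tau> s'. \<tau> \<le> 60 * words s' ''h'' 0 \<and> 1 \<le> words s' ''h'' 0 \<and>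
     (words s' ''h'' 0 = 1 \<or> (words s' ''h'' 0 - 1) ^ 4 * m < N * N * L ^ 4 \<and> words s' ''h'' 0 \<le> N * L)"], goal_cases)
    case 1 show ?case by simp
  next
    case (2 \<tau> s1)
    let ?h = "words s1 ''h'' 0"
    have w: "words s1 ''N'' 0 = N" "words s1 ''m'' 0 = m" "words s1 ''lb'' 0 = L" using 2(1) v by (simp_all add: frm_def)
    have lt: "?h ^ 4 * m < N * N * L ^ 4" using 2(3) w by (simp add: pow4_def p4)
    then have hl: "?h < N * L" by (rule small)
    then have hW: "?h + 1 \<le> W" using W by simp
    have dec: "N * L + 1 - (?h + 1) < N * L + 1 - ?h" by (rule diff_less_mono2) (use hl in simp_all)
    show ?case using 2(2) lt hl hW dec by (simp add: pow4_def)
  next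
    case (3 \<tau> s1)
    have w: "words s1 ''N'' 0 = N" "words s1 ''m'' 0 = m" "words s1 ''lb'' 0 = L" using 3(1) v by (simp_all add: frm_def)
    have "N * N * L ^ 4 \<le> words s1 ''h'' 0 ^ 4 * m" using 3(3) w by (simp add: pow4_def p4)
    then show ?case using 3(2) by (simp add: pow4_def)
  qed
  then show ?thesis using W unfolding choose_h_def by simp
qed

text \<open>The constant \<open>mrc_ram.solve\<close> takes none of the parameters of its locale as
  arguments, so this is one program for all inputs.\<close>

definition prog :: com where
  "prog = setup_graph ;; logs ;; choose_h ;; mrc_ram.solve"

section \<open>Correctness and running time\<close>

text \<open>\<open>lam\<close> is the least ratio among the finitely many simple closed walks.
  \<open>closed_decomp\<close> extends positive times and nonnegative costs at \<open>lam\<close> to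
  all closed walks, and \<open>ex_feasible\<close> supplies \<open>p\<close>. Without cycles
  \<open>lam\<close> is the unspecified minimum of the empty set, and the requirements still
  hold.\<close>

lemma (in arcgraph) ex_mrc:
  assumes pos: "\<And>es. simple_closed es \<Longrightarrow> 0 < wt t es"
  shows "\<exists>lam p. mrc N m sr ds c t lam p"
proof -
  define r where "r es = wt c es / wt t es" for es
  define lam where "lam = Min (r ` {es. simple_closed es})"
  have fin: "finite (r ` {es. simple_closed es})" using finite_simple_closed by (rule finite_imageI)
  have tpos: "0 < wt t es" if "walk u es u" "es \<noteq> []" for u es
    by (rule closed_decomp[where P = "\<lambda>x. 0 < x", OF that]) (use pos in simp_all)
  have diff: "wt (\<lambda>e. c e - x * t e) es = wt c es - x * wt t es" for x es
    by (induction es) (simp_all add: algebra_simps)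
  have nn: "0 \<le> wt (\<lambda>e. c e - lam * t e) es" if "walk u es u" for u es
  proof (cases "es = []")
    case False
    show ?thesis
    proof (rule closed_decomp[where P = "\<lambda>x. 0 \<le> x", OF that False])
      fix es assume es: "simple_closed es"
      then have "lam \<le> r es" unfolding lam_def by (intro Min_le[OF fin]) simp
      then show "0 \<le> wt (\<lambda>e. c e - lam * t e) es" using pos[OF es] by (simp add: diff r_def le_divide_eq)
    qed simp
  qed simp
  have "\<exists>p. feasible (\<lambda>e. c e - lam * t e) p" by (rule ex_feasible) (rule nn)
  then obtain p where p: "feasible (\<lambda>e. c e - lam * t e) p" by blast
  have "\<exists>v es'. walk v es' v \<and> es' \<noteq> [] \<and> wt c es' = lam * wt t es'" if "walk u es u" "es \<noteq> []" for u es
  proof -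
    from ex_simple_closed[OF that] have "r ` {es. simple_closed es} \<noteq> {}" by blast
    from Min_in[OF fin this] obtain es' where es': "simple_closed es'" "lam = r es'" unfolding lam_def by blast
    then have "wt c es' = lam * wt t es'" using pos[OF es'(1)] by (simp add: r_def)
    then show ?thesis using es'(1) unfolding simple_closed_def by blast
  qed
  then have "mrc N m sr ds c t lam p"
    by (intro mrc.intro arcgraph_axioms mrc_axioms.intro tpos p)
  then show ?thesis by blast
qed

lemma (in mrc) cyc_iff: "cyc \<longleftrightarrow> (\<exists>es. simple_closed es)"
  using ex_simple_closed unfolding cyc_def simple_closed_def by blast

section \<open>From the given digraph to the renumbered arcs and back\<close>

locale renaming =
  fixes m :: nat and G :: "(nat, nat) pre_digraph" and f :: "nat \<Rightarrow> nat" and N :: nat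
  assumes nomulti: "nomulti_digraph G" and arcsG: "arcs G = {..<m}"
    and inj: "inj_on f {v. 0 < f v}" and f_le: "f v \<le> N"
    and f_pos: "e < m \<Longrightarrow> 0 < f (tail G e) \<and> 0 < f (head G e)"
begin

definition sr :: "nat \<Rightarrow> nat" where "sr e = f (tail G e) - 1"
definition ds :: "nat \<Rightarrow> nat" where "ds e = f (head G e) - 1"

lemma wfG: "wf_digraph G"
  using nomulti by (rule nomulti_digraph.axioms)

lemma f_eq: "0 < f u \<Longrightarrow> 0 < f v \<Longrightarrow> f u - 1 = f v - 1 \<longleftrightarrow> u = v"
  using inj_onD[OF inj, of u v] by auto

lemma pred_less: "0 < f v \<Longrightarrow> f v - 1 < N"
  using f_le[of v] by simp

sublocale arcgraph N m sr ds
proof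
  show "e < m \<Longrightarrow> sr e < N" "e < m \<Longrightarrow> ds e < N" for e
    unfolding sr_def ds_def using f_pos[of e] by (intro pred_less; simp)+
qed

lemma cas_iff: "set es \<subseteq> {..<m} \<Longrightarrow> 0 < f u \<Longrightarrow> 0 < f v \<Longrightarrow> pre_digraph.cas G u es v \<longleftrightarrow> walk (f u - 1) es (f v - 1)"
proof (induction es arbitrary: u)
  case Nil
  then show ?case using f_eq by (simp add: pre_digraph.cas.simps)
next
  case (Cons e es)
  have e: "e < m" "0 < f (tail G e)" "0 < f (head G e)" using Cons.prems f_pos by simp_all
  then have "pre_digraph.cas G (head G e) es v \<longleftrightarrow> walk (ds e) es (f v - 1)" using Cons unfolding ds_def by simp
  moreover have "tail G e = u \<longleftrightarrow> sr e = f u - 1" unfolding sr_def using f_eq[OF e(2) Cons.prems(2)] by blast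
  ultimately show ?case using e(1) by (simp add: pre_digraph.cas.simps)
qed

lemma distinct_sr: "set es \<subseteq> {..<m} \<Longrightarrow> distinct (map sr es) \<longleftrightarrow> distinct (map (tail G) es)"
proof -
  assume es: "set es \<subseteq> {..<m}"
  have p: "0 < f x" if "x \<in> set (map (tail G) es)" for x using that es f_pos by auto
  have "inj_on (\<lambda>v. f v - 1) (set (map (tail G) es))"
    by (rule inj_onI) (use f_eq p in blast)
  then have "distinct (map (\<lambda>v. f v - 1) (map (tail G) es)) \<longleftrightarrow> distinct (map (tail G) es)"
    unfolding distinct_map by blast
  then show ?thesis by (simp add: sr_def[abs_def] comp_def)
qed

lemma cas_last: "pre_digraph.cas G u es v \<Longrightarrow> es \<noteq> [] \<Longrightarrow> head G (last es) = v"
proof (induction es arbitrary: u)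
  case (Cons e es)
  then show ?case using Cons.IH[of "head G e"] by (cases "es = []") (simp_all add: pre_digraph.cas.simps)
qed simp

text \<open>The library forbids repetitions among all vertices of the walk but the first;
  \<open>simple_closed\<close> forbids them among the sources, which are all vertices but the last.
  On a closed walk the first and the last vertex coincide, so the conditions agree.\<close>

lemma cycle_iff: "pre_digraph.cycle G es \<longleftrightarrow> simple_closed es"
proof
  assume "pre_digraph.cycle G es"
  then obtain u where u: "pre_digraph.awalk G u es u" "distinct (tl (pre_digraph.awalk_verts G u es))" "es \<noteq> []"
    unfolding pre_digraph.cycle_def by blast
  then obtain e fs where e: "es = e # fs" by (cases es) auto
  have a: "set es \<subseteq> {..<m}" "pre_digraph.cas G u es u" using u(1) arcsG by (simp_all add: pre_digraph.awalk_def)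
  then have t: "tail G e = u" "e < m" using e by (simp_all add: pre_digraph.cas.simps)
  have "head G (last es) = u" by (rule cas_last[OF a(2) u(3)])
  then have "distinct (map (tail G) es)" using u(2) e t(1) by (auto simp: pre_digraph.awalk_verts_conv)
  moreover have "walk (f u - 1) es (f u - 1)" using cas_iff[OF a(1)] a(2) t f_pos by blast
  ultimately show "simple_closed es" using distinct_sr[OF a(1)] u(3) unfolding simple_closed_def by blast
next
  assume "simple_closed es"
  then obtain x where x: "es \<noteq> []" "distinct (map sr es)" "walk x es x" unfolding simple_closed_def by blast
  have a: "set es \<subseteq> {..<m}" by (rule walk_arcs[OF x(3)])
  obtain e fs where e: "es = e # fs" using x(1) by (cases es) auto
  let ?u = "tail G e"
  have u: "e < m" "0 < f ?u" "x = f ?u - 1" using e x(3) f_pos by (simp_all add: sr_def)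
  have c: "pre_digraph.cas G ?u es ?u" using cas_iff[OF a u(2,2)] x(3) u(3) by simp
  have "?u \<in> verts G" using wf_digraph.tail_in_verts[OF wfG] u(1) arcsG by simp
  then have w: "pre_digraph.awalk G ?u es ?u" using c a arcsG by (simp add: pre_digraph.awalk_def)
  have "head G (last es) = ?u" by (rule cas_last[OF c x(1)])
  moreover have "distinct (map (tail G) es)" using distinct_sr[OF a] x(2) by blast
  ultimately have "distinct (tl (pre_digraph.awalk_verts G ?u es))" using e by (auto simp: pre_digraph.awalk_verts_conv)
  then show "pre_digraph.cycle G es" using w x(1) unfolding pre_digraph.cycle_def by blast
qed

text \<open>Without parallel arcs an arc is determined by its ends.\<close>

lemma arcs_le: "m \<le> N * N"
proof -
  have "inj_on (\<lambda>e. sr e * N + ds e) {..<m}"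
  proof (rule inj_onI)
    fix e e' assume e: "e \<in> {..<m}" "e' \<in> {..<m}" "sr e * N + ds e = sr e' * N + ds e'"
    then have "sr e = sr e'" "ds e = ds e'" using pair_index_inj[of "sr e" N "ds e" "sr e'" "ds e'"] ds_less by simp_all
    then have "tail G e = tail G e'" "head G e = head G e'" using e(1,2) f_pos f_eq unfolding sr_def ds_def by simp_all
    then show "e = e'" using nomulti_digraph.no_multi_arcs[OF nomulti, of e e'] e(1,2) arcsG by (simp add: arc_to_ends_def)
  qed
  moreover have "(\<lambda>e. sr e * N + ds e) ` {..<m} \<subseteq> {..<N * N}" using pair_index_less sr_less ds_less by auto
  ultimately have "card {..<m} \<le> card {..<N * N}" by (intro card_inj_on_le) simp_all
  then show ?thesis by simp
qed

lemma awalk_cost_eq: "wf_digraph.awalk_cost w es = wt w es"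
  unfolding wf_digraph.awalk_cost_def[OF wfG] wt_def ..

lemma correct:
  assumes "mrc N m sr ds c t lam p" and C: "if mrc.cyc m sr ds then simple_closed C \<and> wt c C = lam * wt t C else C = []"
  shows "correct_output G c t C"
proof -
  interpret mrc N m sr ds c t lam p by fact
  have pos: "0 < wt t es" if "simple_closed es" for es using that tpos unfolding simple_closed_def by blast
  show ?thesis
  proof (cases "\<exists>es. simple_closed es")
    case True
    then have C: "simple_closed C" "wt c C = lam * wt t C" using C cyc_iff by auto
    have "ratio c t C = lam" using C pos[OF C(1)] by (simp add: ratio_def awalk_cost_eq)
    moreover have "lam \<le> ratio c t es" if es: "simple_closed es" for es
    proof -
      from es obtain u where "walk u es u" unfolding simple_closed_def by blast
      from lam_le[OF this] show ?thesis using pos[OF es] by (simp add: ratio_def awalk_cost_eq le_divide_eq)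
    qed
    ultimately show ?thesis using True C(1) by (auto simp: correct_output_def min_ratio_cycle_def cycle_iff)
  next
    case False
    then show ?thesis using C cyc_iff by (auto simp: correct_output_def cycle_iff)
  qed
qed

end

section \<open>Arithmetic of the running time\<close>

lemma hitting_size:
  fixes N h :: real
  assumes N: "1 \<le> N" and h: "0 \<le> h" "h \<le> N" and p: "1 \<le> N * N * (1 - h / N) ^ k"
  shows "real k * h \<le> 2 * N * ln N"
proof -
  \<comment> \<open>\<open>1 - x \<le> exp (- x)\<close> turns the geometric decay of the number of
    unhit paths into an exponential one; taking logarithms then bounds the number of choices by
    about \<open>2 * N * ln N / h\<close>.\<close>
  have "1 - h / N \<le> exp (- (h / N))" using exp_ge_add_one_self[of "- (h / N)"] by simp
  moreover have "0 \<le> 1 - h / N" using N h by (simp add: divide_le_eq)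
  ultimately have "(1 - h / N) ^ k \<le> exp (- (h / N)) ^ k" by (rule power_mono)
  also have "\<dots> = exp (- (real k * h / N))" by (simp add: exp_of_nat_mult[symmetric])
  finally have "1 \<le> N * N * exp (- (real k * h / N))" using p N by (meson mult_left_mono order_trans zero_le_mult_iff zero_le_one)
  then have "exp (real k * h / N) \<le> N * N" by (simp add: exp_minus field_simps)
  also have "N * N = exp (ln N + ln N)" unfolding exp_add using N by simp
  finally have "real k * h / N \<le> ln N + ln N" unfolding exp_le_cancel_iff .
  then have "real k * h / N \<le> 2 * ln N" by simp
  then show ?thesis using N by (simp add: divide_le_eq mult.commute mult.left_commute)
qed

text \<open>Bounds the square of the bit length of \<open>N\<close> by a multiple of
  \<open>N\<close>, hence of \<open>m\<close>, so that the logarithm is at most of the order of the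
  square root of \<open>m\<close>.\<close>

lemma square_le_power2: "k ^ 2 \<le> 4 * 2 ^ k" for k :: nat
proof (cases "3 \<le> k")
  case True
  then show ?thesis
  proof (induction k rule: dec_induct)
    case (step j)
    have "3 * j \<le> j * j" using step(1) by (rule mult_le_mono1)
    then have "Suc (j + j) \<le> j * j" by (rule le_trans[rotated]) (use step(1) in simp)
    then have "(Suc j) ^ 2 \<le> 2 * j ^ 2" by (simp add: power2_eq_square)
    then show ?case using step(3) by simp
  qed simp
next
  case False
  then consider "k = 0" | "k = 1" | "k = 2" by linarith
  then show ?thesis by cases simp_all
qed

text \<open>Here N = (r b)^2 and m = b^4, so that h is about r L and the hitting set has size about r b^2.\<close>

lemma work_bound:
  fixes r b L h q N m :: real
  assumes r: "1 \<le> r" and b: "1 \<le> b" and rb: "r\<^sup>2 \<le> 2 * b\<^sup>2" and L: "1 \<le> L" "L \<le> 4 * b\<^sup>2"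
    and N: "N = r\<^sup>2 * b\<^sup>2" and m: "m = b ^ 4" and h: "0 \<le> h" "h \<le> 2 * (r * L)" and q: "0 \<le> q" "q + 1 \<le> 4 * (r * b\<^sup>2)"
  shows "40000 * ((L + 2) * ((4 * L + 1) * ((q + 1) * ((q + 1) * (q + h + 1)) + (N + 1) * (m + 1)))) +
     40000 * ((h + 1) * ((4 * L + 1) * ((N + 1) * (m + 1)))) + 4000 * ((N + 1) * (N + 1) * (h + 1)) +
     (200 * (m + 1) + 40 * (L + 1) + 100 * (h + 1)) \<le> 200000000 * (L\<^sup>2 * (r * b\<^sup>2) ^ 3)"
proof -
  define x where "x = b\<^sup>2"
  have x1: "1 \<le> x" unfolding x_def by (rule one_le_power[OF b])
  have x: "1 \<le> x" "r\<^sup>2 \<le> 2 * x" "L \<le> 4 * x" "N = r\<^sup>2 * x" "m = x\<^sup>2" "q + 1 \<le> 4 * (r * x)"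
    using assms x1 by (simp_all add: x_def power2_eq_square power4_eq_xxxx mult.assoc)
  define Y where "Y = L\<^sup>2 * (r * x) ^ 3"
  have one: "1 \<le> r\<^sup>2" "1 \<le> x\<^sup>2" "1 \<le> L\<^sup>2" using r x L by (simp_all add: one_le_power)
  have rx: "1 \<le> r\<^sup>2 * x" using mult_mono[OF one(1) x(1)] by simp
  have N1: "1 \<le> N" "N + 1 \<le> 2 * (r\<^sup>2 * x)" using rx x(4) by linarith+
  have m1: "1 \<le> m" "m + 1 \<le> 2 * x\<^sup>2" using one(2) x(5) by linarith+
  have rL: "1 \<le> r * L" using mult_mono[OF r L(1)] r by simp
  have h3: "h + 1 \<le> 3 * (r * L)" using h rL by simp
  have L3: "L + 2 \<le> 3 * L" "4 * L + 1 \<le> 5 * L" using L by simp_all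
  \<comment> \<open>\<open>U ^ 3\<close> is \<open>N^(3/2) m^(3/4)\<close>, so the target is a
    multiple of \<open>L\<^sup>2 * U ^ 3\<close>.\<close>
  define U where "U = r * x"
  have U: "1 \<le> U" "x \<le> U" "r \<le> U" unfolding U_def using mult_mono[OF r x(1)] mult_right_mono[OF r, of x] mult_left_mono[OF x(1), of r] r x(1) by simp_all
  have U3: "1 \<le> U ^ 3" "U \<le> U ^ 3" "U\<^sup>2 \<le> U ^ 3" using U(1) by (simp_all add: one_le_power self_le_power power_increasing)
  have Y: "Y = L\<^sup>2 * U ^ 3" by (simp add: Y_def U_def)
  have LL: "L \<le> L\<^sup>2" using L(1) by (simp add: self_le_power)
  have UY: "U ^ 3 \<le> Y" "L\<^sup>2 \<le> Y" unfolding Y using mult_right_mono[OF one(3), of "U ^ 3"] mult_left_mono[OF U3(1), of "L\<^sup>2"] U3(1) U(1) by simp_all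
  have NM: "(N + 1) * (m + 1) \<le> (2 * (r\<^sup>2 * x)) * (2 * x\<^sup>2)" by (rule mult_mono) (use N1 m1 r x in simp_all)
  have NM0: "0 \<le> (N + 1) * (m + 1)" using N1 m1 by simp
  have "(h + 1) * ((4 * L + 1) * ((N + 1) * (m + 1))) \<le> (3 * (r * L)) * ((5 * L) * ((2 * (r\<^sup>2 * x)) * (2 * x\<^sup>2)))"
    by (intro mult_mono h3 L3 NM) (use h L r x NM0 rL in simp_all)
  also have "\<dots> = 60 * Y" by (simp add: Y_def power2_eq_square power3_eq_cube)
  finally have A: "(h + 1) * ((4 * L + 1) * ((N + 1) * (m + 1))) \<le> 60 * Y" .
  have "(N + 1) * (N + 1) * (h + 1) \<le> (2 * (r\<^sup>2 * x)) * (2 * (r\<^sup>2 * x)) * (3 * (r * L))"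
    by (intro mult_mono h3 N1) (use h L r x N1 in simp_all)
  also have "\<dots> = 12 * (L * (r ^ 3 * x\<^sup>2)) * r\<^sup>2" by (simp add: power2_eq_square power3_eq_cube)
  \<comment> \<open>Here \<open>r\<^sup>2 \<le> 2 * x\<close>, that is \<open>N \<le> 2 * m\<close>,
    absorbs the surplus factor \<open>r\<^sup>2\<close> of the term quadratic in
    \<open>N\<close>.\<close>
  also have "\<dots> \<le> 12 * (L * (r ^ 3 * x\<^sup>2)) * (2 * x)" by (rule mult_left_mono[OF x(2)]) (use L r x in simp)
  also have "\<dots> = 24 * (L * U ^ 3)" by (simp add: U_def power2_eq_square power3_eq_cube)
  also have "\<dots> \<le> 24 * Y" unfolding Y using mult_right_mono[OF LL, of "U ^ 3"] U3(1) U(1) by simp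
  finally have Z: "(N + 1) * (N + 1) * (h + 1) \<le> 24 * Y" .
  \<comment> \<open>\<open>L \<le> 4 * x\<close> brings \<open>h\<close> down to the order of
    \<open>U\<close>, which is also the order of \<open>q\<close>; so the factor
    \<open>q + h + 1\<close> of the first matrix and of the squarings is harmless.\<close>
  have rLU: "r * L \<le> 4 * U" using mult_left_mono[OF x(3), of r] r by (simp add: U_def)
  have qU: "q + 1 \<le> 4 * U" "q + h + 1 \<le> 12 * U" using x(6) h(2) rLU by (simp_all add: U_def)
  have "(q + 1) * ((q + 1) * (q + h + 1)) \<le> (4 * U) * ((4 * U) * (12 * U))"
    by (intro mult_mono qU) (use q h U in simp_all)
  also have "\<dots> = 192 * U ^ 3" by (simp add: power3_eq_cube)
  finally have Q: "(q + 1) * ((q + 1) * (q + h + 1)) \<le> 192 * U ^ 3" .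
  have "(2 * (r\<^sup>2 * x)) * (2 * x\<^sup>2) = 4 * (U\<^sup>2 * x)" by (simp add: U_def power2_eq_square)
  also have "\<dots> \<le> 4 * (U\<^sup>2 * U)" using U by (simp add: mult_left_mono)
  also have "\<dots> = 4 * U ^ 3" by (simp add: power2_eq_square power3_eq_cube)
  finally have QM: "(q + 1) * ((q + 1) * (q + h + 1)) + (N + 1) * (m + 1) \<le> 196 * U ^ 3" using NM Q by linarith
  have "(L + 2) * ((4 * L + 1) * ((q + 1) * ((q + 1) * (q + h + 1)) + (N + 1) * (m + 1))) \<le> (3 * L) * ((5 * L) * (196 * U ^ 3))"
    by (intro mult_mono L3 QM) (use L q h NM0 U3(1) in simp_all)
  also have "\<dots> = 2940 * Y" by (simp add: Y power2_eq_square)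
  finally have C: "(L + 2) * ((4 * L + 1) * ((q + 1) * ((q + 1) * (q + h + 1)) + (N + 1) * (m + 1))) \<le> 2940 * Y" .
  have "x\<^sup>2 \<le> U\<^sup>2" using U(2) x(1) by (intro power_mono) simp_all
  then have D1: "m + 1 \<le> 2 * Y" using m1(2) U3(3) UY(1) by linarith
  have D2: "L + 1 \<le> 2 * Y" using LL L(1) UY(2) by linarith
  have "r * L \<le> U ^ 3 * L\<^sup>2" by (intro mult_mono LL) (use U U3 r L in simp_all)
  then have D3: "h + 1 \<le> 3 * Y" using h3 by (simp add: Y mult.commute)
  have "1 \<le> Y" using U3(1) UY(1) by simp
  have "40000 * a + 40000 * a' + 4000 * z + (200 * d1 + 40 * d2 + 100 * d3) \<le> 200000000 * y"
    if "a \<le> 2940 * y" "a' \<le> 60 * y" "z \<le> 24 * y" "d1 \<le> 2 * y" "d2 \<le> 2 * y" "d3 \<le> 3 * y" "1 \<le> y" for a a' z d1 d2 d3 y :: real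
    using that by linarith
  from this[OF C A Z D1 D2 D3 \<open>1 \<le> Y\<close>] show ?thesis unfolding Y_def x_def .
qed

text \<open>In terms of \<open>b = m^(1/4)\<close> and \<open>r = N^(1/2) / b\<close>, the condition
  \<open>m \<le> N * N\<close> becomes \<open>1 \<le> r\<close>, and \<open>N \<le> 2 * m\<close>
  becomes \<open>r\<^sup>2 \<le> 2 * b\<^sup>2\<close>. The choice of \<open>h\<close> places it
  between \<open>r * L\<close> and \<open>2 * (r * L)\<close>, and the decay bound then makes
  \<open>q\<close> of order \<open>r * b\<^sup>2\<close>.\<close>

lemma final_time:
  fixes n m N L h q T :: nat
  assumes n: "2 \<le> n" "1 \<le> m" "N \<le> n" "1 \<le> N" "N \<le> 2 * m" "m \<le> N * N" and L: "N + 1 \<le> 2 ^ L" "L = 0 \<or> 2 ^ (L - 1) \<le> N"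
    and h: "1 \<le> h" "N * N * L ^ 4 \<le> h ^ 4 * m" "h = 1 \<or> (h - 1) ^ 4 * m < N * N * L ^ 4"
    and q: "q = 0 \<or> h \<le> N \<and> 1 \<le> real N * real N * (1 - real h / real N) ^ (q - 1)"
    and T: "T \<le> 40000 * ((L + 2) * ((4 * L + 1) * ((q + 1) * ((q + 1) * (q + h + 1)) + (N + 1) * (m + 1)))) +
     40000 * ((h + 1) * ((4 * L + 1) * ((N + 1) * (m + 1)))) + 4000 * ((N + 1) * (N + 1) * (h + 1)) +
     (200 * (m + 1) + 40 * (L + 1) + 100 * (h + 1))"
  shows "real T \<le> 800000000 * (real n powr (3/2) * real m powr (3/4) * (log 2 (real n))\<^sup>2)"
proof -
  define b where "b = real m powr (1/4)"
  define r where "r = sqrt (real N) / b"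
  have b1: "1 \<le> b" unfolding b_def using n(2) by (intro ge_one_powr_ge_zero) simp_all
  have b4: "real m = b ^ 4" unfolding b_def using n(2) by (simp add: powr_power)
  have "real m \<le> real (N * N)" using n(6) by (simp only: of_nat_le_iff)
  then have "(b\<^sup>2)\<^sup>2 \<le> (real N)\<^sup>2" using b4 by (simp add: power2_eq_square power4_eq_xxxx mult.assoc)
  then have "b\<^sup>2 \<le> real N" by (rule power2_le_imp_le) simp
  then have "b \<le> sqrt (real N)" by (rule real_le_rsqrt)
  then have r1: "1 \<le> r" unfolding r_def using b1 by (simp add: le_divide_eq)
  have rbs: "r * b = sqrt (real N)" unfolding r_def using b1 by simp
  then have "(r * b)\<^sup>2 = real N" by simp
  then have Nr: "real N = r\<^sup>2 * b\<^sup>2" by (simp add: power_mult_distrib)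
  have "real N \<le> 2 * real m" using n(5) by linarith
  then have "r\<^sup>2 * b\<^sup>2 \<le> (2 * b\<^sup>2) * b\<^sup>2" unfolding Nr b4 by (simp add: power2_eq_square power4_eq_xxxx mult.assoc)
  then have rb: "r\<^sup>2 \<le> 2 * b\<^sup>2" by (rule mult_right_le_imp_le) (use b1 in simp)
  have L0: "L \<noteq> 0" using L(1) n(4) by (cases "L = 0") simp_all
  then have L1: "1 \<le> real L" by simp
  have P: "2 ^ (L - 1) \<le> N" using L(2) L0 by blast
  have "(2::nat) ^ L = 2 * 2 ^ (L - 1)" using L0 by (simp add: power_eq_if)
  then have "L ^ 2 \<le> 8 * N" using square_le_power2[of L] P by linarith
  then have "L ^ 2 \<le> 16 * m" using n(5) by linarith
  then have "real (L ^ 2) \<le> real (16 * m)" by (simp only: of_nat_le_iff)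
  then have "(real L)\<^sup>2 \<le> (4 * b\<^sup>2)\<^sup>2" using b4 by (simp add: power2_eq_square power4_eq_xxxx mult.assoc)
  then have L4: "real L \<le> 4 * b\<^sup>2" by (rule power2_le_imp_le) simp
  have e: "real (N * N * L ^ 4) = (r * real L) ^ 4 * real m"
    by (simp add: Nr b4 power_mult_distrib power2_eq_square power4_eq_xxxx)
  have mp: "0 < real m" using n(2) by simp
  have rL1: "1 \<le> r * real L" using mult_mono[OF r1 L1] r1 by simp
  have "real (N * N * L ^ 4) \<le> real (h ^ 4 * m)" using h(2) by (simp only: of_nat_le_iff)
  then have "(r * real L) ^ 4 * real m \<le> real h ^ 4 * real m" unfolding e by simp
  then have "(r * real L) ^ 4 \<le> real h ^ 4" using mp by (rule mult_right_le_imp_le)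
  then have hlo: "r * real L \<le> real h" by (simp add: power_mono_iff rL1[THEN order_trans[OF zero_le_one]])
  have hhi: "real h \<le> 2 * (r * real L)"
  proof (cases "h = 1")
    case True then show ?thesis using rL1 by simp
  next
    case False
    then have "(h - 1) ^ 4 * m < N * N * L ^ 4" using h(3) by blast
    then have "real ((h - 1) ^ 4 * m) < real (N * N * L ^ 4)" by (simp only: of_nat_less_iff)
    then have "real (h - 1) ^ 4 * real m < (r * real L) ^ 4 * real m" unfolding e by simp
    then have "real (h - 1) ^ 4 < (r * real L) ^ 4" using mp by (simp add: mult_less_cancel_right)
    then have "real (h - 1) < r * real L" by (rule power_less_imp_less_base) (use rL1 in simp)
    then show ?thesis using rL1 h(1) by simp
  qed
  have rb2: "1 \<le> r * b\<^sup>2" using mult_mono[OF r1 one_le_power[OF b1, of 2]] r1 by simp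
  have qhi: "real q + 1 \<le> 4 * (r * b\<^sup>2)"
  proof (cases "q = 0")
    case True then show ?thesis using rb2 by simp
  next
    case False
    then have "h \<le> N" "1 \<le> real N * real N * (1 - real h / real N) ^ (q - 1)" using q by blast+
    then have qh: "real (q - 1) * real h \<le> 2 * real N * ln (real N)" using n(4) by (intro hitting_size) simp_all
    have "N \<le> 2 ^ L" using L(1) by linarith
    then have "real N \<le> 2 ^ L" by (metis of_nat_le_iff of_nat_numeral of_nat_power)
    then have "ln (real N) \<le> ln (2 ^ L)" using n(4) by simp
    also have "\<dots> = real L * ln 2" by (simp add: ln_realpow)
    also have "\<dots> \<le> real L * 1" using ln_2_less_1 by (intro mult_left_mono) simp_all
    finally have "ln (real N) \<le> real L" by simp
    then have "2 * real N * ln (real N) \<le> 2 * real N * real L" by (rule mult_left_mono) simp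
    moreover have "real (q - 1) * (r * real L) \<le> real (q - 1) * real h" by (rule mult_left_mono[OF hlo]) simp
    ultimately have "real (q - 1) * (r * real L) \<le> 2 * real N * real L" using qh by linarith
    also have "\<dots> = (2 * (r * b\<^sup>2)) * (r * real L)" by (simp add: Nr power2_eq_square)
    finally have "real (q - 1) \<le> 2 * (r * b\<^sup>2)" by (rule mult_right_le_imp_le) (use rL1 in simp)
    then show ?thesis using rb2 False by simp
  qed
  have "real T \<le> 200000000 * ((real L)\<^sup>2 * (r * b\<^sup>2) ^ 3)"
  proof (rule order_trans[OF _ work_bound[OF r1 b1 rb L1 L4 Nr b4 _ hhi _ qhi]], goal_cases)
    case 1
    have "real T \<le> real (40000 * ((L + 2) * ((4 * L + 1) * ((q + 1) * ((q + 1) * (q + h + 1)) + (N + 1) * (m + 1)))) +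
     40000 * ((h + 1) * ((4 * L + 1) * ((N + 1) * (m + 1)))) + 4000 * ((N + 1) * (N + 1) * (h + 1)) +
     (200 * (m + 1) + 40 * (L + 1) + 100 * (h + 1)))" using T by (simp only: of_nat_le_iff)
    then show ?case by (simp only: of_nat_add of_nat_mult of_nat_numeral of_nat_1)
  qed simp_all
  \<comment> \<open>Both \<open>L - 1\<close> and 1 are at most the binary logarithm of
    \<open>n\<close>, so \<open>L\<close> is at most twice that logarithm; squaring this factor 2
    turns 200000000 into 800000000. The rest follows from \<open>r * b = sqrt N\<close> and
    \<open>N \<le> n\<close>.\<close>
  also have "(real L)\<^sup>2 * (r * b\<^sup>2) ^ 3 \<le> (2 * log 2 (real n))\<^sup>2 * (real n powr (3/2) * real m powr (3/4))"
  proof (rule mult_mono)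
    have "(2::real) ^ (L - 1) \<le> real N" using P by (metis of_nat_le_iff of_nat_numeral of_nat_power)
    then have "(2::real) ^ (L - 1) \<le> real n" using n(3) by linarith
    then have "log 2 (2 ^ (L - 1)) \<le> log 2 (real n)" by (subst log_le_cancel_iff) (use n(1) in simp_all)
    then have "real (L - 1) \<le> log 2 (real n)" by (simp add: log_nat_power)
    moreover have "log 2 2 \<le> log 2 (real n)" by (subst log_le_cancel_iff) (use n(1) in simp_all)
    ultimately have "real L \<le> 2 * log 2 (real n)" using L0 by simp
    then show "(real L)\<^sup>2 \<le> (2 * log 2 (real n))\<^sup>2" by (rule power_mono) simp
    have "(r * b\<^sup>2) ^ 3 = sqrt (real N) ^ 3 * b ^ 3" unfolding rbs[symmetric] by (simp add: power_mult_distrib power2_eq_square power3_eq_cube)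
    also have "\<dots> \<le> sqrt (real n) ^ 3 * b ^ 3" using n(3) b1 by (intro mult_right_mono power_mono) simp_all
    also have "sqrt (real n) ^ 3 = real n powr (3/2)" using n(1) by (simp add: powr_half_sqrt[symmetric] powr_power)
    also have "b ^ 3 = real m powr (3/4)" unfolding b_def using n(2) by (simp add: powr_power)
    finally show "(r * b\<^sup>2) ^ 3 \<le> real n powr (3/2) * real m powr (3/4)" .
  qed (use r1 b1 in simp_all)
  finally show ?thesis by (simp add: power_mult_distrib mult_ac)
qed

text \<open>The locales are interpreted only after the renumbering has run: \<open>N\<close>,
  \<open>sr\<close> and \<open>ds\<close> are read off the store it leaves, and \<open>lam\<close>
  and \<open>p\<close> exist by \<open>ex_mrc\<close>, where the positive transit times of cycles
  are carried over by \<open>cycle_iff\<close>.\<close>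

lemma prog_wp:
  assumes R: "ratio_input n m G c t"
  shows "wp ((n + m + 2) ^ 16) prog (\<lambda>T s. correct_output G c t (read_cycle s) \<and>
     (n \<ge> 2 \<and> m \<ge> 1 \<longrightarrow> real T \<le> 800000000 * (real n powr (3/2) * real m powr (3/4) * (log 2 (real n))\<^sup>2))) (encode n m G c t)"
  unfolding prog_def
proof (rule wp_seq[OF setup_graph_wp[where m = m and n = n]], goal_cases)
  let ?S = "n + m + 2" let ?W = "?S ^ 16"
  have "4 * ?S \<le> ?S ^ 3"
  proof -
    have "2 * 2 * ?S \<le> ?S * ?S * ?S" by (intro mult_le_mono1 mult_le_mono) simp_all
    then show ?thesis by (simp only: power3_eq_cube)
  qed
  also have "\<dots> \<le> ?W" by (rule power_increasing) simp_all
  finally have W: "4 * ?S \<le> ?W" .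
  have wf: "wf_digraph G" "verts G = {..<n}" "arcs G = {..<m}" "nomulti_digraph G"
    using R nomulti_digraph.axioms(1) unfolding ratio_input_def by blast+
  note ends = wf_digraph.tail_in_verts[OF wf(1)] wf_digraph.head_in_verts[OF wf(1)]
  {
    case 1 then show ?case by (simp add: encode_def)
  next
    case 2 show ?case by (rule le_trans[OF _ W]) simp
  next
    case (3 e) then show ?case using ends[of e] wf by (simp add: encode_def)
  next
    case 4 then show ?case by (simp add: encode_def)
  next
    case 5 then show ?case by (simp add: encode_def)
  next
    case s1: (6 \<tau>1 s1)
    let ?s = "encode n m G c t"
    define f where "f = words s1 ''id''"
    define N where "N = words s1 ''N'' 0"
    have num: "numbering n f N" and N2: "N \<le> 2 * m" using s1(2) by (simp_all add: renamed_def f_def N_def)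
    have te: "words ?s ''tail'' e = tail G e" "words ?s ''head'' e = head G e" "reals ?s ''cost'' e = c e" "reals ?s ''time'' e = t e" if "e < m" for e
      using that by (simp_all add: encode_def)
    have ren: "0 < f (tail G e) \<and> words s1 ''tl'' e = f (tail G e) - 1 \<and> 0 < f (head G e) \<and> words s1 ''hd'' e = f (head G e) - 1" if "e < m" for e
      using s1(2) te[OF that] that unfolding renamed_def f_def by metis
    interpret renaming m G f N
      by (rule renaming.intro) (use wf num ren in \<open>auto simp: numbering_def\<close>)
    have Nn: "N \<le> n" by (rule numbering_le[OF num])
    have "0 < wt t es" if "simple_closed es" for es
      using R that unfolding ratio_input_def cycle_iff awalk_cost_eq by blast
    from ex_mrc[OF this] obtain lam p where M: "mrc N m sr ds c t lam p" by blast
    interpret mrc_ram N m sr ds c t lam p ?W ?S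
      by (intro mrc_ram.intro M mrc_ram_axioms.intro) (use Nn in simp_all)
    have NW: "2 * N + 1 \<le> ?W" by (rule le_trans[OF _ W]) (use Nn in simp)
    show ?case
    proof (rule wp_seq[OF logs_wp[OF N_def[symmetric] NW]], goal_cases)
      case s2: (1 \<tau>2 s2)
      define L where "L = words s2 ''lb'' 0"
      have L: "N + 1 \<le> 2 ^ L" "L = 0 \<or> 2 ^ (L - 1) \<le> N" "\<tau>2 \<le> 40 * (L + 1)" using s2(2) by (simp_all add: L_def)
      have LN: "L \<le> N"
      proof (cases "L = 0")
        case False
        then have "L - 1 < N" using less_le_trans[OF less_exp] L(2) by blast
        then show ?thesis by simp
      qed simp
      have v2: "words s2 ''N'' 0 = N" "words s2 ''m'' 0 = m" using s2(1) s1(1) by (simp_all add: frm_def N_def encode_def)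
      have NL2: "N * L \<le> ?S ^ 2" unfolding power2_eq_square using LN Nn by (intro mult_le_mono) simp_all
      have o: "1 \<le> ?S ^ i" for i by simp
      have NL3: "N * L + 1 \<le> ?S ^ 3" using add_le_power[OF NL2 o] by simp
      have NLW: "N * L + 1 \<le> ?W" by (rule le_W[OF NL3]) simp
      show ?case
      proof (rule wp_seq[OF choose_h_wp[OF v2 L_def[symmetric] N2 NLW]], goal_cases)
        case s3: (1 \<tau>3 s3)
        define h where "h = words s3 ''h'' 0"
        have h: "1 \<le> h" "N * N * L ^ 4 \<le> h ^ 4 * m" "h = 1 \<or> (h - 1) ^ 4 * m < N * N * L ^ 4 \<and> h \<le> N * L" "\<tau>3 \<le> 100 * (h + 1)"
          using s3(2) by (simp_all add: h_def)
        have h3: "h \<le> ?S ^ 3" using h(3) NL3 o[of 3] by auto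
        have L2: "L \<le> 2 ^ L" by (rule less_imp_le[OF less_exp])
        have N2L: "N \<le> 2 ^ L" using L(1) by simp
        have "N * L \<le> 2 ^ L * 2 ^ L" using N2L L2 by (rule mult_le_mono)
        then have hL: "h \<le> 2 ^ (2 * L)" using h(3) by (auto simp: power_add[symmetric] mult_2)
        have "N * N \<le> 2 ^ L * 2 ^ L" using N2L N2L by (rule mult_le_mono)
        then have mL: "m \<le> 2 ^ (2 * L)" using arcs_le by (simp add: power_add[symmetric] mult_2)
        have LS: "L \<le> ?S" using LN Nn by simp
        have i3: "inp s3" unfolding inp_def
          using s3(1) s2(1) s1(1) v2 te ren by (simp add: frm_def sr_def ds_def encode_def)
        have zw: "words s3 a = (\<lambda>_. 0)" if "a \<in> {''tv'', ''mk'', ''cnt'', ''fs'', ''gone'', ''al'', ''ps''}" for a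
          using that s3(1) s2(1) s1(1) by (auto simp: frm_def encode_def)
        have z0: "words s3 ''pc'' 0 = 0" "words s3 ''q'' 0 = 0" "reals s3 ''tc'' = (\<lambda>_. 0)" "reals s3 ''tt'' = (\<lambda>_. 0)"
          using s3(1) s2(1) s1(1) by (simp_all add: frm_def encode_def)
        show ?case
        proof (rule wp_conseq[OF solve_wp[OF i3 h_def[symmetric] h(1) h3 hL L(1) mL LS zw z0]], goal_cases)
          case (1 a) then show ?case .
        next
          case s4: (2 \<tau>4 s4)
          then obtain q where q: "\<tau>4 \<le> solve_time L h q" "q = 0 \<or> h \<le> N \<and> 1 \<le> real N * real N * (1 - real h / real N) ^ (q - 1)" by blast
          have C: "correct_output G c t (read_cycle s4)" by (rule correct[OF M]) (use s4(2) in blast)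
          have "real (\<tau>1 + (\<tau>2 + (\<tau>3 + \<tau>4))) \<le> 800000000 * (real n powr (3/2) * real m powr (3/4) * (log 2 (real n))\<^sup>2)" if nm: "2 \<le> n" "1 \<le> m"
          proof (rule final_time[OF nm Nn _ N2 arcs_le L(1,2) h(1,2) _ q(2)])
            show "1 \<le> N" using pred_less[of "tail G 0"] ren[of 0] nm(2) by simp
            show "h = 1 \<or> (h - 1) ^ 4 * m < N * N * L ^ 4" using h(3) by blast
            have "\<tau>1 \<le> 200 * (m + 1)" using s1(2) by blast
            then have "\<tau>1 + (\<tau>2 + (\<tau>3 + \<tau>4)) \<le> solve_time L h q + (200 * (m + 1) + 40 * (L + 1) + 100 * (h + 1))"
              using L(3) h(4) q(1) by simp
            then show "\<tau>1 + (\<tau>2 + (\<tau>3 + \<tau>4)) \<le> 40000 * ((L + 2) * ((4 * L + 1) * ((q + 1) * ((q + 1) * (q + h + 1)) + (N + 1) * (m + 1)))) +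
              40000 * ((h + 1) * ((4 * L + 1) * ((N + 1) * (m + 1)))) + 4000 * ((N + 1) * (N + 1) * (h + 1)) +
              (200 * (m + 1) + 40 * (L + 1) + 100 * (h + 1))" unfolding solve_time_def .
          qed
          then show ?case using C by blast
        qed
      qed
    qed
  }
qed

theorem theorem21:
  shows "\<exists>(P :: com) (d :: nat) (K :: real).
    \<forall>(n :: nat) (m :: nat) (G :: (nat, nat) pre_digraph) (c :: nat \<Rightarrow> real) (t :: nat \<Rightarrow> real).
      ratio_input n m G c t \<longrightarrow>
      (\<exists>T s. exec ((n + m + 2) ^ d) P (encode n m G c t) T s \<and>
             correct_output G c t (read_cycle s) \<and>
             (n \<ge> 2 \<and> m \<ge> 1 \<longrightarrow>
               real T \<le> K * (real n powr (3/2) * real m powr (3/4) * (log 2 (real n))\<^sup>2)))"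
  by (rule exI[of _ prog], rule exI[of _ 16], rule exI[of _ 800000000], intro allI impI, rule prog_wp[unfolded wp_def])

end
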